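(* Let $(f,\mathcal X,\mathcal Y)$ be a non-degenerate sparse game (all of conditions 1–6 in the context) with unique mixed Nash equilibrium $(\mu^*,\nu^* )$. Fix any $\Gamma_0\ge 1$. There exist $\eta_0,\sigma_0>0$ such that for all $0<\eta\le\eta_0$, $0<\sigma\le\sigma_0$ with $\Gamma_0^{-1}\le \frac{\sigma}{\eta}\le\Gamma_0$, there exist $C,C',r_0,\kappa>0$ such that the following holds for all numbers of particles $n,m\ge 1$ and all $z^0=(a^0,x^0,b^0,y^0)\in\Delta_n\times\mathcal X^n\times\Delta_m\times\mathcal Y^m$. Let $(a^k,x^k,b^k,y^k)_{k\ge0}$ be the CP-PP iterates with step-sizes $\eta,\sigma$ started at $z^0$, and let $\mu^k=\sum_{i=1}^n a_i^k\delta_{x_i^k}$, $\nu^k=\sum_{j=1}^m b_j^k\delta_{y_j^k}$. If $\mathrm{NI}(\mu^0,\nu^0)\le r_0$, then for all $k\in\mathbb N$ $$\mathrm{NI}(\mu^k,\nu^k)\le C(1-\kappa)^k\quad\text{and}\quad \mathrm{WFR}_2^2(\mu^k,\mu^* )+\mathrm{WFR}_2^2(\nu^k,\nu^* )\le C'(1-\kappa)^k .$$ In particular, $\mu^k$ and $\nu^k$ converge narrowly to $\mu^*$ and $\nu^*$, that is, $\int\phi\,d\mu^k\to\int\phi\,d\mu^*$ for every continuous $\phi:\mathcal X\to\mathbb R$ and $\int\psi\,d\nu^k\to\int\psi\,d\nu^*$ for every continuous $\psi:\mathcal Y\to\mathbb R$.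
   Context: **Game.** $\mathcal X=\mathbb T^{d_x}=(\mathbb R/\mathbb Z)^{d_x}$ and $\mathcal Y=\mathbb T^{d_y}$, with distance $\|x-x'\|=\inf_{k\in\mathbb Z^{d}}\|x-x'+k\|_2$ and Euclidean norm on tangent vectors. $\mathcal P(\cdot)$ denotes probability measures. For $f:\mathcal X\times\mathcal Y\to\mathbb R$ let $F(\mu,\nu)=\int\int f\,d\mu\,d\nu$, $(F\nu)(x)=\int f(x,y)d\nu(y)$, $(\mu^\top F)(y)=\int f(x,y)d\mu(x)$. A mixed Nash equilibrium (MNE) is $(\mu^*,\nu^* )\in\mathcal P(\mathcal X)\times\mathcal P(\mathcal Y)$ with $F(\mu^*,\nu)\le F(\mu^*,\nu^* )\le F(\mu,\nu^* )$ for all $\mu,\nu$. The Nikaido–Isoda error is $\mathrm{NI}(\hat\mu,\hat\nu)=\max_{\mu,\nu}F(\hat\mu,\nu)-F(\mu,\hat\nu)$ over $\mu\in\mathcal P(\mathcal X),\nu\in\mathcal P(\mathcal Y)$. **Non-degenerate sparse game:** (1) $\mathcal X,\mathcal Y$ are the tori above; (2) $f$ is $C^{2,1}$ (Lipschitz-continuous second-order differentials); (3) the MNE $(\mu^*,\nu^* )$ is unique; (4) it is sparse: $\mathrm{supp}(\mu^* )=\{x_I^*,I\in[n^*]\}$, $\mathrm{supp}(\nu^* )=\{y_J^*,J\in[m^*]\}$ with $n^*,m^*<\infty$; (5) with $\rho=F(\mu^*,\nu^* )$, $F\nu^*$ equals $\rho$ only at the points $x_I^*$ and $(\mu^* )^\top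 F$ equals $\rho$ only at the points $y_J^*$; (6) $\nabla^2(F\nu^* )(x_I^* )\succ0$ for all $I$ and $\nabla^2((\mu^* )^\top F)(y_J^* )\prec0$ for all $J$. **CP-PP.** $\Delta_n=\{a\in\mathbb R_+^n:\sum_i a_i=1\}$, $\mathrm{KL}(w,\hat w)=\sum_i w_i\log\frac{w_i}{\hat w_i}$ (with $0\log(0/\cdot)=0$, and $+\infty$ if $\hat w_i=0<w_i$), $F_{n,m}((a,x),(b,y))=\sum_{i,j}a_ib_jf(x_i,y_j)$. Given $z^k=(a^k,x^k,b^k,y^k)$, the Conic Particle Proximal Point (CP-PP) update is $$z^{k+1}=\operatorname*{argmin}_{a\in\Delta_n,x\in\mathcal X^n}\operatorname*{argmax}_{b\in\Delta_m,y\in\mathcal Y^m}F_{n,m}((a,x),(b,y))+\tfrac1\eta\mathrm{KL}(a,a^k)+\tfrac1{2\sigma}\sum_i a_i^k\|x_i-x_i^k\|^2-\tfrac1\eta\mathrm{KL}(b,b^k)-\tfrac1{2\sigma}\sum_j b_j^k\|y_j-y_j^k\|^2,$$ understood as the saddle point of this objective in the interior of a neighbourhood (ball) of $z^k$ on which it is convex-concave (this exists for $\eta,\sigma$ below thresholds depending only on $(f,\mathcal X,\mathcal Y)$). It is characterised by its first-order optimality conditions: with $g_i=\sum_j b_j^{k+1}f(x_i^{k+1},y_j^{k+1})$ and $h_j=\sum_i a_i^{k+1}f(x_i^{k+1},y_j^{k+1})$, $a_i^{k+1}=a_i^ke^{-\eta g_i}/\sum_{i'}a_{i'}^ke^{-\eta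 g_{i'}}$, $x_i^{k+1}=x_i^k-\sigma\frac{a_i^{k+1}}{a_i^k}\sum_jb_j^{k+1}\partial_xf(x_i^{k+1},y_j^{k+1})$, $b_j^{k+1}=b_j^ke^{\eta h_j}/\sum_{j'}b_{j'}^ke^{\eta h_{j'}}$, $y_j^{k+1}=y_j^k+\sigma\frac{b_j^{k+1}}{b_j^k}\sum_ia_i^{k+1}\partial_yf(x_i^{k+1},y_j^{k+1})$. (Particles with zero weight keep zero weight and do not contribute to $\mu^k,\nu^k$.) **WFR distance.** For non-negative measures on $\mathcal X$ (similarly on $\mathcal Y$), with the given $\eta,\sigma$, $$\mathrm{WFR}_2^2(\mu_0,\mu_1)=\inf\int_0^1\int_{\mathcal X}\Big(\tfrac{\eta}{2\sigma}\|v_t(x)\|^2+\tfrac12r_t(x)^2\Big)d\mu_t(x)\,dt$$ over triples $(\mu_t,v_t,r_t)_{0\le t\le1}$ where $(\mu_t)$ is a weakly continuous curve of non-negative measures with endpoints $\mu_0,\mu_1$, $v_t\in L^2_{\mu_t}(\mathcal X)^{d_x}$, $r_t\in L^2_{\mu_t}(\mathcal X)$, and $\partial_t\mu_t+\nabla\cdot(\mu_tv_t)=\mu_tr_t$ in the sense of distributions. *)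

theory Defs
  imports "HOL-Probability.Probability"
begin

section \<open>The flat torus\<close>

definition int_lattice :: "(real ^ 'd) set" where
  "int_lattice = {k. \<forall>i. k $ i \<in> \<int>}"

definition torus_rel :: "real ^ 'd \<Rightarrow> real ^ 'd \<Rightarrow> bool" where
  "torus_rel x y \<longleftrightarrow> x - y \<in> int_lattice"

lemma int_lattice_0 [simp]: "0 \<in> int_lattice"
  by (simp add: int_lattice_def)

lemma int_lattice_add: "k \<in> int_lattice \<Longrightarrow> l \<in> int_lattice \<Longrightarrow> k + l \<in> int_lattice"
  by (simp add: int_lattice_def)

lemma int_lattice_minus: "k \<in> int_lattice \<Longrightarrow> - k \<in> int_lattice"
  by (simp add: int_lattice_def)

lemma int_lattice_diff: "k \<in> int_lattice \<Longrightarrow> l \<in> int_lattice \<Longrightarrow> k - l \<in> int_lattice"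
  by (simp add: int_lattice_def)

lemma equivp_torus_rel: "equivp (torus_rel :: real ^ 'd \<Rightarrow> real ^ 'd \<Rightarrow> bool)"
proof (rule equivpI)
  show "reflp torus_rel"
    by (simp add: reflp_def torus_rel_def)
  show "symp torus_rel"
    unfolding symp_def torus_rel_def by (metis int_lattice_minus minus_diff_eq)
  show "transp (torus_rel :: real ^ 'd \<Rightarrow> real ^ 'd \<Rightarrow> bool)"
  proof (rule transpI)
    fix x y z :: "real ^ 'd" assume "torus_rel x y" "torus_rel y z"
    then have "(x - y) + (y - z) \<in> int_lattice"
      unfolding torus_rel_def by (rule int_lattice_add)
    then show "torus_rel x z" by (simp add: torus_rel_def)
  qed
qed

quotient_type 'd torus = "real ^ 'd" / torus_rel
  by (rule equivp_torus_rel)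

lift_definition shift :: "'d::finite torus \<Rightarrow> real ^ 'd \<Rightarrow> 'd torus" is "\<lambda>x v. x + v"
  by (simp add: torus_rel_def)

definition lattice_dist :: "real ^ 'd \<Rightarrow> real ^ 'd \<Rightarrow> real" where
  "lattice_dist x x' = (INF k\<in>int_lattice. norm (x - x' + k))"

lemma lattice_dist_bdd: "bdd_below ((\<lambda>k. norm (x - x' + k)) ` int_lattice)"
  by (rule bdd_belowI2[of _ 0]) simp

lemma lattice_dist_le: "k \<in> int_lattice \<Longrightarrow> lattice_dist x x' \<le> norm (x - x' + k)"
  unfolding lattice_dist_def by (rule cINF_lower[OF lattice_dist_bdd])

lemma le_lattice_dist:
  "(\<And>k. k \<in> int_lattice \<Longrightarrow> c \<le> norm (x - x' + k)) \<Longrightarrow> c \<le> lattice_dist x x'"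
  unfolding lattice_dist_def by (rule cINF_greatest) (auto intro: int_lattice_0)

lemma lattice_dist_cong_le:
  assumes "torus_rel x y" "torus_rel x' y'"
  shows "lattice_dist x x' \<le> lattice_dist y y'"
proof (rule le_lattice_dist)
  fix k :: "real ^ 'a" assume k: "k \<in> int_lattice"
  have "k - (x - y) + (x' - y') \<in> int_lattice"
    using assms k unfolding torus_rel_def
    by (blast intro: int_lattice_add int_lattice_diff)
  from lattice_dist_le[OF this, of x x'] show "lattice_dist x x' \<le> norm (y - y' + k)"
    by (simp add: algebra_simps)
qed

lemma lattice_dist_pos:
  assumes "lattice_dist x x' = 0" shows "torus_rel x x'"
proof -
  have "(INF k\<in>int_lattice. norm (x - x' + k)) < 1/2"
    using assms unfolding lattice_dist_def by simp
  then obtain k where k: "k \<in> int_lattice" "norm (x - x' + k) < 1/2"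
    by (subst (asm) cINF_less_iff[OF _ lattice_dist_bdd]) (auto intro: int_lattice_0)
  have "x - x' + k = 0"
  proof (rule ccontr)
    assume "x - x' + k \<noteq> 0"
    then have "norm (x - x' + k) > 0" by simp
    then have "(INF k\<in>int_lattice. norm (x - x' + k)) < norm (x - x' + k)"
      using assms unfolding lattice_dist_def by simp
    then obtain l where l: "l \<in> int_lattice" "norm (x - x' + l) < norm (x - x' + k)"
      by (subst (asm) cINF_less_iff[OF _ lattice_dist_bdd]) (auto intro: int_lattice_0)
    have "norm (k - l) \<le> norm (x - x' + k) + norm (x - x' + l)"
      using norm_triangle_ineq4[of "x - x' + k" "x - x' + l"] by simp
    then have n1: "norm (k - l) < 1" using k l by linarith
    have "k - l = 0"
    proof (rule vec_eq_iff[THEN iffD2], rule allI)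
      fix i
      have "(k - l) $ i \<in> \<int>" using int_lattice_diff[OF k(1) l(1)] by (simp add: int_lattice_def)
      moreover have "\<bar>(k - l) $ i\<bar> < 1" using component_le_norm_cart[of "k - l" i] n1 by linarith
      ultimately show "(k - l) $ i = 0 $ i" by (metis Ints_nonzero_abs_less1 zero_index)
    qed
    with l show False by simp
  qed
  then have "x - x' = - k" by (simp add: eq_neg_iff_add_eq_0)
  with k show ?thesis by (simp add: torus_rel_def int_lattice_minus)
qed

instantiation torus :: (finite) metric_space
begin

lift_definition dist_torus :: "'a torus \<Rightarrow> 'a torus \<Rightarrow> real" is lattice_dist
proof (rule antisym)
  fix x y x' y' :: "real ^ 'a" assume *: "torus_rel x y" "torus_rel x' y'"
  then show "lattice_dist x x' \<le> lattice_dist y y'" by (rule lattice_dist_cong_le)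
  show "lattice_dist y y' \<le> lattice_dist x x'"
    using *[THEN equivp_symp[OF equivp_torus_rel]] by (rule lattice_dist_cong_le)
qed

definition uniformity_torus :: "('a torus \<times> 'a torus) filter" where
  "uniformity_torus = (INF e\<in>{0<..}. principal {(x, y). dist x y < e})"

definition open_torus :: "'a torus set \<Rightarrow> bool" where
  "open_torus U \<longleftrightarrow> (\<forall>x\<in>U. \<forall>\<^sub>F (x', y) in uniformity. x' = x \<longrightarrow> y \<in> U)"

instance
proof
  fix x y z :: "'a torus"
  show "(dist x y = 0) = (x = y)"
  proof transfer
    fix x y :: "real ^ 'a"
    have "lattice_dist x y = 0" if "torus_rel x y"
    proof (rule antisym)
      have "- (x - y) \<in> int_lattice" 
        using int_lattice_minus that unfolding torus_rel_def by blast
      from lattice_dist_le[OF this, of x y] show "lattice_dist x y \<le> 0" by simp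
      show "0 \<le> lattice_dist x y" by (rule le_lattice_dist) simp
    qed
    then show "(lattice_dist x y = 0) = torus_rel x y" using lattice_dist_pos by blast
  qed
  show "dist x y \<le> dist x z + dist y z"
  proof transfer
    fix x y z :: "real ^ 'a"
    have "lattice_dist x y - norm (y - z + l) \<le> lattice_dist x z" if l: "l \<in> int_lattice" for l
    proof (rule le_lattice_dist)
      fix k :: "real ^ 'a" assume k: "k \<in> int_lattice"
      have "lattice_dist x y \<le> norm (x - y + (k - l))"
        by (rule lattice_dist_le[OF int_lattice_diff[OF k l]])
      also have "\<dots> \<le> norm (x - z + k) + norm (y - z + l)"
        using norm_triangle_ineq4[of "x - z + k" "y - z + l"] by (simp add: algebra_simps)
      finally show "lattice_dist x y - norm (y - z + l) \<le> norm (x - z + k)" by simp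
    qed
    then have "lattice_dist x y - lattice_dist x z \<le> lattice_dist y z"
      by (intro le_lattice_dist) (simp add: algebra_simps)
    then show "lattice_dist x y \<le> lattice_dist x z + lattice_dist y z" by simp
  qed
qed (simp_all add: uniformity_torus_def open_torus_def)

end

text \<open>Tangent spaces are identified with \<open>real ^ 'd\<close>, so derivatives at a point are derivatives at
  0 in the chart \<open>shift x\<close>.\<close>

definition torus_grad :: "('d::finite torus \<Rightarrow> real) \<Rightarrow> 'd torus \<Rightarrow> real ^ 'd" where
  "torus_grad \<phi> x = (THE D. GDERIV (\<lambda>v. \<phi> (shift x v)) 0 :> D)"

definition torus_hess :: "('d::finite torus \<Rightarrow> real) \<Rightarrow> 'd torus \<Rightarrow> real ^ 'd ^ 'd" where
  "torus_hess \<phi> x = matrix (frechet_derivative (\<lambda>v. torus_grad \<phi> (shift x v)) (at 0))"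

definition pos_def :: "real ^ 'd ^ 'd \<Rightarrow> bool" where
  "pos_def A \<longleftrightarrow> transpose A = A \<and> (\<forall>v. v \<noteq> 0 \<longrightarrow> 0 < v \<bullet> (A *v v))"

definition C21 :: "('a::euclidean_space \<Rightarrow> real) \<Rightarrow> bool" where
  "C21 g \<longleftrightarrow> (\<exists>(g' :: 'a \<Rightarrow> 'a \<Rightarrow>\<^sub>L real) (g'' :: 'a \<Rightarrow> 'a \<Rightarrow>\<^sub>L 'a \<Rightarrow>\<^sub>L real) L.
     (\<forall>x. (g has_derivative blinfun_apply (g' x)) (at x)) \<and>
     (\<forall>x. (g' has_derivative blinfun_apply (g'' x)) (at x)) \<and>
     L-lipschitz_on UNIV g'')"

definition torus_C21 :: "('n::finite torus \<Rightarrow> 'm::finite torus \<Rightarrow> real) \<Rightarrow> bool" where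
  "torus_C21 f \<longleftrightarrow> C21 (\<lambda>(u, w). f (abs_torus u) (abs_torus w))"


section \<open>Games and mixed Nash equilibria\<close>

definition prob_measures :: "'a::topological_space measure set" where
  "prob_measures = {\<mu>. prob_space \<mu> \<and> sets \<mu> = sets borel}"

definition payoff :: "('a \<Rightarrow> 'b \<Rightarrow> real) \<Rightarrow> 'a measure \<Rightarrow> 'b measure \<Rightarrow> real" where
  "payoff f \<mu> \<nu> = (\<integral>y. (\<integral>x. f x y \<partial>\<mu>) \<partial>\<nu>)"

definition is_MNE ::
  "('a::topological_space \<Rightarrow> 'b::topological_space \<Rightarrow> real) \<Rightarrow> 'a measure \<Rightarrow> 'b measure \<Rightarrow> bool" where
  "is_MNE f \<mu> \<nu> \<longleftrightarrow> \<mu> \<in> prob_measures \<and> \<nu> \<in> prob_measures \<and>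
     (\<forall>\<nu>'\<in>prob_measures. payoff f \<mu> \<nu>' \<le> payoff f \<mu> \<nu>) \<and>
     (\<forall>\<mu>'\<in>prob_measures. payoff f \<mu> \<nu> \<le> payoff f \<mu>' \<nu>)"

definition NI ::
  "('a::topological_space \<Rightarrow> 'b::topological_space \<Rightarrow> real) \<Rightarrow> 'a measure \<Rightarrow> 'b measure \<Rightarrow> real" where
  "NI f \<mu>' \<nu>' = (SUP (\<mu>, \<nu>)\<in>prob_measures \<times> prob_measures. payoff f \<mu>' \<nu> - payoff f \<mu> \<nu>')"

definition supp :: "'a::topological_space measure \<Rightarrow> 'a set" where
  "supp \<mu> = {x. \<forall>U. open U \<and> x \<in> U \<longrightarrow> 0 < emeasure \<mu> U}"

definition nondegenerate_sparse_game ::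
  "('n::finite torus \<Rightarrow> 'm::finite torus \<Rightarrow> real) \<Rightarrow> 'n torus measure \<Rightarrow> 'm torus measure \<Rightarrow> bool" where
  "nondegenerate_sparse_game f \<mu>s \<nu>s \<longleftrightarrow>
     (let F\<nu> = (\<lambda>x. \<integral>y. f x y \<partial>\<nu>s); \<mu>F = (\<lambda>y. \<integral>x. f x y \<partial>\<mu>s); \<rho> = payoff f \<mu>s \<nu>s in
       torus_C21 f \<and>
       is_MNE f \<mu>s \<nu>s \<and> (\<forall>\<mu> \<nu>. is_MNE f \<mu> \<nu> \<longrightarrow> \<mu> = \<mu>s \<and> \<nu> = \<nu>s) \<and>
       finite (supp \<mu>s) \<and> finite (supp \<nu>s) \<and>
       (\<forall>x. F\<nu> x = \<rho> \<longrightarrow> x \<in> supp \<mu>s) \<and> (\<forall>y. \<mu>F y = \<rho> \<longrightarrow> y \<in> supp \<nu>s) \<and>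
       (\<forall>x\<in>supp \<mu>s. pos_def (torus_hess F\<nu> x)) \<and>
       (\<forall>y\<in>supp \<nu>s. pos_def (- torus_hess \<mu>F y)))"


section \<open>The conic particle proximal point method\<close>

text \<open>A family of \<open>n\<close> weighted particles is a pair (weights, positions); only indices below \<open>n\<close>
  matter.\<close>

type_synonym 'd particles = "(nat \<Rightarrow> real) \<times> (nat \<Rightarrow> 'd torus)"

definition prob_simplex :: "nat \<Rightarrow> (nat \<Rightarrow> real) set" where
  "prob_simplex n = {a. (\<forall>i<n. 0 \<le> a i) \<and> (\<Sum>i<n. a i) = 1}"

text \<open>The measure \<open>\<Sum>i<n. a i * \<delta> (x i)\<close>, as the push-forward of the weights.\<close>

definition particle_measure :: "nat \<Rightarrow> 'd::finite particles \<Rightarrow> 'd torus measure" where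
  "particle_measure n p = distr (point_measure {..<n} (\<lambda>i. ennreal (fst p i))) borel (snd p)"

definition KL :: "nat \<Rightarrow> (nat \<Rightarrow> real) \<Rightarrow> (nat \<Rightarrow> real) \<Rightarrow> ereal" where
  "KL n w w' = (if \<exists>i<n. w' i = 0 \<and> 0 < w i then \<infinity>
                else ereal (\<Sum>i<n. w i * ln (w i / w' i)))"

definition KL_dom :: "nat \<Rightarrow> (nat \<Rightarrow> real) \<Rightarrow> (nat \<Rightarrow> real) set" where
  "KL_dom n w' = {w \<in> prob_simplex n. KL n w w' < \<infinity>}"

definition prox_obj ::
  "('n::finite torus \<Rightarrow> 'm::finite torus \<Rightarrow> real) \<Rightarrow> real \<Rightarrow> real \<Rightarrow> nat \<Rightarrow> nat \<Rightarrow>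
   'n particles \<times> 'm particles \<Rightarrow> 'n particles \<Rightarrow> 'm particles \<Rightarrow> real" where
  "prox_obj f \<eta> \<sigma> n m = (\<lambda>((a0, x0), (b0, y0)) (a, x) (b, y).
     (\<Sum>i<n. \<Sum>j<m. a i * b j * f (x i) (y j))
     + 1 / \<eta> * real_of_ereal (KL n a a0) + 1 / (2 * \<sigma>) * (\<Sum>i<n. a0 i * (dist (x i) (x0 i))\<^sup>2)
     - 1 / \<eta> * real_of_ereal (KL m b b0) - 1 / (2 * \<sigma>) * (\<Sum>j<m. b0 j * (dist (y j) (y0 j))\<^sup>2))"

text \<open>Around given particles \<open>p\<close>, positions are described by displacement vectors, i.e.\ by the
  coordinates \<open>(a, u)\<close> standing for weights \<open>a\<close> and positions \<open>shift (snd p i) (u i)\<close>. Convexity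
  is understood in these coordinates.\<close>

definition displace ::
  "'d::finite particles \<Rightarrow> (nat \<Rightarrow> real) \<times> (nat \<Rightarrow> real ^ 'd) \<Rightarrow> 'd particles" where
  "displace p c = (fst c, \<lambda>i. shift (snd p i) (snd c i))"

definition segment ::
  "(nat \<Rightarrow> real) \<times> (nat \<Rightarrow> real ^ 'd) \<Rightarrow> (nat \<Rightarrow> real) \<times> (nat \<Rightarrow> real ^ 'd) \<Rightarrow> real
   \<Rightarrow> (nat \<Rightarrow> real) \<times> (nat \<Rightarrow> real ^ 'd)" where
  "segment c c' t = (\<lambda>i. (1 - t) * fst c i + t * fst c' i, \<lambda>i. (1 - t) *\<^sub>R snd c i + t *\<^sub>R snd c' i)"

text \<open>Convex neighbourhoods of \<open>p\<close>, open relative to the set where the proximal term of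
  \<open>prox_obj\<close> is finite. Outside that set the objective is infinite, so it does not matter for
  the saddle point; in particular particles of weight zero keep weight zero. Openness is with
  respect to the product topology on functions.\<close>

definition convex_nbhd ::
  "nat \<Rightarrow> 'd::finite particles \<Rightarrow> ((nat \<Rightarrow> real) \<times> (nat \<Rightarrow> real ^ 'd)) set \<Rightarrow> bool" where
  "convex_nbhd n p U \<longleftrightarrow>
     openin (top_of_set (KL_dom n (fst p) \<times> UNIV)) U \<and>
     (fst p, \<lambda>_. 0) \<in> U \<and>
     (\<forall>c\<in>U. \<forall>c'\<in>U. \<forall>t\<in>{0..1}. segment c c' t \<in> U)"

text \<open>The update is the saddle point of \<open>prox_obj\<close> in a neighbourhood \<open>U \<times> V\<close> of the current
  iterate on which \<open>prox_obj\<close> is convex-concave. The neighbourhood being open, the saddle point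
  lies in its interior. The positions of particles of weight zero are left undetermined.\<close>

definition cppp_update ::
  "('n::finite torus \<Rightarrow> 'm::finite torus \<Rightarrow> real) \<Rightarrow> real \<Rightarrow> real \<Rightarrow> nat \<Rightarrow> nat \<Rightarrow>
   'n particles \<times> 'm particles \<Rightarrow> 'n particles \<times> 'm particles \<Rightarrow> bool" where
  "cppp_update f \<eta> \<sigma> n m z z' \<longleftrightarrow>
     (let J = (\<lambda>c d. prox_obj f \<eta> \<sigma> n m z (displace (fst z) c) (displace (snd z) d)) in
      \<exists>U V. convex_nbhd n (fst z) U \<and> convex_nbhd m (snd z) V \<and>
        (\<forall>d\<in>V. \<forall>c\<in>U. \<forall>c'\<in>U. convex_on {0..1} (\<lambda>t. J (segment c c' t) d)) \<and>
        (\<forall>c\<in>U. \<forall>d\<in>V. \<forall>d'\<in>V. concave_on {0..1} (\<lambda>t. J c (segment d d' t))) \<and>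
        (\<exists>c\<^sub>1\<in>U. \<exists>d\<^sub>1\<in>V. z' = (displace (fst z) c\<^sub>1, displace (snd z) d\<^sub>1) \<and>
           (\<forall>c\<in>U. J c\<^sub>1 d\<^sub>1 \<le> J c d\<^sub>1) \<and> (\<forall>d\<in>V. J c\<^sub>1 d \<le> J c\<^sub>1 d\<^sub>1)))"

definition cppp_iterates ::
  "('n::finite torus \<Rightarrow> 'm::finite torus \<Rightarrow> real) \<Rightarrow> real \<Rightarrow> real \<Rightarrow> nat \<Rightarrow> nat \<Rightarrow>
   (nat \<Rightarrow> 'n particles \<times> 'm particles) \<Rightarrow> bool" where
  "cppp_iterates f \<eta> \<sigma> n m z \<longleftrightarrow>
     fst (fst (z 0)) \<in> prob_simplex n \<and> fst (snd (z 0)) \<in> prob_simplex m \<and>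
     (\<forall>k. cppp_update f \<eta> \<sigma> n m (z k) (z (Suc k)))"


section \<open>The Wasserstein-Fisher-Rao distance\<close>

primrec times_differentiable :: "nat \<Rightarrow> ('a::euclidean_space \<Rightarrow> real) \<Rightarrow> bool" where
  "times_differentiable 0 g \<longleftrightarrow> True"
| "times_differentiable (Suc k) g \<longleftrightarrow>
     (\<forall>x. g differentiable (at x)) \<and>
     (\<forall>v. times_differentiable k (\<lambda>x. frechet_derivative g (at x) v))"

text \<open>Smooth functions with compact support in the product of the open interval \<open>{0<..<1}\<close> and
  the torus.\<close>

definition test_function :: "(real \<Rightarrow> 'd::finite torus \<Rightarrow> real) \<Rightarrow> bool" where
  "test_function \<psi> \<longleftrightarrow>
     (\<forall>k. times_differentiable k (\<lambda>(t, u). \<psi> t (abs_torus u))) \<and>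
     (\<exists>s>0. \<exists>s'<1. \<forall>t x. t \<notin> {s..s'} \<longrightarrow> \<psi> t x = 0)"

text \<open>Distributional solutions of \<open>\<partial>\<^sub>t \<mu> + div (\<mu> v) = \<mu> r\<close> on the unit time interval.
  When the energy below is finite, all integrands here are integrable.\<close>

definition continuity_equation ::
  "(real \<Rightarrow> 'd::finite torus measure) \<Rightarrow> (real \<Rightarrow> 'd torus \<Rightarrow> real ^ 'd) \<Rightarrow>
   (real \<Rightarrow> 'd torus \<Rightarrow> real) \<Rightarrow> bool" where
  "continuity_equation \<mu> v r \<longleftrightarrow>
     (\<forall>\<psi>. test_function \<psi> \<longrightarrow>
        (LINT t:{0..1}|lborel. (\<integral>x. deriv (\<lambda>s. \<psi> s x) t + torus_grad (\<psi> t) x \<bullet> v t x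
                                     + \<psi> t x * r t x \<partial>\<mu> t)) = 0)"

definition wfr_admissible ::
  "'d::finite torus measure \<Rightarrow> 'd torus measure \<Rightarrow> (real \<Rightarrow> 'd torus measure) \<Rightarrow>
   (real \<Rightarrow> 'd torus \<Rightarrow> real ^ 'd) \<Rightarrow> (real \<Rightarrow> 'd torus \<Rightarrow> real) \<Rightarrow> bool" where
  "wfr_admissible \<mu>0 \<mu>1 \<mu> v r \<longleftrightarrow>
     (\<forall>t\<in>{0..1}. finite_measure (\<mu> t) \<and> sets (\<mu> t) = sets borel) \<and>
     (\<forall>\<phi>. continuous_on UNIV \<phi> \<longrightarrow> continuous_on {0..1} (\<lambda>t. \<integral>x. (\<phi> x :: real) \<partial>\<mu> t)) \<and>
     \<mu> 0 = \<mu>0 \<and> \<mu> 1 = \<mu>1 \<and>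
     (\<lambda>(t, x). v t x) \<in> borel_measurable (borel \<Otimes>\<^sub>M borel) \<and>
     (\<lambda>(t, x). r t x) \<in> borel_measurable (borel \<Otimes>\<^sub>M borel) \<and>
     (\<forall>t\<in>{0..1}. integrable (\<mu> t) (\<lambda>x. (norm (v t x))\<^sup>2) \<and> integrable (\<mu> t) (\<lambda>x. (r t x)\<^sup>2)) \<and>
     continuity_equation \<mu> v r"

text \<open>The squared distance, valued in \<open>ennreal\<close> so that an infinite infimum is not lost.\<close>

definition WFR2 ::
  "real \<Rightarrow> real \<Rightarrow> 'd::finite torus measure \<Rightarrow> 'd torus measure \<Rightarrow> ennreal" where
  "WFR2 \<eta> \<sigma> \<mu>0 \<mu>1 =
     Inf {(\<integral>\<^sup>+ t\<in>{0..1}. (\<integral>\<^sup>+ x. ennreal (\<eta> / (2 * \<sigma>) * (norm (v t x))\<^sup>2 + 1 / 2 * (r t x)\<^sup>2) \<partial>\<mu> t)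
             \<partial>lborel) | \<mu> v r. wfr_admissible \<mu>0 \<mu>1 \<mu> v r}"

end

theory Submission
  imports Defs
begin

text \<open>For one player, let \<open>M\<^sub>p\<close> be the mass of the particles within distance \<open>R\<close> of the equilibrium point
  \<open>p\<close>, a particle at distance \<open>r\<close> being counted with the factor \<open>1 - (\<eta> / (2 * \<sigma>)) * r\<^sup>2\<close>. The
  Lyapunov function is the relative entropy \<open>\<Sum>\<^sub>p w\<^sub>p ln (w\<^sub>p / M\<^sub>p)\<close>, added up over the two players. Since
  the step is implicit, the payoff terms of the two players combine to the gap of the new iterate with
  respect to the equilibrium, which dominates the mass outside the clusters and the spread inside them. The
  step also gains the variance of the payoff and the squared gradients at the new particles. If these gains are
  small, the weights of the opponent almost satisfy the linear system expressing constant value and zero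
  gradient at the equilibrium points; by uniqueness of the equilibrium this system is injective, so the
  gains control the Lyapunov function and it contracts geometrically. It bounds the NI error through its square
  root, and the WFR distance by moving each clustered particle to its centre while the square roots of the
  cluster masses change linearly.\<close>

section \<open>Geometry of the torus\<close>

text \<open>The obstacle is bilinearity: any weights on the equilibrium points, however wrong, have
  gap zero with respect to the equilibrium. The gap confines the particles to the clusters but says
  nothing about the cluster masses. These are recovered only from terms of second order in the step
  sizes, so constants matter: normalizing the weights gains \<open>\<eta>\<^sup>2 / 3\<close> times
  the variance of the payoff, the cluster estimate loses half of it, and the other half drives the
  convergence. The kernel factor makes the entropy see positions:
  \<open>- ln (a * (1 - \<alpha> / 2 * r\<^sup>2))\<close> is to leading order
  \<open>- ln a + \<alpha> / 2 * r\<^sup>2\<close>, which for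
  \<open>\<alpha> = \<eta> / \<sigma>\<close> weighs entropy against squared distance as the
  proximal term does. Particles enter only through cluster sums, so no constant depends on their
  number. Convexity of the payoff near the clusters is needed at the new iterate, before anything is
  known about it. A crude bound on the displacement in one step breaks this circle; the decrease
  then keeps all iterates in the region where the estimates hold.\<close>

lemma shift_0 [simp]: "shift x 0 = x"
  by transfer (simp add: torus_rel_def)

lemma shift_shift [simp]: "shift (shift x u) v = shift x (u + v)"
  by transfer (simp add: torus_rel_def algebra_simps)

lemma shift_abs: "shift (abs_torus a) u = abs_torus (a + u)"
  by (simp add: shift.abs_eq)

lemma ex_abs_torus: "\<exists>a. x = abs_torus a"
  by (metis Quotient3_abs_rep Quotient3_torus)

lemma abs_torus_lattice: "k \<in> int_lattice \<Longrightarrow> abs_torus (a + k) = abs_torus a"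
  by (metis Quotient3_rel_abs Quotient3_torus add_diff_cancel_left' torus_rel_def)

lemma closed_int_lattice: "closed (int_lattice :: (real ^ 'd::finite) set)"
proof -
  have "int_lattice = (\<Inter>i. (\<lambda>k :: real ^ 'd. k $ i) -` \<int>)"
    by (auto simp: int_lattice_def)
  also have "closed \<dots>"
    by (intro closed_INT ballI closed_vimage closed_Ints continuous_intros)
  finally show ?thesis .
qed

lemma norm_int_lattice_ge_1:
  fixes k :: "real ^ 'd::finite"
  assumes "k \<in> int_lattice" "k \<noteq> 0" shows "1 \<le> norm k"
proof -
  obtain i where i: "k $ i \<noteq> 0" using assms(2) by (auto simp: vec_eq_iff)
  have "1 \<le> \<bar>k $ i\<bar>" using assms(1) i Ints_nonzero_abs_ge1 by (auto simp: int_lattice_def)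
  then show ?thesis using component_le_norm_cart[of k i] by linarith
qed

text \<open>The infimum over the lattice is attained because the lattice is closed, so a shortest
  displacement exists.\<close>

lemma ex_shift: "\<exists>u. shift x u = y \<and> norm u = dist x y"
proof transfer
  fix x y :: "real ^ 'a"
  obtain k where k: "k \<in> int_lattice" "\<And>l. l \<in> int_lattice \<Longrightarrow> dist (y - x) k \<le> dist (y - x) l"
    using distance_attains_inf[OF closed_int_lattice, of "y - x"] int_lattice_0 by blast
  have "lattice_dist x y = norm (x - y + k)"
  proof (rule antisym)
    show "norm (x - y + k) \<le> lattice_dist x y"
      by (rule le_lattice_dist) (use k(2) in \<open>auto simp: dist_norm norm_minus_commute algebra_simps\<close>)
  qed (rule lattice_dist_le[OF k(1)])
  then have "norm (y - x - k) = lattice_dist x y"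
    by (metis norm_minus_commute add.commute add_diff_eq diff_diff_eq2)
  moreover have "torus_rel (x + (y - x - k)) y"
    using k(1) by (simp add: torus_rel_def int_lattice_minus)
  ultimately show "\<exists>u. torus_rel (x + u) y \<and> norm u = lattice_dist x y" by blast
qed

lemma dist_shift_le: "dist (shift x u) (shift x v) \<le> norm (u - v)"
proof transfer
  fix x u v :: "real ^ 'a"
  show "lattice_dist (x + u) (x + v) \<le> norm (u - v)"
    using lattice_dist_le[OF int_lattice_0, of "x + u" "x + v"] by simp
qed

lemma dist_shift_le' : "dist x (shift x u) \<le> norm u"
  using dist_shift_le[of x 0 u] by simp

text \<open>Nonzero lattice vectors have norm at least 1, so a vector of norm at most 1/2 cannot be
  shortened by a lattice translation.\<close>

lemma dist_shift_eq:
  assumes "norm u \<le> 1 / 2" shows "dist x (shift x u) = norm u"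
proof (rule antisym)
  show "norm u \<le> dist x (shift x u)" using assms
  proof transfer
    fix x u :: "real ^ 'a" assume u: "norm u \<le> 1 / 2"
    have "norm u \<le> norm (x - (x + u) + k)" if "k \<in> int_lattice" for k
    proof (cases "k = 0")
      case False
      then show ?thesis
        using norm_int_lattice_ge_1[OF that False] u norm_triangle_ineq2[of k u] by (simp add: norm_minus_commute)
    qed simp
    then show "norm u \<le> lattice_dist x (x + u)" by (rule le_lattice_dist)
  qed
qed (rule dist_shift_le')

text \<open>On the cut locus there are several shortest displacements and the choice is arbitrary.
  Within distance 1/4 it is unique and continuous, see \<open>disp_shift\<close> and
  \<open>continuous_on_disp\<close>.\<close>

definition disp :: "'d::finite torus \<Rightarrow> 'd torus \<Rightarrow> real ^ 'd" where
  "disp x y = (SOME u. shift x u = y \<and> norm u = dist x y)"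

lemma shift_disp [simp]: "shift x (disp x y) = y"
  and norm_disp [simp]: "norm (disp x y) = dist x y"
  using someI_ex[OF ex_shift, of x y] by (auto simp: disp_def)

lemma dist_abs_torus_le: "dist (abs_torus a) (abs_torus b) \<le> norm (a - b)"
  using dist_shift_le[of "abs_torus 0" a b] by (simp add: shift_abs)

lemma continuous_on_abs_torus: "continuous_on S (abs_torus :: real ^ 'd::finite \<Rightarrow> 'd torus)"
  unfolding continuous_on_iff
  by (metis dist_abs_torus_le dist_norm le_less_trans)

lemma continuous_on_shift [continuous_intros]:
  assumes "continuous_on S x" "continuous_on S u"
  shows "continuous_on S (\<lambda>s. shift (x s) (u s))"
proof -
  have "dist (shift a b) (shift c d) \<le> dist a c + dist b d" for a c :: "'b torus" and b d
  proof -
    have 1: "dist (shift a b) (shift c b) \<le> dist a c"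
    proof -
      have "shift c b = shift a (disp a c + b)" by (metis shift_disp shift_shift)
      then show ?thesis using dist_shift_le[of a b "disp a c + b"] by (simp del: shift_shift add: norm_minus_commute)
    qed
    have "dist (shift c b) (shift c d) \<le> dist b d" using dist_shift_le[of c b d] by (simp add: dist_norm)
    then show ?thesis using 1 dist_triangle[of "shift a b" "shift c d" "shift c b"] by linarith
  qed
  note le = this
  show ?thesis
    unfolding continuous_on_def
  proof
    fix t assume t: "t \<in> S"
    have "((\<lambda>s. dist (x s) (x t) + dist (u s) (u t)) \<longlongrightarrow> 0 + 0) (at t within S)"
      using assms t by (intro tendsto_add) (auto simp: continuous_on_def tendsto_dist_iff[symmetric])
    then show "((\<lambda>s. shift (x s) (u s)) \<longlongrightarrow> shift (x t) (u t)) (at t within S)"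
      unfolding tendsto_dist_iff[of "\<lambda>s. shift (x s) (u s)"]
      by (rule Lim_null_comparison[rotated, OF tendsto_eq_rhs]) (auto simp: le)
  qed
qed

text \<open>A neighbour of \<open>abs_torus a\<close> lifts to a point equally close to
  \<open>a\<close>, by adding the shortest displacement. This reduces continuity on the torus to
  calculus on \<open>real ^ 'd\<close>.\<close>

lemma continuous_on_torus_iff:
  fixes g :: "'d::finite torus \<Rightarrow> 'b::metric_space"
  shows "continuous_on UNIV g \<longleftrightarrow> continuous_on UNIV (\<lambda>a. g (abs_torus a))"
proof
  assume "continuous_on UNIV g"
  then show "continuous_on UNIV (\<lambda>a. g (abs_torus a))"
    by (rule continuous_on_compose2) (auto intro: continuous_on_abs_torus)
next
  assume c: "continuous_on UNIV (\<lambda>a. g (abs_torus a))"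
  show "continuous_on UNIV g"
    unfolding continuous_on_iff
  proof (intro ballI allI impI)
    fix x :: "'d torus" and e :: real assume e: "0 < e"
    obtain a where a: "x = abs_torus a" using ex_abs_torus by blast
    obtain d where d: "d > 0" "\<And>b. dist b a < d \<Longrightarrow> dist (g (abs_torus b)) (g (abs_torus a)) < e"
      using c e unfolding continuous_on_iff by blast
    have "dist (g y) (g x) < e" if "dist y x < d" for y
    proof -
      have "y = abs_torus (a + disp x y)" unfolding shift_abs[symmetric] a[symmetric] by simp
      then show ?thesis using d(2)[of "a + disp x y"] that a by (simp add: dist_norm dist_commute)
    qed
    then show "\<exists>d>0. \<forall>x'\<in>UNIV. dist x' x < d \<longrightarrow> dist (g x') (g x) < e" using d(1) by blast
  qed
qed

lemma abs_torus_cbox: "abs_torus ` cbox 0 1 = (UNIV :: 'd::finite torus set)"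
proof -
  have "\<exists>b\<in>cbox 0 1. x = abs_torus b" for x :: "'d torus"
  proof -
    obtain a where a: "x = abs_torus a" using ex_abs_torus by blast
    define k :: "real ^ 'd" where "k = (\<chi> i. - of_int \<lfloor>a $ i\<rfloor>)"
    have "k \<in> int_lattice" by (simp add: k_def int_lattice_def)
    then have "x = abs_torus (a + k)" using a abs_torus_lattice by metis
    moreover have "a + k \<in> cbox 0 1"
      by (auto simp: mem_box_cart k_def; linarith)
    ultimately show ?thesis by blast
  qed
  then show ?thesis by auto
qed

lemma compact_torus: "compact (UNIV :: 'd::finite torus set)"
  using compact_continuous_image[OF continuous_on_abs_torus compact_cbox] abs_torus_cbox by metis

text \<open>Displacements lift, so \<open>abs_torus\<close> is an open map and carries a countable
  basis to a countable basis. The instance makes the Borel sets of a product a product sigma-algebra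
  and provides the Lindelof argument for supports.\<close>

instance torus :: (finite) second_countable_topology
proof
  obtain B :: "(real ^ 'a) set set" where B: "countable B" "topological_basis B"
    using ex_countable_basis by blast
  have opn: "open ((abs_torus :: real ^ 'a \<Rightarrow> _) ` U)" if "open U" for U
    unfolding open_dist
  proof
    fix x assume "x \<in> (abs_torus :: real ^ 'a \<Rightarrow> _) ` U"
    then obtain a where a: "a \<in> U" "x = abs_torus a" by blast
    obtain e where e: "e > 0" "\<And>b. dist b a < e \<Longrightarrow> b \<in> U"
      using \<open>open U\<close> a(1) unfolding open_dist by blast
    have "y \<in> abs_torus ` U" if "dist y x < e" for y
    proof (rule image_eqI)
      show "y = abs_torus (a + disp x y)" by (metis a(2) shift_abs shift_disp)
      show "a + disp x y \<in> U" by (rule e(2)) (use that in \<open>simp add: dist_norm dist_commute\<close>)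
    qed
    then show "\<exists>e>0. \<forall>y. dist y x < e \<longrightarrow> y \<in> abs_torus ` U" using e(1) by blast
  qed
  have "topological_basis ((`) abs_torus ` B)"
  proof (rule topological_basisI)
    show "open B'" if "B' \<in> (`) abs_torus ` B" for B' :: "'a torus set"
      using that opn topological_basis_open[OF B(2)] by blast
    fix O' :: "'a torus set" and x assume O: "open O'" "x \<in> O'"
    obtain a where a: "x = abs_torus a" using ex_abs_torus by blast
    have "open (abs_torus -` O')" 
      by (rule open_vimage[OF O(1) continuous_on_abs_torus])
    then obtain B' where "B' \<in> B" "a \<in> B'" "B' \<subseteq> abs_torus -` O'"
      using topological_basisE[OF B(2)] O(2) a by (metis vimage_eq)
    then show "\<exists>B'\<in>(`) abs_torus ` B. x \<in> B' \<and> B' \<subseteq> O'"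
      using a by (intro bexI[of _ "abs_torus ` B'"]) auto
  qed
  then show "\<exists>B :: 'a torus set set. countable B \<and> open = generate_topology B"
    using B(1) by (intro exI[of _ "(`) abs_torus ` B"]) (simp add: topological_basis_imp_subbasis)
qed

section \<open>Finitely supported measures and payoffs\<close>

text \<open>The index set is arbitrary so that the same lemmas serve particle systems, indexed by
  numbers, and equilibrium measures, indexed by their own atoms.\<close>

definition pmeas :: "'i set \<Rightarrow> ('i \<Rightarrow> real) \<Rightarrow> ('i \<Rightarrow> 'a::topological_space) \<Rightarrow> 'a measure" where
  "pmeas S w X = distr (point_measure S (\<lambda>i. ennreal (w i))) borel X"

lemma particle_measure_pmeas: "particle_measure n p = pmeas {..<n} (fst p) (snd p)"
  by (simp add: particle_measure_def pmeas_def)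

lemma sets_pmeas [simp, measurable_cong]: "sets (pmeas S w X) = sets borel"
  and space_pmeas [simp]: "space (pmeas S w X) = UNIV"
  by (simp_all add: pmeas_def)

lemma nn_integral_pmeas:
  assumes "finite S" "g \<in> borel_measurable borel"
  shows "(\<integral>\<^sup>+ x. g x \<partial>pmeas S w X) = (\<Sum>i\<in>S. ennreal (w i) * g (X i))"
  unfolding pmeas_def using assms
  by (subst nn_integral_distr) (auto simp: nn_integral_point_measure_finite)

lemma emeasure_pmeas:
  assumes "finite S" "\<And>i. i \<in> S \<Longrightarrow> 0 \<le> w i" "A \<in> sets borel"
  shows "emeasure (pmeas S w X) A = ennreal (\<Sum>i\<in>S. if X i \<in> A then w i else 0)"
proof -
  have "emeasure (pmeas S w X) A = (\<integral>\<^sup>+ x. indicator A x \<partial>pmeas S w X)"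
    using assms(3) by simp
  also have "\<dots> = (\<Sum>i\<in>S. ennreal (w i) * indicator A (X i))"
    by (rule nn_integral_pmeas) (use assms in auto)
  also have "\<dots> = (\<Sum>i\<in>S. ennreal (if X i \<in> A then w i else 0))"
    by (intro sum.cong) (auto simp: indicator_def)
  also have "\<dots> = ennreal (\<Sum>i\<in>S. if X i \<in> A then w i else 0)"
    using assms by (intro sum_ennreal) auto
  finally show ?thesis .
qed

lemma finite_measure_pmeas:
  assumes "finite S" "\<And>i. i \<in> S \<Longrightarrow> 0 \<le> w i"
  shows "finite_measure (pmeas S w X)"
  by (rule finite_measureI) (use emeasure_pmeas[OF assms, where A = UNIV and X = X] in simp)

lemma measure_pmeas:
  assumes "finite S" "\<And>i. i \<in> S \<Longrightarrow> 0 \<le> w i" "A \<in> sets borel"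
  shows "measure (pmeas S w X) A = (\<Sum>i\<in>S. if X i \<in> A then w i else 0)"
  using emeasure_pmeas[OF assms, where X = X] assms by (simp add: measure_def sum_nonneg)

lemma pmeas_prob:
  assumes "finite S" "\<And>i. i \<in> S \<Longrightarrow> 0 \<le> w i" "(\<Sum>i\<in>S. w i) = 1"
  shows "pmeas S w X \<in> prob_measures"
  using emeasure_pmeas[OF assms(1,2), where A = UNIV and X = X] assms(3)
  by (auto simp: prob_measures_def intro!: prob_spaceI)

lemma integrable_pmeas:
  fixes g :: "'a::topological_space \<Rightarrow> 'b::{banach, second_countable_topology}"
  assumes "finite S" "g \<in> borel_measurable borel"
  shows "integrable (pmeas S w X) g"
  unfolding pmeas_def using assms
  by (subst integrable_distr_eq) (auto simp: integrable_point_measure_finite)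

lemma integral_pmeas:
  fixes g :: "'a::topological_space \<Rightarrow> 'b::{banach, second_countable_topology}"
  assumes "finite S" "\<And>i. i \<in> S \<Longrightarrow> 0 \<le> w i" "g \<in> borel_measurable borel"
  shows "(\<integral> x. g x \<partial>pmeas S w X) = (\<Sum>i\<in>S. w i *\<^sub>R g (X i))"
  unfolding pmeas_def using assms
  by (subst integral_distr) (auto simp: lebesgue_integral_point_measure_finite)

lemma pmeas_cong:
  assumes "finite S" "\<And>i. i \<in> S \<Longrightarrow> w i = w' i" "\<And>i. i \<in> S \<Longrightarrow> 0 \<le> w i" "\<And>i. i \<in> S \<Longrightarrow> X i = X' i"
  shows "pmeas S w X = pmeas S w' X'"
proof (rule measure_eqI)
  fix A assume "A \<in> sets (pmeas S w X)"
  then have A: "A \<in> sets borel" by simp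
  have "emeasure (pmeas S w X) A = ennreal (\<Sum>i\<in>S. if X i \<in> A then w i else 0)"
    by (rule emeasure_pmeas) (use assms A in auto)
  also have "\<dots> = ennreal (\<Sum>i\<in>S. if X' i \<in> A then w' i else 0)"
    using assms by (intro arg_cong[where f = ennreal] sum.cong) auto
  also have "\<dots> = emeasure (pmeas S w' X') A"
    by (rule emeasure_pmeas[symmetric]) (use assms A in auto)
  finally show "emeasure (pmeas S w X) A = emeasure (pmeas S w' X') A" .
qed simp

text \<open>The complement of the support is a union of open null sets, and by the Lindelof property
  countably many of them suffice.\<close>

lemma emeasure_compl_supp:
  fixes \<mu> :: "'a::second_countable_topology measure"
  assumes "sets \<mu> = sets borel"
  shows "emeasure \<mu> (- supp \<mu>) = 0"
proof -
  define F where "F = {U. open U \<and> emeasure \<mu> U = 0}"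
  obtain F' where F': "F' \<subseteq> F" "countable F'" "\<Union>F' = \<Union>F"
    using Lindelof[of F] by (auto simp: F_def)
  have "\<Union>F = - supp \<mu>" by (auto simp: F_def supp_def zero_less_iff_neq_zero)
  moreover have "\<Union>F' \<in> null_sets \<mu>"
  proof -
    have "(\<Union>U\<in>F'. U) \<in> null_sets \<mu>"
      by (rule null_sets_UN') (use F' assms in \<open>auto simp: F_def null_sets_def\<close>)
    then show ?thesis by simp
  qed
  ultimately show ?thesis using F'(3) by auto
qed

lemma finite_supp_decompose:
  fixes \<mu> :: "'a::{second_countable_topology, t1_space} measure"
  assumes \<mu>: "\<mu> \<in> prob_measures" and fin: "finite (supp \<mu>)"
  shows "\<mu> = pmeas (supp \<mu>) (\<lambda>p. measure \<mu> {p}) (\<lambda>p. p)"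
    and "\<And>p. p \<in> supp \<mu> \<Longrightarrow> 0 < measure \<mu> {p}"
    and "(\<Sum>p\<in>supp \<mu>. measure \<mu> {p}) = 1"
proof -
  interpret prob_space \<mu> using \<mu> by (simp add: prob_measures_def)
  have s: "sets \<mu> = sets borel" using \<mu> by (simp add: prob_measures_def)
  have sp: "space \<mu> = UNIV" using sets_eq_imp_space_eq[OF s] by simp
  have clf: "closed T" if "finite T" for T :: "'a set" using that by (rule finite_imp_closed)
  have null: "measure \<mu> (- supp \<mu>) = 0" using emeasure_compl_supp[OF s] by (simp add: measure_def)
  have ss: "supp \<mu> \<in> sets \<mu>" using s clf[OF fin] by auto
  have m: "measure \<mu> A = (\<Sum>p\<in>supp \<mu>. if p \<in> A then measure \<mu> {p} else 0)" if A: "A \<in> sets borel" for A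
  proof -
    have A': "A \<in> sets \<mu>" using A s by simp
    have "measure \<mu> A = measure \<mu> (A \<inter> supp \<mu>) + measure \<mu> (A - supp \<mu>)"
      by (subst finite_measure_Union[symmetric]) (use A' ss in \<open>auto intro!: arg_cong[where f = "measure \<mu>"]\<close>)
    also have "measure \<mu> (A - supp \<mu>) = 0"
      using null finite_measure_mono[of "A - supp \<mu>" "- supp \<mu>"] ss sp sets.compl_sets[OF ss]
      by (simp add: measure_le_0_iff Compl_eq_Diff_UNIV Diff_mono)
    also have "measure \<mu> (A \<inter> supp \<mu>) = (\<Sum>p\<in>A \<inter> supp \<mu>. measure \<mu> {p})"
      using fin s by (intro finite_measure_eq_sum_singleton) auto
    also have "\<dots> = (\<Sum>p\<in>supp \<mu>. if p \<in> A then measure \<mu> {p} else 0)"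
      using fin by (simp add: sum.If_cases Int_commute)
    finally show ?thesis by simp
  qed
  show "\<mu> = pmeas (supp \<mu>) (\<lambda>p. measure \<mu> {p}) (\<lambda>p. p)"
  proof (rule measure_eqI)
    fix A assume "A \<in> sets \<mu>"
    then have A: "A \<in> sets borel" using s by simp
    have "emeasure \<mu> A = ennreal (measure \<mu> A)" by (rule emeasure_eq_measure)
    also have "\<dots> = ennreal (\<Sum>p\<in>supp \<mu>. if p \<in> A then measure \<mu> {p} else 0)" by (subst m[OF A]) simp
    also have "\<dots> = emeasure (pmeas (supp \<mu>) (\<lambda>p. measure \<mu> {p}) (\<lambda>p. p)) A"
      by (subst emeasure_pmeas) (use fin A in auto)
    finally show "emeasure \<mu> A = emeasure (pmeas (supp \<mu>) (\<lambda>p. measure \<mu> {p}) (\<lambda>p. p)) A" .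
  qed (simp add: s)
  show "0 < measure \<mu> {p}" if p: "p \<in> supp \<mu>" for p
  proof -
    \<comment> \<open>Removing the finitely many other atoms leaves an open neighbourhood of
      \<open>p\<close> whose whole mass sits at \<open>p\<close>.\<close>
    define U where "U = - (supp \<mu> - {p})"
    have U: "open U" "p \<in> U" using clf[of "supp \<mu> - {p}"] fin unfolding U_def by (simp_all only: open_Compl finite_Diff) simp
    then have "0 < emeasure \<mu> U" using p by (auto simp: supp_def)
    then have "0 < measure \<mu> U" by (simp add: emeasure_eq_measure)
    also have "measure \<mu> U = (\<Sum>q\<in>supp \<mu>. if q = p then measure \<mu> {q} else 0)"
      using m[of U] U(1) by (auto simp: U_def intro!: sum.cong)
    finally show ?thesis using fin p by simp
  qed
  show "(\<Sum>p\<in>supp \<mu>. measure \<mu> {p}) = 1"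
    using m[of UNIV] prob_space sp by simp
qed

lemma (in prob_space) abs_integral_le:
  assumes "\<And>x. \<bar>g x\<bar> \<le> (B::real)" shows "\<bar>\<integral>x. g x \<partial>M\<bar> \<le> B"
proof (cases "integrable M g")
  case True
  have "\<bar>\<integral>x. g x \<partial>M\<bar> \<le> (\<integral>x. \<bar>g x\<bar> \<partial>M)" by (rule integral_abs_bound)
  also have "\<dots> \<le> (\<integral>x. B \<partial>M)" using True assms by (intro integral_mono) auto
  finally show ?thesis by (simp add: prob_space)
next
  case False
  \<comment> \<open>The integral is 0 by convention, and \<open>0 \<le> B\<close> follows from the
    bound at any one point.\<close>
  then show ?thesis using assms[of undefined] by (simp add: not_integrable_integral_eq)
qed

section \<open>Mixed payoffs and pure deviations\<close>

locale continuous_payoff =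
  fixes f :: "'a::second_countable_topology \<Rightarrow> 'b::second_countable_topology \<Rightarrow> real" and B :: real
  assumes cont: "continuous_on UNIV (\<lambda>(x, y). f x y)"
    and bound: "\<And>x y. \<bar>f x y\<bar> \<le> B"
begin

lemma f_measurable: "(\<lambda>(x, y). f x y) \<in> borel_measurable (borel \<Otimes>\<^sub>M borel)"
  using borel_measurable_continuous_onI[OF cont] by (simp add: borel_prod)

lemma continuous_fst: "continuous_on UNIV (\<lambda>x. f x y)"
  by (rule continuous_on_compose2[OF cont, where f = "\<lambda>x. (x, y)", simplified]) (intro continuous_intros)

lemma continuous_snd: "continuous_on UNIV (\<lambda>y. f x y)"
  by (rule continuous_on_compose2[OF cont, where f = "\<lambda>y. (x, y)", simplified]) (intro continuous_intros)

lemma integral_pmeas_fst: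
  assumes "finite S" "\<And>i. i \<in> S \<Longrightarrow> 0 \<le> w i"
  shows "(\<integral>x. f x y \<partial>pmeas S w X) = (\<Sum>i\<in>S. w i * f (X i) y)"
  by (subst integral_pmeas) (use assms borel_measurable_continuous_onI[OF continuous_fst] in auto)

lemma integral_pmeas_snd:
  assumes "finite S" "\<And>i. i \<in> S \<Longrightarrow> 0 \<le> w i"
  shows "(\<integral>y. f x y \<partial>pmeas S w X) = (\<Sum>i\<in>S. w i * f x (X i))"
  by (subst integral_pmeas) (use assms borel_measurable_continuous_onI[OF continuous_snd] in auto)

context
  fixes \<mu> :: "'a measure" and \<nu> :: "'b measure"
  assumes \<mu>: "\<mu> \<in> prob_measures" and \<nu>: "\<nu> \<in> prob_measures"
begin

interpretation M: prob_space \<mu> using \<mu> by (simp add: prob_measures_def)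
interpretation N: prob_space \<nu> using \<nu> by (simp add: prob_measures_def)
interpretation MN: pair_prob_space \<mu> \<nu> ..

lemma sets_mn: "sets \<mu> = sets borel" "sets \<nu> = sets borel"
  using \<mu> \<nu> by (simp_all add: prob_measures_def)

lemma f_meas_pair: "(\<lambda>(x, y). f x y) \<in> borel_measurable (\<mu> \<Otimes>\<^sub>M \<nu>)"
  using f_measurable sets_pair_measure_cong[OF sets_mn] measurable_cong_sets by blast

lemma integrable_pair: "integrable (\<mu> \<Otimes>\<^sub>M \<nu>) (\<lambda>(x, y). f x y)"
  by (rule MN.integrable_const_bound[where B = B]) (use bound f_meas_pair in auto)

lemma payoff_swap: "payoff f \<mu> \<nu> = (\<integral>x. (\<integral>y. f x y \<partial>\<nu>) \<partial>\<mu>)"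
  unfolding payoff_def by (rule MN.Fubini_integral[OF integrable_pair])

lemma integrable_inner_fst: "integrable \<nu> (\<lambda>y. \<integral>x. f x y \<partial>\<mu>)"
  by (rule MN.integrable_snd[OF integrable_pair])

lemma integrable_inner_snd: "integrable \<mu> (\<lambda>x. \<integral>y. f x y \<partial>\<nu>)"
  by (rule MN.integrable_fst[OF integrable_pair])

lemma payoff_le: "(\<And>y. (\<integral>x. f x y \<partial>\<mu>) \<le> A) \<Longrightarrow> payoff f \<mu> \<nu> \<le> A"
  unfolding payoff_def using integral_mono[OF integrable_inner_fst, of "\<lambda>_. A"] by (simp add: N.prob_space)

lemma payoff_ge: "(\<And>x. A \<le> (\<integral>y. f x y \<partial>\<nu>)) \<Longrightarrow> A \<le> payoff f \<mu> \<nu>"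
  unfolding payoff_swap using integral_mono[OF _ integrable_inner_snd, of "\<lambda>_. A"] by (simp add: M.prob_space)

lemma abs_payoff_le: "\<bar>payoff f \<mu> \<nu>\<bar> \<le> B"
  unfolding payoff_def by (intro N.abs_integral_le M.abs_integral_le bound)

text \<open>\<open>NI\<close> is a supremum of reals, so it says something only once its range is
  known to be bounded. The bound for the other pairs is a hypothesis because
  \<open>abs_payoff_le\<close> is proved for the fixed pair of this context.\<close>

lemma NI_bdd:
  "bdd_above ((\<lambda>(\<mu>', \<nu>'). payoff f \<mu> \<nu>' - payoff f \<mu>' \<nu>) ` (prob_measures \<times> prob_measures))"
  if "\<And>\<mu>' \<nu>'. (\<mu>' :: 'a measure) \<in> prob_measures \<Longrightarrow> (\<nu>' :: 'b measure) \<in> prob_measures \<Longrightarrow> \<bar>payoff f \<mu>' \<nu>'\<bar> \<le> B"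
proof (rule bdd_aboveI2, clarify)
  fix \<mu>' :: "'a measure" and \<nu>' :: "'b measure" assume "\<mu>' \<in> prob_measures" "\<nu>' \<in> prob_measures"
  then show "payoff f \<mu> \<nu>' - payoff f \<mu>' \<nu> \<le> 2 * B"
    using that[OF \<mu>, of \<nu>'] that[of \<mu>', OF _ \<nu>] by (simp add: abs_le_iff)
qed

end

lemma return_prob: "return borel x \<in> prob_measures"
  by (simp add: prob_measures_def prob_space_return)

lemma payoff_return_snd:
  assumes "\<mu> \<in> prob_measures" shows "payoff f \<mu> (return borel y) = (\<integral>x. f x y \<partial>\<mu>)"
proof -
  have "(\<lambda>y. \<integral>x. f x y \<partial>\<mu>) \<in> borel_measurable borel"
    using integrable_inner_fst[OF assms return_prob, of y] by (auto dest: borel_measurable_integrable)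
  then show ?thesis unfolding payoff_def by (intro integral_return) auto
qed

lemma payoff_return_fst:
  assumes "\<nu> \<in> prob_measures" shows "payoff f (return borel x) \<nu> = (\<integral>y. f x y \<partial>\<nu>)"
proof -
  have "(\<lambda>x. \<integral>y. f x y \<partial>\<nu>) \<in> borel_measurable borel"
    using integrable_inner_snd[OF return_prob assms, of x] by (auto dest: borel_measurable_integrable)
  then show ?thesis unfolding payoff_swap[OF return_prob assms] by (intro integral_return) auto
qed

text \<open>Dirac masses are admissible deviations for both players.\<close>

lemma NI_ge:
  assumes "\<mu> \<in> prob_measures" "\<nu> \<in> prob_measures"
  shows "(\<integral>x. f x y \<partial>\<mu>) - (\<integral>y. f x y \<partial>\<nu>) \<le> NI f \<mu> \<nu>"
  unfolding NI_def
  by (rule cSUP_upper2[OF NI_bdd[OF assms abs_payoff_le], where x = "(return borel x, return borel y)"])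
     (use assms in \<open>simp_all add: return_prob payoff_return_fst payoff_return_snd\<close>)

lemma NI_le:
  assumes "\<mu> \<in> prob_measures" "\<nu> \<in> prob_measures"
    and "\<And>y. (\<integral>x. f x y \<partial>\<mu>) \<le> A" "\<And>x. A' \<le> (\<integral>y. f x y \<partial>\<nu>)"
  shows "NI f \<mu> \<nu> \<le> A - A'"
  unfolding NI_def
proof (rule cSUP_least)
  show "(prob_measures :: 'a measure set) \<times> (prob_measures :: 'b measure set) \<noteq> {}"
    using assms(1,2) by auto
  fix p assume p: "p \<in> (prob_measures :: 'a measure set) \<times> (prob_measures :: 'b measure set)"
  then have p': "fst p \<in> prob_measures" "snd p \<in> prob_measures" by auto
  have "payoff f \<mu> (snd p) \<le> A" by (rule payoff_le[OF assms(1) p'(2) assms(3)])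
  moreover have "A' \<le> payoff f (fst p) \<nu>" by (rule payoff_ge[OF p'(1) assms(2,4)])
  ultimately show "(case p of (\<mu>', \<nu>') \<Rightarrow> payoff f \<mu> \<nu>' - payoff f \<mu>' \<nu>) \<le> A - A'"
    by (cases p) simp
qed

text \<open>Mixed payoffs are averages of pure ones, so testing Dirac masses suffices. The
  equilibrium property becomes a pair of pointwise inequalities.\<close>

lemma is_MNE_iff:
  "is_MNE f \<mu> \<nu> \<longleftrightarrow> \<mu> \<in> prob_measures \<and> \<nu> \<in> prob_measures \<and>
     (\<forall>y. (\<integral>x. f x y \<partial>\<mu>) \<le> payoff f \<mu> \<nu>) \<and> (\<forall>x. payoff f \<mu> \<nu> \<le> (\<integral>y. f x y \<partial>\<nu>))"
proof
  assume "is_MNE f \<mu> \<nu>"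
  then have m: "\<mu> \<in> prob_measures" "\<nu> \<in> prob_measures"
    and u: "\<And>\<nu>'. \<nu>' \<in> prob_measures \<Longrightarrow> payoff f \<mu> \<nu>' \<le> payoff f \<mu> \<nu>"
    and l: "\<And>\<mu>'. \<mu>' \<in> prob_measures \<Longrightarrow> payoff f \<mu> \<nu> \<le> payoff f \<mu>' \<nu>"
    by (auto simp: is_MNE_def)
  show "\<mu> \<in> prob_measures \<and> \<nu> \<in> prob_measures \<and>
     (\<forall>y. (\<integral>x. f x y \<partial>\<mu>) \<le> payoff f \<mu> \<nu>) \<and> (\<forall>x. payoff f \<mu> \<nu> \<le> (\<integral>y. f x y \<partial>\<nu>))"
    using m u[OF return_prob] l[OF return_prob]
    by (simp add: payoff_return_fst[OF m(2)] payoff_return_snd[OF m(1)])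
next
  assume "\<mu> \<in> prob_measures \<and> \<nu> \<in> prob_measures \<and>
     (\<forall>y. (\<integral>x. f x y \<partial>\<mu>) \<le> payoff f \<mu> \<nu>) \<and> (\<forall>x. payoff f \<mu> \<nu> \<le> (\<integral>y. f x y \<partial>\<nu>))"
  then show "is_MNE f \<mu> \<nu>"
    unfolding is_MNE_def by (auto intro: payoff_le[of \<mu>] payoff_ge[of _ \<nu>])
qed

text \<open>The maximizing player of \<open>f\<close> is the minimizing player of the negated
  transpose, so every result about the first player can be applied to the second. Fubini's theorem
  interchanges the integrals.\<close>

lemma is_MNE_swap: "is_MNE f \<mu> \<nu> \<longleftrightarrow> is_MNE (\<lambda>y x. - f x y) \<nu> \<mu>"
proof -
  have "payoff (\<lambda>y x. - f x y) \<nu>' \<mu>' = - payoff f \<mu>' \<nu>'"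
    if "\<mu>' \<in> prob_measures" "\<nu>' \<in> prob_measures" for \<mu>' \<nu>'
    using payoff_swap[OF that] by (simp add: payoff_def)
  then show ?thesis unfolding is_MNE_def by auto
qed

end

section \<open>Smooth functions on the torus\<close>

text \<open>The Hessian is kept as a map at each point: the estimates work with the quadratic form
  \<open>u \<bullet> H x u\<close> along segments in direction \<open>u\<close>.\<close>

definition twice_diff ::
  "('d::finite torus \<Rightarrow> real) \<Rightarrow> ('d torus \<Rightarrow> real ^ 'd) \<Rightarrow> ('d torus \<Rightarrow> real ^ 'd \<Rightarrow> real ^ 'd) \<Rightarrow> bool" where
  "twice_diff \<phi> G H \<longleftrightarrow> (\<forall>x. GDERIV (\<lambda>v. \<phi> (shift x v)) 0 :> G x) \<and>
     (\<forall>x. ((\<lambda>v. G (shift x v)) has_derivative H x) (at 0))"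

lemma GDERIV_inner_unique:
  fixes D D' :: "'a::real_inner"
  assumes "GDERIV f x :> D" "GDERIV f x :> D'" shows "D = D'"
proof -
  have "(\<lambda>h. h \<bullet> D) = (\<lambda>h. h \<bullet> D')"
    using assms unfolding gderiv_def by (rule has_derivative_unique)
  then have "(D - D') \<bullet> D = (D - D') \<bullet> D'" by (rule fun_cong)
  then have "(D - D') \<bullet> (D - D') = 0" by (simp add: inner_diff_right)
  then show ?thesis by simp
qed

lemma torus_grad_eq: "GDERIV (\<lambda>v. \<phi> (shift x v)) 0 :> D \<Longrightarrow> torus_grad \<phi> x = D"
  unfolding torus_grad_def by (rule the_equality) (auto intro: GDERIV_inner_unique)

text \<open>Bridges the Hessian matrix in the definition of the game and the Hessian as a
  map.\<close>

lemma torus_hess_inner: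
  assumes "twice_diff \<phi> G H" shows "v \<bullet> (torus_hess \<phi> x *v v) = v \<bullet> H x v"
proof -
  have "torus_grad \<phi> = G" using assms by (auto simp: twice_diff_def intro: torus_grad_eq)
  moreover have d: "((\<lambda>v. G (shift x v)) has_derivative H x) (at 0)"
    using assms by (simp add: twice_diff_def)
  ultimately have "torus_hess \<phi> x = matrix (H x)"
    unfolding torus_hess_def by (simp add: frechet_derivative_at[OF d, symmetric])
  then show ?thesis using fun_cong[OF matrix_vector_mul(2)[OF has_derivative_linear[OF d]], of v] by simp
qed

lemma twice_diff_sum:
  assumes "\<And>j. j \<in> S \<Longrightarrow> twice_diff (\<phi> j) (G j) (H j)"
  shows "twice_diff (\<lambda>x. \<Sum>j\<in>S. c j * \<phi> j x) (\<lambda>x. \<Sum>j\<in>S. c j *\<^sub>R G j x) (\<lambda>x u. \<Sum>j\<in>S. c j *\<^sub>R H j x u)"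
  unfolding twice_diff_def gderiv_def inner_sum_right inner_scaleR_right
  using assms unfolding twice_diff_def gderiv_def
  by (intro conjI allI has_derivative_sum has_derivative_mult_right has_derivative_scaleR_right) auto

lemma twice_diff_minus:
  assumes "twice_diff \<phi> G H" shows "twice_diff (\<lambda>x. - \<phi> x) (\<lambda>x. - G x) (\<lambda>x u. - H x u)"
  using assms unfolding twice_diff_def gderiv_def inner_minus_right
  by (auto intro: has_derivative_minus)

context
  fixes \<phi> :: "'d::finite torus \<Rightarrow> real" and G H
  assumes td: "twice_diff \<phi> G H"
begin

lemma line_deriv: "((\<lambda>s. \<phi> (shift x (s *\<^sub>R u))) has_real_derivative G (shift x (s *\<^sub>R u)) \<bullet> u) (at s)"
proof -
  have "((\<lambda>v. \<phi> (shift (shift x (s *\<^sub>R u)) v)) has_derivative (\<lambda>h. h \<bullet> G (shift x (s *\<^sub>R u)))) (at ((s - s) *\<^sub>R u))"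
    using td by (simp add: twice_diff_def gderiv_def del: shift_shift)
  note d = this
  have "((\<lambda>t. (t - s) *\<^sub>R u) has_derivative (\<lambda>h. h *\<^sub>R u)) (at s)"
    by (auto intro!: derivative_eq_intros)
  from has_derivative_compose[OF this d]
  have "((\<lambda>t. \<phi> (shift x (s *\<^sub>R u + (t - s) *\<^sub>R u))) has_derivative (\<lambda>h. (h *\<^sub>R u) \<bullet> G (shift x (s *\<^sub>R u)))) (at s)"
    by simp
  then show ?thesis
    by (simp add: has_field_derivative_def inner_commute mult_commute_abs flip: scaleR_add_left)
qed

lemma line_deriv2:
  "((\<lambda>s. G (shift x (s *\<^sub>R u)) \<bullet> u) has_real_derivative u \<bullet> H (shift x (s *\<^sub>R u)) u) (at s)"
proof -
  let ?H = "H (shift x (s *\<^sub>R u))"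
  have d: "((\<lambda>v. G (shift (shift x (s *\<^sub>R u)) v)) has_derivative ?H) (at ((s - s) *\<^sub>R u))"
    using td by (simp add: twice_diff_def del: shift_shift)
  have lin: "linear ?H" using has_derivative_linear[OF d] .
  have "((\<lambda>t. (t - s) *\<^sub>R u) has_derivative (\<lambda>h. h *\<^sub>R u)) (at s)"
    by (auto intro!: derivative_eq_intros)
  from has_derivative_compose[OF this d]
  have "((\<lambda>t. G (shift x (s *\<^sub>R u + (t - s) *\<^sub>R u))) has_derivative (\<lambda>h. ?H (h *\<^sub>R u))) (at s)"
    by simp
  from has_derivative_inner_left[OF this, of u]
  show ?thesis
    by (simp add: has_field_derivative_def inner_commute linear_scale[OF lin] mult_commute_abs flip: scaleR_add_left)
qed

text \<open>Integrates the lower bound \<open>m\<close> for the second derivative along the segment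
  once and twice. The second inequality expands about the end point; the implicit step calls for it
  because its gradients are taken at the new position.\<close>

lemma second_order:
  assumes m: "\<And>s. 0 \<le> s \<Longrightarrow> s \<le> 1 \<Longrightarrow> m \<le> u \<bullet> H (shift x (s *\<^sub>R u)) u"
  shows "\<phi> x + G x \<bullet> u + m / 2 \<le> \<phi> (shift x u)"
    and "\<phi> (shift x u) - G (shift x u) \<bullet> u + m / 2 \<le> \<phi> x"
    and "G x \<bullet> u + m \<le> G (shift x u) \<bullet> u"
proof -
  let ?g = "\<lambda>s. G (shift x (s *\<^sub>R u)) \<bullet> u"
  have mono: "?g a + m * (b - a) \<le> ?g b" if "0 \<le> a" "a \<le> b" "b \<le> 1" for a b
  proof -
    have "?g a - m * a \<le> ?g b - m * b"
    proof (rule DERIV_nonneg_imp_nondecreasing[OF that(2), where f = "\<lambda>s. ?g s - m * s"])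
      fix s assume "a \<le> s" "s \<le> b"
      then show "\<exists>y. ((\<lambda>s. ?g s - m * s) has_real_derivative y) (at s) \<and> 0 \<le> y"
        using m[of s] that by (intro exI[of _ "u \<bullet> H (shift x (s *\<^sub>R u)) u - m"])
          (auto intro!: derivative_eq_intros line_deriv2)
    qed
    then show ?thesis by (simp add: algebra_simps)
  qed
  show "G x \<bullet> u + m \<le> G (shift x u) \<bullet> u" using mono[of 0 1] by simp
  have "\<phi> (shift x (0 *\<^sub>R u)) - ?g 0 * 0 - m * 0\<^sup>2 / 2 \<le> \<phi> (shift x (1 *\<^sub>R u)) - ?g 0 * 1 - m * 1\<^sup>2 / 2"
  proof (rule DERIV_nonneg_imp_nondecreasing[where f = "\<lambda>s. \<phi> (shift x (s *\<^sub>R u)) - ?g 0 * s - m * s\<^sup>2 / 2"])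
    fix s :: real assume s: "0 \<le> s" "s \<le> 1"
    show "\<exists>y. ((\<lambda>s. \<phi> (shift x (s *\<^sub>R u)) - ?g 0 * s - m * s\<^sup>2 / 2) has_real_derivative y) (at s) \<and> 0 \<le> y"
      using mono[of 0 s] s by (intro exI[of _ "?g s - ?g 0 - m * s"])
        (auto intro!: derivative_eq_intros line_deriv)
  qed simp
  then show "\<phi> x + G x \<bullet> u + m / 2 \<le> \<phi> (shift x u)" by simp
  have "?g 1 * 0 - \<phi> (shift x (0 *\<^sub>R u)) + m * (0\<^sup>2 / 2 - 0) \<le> ?g 1 * 1 - \<phi> (shift x (1 *\<^sub>R u)) + m * (1\<^sup>2 / 2 - 1)"
  proof (rule DERIV_nonneg_imp_nondecreasing[where f = "\<lambda>s. ?g 1 * s - \<phi> (shift x (s *\<^sub>R u)) + m * (s\<^sup>2 / 2 - s)"])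
    fix s :: real assume s: "0 \<le> s" "s \<le> 1"
    show "\<exists>y. ((\<lambda>s. ?g 1 * s - \<phi> (shift x (s *\<^sub>R u)) + m * (s\<^sup>2 / 2 - s)) has_real_derivative y) (at s) \<and> 0 \<le> y"
      using mono[of s 1] s by (intro exI[of _ "?g 1 - ?g s - m * (1 - s)"])
        (auto intro!: derivative_eq_intros line_deriv simp: algebra_simps)
  qed simp
  then show "\<phi> (shift x u) - G (shift x u) \<bullet> u + m / 2 \<le> \<phi> x" by (simp add: algebra_simps)
qed

lemma grad_eq_0_at_min:
  assumes "\<And>y. \<phi> x \<le> \<phi> y" shows "G x = 0"
proof -
  have "G x \<bullet> G x = 0"
    using DERIV_local_min[OF line_deriv[of x "G x" 0], of 1] assms by simp
  then show ?thesis by simp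
qed

end

text \<open>One constant bounds everything, and only derivatives in the first variable are recorded:
  the second player uses another instance of the locale, for
  \<open>\<lambda>y x. - f x y\<close>.\<close>

locale smooth_payoff =
  fixes f :: "'n::finite torus \<Rightarrow> 'm::finite torus \<Rightarrow> real"
    and gx :: "'n torus \<Rightarrow> 'm torus \<Rightarrow> real ^ 'n"
    and hx :: "'n torus \<Rightarrow> 'm torus \<Rightarrow> real ^ 'n \<Rightarrow> real ^ 'n" and L :: real
  assumes L_pos: "0 < L"
    and td: "\<And>y. twice_diff (\<lambda>x. f x y) (\<lambda>x. gx x y) (\<lambda>x. hx x y)"
    and f_bound: "\<And>x y. \<bar>f x y\<bar> \<le> L"
    and f_lip: "\<And>x x' y y'. \<bar>f x y - f x' y'\<bar> \<le> L * (dist x x' + dist y y')"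
    and gx_bound: "\<And>x y. norm (gx x y) \<le> L"
    and gx_lip: "\<And>x x' y y'. norm (gx x y - gx x' y') \<le> L * (dist x x' + dist y y')"
    and hx_bound: "\<And>x y u. \<bar>u \<bullet> hx x y u\<bar> \<le> L * (norm u)\<^sup>2"
    and hx_lip: "\<And>x x' y y' u. \<bar>u \<bullet> hx x y u - u \<bullet> hx x' y' u\<bar> \<le> L * (dist x x' + dist y y') * (norm u)\<^sup>2"
begin

lemma continuous_payoff: "continuous_payoff f L"
proof
  show "continuous_on UNIV (\<lambda>(x, y). f x y)"
    unfolding continuous_on_iff
  proof (clarsimp, goal_cases)
    case (1 x y e)
    have "dist (f x' y') (f x y) < e" if "dist (x', y') (x, y) < e / (2 * L)" for x' y'
    proof -
      have "dist x' x \<le> dist (x', y') (x, y)" "dist y' y \<le> dist (x', y') (x, y)"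
        using dist_fst_le[of "(x', y')" "(x, y)"] dist_snd_le[of "(x', y')" "(x, y)"] by auto
      moreover have "2 * (e / (2 * L)) = e / L" by simp
      ultimately have "dist x' x + dist y' y < e / L" using that by linarith
      then have "L * (dist x' x + dist y' y) < L * (e / L)"
        using L_pos by (intro mult_strict_left_mono)
      then show ?thesis using f_lip[of x' y' x y] L_pos by (simp add: dist_real_def)
    qed
    then show ?case using L_pos 1 by (intro exI[of _ "e / (2 * L)"]) auto
  qed
qed (rule f_bound)

lemma minus: "smooth_payoff (\<lambda>x y. - f x y) (\<lambda>x y. - gx x y) (\<lambda>x y u. - hx x y u) L"
proof
  show "twice_diff (\<lambda>x. - f x y) (\<lambda>x. - gx x y) (\<lambda>x u. - hx x y u)" for y
    by (rule twice_diff_minus[OF td])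
  show "\<bar>- f x y - - f x' y'\<bar> \<le> L * (dist x x' + dist y y')" for x x' y y'
    using f_lip[of x y x' y'] by (simp add: abs_minus_commute)
  show "norm (- gx x y - - gx x' y') \<le> L * (dist x x' + dist y y')" for x x' y y'
    using gx_lip[of x y x' y'] by (simp add: norm_minus_commute)
  show "\<bar>u \<bullet> - hx x y u - u \<bullet> - hx x' y' u\<bar> \<le> L * (dist x x' + dist y y') * (norm u)\<^sup>2" for x x' y y' u
    using hx_lip[of u x y x' y'] by (simp add: abs_minus_commute)
qed (use L_pos f_bound gx_bound hx_bound in auto)

end

lemma linear_riesz:
  fixes T :: "'a::euclidean_space \<Rightarrow> real"
  assumes "linear T" shows "v \<bullet> (\<Sum>b\<in>Basis. T b *\<^sub>R b) = T v"
proof -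
  have "T v = T (\<Sum>b\<in>Basis. (v \<bullet> b) *\<^sub>R b)" by (simp add: euclidean_representation)
  also have "\<dots> = (\<Sum>b\<in>Basis. (v \<bullet> b) * T b)" using assms by (simp add: linear_sum linear_scale)
  finally show ?thesis by (simp add: inner_sum_right mult.commute)
qed

lemma norm_riesz_le:
  fixes T :: "'a::euclidean_space \<Rightarrow> real"
  assumes "linear T" "\<And>v. \<bar>T v\<bar> \<le> K * norm v" shows "norm (\<Sum>b\<in>Basis. T b *\<^sub>R b) \<le> K"
proof (cases "(\<Sum>b\<in>Basis. T b *\<^sub>R b) = 0")
  case True
  obtain b :: 'a where "b \<in> Basis" using nonempty_Basis by blast
  then have "0 \<le> K" using assms(2)[of b] by simp
  then show ?thesis unfolding True by simp
next
  case False
  let ?w = "\<Sum>b\<in>Basis. T b *\<^sub>R b"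
  have "norm ?w * norm ?w = T ?w" using linear_riesz[OF assms(1), of ?w] by (simp add: power2_norm_eq_inner flip: power2_eq_square)
  also have "\<dots> \<le> K * norm ?w" using assms(2)[of ?w] by linarith
  finally show ?thesis using False by simp
qed

text \<open>Lifts any two points into one fixed ball at exactly their torus distance. Bounds on a
  ball of \<open>real ^ 'd\<close> thereby become global bounds on the torus.\<close>

lemma torus_reps:
  obtains K where "0 < K"
    and "\<And>x x' :: 'd::finite torus. \<exists>u u'. x = abs_torus u \<and> x' = abs_torus u' \<and>
      norm u \<le> K \<and> norm u' \<le> K \<and> norm (u - u') = dist x x'"
proof -
  obtain B where B: "\<And>u :: real ^ 'd. u \<in> cbox 0 1 \<Longrightarrow> norm u \<le> B"
    using bounded_cbox bounded_iff by metis
  have r: "\<exists>u. x = abs_torus u \<and> norm u \<le> B" for x :: "'d torus"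
    using abs_torus_cbox B by (metis UNIV_I imageE)
  have B0: "0 \<le> B" using B[of 0] by (simp add: mem_box_cart)
  show thesis
  proof (rule that[of "3 * B + 1"])
    fix x x' :: "'d torus"
    obtain u v where uv: "x = abs_torus u" "norm u \<le> B" "x' = abs_torus v" "norm v \<le> B" using r by meson
    have d: "dist x x' \<le> 2 * B"
      using dist_abs_torus_le[of u v] norm_triangle_ineq4[of u v] uv by simp
    have "x' = abs_torus (u + disp x x')" unfolding shift_abs[symmetric] uv(1)[symmetric] by simp
    \<comment> \<open>The point \<open>x\<close> is lifted to the unit cube, contained in the ball
      of radius \<open>B\<close>, and \<open>x'\<close> by adding a displacement of length at most
      \<open>2 * B\<close>.\<close>
    moreover have "norm (u + disp x x') \<le> 3 * B + 1"
      using norm_triangle_ineq[of u "disp x x'"] uv d by simp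
    moreover have "norm (u - (u + disp x x')) = dist x x'" by simp
    ultimately show "\<exists>u u'. x = abs_torus u \<and> x' = abs_torus u' \<and> norm u \<le> 3 * B + 1 \<and>
        norm u' \<le> 3 * B + 1 \<and> norm (u - u') = dist x x'"
      using uv B0 by (intro exI[of _ u] exI[of _ "u + disp x x'"]) simp
  qed (use B0 in simp)
qed

text \<open>The two inclusions cover both orders of the two players with one proof.\<close>

lemma smooth_payoff_of_C21:
  fixes F :: "'e::euclidean_space \<Rightarrow> real" and iu :: "real ^ 'n::finite \<Rightarrow> 'e" and iw :: "real ^ 'm::finite \<Rightarrow> 'e"
  assumes "C21 F" and iu: "linear iu" "\<And>u. norm (iu u) = norm u" and iw: "linear iw" "\<And>w. norm (iw w) = norm w"
    and f: "\<And>u w. f (abs_torus u) (abs_torus w) = F (iu u + iw w)"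
  shows "\<exists>gx hx L. smooth_payoff f gx hx L"
proof -
  obtain D1 :: "'e \<Rightarrow> 'e \<Rightarrow>\<^sub>L real" and D2 :: "'e \<Rightarrow> 'e \<Rightarrow>\<^sub>L 'e \<Rightarrow>\<^sub>L real" and M
    where D1: "\<And>z. (F has_derivative blinfun_apply (D1 z)) (at z)"
      and D2: "\<And>z. (D1 has_derivative blinfun_apply (D2 z)) (at z)"
      and lip: "M-lipschitz_on UNIV D2"
    using \<open>C21 F\<close> unfolding C21_def by blast
  have M: "0 \<le> M" "\<And>z z'. norm (D2 z - D2 z') \<le> M * norm (z - z')"
    using lip by (auto simp: lipschitz_on_def dist_norm)
  \<comment> \<open>The Riesz vector of a functional restricted to the variables of the first
    player.\<close>
  define R where "R T = (\<Sum>b\<in>Basis. blinfun_apply T (iu b) *\<^sub>R b)" for T :: "'e \<Rightarrow>\<^sub>L real"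
  have blu: "bounded_linear iu" using iu(1) by (simp add: linear_conv_bounded_linear)
  have linT: "linear (\<lambda>v. blinfun_apply T (iu v))" for T :: "'e \<Rightarrow>\<^sub>L real"
    by (intro bounded_linear.linear bounded_linear_compose[OF blinfun.bounded_linear_right blu])
  have R: "v \<bullet> R T = T (iu v)" for T v
    unfolding R_def by (rule linear_riesz[OF linT])
  have Tn: "\<bar>T (iu v)\<bar> \<le> norm T * norm v" for T :: "'e \<Rightarrow>\<^sub>L real" and v
    using norm_blinfun[of T "iu v"] iu(2) by simp
  have Rn: "norm (R T) \<le> norm T" for T
    unfolding R_def by (rule norm_riesz_le[OF linT Tn])
  have Rd: "R (T - T') = R T - R T'" for T T'
    unfolding R_def by (simp add: blinfun.diff_left scaleR_diff_left sum_subtractf)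
  have Rbl: "bounded_linear R"
  proof (rule bounded_linear_intro[of _ 1])
    show "R (a + b) = R a + R b" for a b
      unfolding R_def by (simp add: blinfun.add_left scaleR_add_left sum.distrib)
    show "R (r *\<^sub>R a) = r *\<^sub>R R a" for r a
      unfolding R_def by (simp add: blinfun.scaleR_left scaleR_sum_right)
  qed (use Rn in simp)
  define rx :: "'n torus \<Rightarrow> real ^ 'n" where "rx x = (SOME u. x = abs_torus u)" for x
  define ry :: "'m torus \<Rightarrow> real ^ 'm" where "ry y = (SOME u. y = abs_torus u)" for y
  have rx: "x = abs_torus (rx x)" for x unfolding rx_def by (rule someI_ex[OF ex_abs_torus])
  have ry: "y = abs_torus (ry y)" for y unfolding ry_def by (rule someI_ex[OF ex_abs_torus])
  define gx where "gx x y = R (D1 (iu (rx x) + iw (ry y)))" for x y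
  define hx where "hx x y h = R (D2 (iu (rx x) + iw (ry y)) (iu h))" for x y h
  have GD: "GDERIV (\<lambda>v. f (shift (abs_torus u) v) (abs_torus w)) 0 :> R (D1 (iu u + iw w))" for u w
  proof -
    have d: "(F has_derivative blinfun_apply (D1 (iu u + iw w))) (at (iu (u + 0) + iw w))" using D1 by simp
    have "((\<lambda>v. F (iu (u + v) + iw w)) has_derivative (\<lambda>h. D1 (iu u + iw w) (iu h))) (at 0)"
      by (rule has_derivative_compose[where f = "\<lambda>v. iu (u + v) + iw w", OF _ d])
        (auto intro!: derivative_eq_intros bounded_linear.has_derivative[OF blu])
    then show ?thesis by (simp add: gderiv_def shift_abs f R)
  qed
  \<comment> \<open>\<open>gx\<close> was defined through chosen representatives; uniqueness of the
    derivative shows that all representatives give the same value.\<close>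
  have gx: "gx (abs_torus u) (abs_torus w) = R (D1 (iu u + iw w))" for u w
    by (rule GDERIV_inner_unique[OF _ GD[of u w]])
       (use GD[of "rx (abs_torus u)" "ry (abs_torus w)"] in \<open>simp add: gx_def flip: rx ry\<close>)
  have HD: "((\<lambda>v. gx (shift (abs_torus u) v) (abs_torus w)) has_derivative (\<lambda>h. R (D2 (iu u + iw w) (iu h)))) (at 0)" for u w
  proof -
    have d: "(D1 has_derivative blinfun_apply (D2 (iu u + iw w))) (at (iu (u + 0) + iw w))" using D2 by simp
    have "((\<lambda>v. D1 (iu (u + v) + iw w)) has_derivative (\<lambda>h. D2 (iu u + iw w) (iu h))) (at 0)"
      by (rule has_derivative_compose[where f = "\<lambda>v. iu (u + v) + iw w", OF _ d])
        (auto intro!: derivative_eq_intros bounded_linear.has_derivative[OF blu])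
    then have "((\<lambda>v. R (D1 (iu (u + v) + iw w))) has_derivative (\<lambda>h. R (D2 (iu u + iw w) (iu h)))) (at 0)"
      by (rule bounded_linear.has_derivative[OF Rbl])
    then show ?thesis by (simp add: shift_abs gx)
  qed
  have hx: "hx (abs_torus u) (abs_torus w) = (\<lambda>h. R (D2 (iu u + iw w) (iu h)))" for u w
    by (rule has_derivative_unique[OF _ HD[of u w]])
       (use HD[of "rx (abs_torus u)" "ry (abs_torus w)"] in \<open>simp add: hx_def[abs_def] flip: rx ry\<close>)
  obtain Kx where Kx: "0 < Kx" "\<And>x x' :: 'n torus. \<exists>u u'. x = abs_torus u \<and> x' = abs_torus u' \<and>
      norm u \<le> Kx \<and> norm u' \<le> Kx \<and> norm (u - u') = dist x x'" using torus_reps by metis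
  obtain Ky where Ky: "0 < Ky" "\<And>x x' :: 'm torus. \<exists>u u'. x = abs_torus u \<and> x' = abs_torus u' \<and>
      norm u \<le> Ky \<and> norm u' \<le> Ky \<and> norm (u - u') = dist x x'" using torus_reps by metis
  define K where "K = Kx + Ky"
  have reps: "\<exists>u u' w w'. x = abs_torus u \<and> x' = abs_torus u' \<and> y = abs_torus w \<and> y' = abs_torus w' \<and>
      norm (iu u + iw w) \<le> K \<and> norm (iu u' + iw w') \<le> K \<and>
      norm ((iu u + iw w) - (iu u' + iw w')) \<le> dist x x' + dist y y'" for x x' y y'
  proof -
    obtain u u' where u: "x = abs_torus u" "x' = abs_torus u'" "norm u \<le> Kx" "norm u' \<le> Kx" "norm (u - u') = dist x x'"
      using Kx(2) by blast
    obtain w w' where w: "y = abs_torus w" "y' = abs_torus w'" "norm w \<le> Ky" "norm w' \<le> Ky" "norm (w - w') = dist y y'"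
      using Ky(2) by blast
    have "(iu u + iw w) - (iu u' + iw w') = iu (u - u') + iw (w - w')"
      by (simp add: linear_diff iu(1) iw(1))
    then have "norm ((iu u + iw w) - (iu u' + iw w')) \<le> dist x x' + dist y y'"
      using norm_triangle_ineq[of "iu (u - u')" "iw (w - w')"] iu(2) iw(2) u(5) w(5) by simp
    moreover have "norm (iu u + iw w) \<le> K" "norm (iu u' + iw w') \<le> K"
      unfolding K_def using norm_triangle_ineq[of "iu u" "iw w"] norm_triangle_ineq[of "iu u'" "iw w'"] u w iu(2) iw(2) by simp_all
    ultimately show ?thesis using u w by blast
  qed
  have K0: "0 < K" using Kx Ky by (simp add: K_def)
  \<comment> \<open>On the ball of radius \<open>K\<close>, the Lipschitz constant of the second
    derivative bounds the second derivative, which bounds the first by the mean value inequality,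
    which in turn bounds \<open>F\<close>.\<close>
  define B2 where "B2 = norm (D2 0) + M * K"
  have B2: "norm (D2 z) \<le> B2" if "norm z \<le> K" for z
  proof -
    have "norm (D2 z) \<le> norm (D2 0) + norm (D2 z - D2 0)" using norm_triangle_ineq[of "D2 0" "D2 z - D2 0"] by simp
    moreover have "norm (D2 z - D2 0) \<le> M * norm z" using M(2)[of z 0] by simp
    moreover have "M * norm z \<le> M * K" using that M(1) by (intro mult_left_mono)
    ultimately show ?thesis by (simp add: B2_def)
  qed
  have D1l: "norm (D1 z - D1 z') \<le> B2 * norm (z - z')" if "norm z \<le> K" "norm z' \<le> K" for z z'
  proof (rule differentiable_bound[of "cball 0 K" D1 "\<lambda>z. blinfun_apply (D2 z)"])
    show "onorm (blinfun_apply (D2 x)) \<le> B2" if "x \<in> cball 0 K" for x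
      using B2 that by (simp flip: norm_blinfun.rep_eq)
  qed (use that D2 in \<open>auto intro: has_derivative_at_withinI\<close>)
  define B1 where "B1 = norm (D1 0) + B2 * K"
  have B2nn: "0 \<le> B2" using M(1) K0 by (simp add: B2_def)
  have B1: "norm (D1 z) \<le> B1" if "norm z \<le> K" for z
  proof -
    have "norm (D1 z) \<le> norm (D1 0) + norm (D1 z - D1 0)" using norm_triangle_ineq[of "D1 0" "D1 z - D1 0"] by simp
    moreover have "norm (D1 z - D1 0) \<le> B2 * norm z" using D1l[of z 0] that K0 by simp
    moreover have "B2 * norm z \<le> B2 * K" using that B2nn by (intro mult_left_mono)
    ultimately show ?thesis by (simp add: B1_def)
  qed
  have B1nn: "0 \<le> B1" using B2nn K0 by (simp add: B1_def)
  have Fl: "norm (F z - F z') \<le> B1 * norm (z - z')" if "norm z \<le> K" "norm z' \<le> K" for z z'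
  proof (rule differentiable_bound[of "cball 0 K" F "\<lambda>z. blinfun_apply (D1 z)"])
    show "onorm (blinfun_apply (D1 x)) \<le> B1" if "x \<in> cball 0 K" for x
      using B1 that by (simp flip: norm_blinfun.rep_eq)
  qed (use that D1 in \<open>auto intro: has_derivative_at_withinI\<close>)
  define B0 where "B0 = \<bar>F 0\<bar> + B1 * K"
  have B0: "\<bar>F z\<bar> \<le> B0" if "norm z \<le> K" for z
  proof -
    have "\<bar>F z - F 0\<bar> \<le> B1 * norm z" using Fl[of z 0] that K0 by simp
    moreover have "B1 * norm z \<le> B1 * K" using that B1nn by (intro mult_left_mono)
    ultimately show ?thesis by (simp add: B0_def)
  qed
  have B0nn: "0 \<le> B0" using B1nn K0 by (simp add: B0_def)
  define L where "L = M + B2 + B1 + B0 + 1"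
  have Ls: "M \<le> L" "B2 \<le> L" "B1 \<le> L" "B0 \<le> L" "0 < L" using M(1) B2nn B1nn B0nn by (auto simp: L_def)
  have quad: "\<bar>u \<bullet> R (T (iu u))\<bar> \<le> norm T * (norm u)\<^sup>2" for T :: "'e \<Rightarrow>\<^sub>L 'e \<Rightarrow>\<^sub>L real" and u
  proof -
    have "\<bar>u \<bullet> R (T (iu u))\<bar> \<le> norm (T (iu u)) * norm u" using Tn by (simp add: R)
    also have "\<dots> \<le> (norm T * norm u) * norm u"
      using norm_blinfun[of T "iu u"] iu(2) by (intro mult_right_mono) auto
    finally show ?thesis by (simp add: power2_eq_square mult.assoc)
  qed
  have "smooth_payoff f gx hx L"
  proof
    show "0 < L" by (rule Ls)
    show "twice_diff (\<lambda>x. f x y) (\<lambda>x. gx x y) (\<lambda>x. hx x y)" for y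
      unfolding twice_diff_def
    proof (intro conjI allI)
      fix x
      show "GDERIV (\<lambda>v. f (shift x v) y) 0 :> gx x y"
        using GD[of "rx x" "ry y"] gx[of "rx x" "ry y"] by (simp flip: rx ry)
      show "((\<lambda>v. gx (shift x v) y) has_derivative hx x y) (at 0)"
        using HD[of "rx x" "ry y"] hx[of "rx x" "ry y"] by (simp flip: rx ry)
    qed
    fix x x' y y'
    obtain u u' w w' where z: "x = abs_torus u" "x' = abs_torus u'" "y = abs_torus w" "y' = abs_torus w'"
      "norm (iu u + iw w) \<le> K" "norm (iu u' + iw w') \<le> K"
      "norm ((iu u + iw w) - (iu u' + iw w')) \<le> dist x x' + dist y y'"
      using reps by blast
    let ?z = "iu u + iw w" and ?z' = "iu u' + iw w'"
    have up: "c * norm (?z - ?z') \<le> L * (dist x x' + dist y y')" if "c \<le> L" for c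
      using that z(7) Ls(5) by (intro mult_mono) auto
    show "\<bar>f x y\<bar> \<le> L" using B0[OF z(5)] Ls f z by simp
    show "\<bar>f x y - f x' y'\<bar> \<le> L * (dist x x' + dist y y')"
      using Fl[OF z(5,6)] up[OF Ls(3)] unfolding z(1-4) f by (simp add: z(1-4))
    show "norm (gx x y) \<le> L" using B1[OF z(5)] Rn[of "D1 ?z"] Ls unfolding z(1-4) gx by simp
    show "norm (gx x y - gx x' y') \<le> L * (dist x x' + dist y y')"
      using D1l[OF z(5,6)] Rn[of "D1 ?z - D1 ?z'"] up[OF Ls(2)] unfolding z(1-4) gx Rd by (simp add: z(1-4))
    fix v :: "real ^ 'n"
    have "norm (D2 ?z) * (norm v)\<^sup>2 \<le> L * (norm v)\<^sup>2" using B2[OF z(5)] Ls by (intro mult_right_mono) auto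
    then show "\<bar>v \<bullet> hx x y v\<bar> \<le> L * (norm v)\<^sup>2"
      using quad[of v "D2 ?z"] unfolding z(1-4) hx by linarith
    have "norm (D2 ?z - D2 ?z') \<le> L * (dist x x' + dist y y')"
      using M(2)[of ?z ?z'] up[OF Ls(1)] by linarith
    then have "norm (D2 ?z - D2 ?z') * (norm v)\<^sup>2 \<le> L * (dist x x' + dist y y') * (norm v)\<^sup>2"
      by (intro mult_right_mono) auto
    moreover have "v \<bullet> hx x y v - v \<bullet> hx x' y' v = v \<bullet> R ((D2 ?z - D2 ?z') (iu v))"
      unfolding z(1-4) hx by (simp add: blinfun.diff_left Rd inner_diff_right)
    ultimately show "\<bar>v \<bullet> hx x y v - v \<bullet> hx x' y' v\<bar> \<le> L * (dist x x' + dist y y') * (norm v)\<^sup>2"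
      using quad[of v "D2 ?z - D2 ?z'"] by linarith
  qed
  then show ?thesis by blast
qed

lemma torus_C21_smooth_payoff:
  assumes "torus_C21 f"
  shows "\<exists>gx hx L. smooth_payoff f gx hx L"
    and "\<exists>gy hy L. smooth_payoff (\<lambda>y x. - f x y) gy hy L"
proof -
  let ?F = "\<lambda>(u, w). f (abs_torus u) (abs_torus w)"
  have C: "C21 ?F" using assms by (simp add: torus_C21_def)
  have lin: "linear (\<lambda>u :: real ^ 'a. (u, 0 :: real ^ 'b))" "linear (\<lambda>w :: real ^ 'b. (0 :: real ^ 'a, w))"
    by (auto intro!: linearI)
  show "\<exists>gx hx L. smooth_payoff f gx hx L"
    by (rule smooth_payoff_of_C21[OF C lin(1) _ lin(2)]) auto
  have "\<exists>gy hy L. smooth_payoff (\<lambda>y x. f x y) gy hy L"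
    by (rule smooth_payoff_of_C21[OF C lin(2) _ lin(1)]) auto
  then show "\<exists>gy hy L. smooth_payoff (\<lambda>y x. - f x y) gy hy L" using smooth_payoff.minus by blast
qed

section \<open>First-order conditions of the proximal step\<close>

lemma x_ln_ge:
  fixes x c :: real
  assumes "0 \<le> x" "0 < c" shows "x - c \<le> x * ln (x / c)"
proof (cases "x = 0")
  case False
  then have "ln (c / x) \<le> c / x - 1" using assms by (intro ln_le_minus_one) auto
  then have "x * ln (c / x) \<le> x * (c / x - 1)" using assms by (intro mult_left_mono) auto
  moreover have "ln (c / x) = - ln (x / c)" using assms False by (simp add: ln_div)
  ultimately show ?thesis using False by (simp add: algebra_simps)
qed (use assms in simp)

lemma x_ln_eq:
  fixes x c :: real
  assumes "0 \<le> x" "0 < c" "x * ln (x / c) = x - c" shows "x = c"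
proof -
  have "x \<noteq> 0" using assms by auto
  then have "x > 0" using assms by simp
  then have "ln (c / x) = c / x - 1" using assms by (simp add: ln_div field_simps)
  then have "c / x = 1" using ln_eq_minus_one[of "c / x"] \<open>0 < x\<close> assms by simp
  then show ?thesis using \<open>0 < x\<close> by simp
qed

text \<open>Convexity of \<open>x * ln (x / c)\<close>, which vanishes at \<open>c\<close>, in a
  form that includes \<open>x = 0\<close>. Both parts of the sum use
  \<open>ln t \<le> t - 1\<close>, and the resulting linear terms cancel.\<close>

lemma x_ln_segment_le:
  fixes x c s :: real
  assumes "0 \<le> x" "0 < c" "0 < s" "s \<le> 1"
  defines "y \<equiv> (1 - s) * x + s * c"
  shows "y * ln (y / c) \<le> (1 - s) * (x * ln (x / c))"
proof -
  have y: "0 < y" using assms by (auto simp: y_def intro: add_nonneg_pos)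
  have "(1 - s) * x * (ln y - ln x) \<le> (1 - s) * (y - x)" if "x > 0"
  proof -
    have "ln y - ln x = ln (y / x)" using y that by (simp add: ln_div)
    also have "\<dots> \<le> y / x - 1" using y that by (intro ln_le_minus_one) simp
    finally have "(1 - s) * x * (ln y - ln x) \<le> (1 - s) * x * (y / x - 1)"
      using that assms by (intro mult_left_mono) auto
    also have "\<dots> = (1 - s) * (y - x)" using that by (simp add: field_simps)
    finally show ?thesis .
  qed
  moreover have "s * c * (ln y - ln c) \<le> s * (y - c)"
  proof -
    have "ln y - ln c = ln (y / c)" using y assms by (simp add: ln_div)
    also have "\<dots> \<le> y / c - 1" using y assms by (intro ln_le_minus_one) simp
    finally have "s * c * (ln y - ln c) \<le> s * c * (y / c - 1)" using assms by (intro mult_left_mono) auto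
    also have "\<dots> = s * (y - c)" using assms by (simp add: field_simps)
    finally show ?thesis .
  qed
  moreover have "(1 - s) * (y - x) + s * (y - c) = 0" by (simp add: y_def algebra_simps)
  moreover have "y * ln (y / c) = (1 - s) * x * (ln y - ln c) + s * c * (ln y - ln c)"
    using y assms by (simp add: ln_div y_def algebra_simps)
  ultimately have "x \<noteq> 0 \<Longrightarrow> ?thesis" using assms(1,2) y by (simp add: ln_div algebra_simps)
  moreover have "x = 0 \<Longrightarrow> ?thesis" using assms by (simp add: mult_nonneg_nonpos)
  ultimately show ?thesis by blast
qed

text \<open>Optimality in a neighbourhood is exploited along curves of competitors; this supplies
  the time during which such a curve stays in the neighbourhood.\<close>

lemma openin_eventually_path:
  fixes \<gamma> :: "real \<Rightarrow> 'a::topological_space"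
  assumes "openin (top_of_set S) U" "continuous_on UNIV \<gamma>" "\<gamma> 0 \<in> U"
  obtains d where "0 < d" "\<And>s. \<bar>s\<bar> < d \<Longrightarrow> \<gamma> s \<in> S \<Longrightarrow> \<gamma> s \<in> U"
proof -
  obtain T where T: "open T" "U = S \<inter> T" using assms(1) by (auto simp: openin_open)
  have "open (\<gamma> -` T)" by (rule open_vimage[OF T(1) assms(2)])
  moreover have "0 \<in> \<gamma> -` T" using assms(3) T by auto
  ultimately obtain d where "d > 0" "\<And>s. dist s 0 < d \<Longrightarrow> s \<in> \<gamma> -` T" unfolding open_dist by blast
  then show thesis using that T by auto
qed

lemma KL_dom_iff:
  "w \<in> KL_dom n w' \<longleftrightarrow> w \<in> prob_simplex n \<and> \<not> (\<exists>i<n. w' i = 0 \<and> 0 < w i)"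
  by (auto simp: KL_dom_def KL_def)

lemma KL_dom_eq: "w \<in> KL_dom n w' \<Longrightarrow> real_of_ereal (KL n w w') = (\<Sum>i<n. w i * ln (w i / w' i))"
  by (auto simp: KL_dom_iff KL_def)

text \<open>The position equation is solved for the old position, so that the weight ratio and the
  gradient both refer to the new particle. Positions of particles of weight zero are left
  free.\<close>

definition prox_step ::
  "('d::finite torus \<Rightarrow> real) \<Rightarrow> ('d torus \<Rightarrow> real ^ 'd) \<Rightarrow> real \<Rightarrow> real \<Rightarrow> nat \<Rightarrow> 'd particles \<Rightarrow> 'd particles \<Rightarrow> bool" where
  "prox_step G Gg \<eta> \<sigma> n p p' \<longleftrightarrow>
     fst p \<in> prob_simplex n \<and> fst p' \<in> prob_simplex n \<and>
     (\<forall>i<n. fst p' i = fst p i * exp (- \<eta> * G (snd p' i)) / (\<Sum>i<n. fst p i * exp (- \<eta> * G (snd p' i)))) \<and>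
     (\<forall>i<n. 0 < fst p i \<longrightarrow> snd p i = shift (snd p' i) ((\<sigma> * fst p' i / fst p i) *\<^sub>R Gg (snd p' i)))"

context
  fixes G :: "'d::finite torus \<Rightarrow> real" and Gg H and \<eta> \<sigma> :: real and n :: nat and p :: "'d particles"
    and U :: "((nat \<Rightarrow> real) \<times> (nat \<Rightarrow> real ^ 'd)) set" and a1 :: "nat \<Rightarrow> real" and u1 :: "nat \<Rightarrow> real ^ 'd"
    and \<Phi> :: "(nat \<Rightarrow> real) \<times> (nat \<Rightarrow> real ^ 'd) \<Rightarrow> real"
  assumes td: "twice_diff G Gg H" and pos: "0 < \<eta>" "0 < \<sigma>" and a0: "fst p \<in> prob_simplex n"
    and U: "openin (top_of_set (KL_dom n (fst p) \<times> UNIV)) U" and c1: "(a1, u1) \<in> U"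
    and min: "\<And>a u. (a, u) \<in> U \<Longrightarrow> \<Phi> (a1, u1) \<le> \<Phi> (a, u)"
    and \<Phi>: "\<And>a u. (a, u) \<in> U \<Longrightarrow> \<Phi> (a, u) = (\<Sum>i<n. a i * G (shift (snd p i) (u i)))
       + 1 / \<eta> * real_of_ereal (KL n a (fst p))
       + 1 / (2 * \<sigma>) * (\<Sum>i<n. fst p i * (dist (shift (snd p i) (u i)) (snd p i))\<^sup>2)"
begin

lemma U_dom: "(a, u) \<in> U \<Longrightarrow> a \<in> KL_dom n (fst p)"
  using openin_imp_subset[OF U] by auto

text \<open>Along the segment from the minimizing weights to the Gibbs weights the relative entropy to the
  Gibbs weights decreases, so local minimality forces it to vanish.\<close>

lemma prox_weights:
  assumes "i < n"
  shows "a1 i = fst p i * exp (- \<eta> * G (shift (snd p i) (u1 i))) /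
    (\<Sum>i<n. fst p i * exp (- \<eta> * G (shift (snd p i) (u1 i))))"
proof -
  define g where "g i = G (shift (snd p i) (u1 i))" for i
  define Z where "Z = (\<Sum>i<n. fst p i * exp (- \<eta> * g i))"
  \<comment> \<open>The Gibbs weights for the payoffs at the minimizing positions.\<close>
  define b where "b i = fst p i * exp (- \<eta> * g i) / Z" for i
  have p0: "0 \<le> fst p i" if "i < n" for i using a0 that by (simp add: prob_simplex_def)
  have a1d: "a1 \<in> KL_dom n (fst p)" using U_dom[OF c1] .
  have "Z > 0"
  proof -
    have "\<exists>i<n. fst p i \<noteq> 0"
    proof (rule ccontr)
      assume "\<not> ?thesis"
      then have "(\<Sum>i<n. fst p i) = 0" by (intro sum.neutral) auto
      then show False using a0 by (simp add: prob_simplex_def)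
    qed
    then obtain i where i: "i < n" "0 < fst p i" using p0 by (metis order_le_less)
    have "0 < fst p i * exp (- \<eta> * g i)" using i by simp
    also have "\<dots> \<le> Z" unfolding Z_def using i p0 by (intro member_le_sum) auto
    finally show ?thesis .
  qed
  have b: "b \<in> prob_simplex n" and bpos: "\<And>i. i < n \<Longrightarrow> 0 < fst p i \<Longrightarrow> 0 < b i"
    and b0: "\<And>i. fst p i = 0 \<Longrightarrow> b i = 0" and bnn: "\<And>i. i < n \<Longrightarrow> 0 \<le> b i"
    using \<open>Z > 0\<close> p0 by (auto simp: b_def prob_simplex_def Z_def simp flip: sum_divide_distrib)
  define K where "K a = (\<Sum>i<n. a i * ln (a i / b i))" for a
  \<comment> \<open>Gibbs variational identity: at fixed positions the objective is
    \<open>1 / \<eta>\<close> times the relative entropy to \<open>b\<close>, up to a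
    constant.\<close>
  have T: "\<Phi> (a, u1) = 1 / \<eta> * K a - 1 / \<eta> * ln Z
      + 1 / (2 * \<sigma>) * (\<Sum>i<n. fst p i * (dist (shift (snd p i) (u1 i)) (snd p i))\<^sup>2)" if "(a, u1) \<in> U" for a
  proof -
    have ad: "a \<in> KL_dom n (fst p)" using U_dom[OF that] .
    have "(\<Sum>i<n. a i * g i) + 1 / \<eta> * (\<Sum>i<n. a i * ln (a i / fst p i))
        = (\<Sum>i<n. a i * g i + 1 / \<eta> * (a i * ln (a i / fst p i)))"
      by (simp add: sum.distrib sum_distrib_left)
    also have "\<dots> = (\<Sum>i<n. 1 / \<eta> * (a i * ln (a i / b i)) - 1 / \<eta> * ln Z * a i)"
    proof (intro sum.cong refl)
      fix i assume "i \<in> {..<n}"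
      then have i: "i < n" by simp
      show "a i * g i + 1 / \<eta> * (a i * ln (a i / fst p i)) = 1 / \<eta> * (a i * ln (a i / b i)) - 1 / \<eta> * ln Z * a i"
      proof (cases "a i = 0")
        case False
        then have ai: "0 < a i" using ad i by (auto simp: KL_dom_iff prob_simplex_def order_le_less)
        then have fi: "0 < fst p i" using ad i p0[OF i] by (auto simp: KL_dom_iff order_le_less)
        have "ln (a i / b i) = ln (a i / fst p i) + \<eta> * g i + ln Z"
          using ai fi \<open>Z > 0\<close> by (simp add: b_def ln_div ln_mult)
        then show ?thesis using pos by (simp add: field_simps)
      qed simp
    qed
    also have "\<dots> = 1 / \<eta> * K a - 1 / \<eta> * ln Z"
    proof -
      have "(\<Sum>i<n. a i) = 1" using ad by (simp add: KL_dom_iff prob_simplex_def)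
      then show ?thesis unfolding sum_subtractf sum_distrib_left[symmetric] K_def by simp
    qed
    finally show ?thesis using \<Phi>[OF that] KL_dom_eq[OF ad] by (simp add: g_def)
  qed
  let ?\<gamma> = "\<lambda>s. (\<lambda>i. (1 - s) * a1 i + s * b i, u1)"
  have cg: "continuous_on UNIV ?\<gamma>"
    by (rule continuous_on_Pair[OF continuous_on_coordinatewise_then_product continuous_on_const])
      (auto intro!: continuous_intros)
  have "?\<gamma> 0 \<in> U" using c1 by simp
  then obtain d where d: "0 < d" "\<And>s. \<bar>s\<bar> < d \<Longrightarrow> ?\<gamma> s \<in> KL_dom n (fst p) \<times> UNIV \<Longrightarrow> ?\<gamma> s \<in> U"
    using openin_eventually_path[OF U cg] by auto
  define s where "s = min (d / 2) 1"
  have s: "0 < s" "s \<le> 1" "\<bar>s\<bar> < d" using d(1) by (auto simp: s_def)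
  have a1s: "(\<Sum>i<n. a1 i) = 1" "\<And>i. i < n \<Longrightarrow> 0 \<le> a1 i" "\<And>i. i < n \<Longrightarrow> fst p i = 0 \<Longrightarrow> a1 i = 0"
    using a1d by (force simp: KL_dom_iff prob_simplex_def)+
  have "fst (?\<gamma> s) \<in> KL_dom n (fst p)"
    unfolding KL_dom_iff prob_simplex_def using s a1s bnn b b0
    by (auto simp: sum.distrib prob_simplex_def simp flip: sum_distrib_left)
  then have sU: "?\<gamma> s \<in> U" using d(2)[OF s(3)] by simp
  have "1 / \<eta> * K a1 \<le> 1 / \<eta> * K (fst (?\<gamma> s))" using min[OF sU] T[OF sU] T[OF c1] by simp
  then have "K a1 \<le> K (fst (?\<gamma> s))" using pos by (simp add: divide_le_cancel)
  also have "\<dots> \<le> (\<Sum>i<n. (1 - s) * (a1 i * ln (a1 i / b i)))"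
    unfolding K_def fst_conv
  proof (rule sum_mono)
    fix i assume "i \<in> {..<n}"
    then have i: "i < n" by simp
    show "((1 - s) * a1 i + s * b i) * ln (((1 - s) * a1 i + s * b i) / b i) \<le> (1 - s) * (a1 i * ln (a1 i / b i))"
    proof (cases "fst p i = 0")
      case False
      then show ?thesis using x_ln_segment_le[OF a1s(2)[OF i] bpos[OF i] s(1,2)] p0[OF i] by simp
    qed (use b0 a1s i in simp)
  qed
  finally have "K a1 \<le> (1 - s) * K a1" by (simp add: K_def sum_distrib_left)
  \<comment> \<open>Hence the nonnegative summands below, whose sum is \<open>K a1\<close>, all
    vanish, and \<open>a1\<close> agrees with \<open>b\<close> entry by entry.\<close>
  then have K0: "K a1 \<le> 0" using s by (simp add: algebra_simps mult_le_0_iff)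
  have nn: "0 \<le> a1 i * ln (a1 i / b i) - (a1 i - b i)" if "i < n" for i
    using x_ln_ge[OF a1s(2)[OF that] bpos[OF that]] p0[OF that] b0[of i] a1s(3)[OF that]
    by (cases "fst p i = 0") auto
  have "(\<Sum>i<n. a1 i * ln (a1 i / b i) - (a1 i - b i)) = K a1"
    using a1s(1) b by (simp add: sum_subtractf K_def prob_simplex_def)
  then have "(\<Sum>i<n. a1 i * ln (a1 i / b i) - (a1 i - b i)) = 0"
    using K0 nn by (intro antisym sum_nonneg) auto
  then have "a1 i * ln (a1 i / b i) - (a1 i - b i) = 0"
    using nn \<open>i < n\<close> by (subst (asm) sum_nonneg_eq_0_iff) auto
  then have "a1 i = b i"
    using x_ln_eq[OF a1s(2)[OF \<open>i < n\<close>] bpos[OF \<open>i < n\<close>]] p0[OF \<open>i < n\<close>] b0[of i] a1s(3)[OF \<open>i < n\<close>]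
    by (cases "fst p i = 0") auto
  then show ?thesis by (simp add: b_def g_def Z_def)
qed

text \<open>The squared distance is not differentiable at the cut locus, but it is dominated by the
  squared norm of a displacement, with equality at the minimizer.\<close>

lemma prox_positions:
  assumes i: "i < n" and ai: "0 < fst p i"
  shows "snd p i = shift (shift (snd p i) (u1 i)) ((\<sigma> * a1 i / fst p i) *\<^sub>R Gg (shift (snd p i) (u1 i)))"
proof -
  define x where "x = shift (snd p i) (u1 i)"
  define v where "v = disp (snd p i) x"
  have xv: "x = shift (snd p i) v" by (simp add: v_def)
  have crit: "a1 i * (Gg x \<bullet> h) + fst p i / \<sigma> * (v \<bullet> h) = 0" for h
  proof -
    let ?\<gamma> = "\<lambda>s. (a1, \<lambda>j. if j = i then u1 i + s *\<^sub>R h else u1 j)"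
    have "continuous_on UNIV (\<lambda>s. if j = i then u1 i + s *\<^sub>R h else u1 j)" for j
      by (cases "j = i") (auto intro!: continuous_intros)
    then have cg: "continuous_on UNIV ?\<gamma>"
      by (intro continuous_on_Pair continuous_on_coordinatewise_then_product continuous_on_const)
    have "(\<lambda>j. if j = i then u1 i + 0 *\<^sub>R h else u1 j) = u1" by auto
    then have "?\<gamma> 0 \<in> U" using c1 by simp
    then obtain d where d: "0 < d" "\<And>s. \<bar>s\<bar> < d \<Longrightarrow> ?\<gamma> s \<in> KL_dom n (fst p) \<times> UNIV \<Longrightarrow> ?\<gamma> s \<in> U"
      using openin_eventually_path[OF U cg] by blast
    let ?\<psi> = "\<lambda>s. a1 i * G (shift x (s *\<^sub>R h)) + fst p i / (2 * \<sigma>) * ((v + s *\<^sub>R h) \<bullet> (v + s *\<^sub>R h))"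
    have "?\<psi> 0 \<le> ?\<psi> s" if "\<bar>s\<bar> < d" for s
    proof -
      have sU: "?\<gamma> s \<in> U" using d(2)[OF that] U_dom[OF c1] by simp
      let ?D = "\<lambda>j. (dist (shift (snd p j) (u1 j)) (snd p j))\<^sup>2"
      have "(\<Sum>j<n. a1 j * G (shift (snd p j) (if j = i then u1 i + s *\<^sub>R h else u1 j)))
          = (\<Sum>j<n. a1 j * G (shift (snd p j) (u1 j)) + (if j = i then a1 i * (G (shift x (s *\<^sub>R h)) - G x) else 0))"
        by (intro sum.cong) (auto simp: x_def algebra_simps)
      then have 1: "(\<Sum>j<n. a1 j * G (shift (snd p j) (if j = i then u1 i + s *\<^sub>R h else u1 j)))
          = (\<Sum>j<n. a1 j * G (shift (snd p j) (u1 j))) + a1 i * (G (shift x (s *\<^sub>R h)) - G x)"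
        using i by (simp add: sum.distrib)
      have "(\<Sum>j<n. fst p j * (dist (shift (snd p j) (if j = i then u1 i + s *\<^sub>R h else u1 j)) (snd p j))\<^sup>2)
          = (\<Sum>j<n. fst p j * ?D j + (if j = i then fst p i * ((dist (shift x (s *\<^sub>R h)) (snd p i))\<^sup>2 - ?D i) else 0))"
        by (intro sum.cong) (auto simp: x_def algebra_simps)
      then have 2: "(\<Sum>j<n. fst p j * (dist (shift (snd p j) (if j = i then u1 i + s *\<^sub>R h else u1 j)) (snd p j))\<^sup>2)
          = (\<Sum>j<n. fst p j * ?D j) + fst p i * ((dist (shift x (s *\<^sub>R h)) (snd p i))\<^sup>2 - ?D i)"
        using i by (simp add: sum.distrib)
      have "0 \<le> a1 i * (G (shift x (s *\<^sub>R h)) - G x)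
          + 1 / (2 * \<sigma>) * (fst p i * ((dist (shift x (s *\<^sub>R h)) (snd p i))\<^sup>2 - ?D i))"
        using min[OF sU] \<Phi>[OF sU] \<Phi>[OF c1] unfolding 1 2 by (simp add: algebra_simps)
      moreover have "?D i = v \<bullet> v"
        by (simp add: v_def x_def dist_commute flip: power2_norm_eq_inner)
      moreover have "(dist (shift x (s *\<^sub>R h)) (snd p i))\<^sup>2 \<le> (v + s *\<^sub>R h) \<bullet> (v + s *\<^sub>R h)"
        unfolding xv shift_shift power2_norm_eq_inner[symmetric]
        by (intro power_mono) (auto simp: dist_commute[of _ "snd p i"] intro: dist_shift_le')
      then have "1 / (2 * \<sigma>) * (fst p i * ((dist (shift x (s *\<^sub>R h)) (snd p i))\<^sup>2 - ?D i))
          \<le> 1 / (2 * \<sigma>) * (fst p i * ((v + s *\<^sub>R h) \<bullet> (v + s *\<^sub>R h) - ?D i))"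
        using ai pos by (intro mult_left_mono) auto
      ultimately show ?thesis by (simp add: algebra_simps)
    qed
    moreover have "(?\<psi> has_real_derivative a1 i * (Gg x \<bullet> h) + fst p i / (2 * \<sigma>) * (2 * (v \<bullet> h))) (at 0)"
    proof -
      have 1: "((\<lambda>s. G (shift x (s *\<^sub>R h))) has_real_derivative Gg x \<bullet> h) (at 0)"
        using line_deriv[OF td, of x h 0] by simp
      have 2: "((\<lambda>s. (v + s *\<^sub>R h) \<bullet> (v + s *\<^sub>R h)) has_real_derivative 2 * (v \<bullet> h)) (at 0)"
        unfolding has_field_derivative_def
        by (auto intro!: derivative_eq_intros simp: inner_commute algebra_simps)
      show ?thesis by (intro DERIV_add DERIV_cmult 1 2)
    qed
    ultimately have "a1 i * (Gg x \<bullet> h) + fst p i / (2 * \<sigma>) * (2 * (v \<bullet> h)) = 0"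
      using DERIV_local_min[of ?\<psi> _ 0 d] d(1) by simp
    then show ?thesis by simp
  qed
  define w where "w = a1 i *\<^sub>R Gg x + (fst p i / \<sigma>) *\<^sub>R v"
  have "w \<bullet> w = 0" using crit[of w] by (simp add: w_def inner_add_left)
  then have "w = 0" by simp
  then have "(\<sigma> / fst p i) *\<^sub>R (a1 i *\<^sub>R Gg x + (fst p i / \<sigma>) *\<^sub>R v) = 0" by (simp add: w_def)
  then have "(\<sigma> * a1 i / fst p i) *\<^sub>R Gg x + v = 0" using ai pos by (simp add: scaleR_add_right)
  then have "shift x ((\<sigma> * a1 i / fst p i) *\<^sub>R Gg x) = snd p i"
    unfolding xv[THEN arg_cong[where f = "\<lambda>x'. shift x' _"]] by (simp add: add.commute)
  then show ?thesis by (simp add: x_def)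
qed

lemma prox_step_local_min: "prox_step G Gg \<eta> \<sigma> n p (displace p (a1, u1))"
  using U_dom[OF c1] a0 prox_weights prox_positions
  by (auto simp: prox_step_def displace_def KL_dom_iff simp del: shift_shift)

end

text \<open>With the other player frozen at its new value, each half of the saddle-point condition
  is a local minimization. That the payoff is taken against the new opponent is what makes the step
  implicit.\<close>

lemma cppp_update_prox_step:
  assumes upd: "cppp_update f \<eta> \<sigma> n m z z'" and pos: "0 < \<eta>" "0 < \<sigma>"
    and simplex: "fst (fst z) \<in> prob_simplex n" "fst (snd z) \<in> prob_simplex m"
    and "smooth_payoff f gx hx L" "smooth_payoff (\<lambda>y x. - f x y) gy hy L'"
  shows "prox_step (\<lambda>x. \<Sum>j<m. fst (snd z') j * f x (snd (snd z') j))
       (\<lambda>x. \<Sum>j<m. fst (snd z') j *\<^sub>R gx x (snd (snd z') j)) \<eta> \<sigma> n (fst z) (fst z')"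
    and "prox_step (\<lambda>y. \<Sum>i<n. fst (fst z') i * - f (snd (fst z') i) y)
       (\<lambda>y. \<Sum>i<n. fst (fst z') i *\<^sub>R gy y (snd (fst z') i)) \<eta> \<sigma> m (snd z) (snd z')"
proof -
  interpret X: smooth_payoff f gx hx L by fact
  interpret Y: smooth_payoff "\<lambda>y x. - f x y" gy hy L' by fact
  let ?J = "\<lambda>c d. prox_obj f \<eta> \<sigma> n m z (displace (fst z) c) (displace (snd z) d)"
  obtain U V c d where U: "convex_nbhd n (fst z) U" and V: "convex_nbhd m (snd z) V"
    and c: "c \<in> U" and d: "d \<in> V" and z': "z' = (displace (fst z) c, displace (snd z) d)"
    and mn: "\<And>c'. c' \<in> U \<Longrightarrow> ?J c d \<le> ?J c' d" and mx: "\<And>d'. d' \<in> V \<Longrightarrow> ?J c d' \<le> ?J c d"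
    using upd unfolding cppp_update_def Let_def by blast
  have oU: "openin (top_of_set (KL_dom n (fst (fst z)) \<times> UNIV)) U"
    and oV: "openin (top_of_set (KL_dom m (fst (snd z)) \<times> UNIV)) V"
    using U V by (auto simp: convex_nbhd_def)
  obtain a1 u1 b1 w1 where cd: "c = (a1, u1)" "d = (b1, w1)" by (metis surj_pair)
  obtain a0 x0 b0 y0 where z: "z = ((a0, x0), (b0, y0))" by (metis surj_pair)
  have J: "?J (a, u) (b, w) = (\<Sum>i<n. \<Sum>j<m. a i * b j * f (shift (x0 i) (u i)) (shift (y0 j) (w j)))
     + 1 / \<eta> * real_of_ereal (KL n a a0) + 1 / (2 * \<sigma>) * (\<Sum>i<n. a0 i * (dist (shift (x0 i) (u i)) (x0 i))\<^sup>2)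
     - 1 / \<eta> * real_of_ereal (KL m b b0) - 1 / (2 * \<sigma>) * (\<Sum>j<m. b0 j * (dist (shift (y0 j) (w j)) (y0 j))\<^sup>2)" for a u b w
    by (simp add: prox_obj_def displace_def z)
  define \<Phi> where "\<Phi> = (\<lambda>(a, u). ?J (a, u) d + 1 / \<eta> * real_of_ereal (KL m b1 b0)
      + 1 / (2 * \<sigma>) * (\<Sum>j<m. b0 j * (dist (shift (y0 j) (w1 j)) (y0 j))\<^sup>2))"
  define \<Psi> where "\<Psi> = (\<lambda>(b, w). 1 / \<eta> * real_of_ereal (KL n a1 a0)
      + 1 / (2 * \<sigma>) * (\<Sum>i<n. a0 i * (dist (shift (x0 i) (u1 i)) (x0 i))\<^sup>2) - ?J c (b, w))"
  have "prox_step (\<lambda>x. \<Sum>j<m. b1 j * f x (shift (y0 j) (w1 j))) (\<lambda>x. \<Sum>j<m. b1 j *\<^sub>R gx x (shift (y0 j) (w1 j)))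
      \<eta> \<sigma> n (fst z) (displace (fst z) (a1, u1))"
  proof (rule prox_step_local_min[OF twice_diff_sum[OF X.td] pos simplex(1) oU c[unfolded cd], where \<Phi> = \<Phi>])
    show "\<Phi> (a1, u1) \<le> \<Phi> (a, u)" if "(a, u) \<in> U" for a u
      using mn[OF that] by (simp add: \<Phi>_def cd)
    show "\<Phi> (a, u) = (\<Sum>i<n. a i * (\<Sum>j<m. b1 j * f (shift (snd (fst z) i) (u i)) (shift (y0 j) (w1 j))))
       + 1 / \<eta> * real_of_ereal (KL n a (fst (fst z)))
       + 1 / (2 * \<sigma>) * (\<Sum>i<n. fst (fst z) i * (dist (shift (snd (fst z) i) (u i)) (snd (fst z) i))\<^sup>2)" for a u
      unfolding \<Phi>_def prod.case cd J by (simp add: z sum_distrib_left mult.assoc)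
  qed
  then show "prox_step (\<lambda>x. \<Sum>j<m. fst (snd z') j * f x (snd (snd z') j))
       (\<lambda>x. \<Sum>j<m. fst (snd z') j *\<^sub>R gx x (snd (snd z') j)) \<eta> \<sigma> n (fst z) (fst z')"
    by (simp add: z' cd z displace_def)
  have "prox_step (\<lambda>y. \<Sum>i<n. a1 i * - f (shift (x0 i) (u1 i)) y) (\<lambda>y. \<Sum>i<n. a1 i *\<^sub>R gy y (shift (x0 i) (u1 i)))
      \<eta> \<sigma> m (snd z) (displace (snd z) (b1, w1))"
  proof (rule prox_step_local_min[OF twice_diff_sum[OF Y.td] pos simplex(2) oV d[unfolded cd], where \<Phi> = \<Psi>])
    show "\<Psi> (b1, w1) \<le> \<Psi> (b, w)" if "(b, w) \<in> V" for b w
      using mx[OF that] by (simp add: \<Psi>_def cd)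
    show "\<Psi> (b, w) = (\<Sum>j<m. b j * (\<Sum>i<n. a1 i * - f (shift (x0 i) (u1 i)) (shift (snd (snd z) j) (w j))))
       + 1 / \<eta> * real_of_ereal (KL m b (fst (snd z)))
       + 1 / (2 * \<sigma>) * (\<Sum>j<m. fst (snd z) j * (dist (shift (snd (snd z) j) (w j)) (snd (snd z) j))\<^sup>2)" for b w
    proof -
      have "(\<Sum>i<n. \<Sum>j<m. a1 i * b j * f (shift (x0 i) (u1 i)) (shift (y0 j) (w j)))
        = (\<Sum>j<m. b j * (\<Sum>i<n. a1 i * f (shift (x0 i) (u1 i)) (shift (y0 j) (w j))))"
        by (subst sum.swap) (simp add: sum_distrib_left mult_ac)
      then show ?thesis
        unfolding \<Psi>_def prod.case cd J by (simp add: z sum_negf)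
    qed
  qed
  then show "prox_step (\<lambda>y. \<Sum>i<n. fst (fst z') i * - f (snd (fst z') i) y)
       (\<lambda>y. \<Sum>i<n. fst (fst z') i *\<^sub>R gy y (snd (fst z') i)) \<eta> \<sigma> m (snd z) (snd z')"
    by (simp add: z' cd z displace_def)
qed

section \<open>The one-player Lyapunov estimate\<close>

lemma exp_le_quadratic:
  fixes x :: real assumes "\<bar>x\<bar> \<le> 1" shows "exp x \<le> 1 + x + x\<^sup>2"
proof (cases "0 \<le> x")
  case False
  define y where "y = - x"
  have y: "0 \<le> y" "y \<le> 1" using False assms by (auto simp: y_def)
  have "1 + y + y\<^sup>2 / 2 \<le> exp y" using exp_lower_Taylor_quadratic[OF y(1)] .
  then have "exp (- y) \<le> 1 / (1 + y + y\<^sup>2 / 2)"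
    using y by (simp add: exp_minus field_simps add_pos_nonneg)
  also have "\<dots> \<le> 1 - y + y\<^sup>2"
  proof -
    have "(1 - y + y\<^sup>2) * (1 + y + y\<^sup>2 / 2) = 1 + (y\<^sup>2 / 2 + y ^ 3 / 2 + y ^ 4 / 2)"
      by (simp add: field_simps power2_eq_square power3_eq_cube power4_eq_xxxx)
    moreover have "0 \<le> y\<^sup>2 / 2 + y ^ 3 / 2 + y ^ 4 / 2" using y by simp
    moreover have "0 < 1 + y + y\<^sup>2 / 2" using y by (simp add: add_pos_nonneg)
    ultimately show ?thesis by (subst pos_divide_le_eq) auto
  qed
  finally show ?thesis by (simp add: y_def)
qed (use assms exp_bound in auto)

text \<open>For negative \<open>x\<close> the Taylor coefficient 1/2 is too large. The smaller 1/3
  becomes the constant of the gain in \<open>entropy_gain\<close>.\<close>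

lemma exp_ge_quadratic:
  fixes x :: real assumes "\<bar>x\<bar> \<le> 1 / 3" shows "1 + x + x\<^sup>2 / 3 \<le> exp x"
proof (cases "0 \<le> x")
  case True
  have "x\<^sup>2 / 3 \<le> x\<^sup>2 / 2" by simp
  then show ?thesis using exp_lower_Taylor_quadratic[OF True] by linarith
next
  case False
  define y where "y = - x"
  have y: "0 \<le> y" "y \<le> 1 / 3" using False assms by (auto simp: y_def)
  have "exp (- 0) - (1 - 0 + 0\<^sup>2 / 3) \<le> exp (- y) - (1 - y + y\<^sup>2 / 3)"
  proof (rule DERIV_nonneg_imp_nondecreasing[OF y(1), where f = "\<lambda>y. exp (- y) - (1 - y + y\<^sup>2 / 3)"])
    fix t assume t: "0 \<le> t" "t \<le> y"
    then have "t * t \<le> 1 / 3 * t" using y by (intro mult_right_mono) auto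
    then have "exp (- t) \<le> 1 - t * 2 / 3" using exp_le_quadratic[of "- t"] t y by (simp add: power2_eq_square)
    then show "\<exists>d. ((\<lambda>y. exp (- y) - (1 - y + y\<^sup>2 / 3)) has_real_derivative d) (at t) \<and> 0 \<le> d"
      by (intro exI[of _ "1 - t * 2 / 3 - exp (- t)"]) (auto intro!: derivative_eq_intros)
  qed
  then show ?thesis by (simp add: y_def)
qed

text \<open>With \<open>4 * R \<le> 1\<close> the displacement from a centre to a point of its
  cluster is unique; separation by \<open>2 * R\<close> puts every particle into at most one
  cluster.\<close>

locale clusters =
  fixes P :: "'d::finite torus set" and w :: "'d torus \<Rightarrow> real" and R :: real
  assumes fin: "finite P" and w_pos: "\<And>q. q \<in> P \<Longrightarrow> 0 < w q" and w_sum: "(\<Sum>q\<in>P. w q) = 1"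
    and R_pos: "0 < R" and R_le: "4 * R \<le> 1"
    and separated: "\<And>q q'. q \<in> P \<Longrightarrow> q' \<in> P \<Longrightarrow> q \<noteq> q' \<Longrightarrow> 2 * R < dist q q'"
begin

definition grp :: "nat \<Rightarrow> 'd particles \<Rightarrow> 'd torus \<Rightarrow> nat set" where
  "grp n z q = {i. i < n \<and> dist q (snd z i) \<le> R}"

definition outer :: "nat \<Rightarrow> 'd particles \<Rightarrow> nat set" where
  "outer n z = {i. i < n \<and> (\<forall>q\<in>P. R < dist q (snd z i))}"

definition spread :: "nat \<Rightarrow> 'd particles \<Rightarrow> real" where
  "spread n z = (\<Sum>q\<in>P. \<Sum>i\<in>grp n z q. fst z i * (dist q (snd z i))\<^sup>2)"

definition kmass :: "real \<Rightarrow> nat \<Rightarrow> 'd particles \<Rightarrow> 'd torus \<Rightarrow> real" where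
  "kmass \<alpha> n z q = (\<Sum>i\<in>grp n z q. fst z i * (1 - \<alpha> / 2 * (dist q (snd z i))\<^sup>2))"

definition lyap :: "real \<Rightarrow> nat \<Rightarrow> 'd particles \<Rightarrow> real" where
  "lyap \<alpha> n z = (\<Sum>q\<in>P. w q * ln (w q / kmass \<alpha> n z q))"

lemma finite_grp [simp]: "finite (grp n z q)" by (simp add: grp_def)
lemma finite_outer [simp]: "finite (outer n z)" by (simp add: outer_def)

lemma grp_disjoint: "q \<in> P \<Longrightarrow> q' \<in> P \<Longrightarrow> q \<noteq> q' \<Longrightarrow> grp n z q \<inter> grp n z q' = {}"
proof (rule ccontr)
  assume q: "q \<in> P" "q' \<in> P" "q \<noteq> q'" and "grp n z q \<inter> grp n z q' \<noteq> {}"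
  then obtain i where "dist q (snd z i) \<le> R" "dist q' (snd z i) \<le> R" by (auto simp: grp_def)
  then show False using separated[OF q] dist_triangle2[of q q' "snd z i"] by linarith
qed

lemma sum_split_groups:
  fixes h :: "nat \<Rightarrow> 'b::comm_monoid_add"
  shows "(\<Sum>i<n. h i) = (\<Sum>q\<in>P. \<Sum>i\<in>grp n z q. h i) + (\<Sum>i\<in>outer n z. h i)"
proof -
  have "(\<Sum>q\<in>P. \<Sum>i\<in>grp n z q. h i) = (\<Sum>i\<in>(\<Union>q\<in>P. grp n z q). h i)"
    using fin grp_disjoint by (subst sum.UNION_disjoint) auto
  moreover have "{..<n} = (\<Union>q\<in>P. grp n z q) \<union> outer n z"
    by (auto simp: grp_def outer_def not_less)
  moreover have "(\<Union>q\<in>P. grp n z q) \<inter> outer n z = {}"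
    by (auto simp: grp_def outer_def)
  ultimately show ?thesis using fin by (metis sum.union_disjoint finite_UN finite_grp finite_outer)
qed

end

text \<open>If a particle moves from \<open>u + \<sigma> * \<tau> * g\<close> to \<open>u\<close> and its weight is multiplied by \<open>\<tau>\<close>, where \<open>r = norm u\<close>,
  \<open>N = (norm g)\<^sup>2\<close>, \<open>D = g \<bullet> u\<close> and \<open>\<alpha> * \<sigma> = \<eta>\<close>, then the left-hand side is its old contribution to the
  kernel mass relative to its new weight. Convexity of the payoff gives \<open>s \<le> D\<close>, so the linear term \<open>\<eta> * s\<close>
  of \<open>1 / \<tau>\<close> is absorbed by \<open>- \<eta> * D\<close>.\<close>

lemma particle_estimate:
  fixes \<eta> \<sigma> \<alpha> B R r s D N q \<delta> \<tau> :: real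
  assumes pos: "0 < \<eta>" "0 < \<sigma>" "0 < B" "0 \<le> \<alpha>" "0 \<le> r" "r \<le> R" "0 \<le> N"
    and small: "\<eta> * B \<le> 1 / 16" "\<alpha> * R\<^sup>2 \<le> 1 / 8"
    and \<delta>: "\<bar>\<delta>\<bar> \<le> 2 * B" and q: "\<bar>q\<bar> \<le> 2 * B" "\<delta> = q + s" and s: "\<bar>s\<bar> \<le> B * r" "s \<le> D" and D: "\<bar>D\<bar> \<le> B * r"
    and \<tau>: "\<tau> = exp (- \<eta> * \<delta>)"
  defines "k \<equiv> 1 - \<alpha> / 2 * r\<^sup>2"
  shows "k / \<tau> - \<eta> * D - \<eta> * \<sigma> / 2 * \<tau> * N \<le> exp (\<eta> * q) * k *
    (1 + (\<eta> * (\<alpha> * B * R + 31 * \<eta> * B\<^sup>2) * r\<^sup>2 + \<eta>\<^sup>2 * \<delta>\<^sup>2 / 12 - \<eta> * \<sigma> / 4 * N))"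
proof -
  \<comment> \<open>Up to its last factor, \<open>X\<close> is the right-hand side of the
    claim.\<close>
  define X where "X = exp (\<eta> * q) * k"
  define y where "y = \<alpha> * r\<^sup>2"
  define t where "t = \<eta> * q"
  have "r\<^sup>2 \<le> R\<^sup>2" using pos by (intro power_mono) auto
  then have "y \<le> \<alpha> * R\<^sup>2" unfolding y_def using pos by (intro mult_left_mono) auto
  then have y: "0 \<le> y" "y \<le> 1 / 8" using small pos by (auto simp: y_def)
  have k: "k = 1 - y / 2" by (simp add: k_def y_def)
  have kb: "15 / 16 \<le> k" "k \<le> 1" using y by (auto simp: k)
  have t2: "\<bar>\<eta> * v\<bar> \<le> 1 / 8" if "\<bar>v\<bar> \<le> 2 * B" for v
  proof -
    have "\<eta> * \<bar>v\<bar> \<le> \<eta> * (2 * B)" using that pos by (intro mult_left_mono) auto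
    also have "\<dots> \<le> 1 / 8" using small(1) by simp
    finally show ?thesis using pos by (simp add: abs_mult)
  qed
  have t: "\<bar>t\<bar> \<le> 1 / 8" using t2[OF q(1)] by (simp add: t_def)
  have eta: "\<bar>\<eta> * \<delta>\<bar> \<le> 1 / 8" using t2[OF \<delta>] .
  have \<tau>b: "7 / 8 \<le> \<tau>" using exp_ge_add_one_self[of "- \<eta> * \<delta>"] eta unfolding \<tau> by (simp add: abs_le_iff)
  have ubt: "exp (\<bar>t\<bar>) \<le> 1 + 9 / 8 * \<bar>t\<bar>"
  proof -
    have "\<bar>t\<bar> * \<bar>t\<bar> \<le> 1 / 8 * \<bar>t\<bar>" using t by (intro mult_right_mono) auto
    moreover have "t\<^sup>2 = \<bar>t\<bar> * \<bar>t\<bar>" by (simp add: power2_eq_square)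
    ultimately show ?thesis using exp_le_quadratic[of "\<bar>t\<bar>"] t by simp
  qed
  have X: "0 < X" "X \<le> 8 / 7"
  proof -
    show "0 < X" using kb by (simp add: X_def)
    have "exp t \<le> exp \<bar>t\<bar>" by simp
    then have "exp t \<le> 8 / 7" using ubt t by linarith
    then have "exp t * k \<le> 8 / 7 * 1" using kb by (intro mult_mono) auto
    then show "X \<le> 8 / 7" by (simp add: X_def t_def)
  qed
  have iX: "1 / X = exp (- t) * (1 / k)" by (simp add: X_def t_def exp_minus field_simps)
  have ub: "1 / X - 1 \<le> y + 3 * \<bar>t\<bar>"
  proof -
    have "1 \<le> (1 + y) * k" using y mult_left_mono[of y 1 y] by (simp add: k algebra_simps)
    then have "1 / k \<le> 1 + y" using kb by (simp add: divide_le_eq)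
    moreover have "exp (- t) \<le> 1 + 9 / 8 * \<bar>t\<bar>" by (rule order_trans[OF _ ubt]) simp
    ultimately have "1 / X \<le> (1 + 9 / 8 * \<bar>t\<bar>) * (1 + y)"
      unfolding iX using kb y by (intro mult_mono) auto
    also have "\<dots> = 1 + y + 9 / 8 * \<bar>t\<bar> + 9 / 8 * (\<bar>t\<bar> * y)" by (simp add: algebra_simps)
    also have "\<bar>t\<bar> * y \<le> \<bar>t\<bar> * (1 / 8)" using y by (intro mult_left_mono) auto
    finally show ?thesis by simp
  qed
  have lb: "1 - 1 / X \<le> y + 3 * \<bar>t\<bar>"
  proof -
    have "1 - t \<le> exp (- t)" using exp_ge_add_one_self[of "- t"] by simp
    also have "exp (- t) * 1 \<le> exp (- t) * (1 / k)" using kb by (intro mult_left_mono) auto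
    finally show ?thesis using y unfolding iX by (simp add: abs_if split: if_splits)
  qed
  \<comment> \<open>The linear terms \<open>s\<close> and \<open>D\<close> carry the coefficients
    \<open>X\<close> and 1. Their mismatch is measured relative to \<open>X\<close>, so that
    \<open>X\<close> can be factored out at the end.\<close>
  have z: "\<bar>1 - X\<bar> \<le> X * (y + 3 * \<bar>t\<bar>)"
  proof -
    have "1 - X = X * (1 / X - 1)" using X by (simp add: field_simps)
    then have "\<bar>1 - X\<bar> = X * \<bar>1 / X - 1\<bar>" using X by (simp only: abs_mult)
    also have "\<dots> \<le> X * (y + 3 * \<bar>t\<bar>)" using ub lb X by (intro mult_left_mono) auto
    finally show ?thesis .
  qed
  have es: "exp (\<eta> * s) \<le> 1 + \<eta> * s + (\<eta> * s)\<^sup>2"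
  proof (rule exp_le_quadratic)
    have "\<eta> * s = \<eta> * \<delta> - \<eta> * q" using q by (simp add: algebra_simps)
    then show "\<bar>\<eta> * s\<bar> \<le> 1" using eta t unfolding t_def by linarith
  qed
  have s2: "s\<^sup>2 \<le> B\<^sup>2 * r\<^sup>2" using power_mono[OF s(1), of 2] by (simp add: power_mult_distrib)
  have "k / \<tau> = k * exp (\<eta> * \<delta>)" by (simp add: \<tau> exp_minus divide_inverse)
  also have "\<dots> = X * exp (\<eta> * s)" by (simp add: X_def q(2) distrib_left exp_add)
  also have "\<dots> \<le> X * (1 + \<eta> * s + (\<eta> * s)\<^sup>2)" using es X by (intro mult_left_mono) auto
  finally have 1: "k / \<tau> - \<eta> * D \<le> X + (X * (\<eta> * s) - \<eta> * D) + X * (\<eta>\<^sup>2 * s\<^sup>2)"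
    by (simp add: algebra_simps power_mult_distrib)
  \<comment> \<open>By \<open>s \<le> D\<close>, only the small multiple \<open>(X - 1) * D\<close>
    remains of the linear terms.\<close>
  have 2: "X * (\<eta> * s) - \<eta> * D \<le> X * (\<eta> * (y + 3 * \<bar>t\<bar>) * (B * r))"
  proof -
    have "X * (\<eta> * s) \<le> X * (\<eta> * D)" using s X pos by (intro mult_left_mono) auto
    then have "X * (\<eta> * s) - \<eta> * D \<le> \<eta> * ((X - 1) * D)" by (simp add: algebra_simps)
    also have "(X - 1) * D \<le> \<bar>1 - X\<bar> * \<bar>D\<bar>" using abs_ge_self[of "(X - 1) * D"] by (simp add: abs_mult abs_minus_commute)
    also have "\<bar>1 - X\<bar> * \<bar>D\<bar> \<le> (X * (y + 3 * \<bar>t\<bar>)) * (B * r)" using z D X y by (intro mult_mono) auto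
    finally show ?thesis using pos by (simp add: algebra_simps)
  qed
  have 3: "X * (\<eta>\<^sup>2 * s\<^sup>2) \<le> X * (\<eta>\<^sup>2 * (B\<^sup>2 * r\<^sup>2))" using s2 X by (intro mult_left_mono) auto
  have 4: "\<eta> * \<sigma> / 2 * \<tau> * N \<ge> X * (\<eta> * \<sigma> / 4 * N)"
  proof -
    have "X / 4 \<le> \<tau> / 2" using X \<tau>b by simp
    then have "X / 4 * (\<eta> * \<sigma> * N) \<le> \<tau> / 2 * (\<eta> * \<sigma> * N)" using pos by (intro mult_right_mono) auto
    then show ?thesis by (simp add: algebra_simps)
  qed
  \<comment> \<open>Young's inequality is weighted so as to lose only
    \<open>\<delta>\<^sup>2 / 12\<close>, at the price of the coefficient 27. With 3 from
    \<open>\<bar>q\<bar> \<le> \<bar>\<delta>\<bar> + B * r\<close> and 1 from the quadratic term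
    this gives 31.\<close>
  have 5: "\<eta> * (y + 3 * \<bar>t\<bar>) * (B * r) + \<eta>\<^sup>2 * (B\<^sup>2 * r\<^sup>2)
      \<le> \<eta> * (\<alpha> * B * R + 31 * \<eta> * B\<^sup>2) * r\<^sup>2 + \<eta>\<^sup>2 * \<delta>\<^sup>2 / 12"
  proof -
    have "\<bar>q\<bar> \<le> \<bar>\<delta>\<bar> + B * r" using q s by linarith
    then have "\<bar>q\<bar> * (B * r) \<le> (\<bar>\<delta>\<bar> + B * r) * (B * r)" using pos by (intro mult_right_mono) auto
    then have "\<eta>\<^sup>2 * (\<bar>q\<bar> * (B * r)) \<le> \<eta>\<^sup>2 * ((\<bar>\<delta>\<bar> + B * r) * (B * r))" by (intro mult_left_mono) auto
    moreover have "\<eta>\<^sup>2 * (3 * (\<bar>\<delta>\<bar> * (B * r))) \<le> \<eta>\<^sup>2 * (\<delta>\<^sup>2 / 12 + 27 * (B * r)\<^sup>2)"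
    proof (rule mult_left_mono)
      have "0 \<le> 3 * (\<bar>\<delta>\<bar> / 6 - 3 * (B * r))\<^sup>2" by simp
      then show "3 * (\<bar>\<delta>\<bar> * (B * r)) \<le> \<delta>\<^sup>2 / 12 + 27 * (B * r)\<^sup>2"
        by (simp add: power2_diff power_divide)
    qed simp
    moreover have "\<eta> * y * (B * r) \<le> \<eta> * (\<alpha> * B * R) * r\<^sup>2"
    proof -
      have "(\<eta> * y * B) * r \<le> (\<eta> * y * B) * R" using pos y by (intro mult_left_mono) auto
      then show ?thesis by (simp add: y_def algebra_simps)
    qed
    moreover have "\<bar>t\<bar> = \<eta> * \<bar>q\<bar>" using pos by (simp add: t_def abs_mult)
    ultimately show ?thesis by (simp add: power_mult_distrib power2_eq_square algebra_simps)
  qed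
  have "X * (\<eta> * (y + 3 * \<bar>t\<bar>) * (B * r)) + X * (\<eta>\<^sup>2 * (B\<^sup>2 * r\<^sup>2))
      \<le> X * (\<eta> * (\<alpha> * B * R + 31 * \<eta> * B\<^sup>2) * r\<^sup>2 + \<eta>\<^sup>2 * \<delta>\<^sup>2 / 12)"
    using mult_left_mono[OF 5, of X] X by (simp add: distrib_left)
  then have "k / \<tau> - \<eta> * D - \<eta> * \<sigma> / 2 * \<tau> * N
     \<le> X + X * (\<eta> * (\<alpha> * B * R + 31 * \<eta> * B\<^sup>2) * r\<^sup>2 + \<eta>\<^sup>2 * \<delta>\<^sup>2 / 12) - X * (\<eta> * \<sigma> / 4 * N)"
    using 1 2 3 4 by linarith
  also have "\<dots> = X * (1 + (\<eta> * (\<alpha> * B * R + 31 * \<eta> * B\<^sup>2) * r\<^sup>2 + \<eta>\<^sup>2 * \<delta>\<^sup>2 / 12 - \<eta> * \<sigma> / 4 * N))"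
    by (simp only: distrib_left right_diff_distrib mult_1_right)
  finally show ?thesis unfolding X_def .
qed

section \<open>One proximal step of one player\<close>

context clusters begin

context
  fixes G :: "'d torus \<Rightarrow> real" and Gg :: "'d torus \<Rightarrow> real ^ 'd" and \<eta> \<sigma> \<alpha> B :: real and n :: nat
    and z z' :: "'d particles"
  assumes step: "prox_step G Gg \<eta> \<sigma> n z z'"
    and pos: "0 < \<eta>" "0 < \<sigma>" "0 < B" and \<alpha>: "\<alpha> * \<sigma> = \<eta>"
    and G_bound: "\<And>x. \<bar>G x\<bar> \<le> B" and Gg_bound: "\<And>x. norm (Gg x) \<le> B"
    and G_lip: "\<And>x y. \<bar>G x - G y\<bar> \<le> B * dist x y"
    and conv: "\<And>q u. q \<in> P \<Longrightarrow> norm u \<le> 2 * R \<Longrightarrow> G (shift q u) - Gg (shift q u) \<bullet> u \<le> G q"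
    and outward: "\<And>q u. q \<in> P \<Longrightarrow> R \<le> norm u \<Longrightarrow> norm u \<le> 2 * R \<Longrightarrow> 0 \<le> Gg (shift q u) \<bullet> u"
    and small: "\<eta> * B \<le> 1 / 16" "\<alpha> * R\<^sup>2 \<le> 1 / 8" "2 * \<sigma> * B \<le> R"
begin

text \<open>A soft minimum of the payoff over the particles: with it as reference level, a weight
  changes exactly by the factor \<open>exp (- \<eta> * (G x - cst))\<close>, and the normalizer
  disappears.\<close>

definition cst :: real where
  "cst = - ln (\<Sum>i<n. fst z i * exp (- \<eta> * G (snd z' i))) / \<eta>"

lemma weights: "(\<Sum>i<n. fst z i) = 1" "(\<Sum>i<n. fst z' i) = 1"
    "i < n \<Longrightarrow> 0 \<le> fst z i" "i < n \<Longrightarrow> 0 \<le> fst z' i"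
  using step by (auto simp: prox_step_def prob_simplex_def)

lemma G_exp: "exp (- \<eta> * B) \<le> exp (- \<eta> * G x)" "exp (- \<eta> * G x) \<le> exp (\<eta> * B)"
  using G_bound[of x] pos mult_left_mono[of "G x" B \<eta>] mult_left_mono[of "- B" "G x" \<eta>]
  by (auto simp: abs_le_iff)

lemma normalizer:
  "exp (- \<eta> * B) \<le> (\<Sum>i<n. fst z i * exp (- \<eta> * G (snd z' i)))"
  "(\<Sum>i<n. fst z i * exp (- \<eta> * G (snd z' i))) \<le> exp (\<eta> * B)"
proof -
  have "exp (- \<eta> * B) = (\<Sum>i<n. fst z i * exp (- \<eta> * B))" using weights(1) by (simp flip: sum_distrib_right)
  also have "\<dots> \<le> (\<Sum>i<n. fst z i * exp (- \<eta> * G (snd z' i)))"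
    using weights(3) G_exp(1) by (intro sum_mono mult_left_mono) auto
  finally show "exp (- \<eta> * B) \<le> (\<Sum>i<n. fst z i * exp (- \<eta> * G (snd z' i)))" .
  have "(\<Sum>i<n. fst z i * exp (- \<eta> * G (snd z' i))) \<le> (\<Sum>i<n. fst z i * exp (\<eta> * B))"
    using weights(3) G_exp(2) by (intro sum_mono mult_left_mono) auto
  also have "\<dots> = exp (\<eta> * B)" using weights(1) by (simp flip: sum_distrib_right)
  finally show "(\<Sum>i<n. fst z i * exp (- \<eta> * G (snd z' i))) \<le> exp (\<eta> * B)" .
qed

lemma exp_cst: "exp (- \<eta> * cst) = (\<Sum>i<n. fst z i * exp (- \<eta> * G (snd z' i)))"
proof -
  have "0 < (\<Sum>i<n. fst z i * exp (- \<eta> * G (snd z' i)))" using normalizer(1) exp_gt_zero less_le_trans by blast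
  then show ?thesis using pos by (simp add: cst_def)
qed

lemma cst_bound: "\<bar>cst\<bar> \<le> B"
proof -
  have "- \<eta> * B \<le> - \<eta> * cst" "- \<eta> * cst \<le> \<eta> * B"
    using normalizer unfolding exp_cst[symmetric] by simp_all
  then show ?thesis using pos by (simp add: abs_le_iff) (metis minus_le_iff mult_le_cancel_left_pos mult_minus_right)
qed

lemma G_cst: "\<bar>G x - cst\<bar> \<le> 2 * B"
  using cst_bound G_bound[of x] by linarith

lemma eta_G_cst: "\<bar>\<eta> * (G x - cst)\<bar> \<le> 1 / 8"
proof -
  have "\<eta> * \<bar>G x - cst\<bar> \<le> \<eta> * (2 * B)" using G_cst[of x] pos by (intro mult_left_mono) auto
  also have "\<dots> \<le> 1 / 8" using small(1) by simp
  finally show ?thesis using pos by (simp add: abs_mult)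
qed

definition ratio :: "nat \<Rightarrow> real" where
  "ratio i = exp (- \<eta> * (G (snd z' i) - cst))"

lemma ratio: "i < n \<Longrightarrow> fst z' i = fst z i * ratio i"
proof -
  assume "i < n"
  then have "fst z' i = fst z i * exp (- \<eta> * G (snd z' i)) / exp (- \<eta> * cst)"
    using step unfolding prox_step_def exp_cst by blast
  also have "\<dots> = fst z i * ratio i" by (simp add: ratio_def right_diff_distrib exp_diff[of "\<eta> * cst"] exp_minus field_simps)
  finally show ?thesis .
qed

lemma ratio_bound: "7 / 8 \<le> ratio i" "ratio i \<le> 8 / 7"
proof -
  let ?x = "\<eta> * (G (snd z' i) - cst)"
  have e: "\<bar>?x\<bar> \<le> 1 / 8" by (rule eta_G_cst)
  show "7 / 8 \<le> ratio i" using exp_ge_add_one_self[of "- ?x"] e by (simp add: ratio_def abs_le_iff)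
  have "7 / 8 \<le> exp ?x" using exp_ge_add_one_self[of ?x] e by linarith
  then have "1 / exp ?x \<le> 1 / (7 / 8)" by (intro divide_left_mono) auto
  then show "ratio i \<le> 8 / 7" by (simp add: ratio_def exp_minus inverse_eq_divide)
qed

text \<open>The old weights are the new ones times \<open>exp (\<eta> * (G - cst))\<close>, and both
  sum to 1. The linear term of the exponential gives the left-hand side; the quadratic term is the
  gain.\<close>

lemma entropy_gain:
  "\<eta> * (\<Sum>i<n. fst z' i * G (snd z' i)) - \<eta> * cst \<le> - (\<eta>\<^sup>2 / 3) * (\<Sum>i<n. fst z' i * (G (snd z' i) - cst)\<^sup>2)"
proof -
  let ?x = "\<lambda>i. \<eta> * (G (snd z' i) - cst)"
  have "fst z i = fst z' i * exp (?x i)" if "i < n" for i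
    using ratio[OF that] by (simp add: ratio_def exp_minus)
  then have "1 = (\<Sum>i<n. fst z' i * exp (?x i))" using weights(1) by simp
  moreover have "(\<Sum>i<n. fst z' i * (1 + ?x i + (?x i)\<^sup>2 / 3)) \<le> (\<Sum>i<n. fst z' i * exp (?x i))"
    using weights(4) by (intro sum_mono mult_left_mono exp_ge_quadratic order_trans[OF eta_G_cst]) auto
  moreover have "(\<Sum>i<n. fst z' i * (1 + ?x i + (?x i)\<^sup>2 / 3))
     = (\<Sum>i<n. fst z' i * (1 - \<eta> * cst) + \<eta> * (fst z' i * G (snd z' i)) + \<eta>\<^sup>2 / 3 * (fst z' i * (G (snd z' i) - cst)\<^sup>2))"
    unfolding power_mult_distrib by (intro sum.cong refl) (simp add: algebra_simps)
  moreover have "\<dots> = (1 - \<eta> * cst) + \<eta> * (\<Sum>i<n. fst z' i * G (snd z' i)) + \<eta>\<^sup>2 / 3 * (\<Sum>i<n. fst z' i * (G (snd z' i) - cst)\<^sup>2)"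
    unfolding sum.distrib sum_distrib_left[symmetric] sum_distrib_right[symmetric] weights(2) by simp
  ultimately show ?thesis by simp
qed

text \<open>A particle of a cluster cannot leave it: on the shell between the radii \<open>R\<close> and \<open>2 * R\<close> the
  gradient points outwards, hence a step that ends there started farther away.\<close>

lemma trapped:
  assumes q: "q \<in> P" and i: "i \<in> grp n z q" and ai: "0 < fst z i"
  obtains u where "snd z' i = shift q u" "norm u = dist q (snd z' i)" "dist q (snd z' i) \<le> R"
    "(dist q (snd z i))\<^sup>2 = (norm u)\<^sup>2 + 2 * \<sigma> * ratio i * (Gg (snd z' i) \<bullet> u) + (\<sigma> * ratio i)\<^sup>2 * (norm (Gg (snd z' i)))\<^sup>2"
proof -
  have i': "i < n" "dist q (snd z i) \<le> R" using i by (auto simp: grp_def)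
  let ?g = "Gg (snd z' i)"
  define v where "v = (\<sigma> * ratio i) *\<^sub>R ?g"
  have rt: "\<sigma> * fst z' i / fst z i = \<sigma> * ratio i" using ratio[OF i'(1)] ai by simp
  have x: "snd z i = shift (snd z' i) v"
    using step i'(1) ai unfolding prox_step_def v_def rt[symmetric] by blast
  define u where "u = disp q (snd z i) - v"
  have shu: "shift q u = snd z' i"
  proof -
    have "shift q u = shift (shift q (disp q (snd z i))) (- v)"
      by (simp only: u_def shift_shift diff_conv_add_uminus)
    also have "\<dots> = shift (snd z i) (- v)" by (simp only: shift_disp)
    also have "\<dots> = snd z' i" by (subst x) simp
    finally show ?thesis .
  qed
  have "norm v \<le> 2 * \<sigma> * B"
  proof -
    have "norm v = \<sigma> * ratio i * norm ?g" using pos ratio_bound[of i] by (simp add: v_def)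
    also have "\<dots> \<le> \<sigma> * 2 * B" using Gg_bound pos ratio_bound[of i] by (intro mult_mono) auto
    finally show ?thesis by simp
  qed
  then have nv: "norm v \<le> R" using small(3) by simp
  have nu2: "norm u \<le> 2 * R"
    using norm_triangle_ineq4[of "disp q (snd z i)" v] nv i'(2) by (simp add: u_def)
  have "(norm (u + v))\<^sup>2 = (norm u)\<^sup>2 + 2 * (u \<bullet> v) + (norm v)\<^sup>2"
    by (simp add: power2_norm_eq_inner inner_add_left inner_add_right inner_commute)
  then have sq: "(dist q (snd z i))\<^sup>2 = (norm u)\<^sup>2 + 2 * \<sigma> * ratio i * (?g \<bullet> u) + (\<sigma> * ratio i)\<^sup>2 * (norm ?g)\<^sup>2"
    by (simp add: u_def v_def inner_commute power_mult_distrib)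
  have nuR: "norm u \<le> R"
  proof (rule ccontr)
    assume "\<not> norm u \<le> R"
    then have "R < norm u" by simp
    then have "0 \<le> ?g \<bullet> u" using outward[OF q _ nu2] shu by simp
    then have "0 \<le> 2 * \<sigma> * ratio i * (?g \<bullet> u)" using pos ratio_bound(1)[of i] by (intro mult_nonneg_nonneg) auto
    then have "(norm u)\<^sup>2 \<le> (dist q (snd z i))\<^sup>2" unfolding sq by simp
    then have "norm u \<le> dist q (snd z i)" using power2_le_imp_le by auto
    then show False using i'(2) \<open>R < norm u\<close> by simp
  qed
  have "norm u \<le> 1 / 2" using nuR R_le by simp
  then have du: "norm u = dist q (snd z' i)" using dist_shift_eq[of u q] shu by simp
  show thesis by (rule that[OF shu[symmetric] du]) (use nuR du sq in auto)
qed

lemma trapped_grp: "q \<in> P \<Longrightarrow> i \<in> grp n z q \<Longrightarrow> 0 < fst z i \<Longrightarrow> i \<in> grp n z' q"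
  by (rule trapped) (auto simp: grp_def)

text \<open>In \<open>old_spread\<close>, \<open>old_grad\<close> and \<open>old_kmass\<close> only
  the grouping is that of \<open>z\<close>; weights and positions are those of \<open>z'\<close>.
  Particles that enter a cluster during the step are thus left out, since nothing is known about
  where they came from.\<close>

definition old_spread :: real where
  "old_spread = (\<Sum>q\<in>P. \<Sum>i\<in>grp n z q. fst z' i * (dist q (snd z' i))\<^sup>2)"

definition old_grad :: real where
  "old_grad = (\<Sum>q\<in>P. \<Sum>i\<in>grp n z q. fst z' i * (norm (Gg (snd z' i)))\<^sup>2)"

definition variation :: real where
  "variation = (\<Sum>i<n. fst z' i * (G (snd z' i) - cst)\<^sup>2)"

definition old_kmass :: "'d torus \<Rightarrow> real" where
  "old_kmass q = (\<Sum>i\<in>grp n z q. fst z' i * (1 - \<alpha> / 2 * (dist q (snd z' i))\<^sup>2))"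

lemma alpha_pos: "0 < \<alpha>"
  using \<alpha> pos by (metis zero_less_mult_pos2)

lemma zero_weight: "i < n \<Longrightarrow> \<not> 0 < fst z i \<Longrightarrow> fst z i = 0 \<and> fst z' i = 0"
  using weights(3)[of i] ratio[of i] by simp

lemma kernel_bound:
  assumes "dist q x \<le> R" shows "15 / 16 \<le> 1 - \<alpha> / 2 * (dist q x)\<^sup>2" "1 - \<alpha> / 2 * (dist q x)\<^sup>2 \<le> 1"
proof -
  have "\<alpha> * (dist q x)\<^sup>2 \<le> \<alpha> * R\<^sup>2" using assms alpha_pos by (intro mult_left_mono power_mono) auto
  then show "15 / 16 \<le> 1 - \<alpha> / 2 * (dist q x)\<^sup>2" using small(2) by simp
  show "1 - \<alpha> / 2 * (dist q x)\<^sup>2 \<le> 1" using alpha_pos by simp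
qed

lemma old_terms:
  assumes q: "q \<in> P" and i: "i \<in> grp n z q"
  shows "49 / 64 * (fst z i * (1 - \<alpha> / 2 * (dist q (snd z i))\<^sup>2)) \<le> fst z' i * (1 - \<alpha> / 2 * (dist q (snd z' i))\<^sup>2)"
    and "fst z' i * (1 - \<alpha> / 2 * (dist q (snd z' i))\<^sup>2) \<le> 64 / 49 * (fst z i * (1 - \<alpha> / 2 * (dist q (snd z i))\<^sup>2))"
    and "fst z' i * (1 - \<alpha> / 2 * (dist q (snd z' i))\<^sup>2) \<le> fst z' i"
    and "0 \<le> fst z' i * (1 - \<alpha> / 2 * (dist q (snd z' i))\<^sup>2)"
proof -
  let ?k = "1 - \<alpha> / 2 * (dist q (snd z i))\<^sup>2" and ?k' = "1 - \<alpha> / 2 * (dist q (snd z' i))\<^sup>2"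
  have i': "i < n" "dist q (snd z i) \<le> R" using i by (auto simp: grp_def)
  have "49 / 64 * (fst z i * ?k) \<le> fst z' i * ?k' \<and> fst z' i * ?k' \<le> 64 / 49 * (fst z i * ?k)
      \<and> fst z' i * ?k' \<le> fst z' i \<and> 0 \<le> fst z' i * ?k'"
  proof (cases "0 < fst z i")
    case True
    have d': "dist q (snd z' i) \<le> R" using trapped_grp[OF q i True] by (simp add: grp_def)
    note k = kernel_bound[OF i'(2)] kernel_bound[OF d']
    \<comment> \<open>The factor 7/8 bounds the weight ratio and 49/56 = 7/8 the quotient of the
      kernel factors; their product is 49/64.\<close>
    have "7 / 8 * (49 / 56 * ?k) \<le> ratio i * ?k'" using ratio_bound[of i] k by (intro mult_mono) auto
    then have 1: "fst z i * (49 / 64 * ?k) \<le> fst z i * (ratio i * ?k')" using True by (intro mult_left_mono) auto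
    have "ratio i * ?k' \<le> 8 / 7 * (56 / 49 * ?k)" using ratio_bound[of i] k by (intro mult_mono) auto
    then have 2: "fst z i * (ratio i * ?k') \<le> fst z i * (64 / 49 * ?k)" using True by (intro mult_left_mono) auto
    have 3: "fst z' i * ?k' \<le> fst z' i * 1" using weights(4)[OF i'(1)] k by (intro mult_left_mono) auto
    have 4: "0 \<le> fst z' i * ?k'" using weights(4)[OF i'(1)] k by (intro mult_nonneg_nonneg) auto
    show ?thesis using 1 2 3 4 unfolding ratio[OF i'(1)] by (simp add: mult_ac)
  next
    case False
    then show ?thesis using zero_weight[OF i'(1)] by simp
  qed
  then show "49 / 64 * (fst z i * ?k) \<le> fst z' i * ?k'" "fst z' i * ?k' \<le> 64 / 49 * (fst z i * ?k)"
    "fst z' i * ?k' \<le> fst z' i" "0 \<le> fst z' i * ?k'" by blast+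
qed

lemma old_kmass_bounds:
  assumes q: "q \<in> P"
  shows "49 / 64 * kmass \<alpha> n z q \<le> old_kmass q" "old_kmass q \<le> 64 / 49 * kmass \<alpha> n z q"
    "old_kmass q \<le> (\<Sum>i\<in>grp n z q. fst z' i)"
  unfolding kmass_def old_kmass_def sum_distrib_left using old_terms[OF q] by (auto intro: sum_mono)

text \<open>Particles of positive weight stay in their cluster, the others contribute nothing, and
  newly entered particles only add nonnegative terms.\<close>

lemma old_le_new:
  assumes q: "q \<in> P" and h: "\<And>i. i \<in> grp n z' q \<Longrightarrow> 0 \<le> h i"
  shows "(\<Sum>i\<in>grp n z q. fst z' i * h i) \<le> (\<Sum>i\<in>grp n z' q. fst z' i * h i)"
proof -
  have "(\<Sum>i\<in>grp n z q. fst z' i * h i) = (\<Sum>i\<in>{i \<in> grp n z q. 0 < fst z i}. fst z' i * h i)"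
    using zero_weight by (intro sum.mono_neutral_right) (auto simp: grp_def)
  also have "\<dots> \<le> (\<Sum>i\<in>grp n z' q. fst z' i * h i)"
    using trapped_grp[OF q] weights(4) h by (intro sum_mono2) (auto simp: grp_def)
  finally show ?thesis .
qed

lemma old_kmass_le: "q \<in> P \<Longrightarrow> old_kmass q \<le> kmass \<alpha> n z' q"
  unfolding old_kmass_def kmass_def
  by (rule old_le_new) (use kernel_bound in \<open>force simp: grp_def\<close>)+

lemma old_spread_le: "old_spread \<le> spread n z'"
  unfolding old_spread_def spread_def by (intro sum_mono old_le_new) auto

text \<open>The sum of \<open>particle_estimate\<close> over the cluster. Comparing with the payoff
  \<open>G q\<close> at the centre, instead of the payoff at each particle, produces an exponential
  factor common to the whole cluster.\<close>

lemma kmass_estimate: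
  assumes q: "q \<in> P"
  shows "kmass \<alpha> n z q \<le> exp (\<eta> * (G q - cst)) * (\<Sum>i\<in>grp n z q. fst z' i * (1 - \<alpha> / 2 * (dist q (snd z' i))\<^sup>2) *
    (1 + (\<eta> * (\<alpha> * B * R + 31 * \<eta> * B\<^sup>2) * (dist q (snd z' i))\<^sup>2 + \<eta>\<^sup>2 * (G (snd z' i) - cst)\<^sup>2 / 12
      - \<eta> * \<sigma> / 4 * (norm (Gg (snd z' i)))\<^sup>2)))"
  unfolding kmass_def sum_distrib_left
proof (rule sum_mono)
  fix i assume i: "i \<in> grp n z q"
  then have i': "i < n" "dist q (snd z i) \<le> R" by (auto simp: grp_def)
  let ?r = "dist q (snd z' i)" and ?g = "Gg (snd z' i)" and ?\<delta> = "G (snd z' i) - cst"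
  let ?bad = "\<eta> * (\<alpha> * B * R + 31 * \<eta> * B\<^sup>2) * ?r\<^sup>2 + \<eta>\<^sup>2 * ?\<delta>\<^sup>2 / 12 - \<eta> * \<sigma> / 4 * (norm ?g)\<^sup>2"
  show "fst z i * (1 - \<alpha> / 2 * (dist q (snd z i))\<^sup>2)
      \<le> exp (\<eta> * (G q - cst)) * (fst z' i * (1 - \<alpha> / 2 * ?r\<^sup>2) * (1 + ?bad))"
  proof (cases "0 < fst z i")
    case True
    obtain u where u: "snd z' i = shift q u" "norm u = ?r" "?r \<le> R"
      "(dist q (snd z i))\<^sup>2 = (norm u)\<^sup>2 + 2 * \<sigma> * ratio i * (?g \<bullet> u) + (\<sigma> * ratio i)\<^sup>2 * (norm ?g)\<^sup>2"
      by (rule trapped[OF q i True])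
    have rp: "0 < ratio i" using ratio_bound(1)[of i] by linarith
    have le: "(1 - \<alpha> / 2 * ?r\<^sup>2) / ratio i - \<eta> * (?g \<bullet> u) - \<eta> * \<sigma> / 2 * ratio i * (norm ?g)\<^sup>2
       \<le> exp (\<eta> * (G q - cst)) * (1 - \<alpha> / 2 * ?r\<^sup>2) * (1 + ?bad)"
    proof (rule particle_estimate[where R = R and s = "G (snd z' i) - G q"])
      show "\<bar>G (snd z' i) - G q\<bar> \<le> B * ?r" using G_lip[of "snd z' i" q] by (simp add: dist_commute)
      have "norm u \<le> 2 * R" using u(2,3) R_pos by simp
      then show "G (snd z' i) - G q \<le> ?g \<bullet> u" using conv[OF q, of u] u(1) by simp
      show "\<bar>?g \<bullet> u\<bar> \<le> B * ?r"
        using Cauchy_Schwarz_ineq2[of ?g u] mult_right_mono[OF Gg_bound[of "snd z' i"], of "norm u"] u(2) by simp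
      show "ratio i = exp (- \<eta> * ?\<delta>)" by (simp add: ratio_def)
    qed (use pos alpha_pos small u(3) G_cst in auto)
    \<comment> \<open>The old squared distance from \<open>trapped\<close> is inserted. As
      \<open>\<alpha> * \<sigma> = \<eta>\<close>, its cross term becomes exactly the
      \<open>- \<eta> * D\<close> that absorbs the first-order change of the weights.\<close>
    have alg: "(1 - \<alpha> / 2 * (r2 + 2 * \<sigma> * \<tau> * D + (\<sigma> * \<tau>)\<^sup>2 * N)) / \<tau>
        = (1 - \<alpha> / 2 * r2) / \<tau> - (\<alpha> * \<sigma>) * D - (\<alpha> * \<sigma>) * \<sigma> / 2 * \<tau> * N" if "0 < \<tau>" for \<tau> r2 D N
      using that by (simp add: field_simps power2_eq_square)
    have "fst z i * (1 - \<alpha> / 2 * (dist q (snd z i))\<^sup>2)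
        = fst z' i * ((1 - \<alpha> / 2 * ?r\<^sup>2) / ratio i - \<eta> * (?g \<bullet> u) - \<eta> * \<sigma> / 2 * ratio i * (norm ?g)\<^sup>2)"
    proof -
      have "fst z i = fst z' i / ratio i" using ratio[OF i'(1)] rp by simp
      moreover have "(1 - \<alpha> / 2 * (dist q (snd z i))\<^sup>2) / ratio i
          = (1 - \<alpha> / 2 * ?r\<^sup>2) / ratio i - \<eta> * (?g \<bullet> u) - \<eta> * \<sigma> / 2 * ratio i * (norm ?g)\<^sup>2"
        using alg[OF rp, of "?r\<^sup>2" "?g \<bullet> u" "(norm ?g)\<^sup>2"] unfolding u(4) u(2) \<alpha> .
      ultimately show ?thesis by (metis times_divide_eq_left times_divide_eq_right)
    qed
    also have "\<dots> \<le> fst z' i * (exp (\<eta> * (G q - cst)) * (1 - \<alpha> / 2 * ?r\<^sup>2) * (1 + ?bad))"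
      by (rule mult_left_mono[OF le weights(4)[OF i'(1)]])
    finally show ?thesis by (simp add: mult_ac)
  next
    case False
    then show ?thesis using zero_weight[OF i'(1)] by simp
  qed
qed

context
  assumes mass: "\<And>q. q \<in> P \<Longrightarrow> 3 / 4 * w q \<le> kmass \<alpha> n z q" "\<And>q. q \<in> P \<Longrightarrow> kmass \<alpha> n z q \<le> 5 / 4 * w q"
begin

lemma old_kmass_w:
  assumes "q \<in> P" shows "w q / 2 \<le> old_kmass q" "old_kmass q \<le> 2 * w q" "0 < old_kmass q"
proof -
  show 1: "w q / 2 \<le> old_kmass q" "old_kmass q \<le> 2 * w q"
    using old_kmass_bounds[OF assms] mass[OF assms] w_pos[OF assms] by simp_all
  show "0 < old_kmass q" using 1(1) w_pos[OF assms] by simp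
qed

text \<open>Take logarithms in \<open>kmass_estimate\<close> and average with \<open>w\<close>: the
  exponential becomes the payoff at the centres, and the relative error is linearized by
  \<open>ln t \<le> t - 1\<close>. Particles that enter a cluster only help, by
  \<open>old_kmass_le\<close>.\<close>

lemma lyap_step:
  "lyap \<alpha> n z' \<le> lyap \<alpha> n z + \<eta> * ((\<Sum>q\<in>P. w q * G q) - cst)
     + 2 * \<eta> * (\<alpha> * B * R + 31 * \<eta> * B\<^sup>2) * old_spread + \<eta>\<^sup>2 / 6 * variation - \<eta> * \<sigma> / 16 * old_grad"
proof -
  define lam where "lam = \<eta> * (\<alpha> * B * R + 31 * \<eta> * B\<^sup>2)"
  have lam: "0 \<le> lam" using pos alpha_pos R_pos by (simp add: lam_def)
  let ?r2 = "\<lambda>q i. (dist q (snd z' i))\<^sup>2" and ?\<delta>2 = "\<lambda>i. (G (snd z' i) - cst)\<^sup>2" and ?g2 = "\<lambda>i. (norm (Gg (snd z' i)))\<^sup>2"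
  let ?k = "\<lambda>q i. fst z' i * (1 - \<alpha> / 2 * ?r2 q i)"
  let ?bad = "\<lambda>q i. lam * ?r2 q i + \<eta>\<^sup>2 * ?\<delta>2 i / 12 - \<eta> * \<sigma> / 4 * ?g2 i"
  have key: "w q * ln (w q / kmass \<alpha> n z' q) \<le> w q * ln (w q / kmass \<alpha> n z q) + \<eta> * (w q * G q - w q * cst)
      + (2 * lam * (\<Sum>i\<in>grp n z q. fst z' i * ?r2 q i) + \<eta>\<^sup>2 / 6 * (\<Sum>i\<in>grp n z q. fst z' i * ?\<delta>2 i)
        - \<eta> * \<sigma> / 16 * (\<Sum>i\<in>grp n z q. fst z' i * ?g2 i))" if q: "q \<in> P" for q
  proof -
    note ok = old_kmass_w[OF q] and wq = w_pos[OF q]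
    have M: "0 < kmass \<alpha> n z q" using mass(1)[OF q] wq by linarith
    have M': "old_kmass q \<le> kmass \<alpha> n z' q" "0 < kmass \<alpha> n z' q" using old_kmass_le[OF q] ok by auto
    define S where "S = (\<Sum>i\<in>grp n z q. ?k q i * ?bad q i)"
    have est: "kmass \<alpha> n z q \<le> exp (\<eta> * (G q - cst)) * (old_kmass q + S)"
      using kmass_estimate[OF q] unfolding lam_def[symmetric] S_def old_kmass_def
      by (simp only: distrib_left mult_1_right sum.distrib)
    have pS: "0 < old_kmass q + S"
      using est M by (metis exp_gt_zero less_le_trans zero_less_mult_pos)
    have "ln (kmass \<alpha> n z q) \<le> \<eta> * (G q - cst) + ln (old_kmass q + S)"
    proof -
      have "ln (kmass \<alpha> n z q) \<le> ln (exp (\<eta> * (G q - cst)) * (old_kmass q + S))" using est M by simp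
      also have "\<dots> = \<eta> * (G q - cst) + ln (old_kmass q + S)" using pS by (simp add: ln_mult)
      finally show ?thesis .
    qed
    moreover have "ln (old_kmass q + S) \<le> ln (old_kmass q) + S / old_kmass q"
    proof -
      have "ln (old_kmass q + S) - ln (old_kmass q) = ln ((old_kmass q + S) / old_kmass q)"
        using pS ok by (simp add: ln_div)
      also have "\<dots> \<le> (old_kmass q + S) / old_kmass q - 1" using pS ok by (intro ln_le_minus_one) simp
      also have "\<dots> = S / old_kmass q" using ok by (simp add: field_simps)
      finally show ?thesis by simp
    qed
    moreover have "ln (old_kmass q) \<le> ln (kmass \<alpha> n z' q)" using M' ok by simp
    ultimately have "ln (kmass \<alpha> n z q) - ln (kmass \<alpha> n z' q) \<le> \<eta> * (G q - cst) + S / old_kmass q" by linarith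
    then have "w q * (ln (kmass \<alpha> n z q) - ln (kmass \<alpha> n z' q)) \<le> w q * (\<eta> * (G q - cst) + S / old_kmass q)"
      using wq by (intro mult_left_mono) auto
    moreover have "w q * ln (w q / kmass \<alpha> n z' q) - w q * ln (w q / kmass \<alpha> n z q)
        = w q * (ln (kmass \<alpha> n z q) - ln (kmass \<alpha> n z' q))"
      using wq M M' by (simp add: ln_div algebra_simps)
    moreover have "w q * (S / old_kmass q) \<le> 2 * lam * (\<Sum>i\<in>grp n z q. fst z' i * ?r2 q i)
        + \<eta>\<^sup>2 / 6 * (\<Sum>i\<in>grp n z q. fst z' i * ?\<delta>2 i) - \<eta> * \<sigma> / 16 * (\<Sum>i\<in>grp n z q. fst z' i * ?g2 i)"
    proof -
      \<comment> \<open>The error \<open>S\<close> is relative to \<open>old_kmass q\<close> but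
        weighted with \<open>w q\<close>; the mass window keeps the quotient between 1/2 and
        2.\<close>
      define c where "c = w q / old_kmass q"
      have c: "1 / 2 \<le> c" "c \<le> 2" using ok wq by (auto simp: c_def field_simps)
      have "c * (?k q i * ?bad q i) \<le> 2 * lam * (fst z' i * ?r2 q i) + \<eta>\<^sup>2 / 6 * (fst z' i * ?\<delta>2 i)
          - \<eta> * \<sigma> / 16 * (fst z' i * ?g2 i)" if i: "i \<in> grp n z q" for i
      proof (cases "0 < fst z i")
        case True
        have i': "i < n" using i by (simp add: grp_def)
        have "dist q (snd z' i) \<le> R" using trapped_grp[OF q i True] by (simp add: grp_def)
        note kb = kernel_bound[OF this]
        \<comment> \<open>Losses are multiplied by at most 2 and the gradient gain by at least 1/4.
          This turns the coefficient 1/12 into 1/6 and 1/4 into 1/16.\<close>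
        define \<kappa> where "\<kappa> = c * (1 - \<alpha> / 2 * ?r2 q i)"
        have "1 / 2 * (1 / 2) \<le> \<kappa>" unfolding \<kappa>_def using c kb by (intro mult_mono) auto
        moreover have "\<kappa> \<le> 2 * 1" unfolding \<kappa>_def using c kb by (intro mult_mono) auto
        ultimately have \<kappa>: "1 / 4 \<le> \<kappa>" "\<kappa> \<le> 2" by auto
        have "\<kappa> * (lam * ?r2 q i + \<eta>\<^sup>2 * ?\<delta>2 i / 12) \<le> 2 * (lam * ?r2 q i + \<eta>\<^sup>2 * ?\<delta>2 i / 12)"
          using \<kappa> lam by (intro mult_right_mono) auto
        moreover have "1 / 4 * (\<eta> * \<sigma> / 4 * ?g2 i) \<le> \<kappa> * (\<eta> * \<sigma> / 4 * ?g2 i)"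
          using \<kappa> pos by (intro mult_right_mono) auto
        ultimately have "\<kappa> * ?bad q i \<le> 2 * lam * ?r2 q i + \<eta>\<^sup>2 / 6 * ?\<delta>2 i - \<eta> * \<sigma> / 16 * ?g2 i"
          by (simp add: right_diff_distrib)
        then have "fst z' i * (\<kappa> * ?bad q i) \<le> fst z' i * (2 * lam * ?r2 q i + \<eta>\<^sup>2 / 6 * ?\<delta>2 i - \<eta> * \<sigma> / 16 * ?g2 i)"
          using weights(4)[OF i'] by (intro mult_left_mono)
        moreover have "c * (?k q i * ?bad q i) = fst z' i * (\<kappa> * ?bad q i)" by (simp only: \<kappa>_def mult_ac)
        ultimately show ?thesis by (simp only: distrib_left right_diff_distrib mult_ac) 
      next
        case False
        then show ?thesis using zero_weight[of i] i by (simp add: grp_def)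
      qed
      then have "(\<Sum>i\<in>grp n z q. c * (?k q i * ?bad q i)) \<le> (\<Sum>i\<in>grp n z q. 2 * lam * (fst z' i * ?r2 q i)
          + \<eta>\<^sup>2 / 6 * (fst z' i * ?\<delta>2 i) - \<eta> * \<sigma> / 16 * (fst z' i * ?g2 i))" by (rule sum_mono)
      moreover have "w q * (S / old_kmass q) = (\<Sum>i\<in>grp n z q. c * (?k q i * ?bad q i))"
        unfolding S_def c_def by (simp only: sum_distrib_left[symmetric]) simp
      ultimately show ?thesis by (simp only: sum.distrib sum_subtractf sum_distrib_left[symmetric])
    qed
    ultimately show ?thesis by (simp add: algebra_simps)
  qed
  have "lyap \<alpha> n z' \<le> (\<Sum>q\<in>P. w q * ln (w q / kmass \<alpha> n z q) + \<eta> * (w q * G q - w q * cst)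
      + (2 * lam * (\<Sum>i\<in>grp n z q. fst z' i * ?r2 q i) + \<eta>\<^sup>2 / 6 * (\<Sum>i\<in>grp n z q. fst z' i * ?\<delta>2 i)
        - \<eta> * \<sigma> / 16 * (\<Sum>i\<in>grp n z q. fst z' i * ?g2 i)))"
    unfolding lyap_def by (rule sum_mono[OF key])
  also have "\<dots> = lyap \<alpha> n z + \<eta> * ((\<Sum>q\<in>P. w q * G q) - cst)
     + (2 * lam * old_spread + \<eta>\<^sup>2 / 6 * (\<Sum>q\<in>P. \<Sum>i\<in>grp n z q. fst z' i * ?\<delta>2 i) - \<eta> * \<sigma> / 16 * old_grad)"
    unfolding sum.distrib sum_subtractf sum_distrib_left[symmetric] sum_distrib_right[symmetric] w_sum
    by (simp add: lyap_def old_spread_def old_grad_def)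
  finally have 1: "lyap \<alpha> n z' \<le> \<dots>" .
  have "(\<Sum>q\<in>P. \<Sum>i\<in>grp n z q. fst z' i * ?\<delta>2 i) \<le> variation"
    unfolding variation_def sum_split_groups[of _ n z]
    using weights(4) sum_nonneg[of "outer n z" "\<lambda>i. fst z' i * ?\<delta>2 i"] by (simp add: outer_def)
  then have "\<eta>\<^sup>2 / 6 * (\<Sum>q\<in>P. \<Sum>i\<in>grp n z q. fst z' i * ?\<delta>2 i) \<le> \<eta>\<^sup>2 / 6 * variation"
    by (intro mult_left_mono) auto
  then show ?thesis using 1 unfolding lam_def by (simp only: mult.assoc)
qed

text \<open>New particles of total mass at least \<open>w q / 2\<close> lie near the centre, and the
  Lipschitz bounds carry their payoffs and gradients over to it. The values at the centres are the
  data of the linear system for the opponent's weights.\<close>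

lemma center_values_bound:
  assumes q: "q \<in> P" and Gg_lip: "\<And>x y. norm (Gg x - Gg y) \<le> B * dist x y"
  shows "w q / 4 * ((G q - cst)\<^sup>2 + (norm (Gg q))\<^sup>2) \<le> variation + old_grad + 2 * B\<^sup>2 * old_spread"
proof -
  let ?A = "(G q - cst)\<^sup>2 + (norm (Gg q))\<^sup>2"
  let ?t = "\<lambda>i. (G (snd z' i) - cst)\<^sup>2 + (norm (Gg (snd z' i)))\<^sup>2 + 2 * B\<^sup>2 * (dist q (snd z' i))\<^sup>2"
  have t: "?A \<le> 2 * ?t i" for i
  proof -
    have sq: "(a + b)\<^sup>2 \<le> 2 * a\<^sup>2 + 2 * b\<^sup>2" for a b :: real
      using zero_le_power2[of "a - b"] by (simp add: power2_sum power2_diff)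
    let ?d = "B * dist q (snd z' i)"
    have "(G q - cst)\<^sup>2 \<le> (\<bar>G (snd z' i) - cst\<bar> + ?d)\<^sup>2"
      using G_lip[of q "snd z' i"] by (intro power2_le_iff_abs_le[THEN iffD2]) auto
    also have "\<dots> \<le> 2 * (G (snd z' i) - cst)\<^sup>2 + 2 * ?d\<^sup>2" using sq[of "\<bar>G (snd z' i) - cst\<bar>" ?d] by simp
    finally have 1: "(G q - cst)\<^sup>2 \<le> 2 * (G (snd z' i) - cst)\<^sup>2 + 2 * ?d\<^sup>2" .
    have "norm (Gg q) \<le> norm (Gg (snd z' i)) + ?d"
      using Gg_lip[of q "snd z' i"] norm_triangle_ineq2[of "Gg q" "Gg (snd z' i)"] by linarith
    then have "(norm (Gg q))\<^sup>2 \<le> (norm (Gg (snd z' i)) + ?d)\<^sup>2" by (intro power_mono) auto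
    also have "\<dots> \<le> 2 * (norm (Gg (snd z' i)))\<^sup>2 + 2 * ?d\<^sup>2" by (rule sq)
    finally show ?thesis using 1 by (simp add: power_mult_distrib)
  qed
  have "w q / 2 * ?A \<le> (\<Sum>i\<in>grp n z q. fst z' i) * ?A"
    using old_kmass_w(1)[OF q] old_kmass_bounds(3)[OF q] by (intro mult_right_mono) auto
  also have "\<dots> = (\<Sum>i\<in>grp n z q. fst z' i * ?A)" by (rule sum_distrib_right)
  also have "\<dots> \<le> (\<Sum>i\<in>grp n z q. fst z' i * (2 * ?t i))"
    using t weights(4) by (intro sum_mono mult_left_mono) (auto simp: grp_def)
  also have "\<dots> = 2 * (\<Sum>i\<in>grp n z q. fst z' i * ?t i)"
    unfolding sum_distrib_left by (intro sum.cong refl) (simp only: mult.left_commute)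
  finally have 1: "w q / 4 * ?A \<le> (\<Sum>i\<in>grp n z q. fst z' i * ?t i)" by simp
  have nn: "0 \<le> (\<Sum>i\<in>grp n z q'. fst z' i * h i)" if "\<And>i. 0 \<le> h i" for q' and h :: "nat \<Rightarrow> real"
    using that weights(4) by (intro sum_nonneg mult_nonneg_nonneg) (auto simp: grp_def)
  have single: "(\<Sum>i\<in>grp n z q. fst z' i * h q i) \<le> (\<Sum>q\<in>P. \<Sum>i\<in>grp n z q. fst z' i * h q i)"
    if "\<And>q i. 0 \<le> h q i" for h :: "'d torus \<Rightarrow> nat \<Rightarrow> real"
    using q fin that by (intro member_le_sum[where f = "\<lambda>q. \<Sum>i\<in>grp n z q. fst z' i * h q i"] nn) auto
  have "(\<Sum>i\<in>grp n z q. fst z' i * (G (snd z' i) - cst)\<^sup>2) \<le> variation"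
    unfolding variation_def using weights(4) by (intro sum_mono2) (auto simp: grp_def)
  moreover have "(\<Sum>i\<in>grp n z q. fst z' i * (norm (Gg (snd z' i)))\<^sup>2) \<le> old_grad"
    unfolding old_grad_def by (rule single) simp
  moreover have "2 * B\<^sup>2 * (\<Sum>i\<in>grp n z q. fst z' i * (dist q (snd z' i))\<^sup>2) \<le> 2 * B\<^sup>2 * old_spread"
    unfolding old_spread_def by (intro mult_left_mono single) auto
  moreover have "(\<Sum>i\<in>grp n z q. fst z' i * ?t i) = (\<Sum>i\<in>grp n z q. fst z' i * (G (snd z' i) - cst)\<^sup>2)
      + (\<Sum>i\<in>grp n z q. fst z' i * (norm (Gg (snd z' i)))\<^sup>2)
      + 2 * B\<^sup>2 * (\<Sum>i\<in>grp n z q. fst z' i * (dist q (snd z' i))\<^sup>2)"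
    by (simp add: distrib_left sum.distrib sum_distrib_left mult_ac)
  ultimately show ?thesis using 1 by linarith
qed

text \<open>Exports the step with the soft minimum, the variance and the squared gradients hidden in
  \<open>c\<close>, \<open>E\<close> and \<open>D\<close>, so that the estimates of the two players
  can be added.\<close>

lemma half_step:
  assumes Gg_lip: "\<And>x y. norm (Gg x - Gg y) \<le> B * dist x y"
  obtains c E D where "0 \<le> E" "0 \<le> D"
    "\<eta> * (\<Sum>i<n. fst z' i * G (snd z' i)) - \<eta> * c \<le> - (\<eta>\<^sup>2 / 3) * E"
    "lyap \<alpha> n z' \<le> lyap \<alpha> n z + \<eta> * ((\<Sum>q\<in>P. w q * G q) - c)
      + 2 * \<eta> * (\<alpha> * B * R + 31 * \<eta> * B\<^sup>2) * spread n z' + \<eta>\<^sup>2 / 6 * E - \<eta> * \<sigma> / 16 * D"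
    "\<And>q. q \<in> P \<Longrightarrow> w q / 4 * ((G q - c)\<^sup>2 + (norm (Gg q))\<^sup>2) \<le> E + D + 2 * B\<^sup>2 * spread n z'"
    "\<And>q. q \<in> P \<Longrightarrow> w q / 2 \<le> kmass \<alpha> n z' q"
proof -
  have E: "0 \<le> variation"
    unfolding variation_def using weights(4) by (intro sum_nonneg mult_nonneg_nonneg) auto
  have D: "0 \<le> old_grad"
    unfolding old_grad_def using weights(4) by (intro sum_nonneg mult_nonneg_nonneg) (auto simp: grp_def)
  have l: "0 \<le> 2 * \<eta> * (\<alpha> * B * R + 31 * \<eta> * B\<^sup>2)" using pos alpha_pos R_pos by simp
  show thesis
  proof (rule that[OF E D entropy_gain[folded variation_def]])
    show "lyap \<alpha> n z' \<le> lyap \<alpha> n z + \<eta> * ((\<Sum>q\<in>P. w q * G q) - cst)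
      + 2 * \<eta> * (\<alpha> * B * R + 31 * \<eta> * B\<^sup>2) * spread n z' + \<eta>\<^sup>2 / 6 * variation - \<eta> * \<sigma> / 16 * old_grad"
      using lyap_step mult_left_mono[OF old_spread_le l] by linarith
    show "w q / 4 * ((G q - cst)\<^sup>2 + (norm (Gg q))\<^sup>2) \<le> variation + old_grad + 2 * B\<^sup>2 * spread n z'" if "q \<in> P" for q
      using center_values_bound[OF that Gg_lip] mult_left_mono[OF old_spread_le, of "2 * B\<^sup>2"] by simp
    show "w q / 2 \<le> kmass \<alpha> n z' q" if "q \<in> P" for q
      using old_kmass_w(1)[OF that] old_kmass_le[OF that] by linarith
  qed
qed

end

end

end

section \<open>Cluster masses and the Lyapunov function\<close>

context clusters begin

definition gmass :: "nat \<Rightarrow> 'd particles \<Rightarrow> 'd torus \<Rightarrow> real" where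
  "gmass n z q = (\<Sum>i\<in>grp n z q. fst z i)"

definition omass :: "nat \<Rightarrow> 'd particles \<Rightarrow> real" where
  "omass n z = (\<Sum>i\<in>outer n z. fst z i)"

definition gspread :: "nat \<Rightarrow> 'd particles \<Rightarrow> 'd torus \<Rightarrow> real" where
  "gspread n z q = (\<Sum>i\<in>grp n z q. fst z i * (dist q (snd z i))\<^sup>2)"

lemma kmass_eq: "kmass \<alpha> n z q = gmass n z q - \<alpha> / 2 * gspread n z q"
  by (simp add: kmass_def gmass_def gspread_def sum_subtractf sum_distrib_left algebra_simps)

lemma w_le_1: "q \<in> P \<Longrightarrow> w q \<le> 1"
  using member_le_sum[of q P w] fin w_pos w_sum by (simp add: less_imp_le)

context
  fixes n :: nat and z :: "'d particles"
  assumes simplex: "fst z \<in> prob_simplex n"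
begin

lemma fst_nonneg: "i < n \<Longrightarrow> 0 \<le> fst z i"
  using simplex by (simp add: prob_simplex_def)

lemma gmass_nonneg: "0 \<le> gmass n z q" and omass_nonneg: "0 \<le> omass n z"
  and gspread_nonneg: "0 \<le> gspread n z q" and spread_nonneg: "0 \<le> spread n z"
  using fst_nonneg by (auto simp: gmass_def omass_def gspread_def spread_def grp_def outer_def intro!: sum_nonneg)

lemma total_mass: "(\<Sum>q\<in>P. gmass n z q) + omass n z = 1"
  using simplex sum_split_groups[of "fst z" n z] by (simp add: gmass_def omass_def prob_simplex_def)

lemma spread_eq: "spread n z = (\<Sum>q\<in>P. gspread n z q)"
  by (simp add: spread_def gspread_def)

lemma gmass_le_1: "q \<in> P \<Longrightarrow> gmass n z q \<le> 1"
  using member_le_sum[of q P "gmass n z"] fin gmass_nonneg total_mass omass_nonneg by simp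

lemma gspread_le: "q \<in> P \<Longrightarrow> gspread n z q \<le> spread n z"
  unfolding spread_eq using fin gspread_nonneg by (intro member_le_sum) auto

lemma sum_kmass: "(\<Sum>q\<in>P. kmass \<alpha> n z q) = 1 - omass n z - \<alpha> / 2 * spread n z"
  unfolding kmass_eq sum_subtractf sum_distrib_left[symmetric] spread_eq using total_mass by simp

lemma kmass_le_1: "q \<in> P \<Longrightarrow> 0 \<le> \<alpha> \<Longrightarrow> kmass \<alpha> n z q \<le> 1"
proof -
  assume "q \<in> P" "0 \<le> \<alpha>"
  moreover have "0 \<le> \<alpha> / 2 * gspread n z q" using gspread_nonneg \<open>0 \<le> \<alpha>\<close> by simp
  ultimately show ?thesis using gmass_le_1[of q] unfolding kmass_eq by linarith
qed

text \<open>The kernel masses fall short of total mass 1 by exactly the outside mass and the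
  weighted spread, and relative entropy contains this deficit linearly. What is left dominates a
  squared Hellinger distance, by \<open>ln t \<le> 2 * (sqrt t - 1)\<close>.\<close>

lemma lyap_ge:
  assumes "\<And>q. q \<in> P \<Longrightarrow> 0 < kmass \<alpha> n z q"
  shows "omass n z + \<alpha> / 2 * spread n z + (\<Sum>q\<in>P. (sqrt (kmass \<alpha> n z q) - sqrt (w q))\<^sup>2) \<le> lyap \<alpha> n z"
proof -
  have "(sqrt (kmass \<alpha> n z q) - sqrt (w q))\<^sup>2 + w q - kmass \<alpha> n z q \<le> w q * ln (w q / kmass \<alpha> n z q)" if q: "q \<in> P" for q
  proof -
    let ?M = "kmass \<alpha> n z q"
    have p: "0 < ?M" "0 < w q" using assms q w_pos by auto
    have "ln (?M / w q) = 2 * ln (sqrt (?M / w q))" using p by (simp add: ln_sqrt)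
    also have "\<dots> \<le> 2 * (sqrt (?M / w q) - 1)" using p ln_le_minus_one[of "sqrt (?M / w q)"] by simp
    finally have "w q * ln (?M / w q) \<le> w q * (2 * (sqrt (?M / w q) - 1))" using p by (intro mult_left_mono) auto
    moreover have "w q * sqrt (?M / w q) = sqrt ?M * sqrt (w q)"
      using p by (simp add: real_sqrt_divide field_simps flip: power2_eq_square)
    moreover have "ln (w q / ?M) = - ln (?M / w q)" using p by (simp add: ln_div)
    moreover have "(sqrt ?M - sqrt (w q))\<^sup>2 = ?M + w q - 2 * (sqrt ?M * sqrt (w q))"
      using p by (simp add: power2_diff)
    ultimately show ?thesis by (simp add: algebra_simps)
  qed
  then have "(\<Sum>q\<in>P. (sqrt (kmass \<alpha> n z q) - sqrt (w q))\<^sup>2 + w q - kmass \<alpha> n z q) \<le> lyap \<alpha> n z"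
    unfolding lyap_def by (rule sum_mono)
  then show ?thesis using w_sum sum_kmass by (simp add: sum.distrib sum_subtractf)
qed

text \<open>The mass deficit enters with the same coefficients as in \<open>lyap_ge\<close>; the
  remainder is quadratic because the kernel masses stay above half their targets.\<close>

lemma lyap_le:
  assumes "\<And>q. q \<in> P \<Longrightarrow> w q / 2 \<le> kmass \<alpha> n z q"
  shows "lyap \<alpha> n z \<le> omass n z + \<alpha> / 2 * spread n z + (\<Sum>q\<in>P. 2 * (kmass \<alpha> n z q - w q)\<^sup>2 / w q)"
proof -
  have "w q * ln (w q / kmass \<alpha> n z q) \<le> w q - kmass \<alpha> n z q + 2 * (kmass \<alpha> n z q - w q)\<^sup>2 / w q" if q: "q \<in> P" for q
  proof -
    let ?M = "kmass \<alpha> n z q"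
    have p: "0 < w q" using w_pos q by auto
    have M: "w q / 2 \<le> ?M" "0 < ?M" using assms[OF q] p by auto
    have "ln (w q / ?M) \<le> w q / ?M - 1" using p M by (intro ln_le_minus_one) auto
    then have "w q * ln (w q / ?M) \<le> w q * (w q / ?M - 1)" using p by (intro mult_left_mono) auto
    also have "w q * (w q / ?M - 1) = w q - ?M + (?M - w q)\<^sup>2 / ?M"
      using M by (simp add: field_simps power2_eq_square)
    also have "(?M - w q)\<^sup>2 / ?M \<le> (?M - w q)\<^sup>2 / (w q / 2)"
      using M p by (intro divide_left_mono) auto
    finally show ?thesis by (simp add: mult.commute)
  qed
  then have "lyap \<alpha> n z \<le> (\<Sum>q\<in>P. w q - kmass \<alpha> n z q + 2 * (kmass \<alpha> n z q - w q)\<^sup>2 / w q)"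
    unfolding lyap_def by (rule sum_mono)
  then show ?thesis using w_sum sum_kmass by (simp add: sum.distrib sum_subtractf)
qed

lemma lyap_nonneg: "(\<And>q. q \<in> P \<Longrightarrow> 0 < kmass \<alpha> n z q) \<Longrightarrow> 0 \<le> \<alpha> \<Longrightarrow> 0 \<le> lyap \<alpha> n z"
proof -
  assume k: "\<And>q. q \<in> P \<Longrightarrow> 0 < kmass \<alpha> n z q" and "0 \<le> \<alpha>"
  have "0 \<le> \<alpha> / 2 * spread n z" using spread_nonneg \<open>0 \<le> \<alpha>\<close> by simp
  moreover have "0 \<le> (\<Sum>q\<in>P. (sqrt (kmass \<alpha> n z q) - sqrt (w q))\<^sup>2)" by (intro sum_nonneg) auto
  ultimately show ?thesis using lyap_ge[OF k] omass_nonneg by linarith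
qed

text \<open>Moving each clustered particle to its centre costs the mean distance, bounded by the
  root of the spread through Cauchy-Schwarz; particles outside cost their mass. The cluster masses
  are not yet compared with the targets.\<close>

lemma spread_approx:
  fixes \<psi> :: "'d torus \<Rightarrow> 'b::real_normed_vector"
  assumes "0 \<le> B" "\<And>x. norm (\<psi> x) \<le> B" "\<And>x y. norm (\<psi> x - \<psi> y) \<le> B * dist x y"
  shows "norm ((\<Sum>i<n. fst z i *\<^sub>R \<psi> (snd z i)) - (\<Sum>q\<in>P. gmass n z q *\<^sub>R \<psi> q)) \<le> B * (sqrt (spread n z) + omass n z)"
proof -
  have eq: "(\<Sum>i<n. fst z i *\<^sub>R \<psi> (snd z i)) - (\<Sum>q\<in>P. gmass n z q *\<^sub>R \<psi> q)
     = (\<Sum>q\<in>P. \<Sum>i\<in>grp n z q. fst z i *\<^sub>R (\<psi> (snd z i) - \<psi> q)) + (\<Sum>i\<in>outer n z. fst z i *\<^sub>R \<psi> (snd z i))"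
    unfolding sum_split_groups[of _ n z] gmass_def
    by (simp add: scaleR_diff_right sum_subtractf scaleR_sum_left)
  have A: "norm (\<Sum>q\<in>P. \<Sum>i\<in>grp n z q. fst z i *\<^sub>R (\<psi> (snd z i) - \<psi> q)) \<le> B * sqrt (spread n z)"
  proof -
    have "norm (\<Sum>q\<in>P. \<Sum>i\<in>grp n z q. fst z i *\<^sub>R (\<psi> (snd z i) - \<psi> q))
        \<le> (\<Sum>q\<in>P. \<Sum>i\<in>grp n z q. B * (fst z i * dist q (snd z i)))"
    proof (intro sum_norm_le)
      fix q i assume "q \<in> P" "i \<in> grp n z q"
      then have "0 \<le> fst z i" using fst_nonneg by (simp add: grp_def)
      then show "norm (fst z i *\<^sub>R (\<psi> (snd z i) - \<psi> q)) \<le> B * (fst z i * dist q (snd z i))"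
        using mult_left_mono[OF assms(3)[of "snd z i" q], of "fst z i"] by (simp add: dist_commute mult_ac)
    qed
    also have "\<dots> = B * (\<Sum>q\<in>P. \<Sum>i\<in>grp n z q. fst z i * dist q (snd z i))" by (simp add: sum_distrib_left)
    also have "(\<Sum>q\<in>P. \<Sum>i\<in>grp n z q. fst z i * dist q (snd z i)) \<le> sqrt (spread n z)"
    proof (rule real_le_rsqrt)
      let ?I = "SIGMA q:P. grp n z q"
      have fI: "finite ?I" using fin by auto
      have s: "(\<Sum>q\<in>P. \<Sum>i\<in>grp n z q. h q i) = (\<Sum>(q, i)\<in>?I. h q i)" for h :: "_ \<Rightarrow> _ \<Rightarrow> real"
        by (rule sum.Sigma) (use fin in auto)
      have "(\<Sum>(q, i)\<in>?I. sqrt (fst z i) * (sqrt (fst z i) * dist q (snd z i)))\<^sup>2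
          \<le> (\<Sum>(q, i)\<in>?I. (sqrt (fst z i))\<^sup>2) * (\<Sum>(q, i)\<in>?I. (sqrt (fst z i) * dist q (snd z i))\<^sup>2)"
        unfolding case_prod_beta by (rule Cauchy_Schwarz_ineq_sum)
      also have "(\<Sum>(q, i)\<in>?I. sqrt (fst z i) * (sqrt (fst z i) * dist q (snd z i))) = (\<Sum>q\<in>P. \<Sum>i\<in>grp n z q. fst z i * dist q (snd z i))"
        unfolding s by (intro sum.cong) (auto simp: grp_def fst_nonneg simp flip: mult.assoc)
      also have "(\<Sum>(q, i)\<in>?I. (sqrt (fst z i))\<^sup>2) = (\<Sum>q\<in>P. gmass n z q)"
        unfolding gmass_def s by (intro sum.cong) (auto simp: grp_def fst_nonneg)
      also have "(\<Sum>(q, i)\<in>?I. (sqrt (fst z i) * dist q (snd z i))\<^sup>2) = spread n z"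
        unfolding spread_def s by (intro sum.cong) (auto simp: grp_def fst_nonneg power_mult_distrib)
      also have "(\<Sum>q\<in>P. gmass n z q) * spread n z \<le> 1 * spread n z"
        using total_mass omass_nonneg spread_nonneg by (intro mult_right_mono) auto
      finally show "(\<Sum>q\<in>P. \<Sum>i\<in>grp n z q. fst z i * dist q (snd z i))\<^sup>2 \<le> spread n z" by simp
    qed
    finally show ?thesis using assms(1) by (simp add: mult_left_mono)
  qed
  have "norm (\<Sum>i\<in>outer n z. fst z i *\<^sub>R \<psi> (snd z i)) \<le> (\<Sum>i\<in>outer n z. B * fst z i)"
    using assms(2) fst_nonneg mult_right_mono by (intro sum_norm_le) (auto simp: outer_def mult.commute[of B] intro!: mult_left_mono)
  then have "norm (\<Sum>i\<in>outer n z. fst z i *\<^sub>R \<psi> (snd z i)) \<le> B * omass n z"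
    by (simp add: omass_def sum_distrib_left)
  then show ?thesis unfolding eq by (intro norm_triangle_le) (use A in \<open>simp add: distrib_left\<close>)
qed

lemma target_approx:
  fixes \<psi> :: "'d torus \<Rightarrow> 'b::real_normed_vector"
  assumes "0 \<le> B" "\<And>x. norm (\<psi> x) \<le> B" "\<And>x y. norm (\<psi> x - \<psi> y) \<le> B * dist x y"
  shows "norm ((\<Sum>i<n. fst z i *\<^sub>R \<psi> (snd z i)) - (\<Sum>q\<in>P. w q *\<^sub>R \<psi> q))
    \<le> B * (sqrt (spread n z) + omass n z + (\<Sum>q\<in>P. \<bar>gmass n z q - w q\<bar>))"
proof -
  have "norm (\<Sum>q\<in>P. (gmass n z q - w q) *\<^sub>R \<psi> q) \<le> (\<Sum>q\<in>P. \<bar>gmass n z q - w q\<bar> * B)"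
    using assms(2) by (intro sum_norm_le) (auto intro!: mult_left_mono)
  also have "\<dots> = B * (\<Sum>q\<in>P. \<bar>gmass n z q - w q\<bar>)" by (simp add: sum_distrib_left mult.commute)
  finally have "norm ((\<Sum>q\<in>P. gmass n z q *\<^sub>R \<psi> q) - (\<Sum>q\<in>P. w q *\<^sub>R \<psi> q)) \<le> B * (\<Sum>q\<in>P. \<bar>gmass n z q - w q\<bar>)"
    by (simp add: scaleR_diff_left sum_subtractf)
  moreover have "(\<Sum>i<n. fst z i *\<^sub>R \<psi> (snd z i)) - (\<Sum>q\<in>P. w q *\<^sub>R \<psi> q)
     = ((\<Sum>i<n. fst z i *\<^sub>R \<psi> (snd z i)) - (\<Sum>q\<in>P. gmass n z q *\<^sub>R \<psi> q))
     + ((\<Sum>q\<in>P. gmass n z q *\<^sub>R \<psi> q) - (\<Sum>q\<in>P. w q *\<^sub>R \<psi> q))" by simp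
  ultimately show ?thesis
    using spread_approx[OF assms] norm_triangle_ineq[of "(\<Sum>i<n. fst z i *\<^sub>R \<psi> (snd z i)) - (\<Sum>q\<in>P. gmass n z q *\<^sub>R \<psi> q)"
        "(\<Sum>q\<in>P. gmass n z q *\<^sub>R \<psi> q) - (\<Sum>q\<in>P. w q *\<^sub>R \<psi> q)"]
    by (simp only: distrib_left)
qed

context
  fixes \<alpha> V :: real
  assumes kpos: "\<And>q. q \<in> P \<Longrightarrow> 0 < kmass \<alpha> n z q" and \<alpha>: "0 < \<alpha>"
    and V: "lyap \<alpha> n z \<le> V" "V \<le> 1"
begin

lemma lyap_controls:
  "omass n z \<le> V" "spread n z \<le> 2 / \<alpha> * V" "0 \<le> V"
  "q \<in> P \<Longrightarrow> (sqrt (kmass \<alpha> n z q) - sqrt (w q))\<^sup>2 \<le> V"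
  "q \<in> P \<Longrightarrow> \<bar>kmass \<alpha> n z q - w q\<bar> \<le> 2 * sqrt V"
  "q \<in> P \<Longrightarrow> \<bar>gmass n z q - w q\<bar> \<le> 3 * sqrt V"
proof -
  let ?S = "\<Sum>q\<in>P. (sqrt (kmass \<alpha> n z q) - sqrt (w q))\<^sup>2"
  have S: "0 \<le> ?S" by (intro sum_nonneg) auto
  have le: "omass n z + \<alpha> / 2 * spread n z + ?S \<le> V" using lyap_ge[OF kpos] V by linarith
  have as: "0 \<le> \<alpha> / 2 * spread n z" using spread_nonneg \<alpha> by simp
  show 1: "omass n z \<le> V" using le S as by linarith
  show V0: "0 \<le> V" using 1 omass_nonneg by linarith
  have sp: "\<alpha> / 2 * spread n z \<le> V" using le S omass_nonneg by linarith
  then show "spread n z \<le> 2 / \<alpha> * V" using \<alpha> by (simp add: field_simps)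
  assume q: "q \<in> P"
  have "(sqrt (kmass \<alpha> n z q) - sqrt (w q))\<^sup>2 \<le> ?S" using q fin by (intro member_le_sum) auto
  then show 2: "(sqrt (kmass \<alpha> n z q) - sqrt (w q))\<^sup>2 \<le> V" using le as omass_nonneg by linarith
  have "\<bar>sqrt (kmass \<alpha> n z q) - sqrt (w q)\<bar> \<le> sqrt V" using 2 real_le_rsqrt[of "\<bar>sqrt (kmass \<alpha> n z q) - sqrt (w q)\<bar>"] by simp
  moreover have kw: "0 \<le> kmass \<alpha> n z q" "0 \<le> w q" using kpos[OF q] w_pos[OF q] by auto
  moreover have "\<bar>sqrt (kmass \<alpha> n z q) + sqrt (w q)\<bar> \<le> 2"
  proof -
    have "sqrt (kmass \<alpha> n z q) \<le> 1" "sqrt (w q) \<le> 1" using kmass_le_1[OF q] \<alpha> w_le_1[OF q] by auto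
    then show ?thesis using real_sqrt_ge_zero[OF kw(1)] real_sqrt_ge_zero[OF kw(2)] by linarith
  qed
  moreover have "kmass \<alpha> n z q - w q = (sqrt (kmass \<alpha> n z q) - sqrt (w q)) * (sqrt (kmass \<alpha> n z q) + sqrt (w q))"
    using kw by (simp add: algebra_simps)
  ultimately have "\<bar>kmass \<alpha> n z q - w q\<bar> \<le> sqrt V * 2"
    using V0 by (simp only: abs_mult) (rule mult_mono, auto)
  then show 3: "\<bar>kmass \<alpha> n z q - w q\<bar> \<le> 2 * sqrt V" by simp
  \<comment> \<open>\<open>gmass\<close> exceeds \<open>kmass\<close> by at most \<open>V\<close>,
    and \<open>V \<le> sqrt V\<close> turns the constant 2 into 3.\<close>
  have "\<alpha> / 2 * gspread n z q \<le> \<alpha> / 2 * spread n z" using gspread_le[OF q] \<alpha> by (intro mult_left_mono) auto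
  moreover have "V \<le> sqrt V"
  proof -
    have "V\<^sup>2 \<le> V" using V0 V(2) mult_left_le[of V V] by (simp add: power2_eq_square)
    then show ?thesis by (rule real_le_rsqrt)
  qed
  moreover have "0 \<le> \<alpha> / 2 * gspread n z q" using gspread_nonneg \<alpha> by simp
  ultimately show "\<bar>gmass n z q - w q\<bar> \<le> 3 * sqrt V"
    using 3 sp unfolding kmass_eq by linarith
qed

text \<open>The error is only of order \<open>sqrt V\<close>, because the Lyapunov function controls
  the squares of the mean distance and of the mass errors. This is the origin of the square root in
  the bound for the NI error.\<close>

lemma target_approx_lyap:
  fixes \<psi> :: "'d torus \<Rightarrow> 'b::real_normed_vector"
  assumes "0 \<le> B" "\<And>x. norm (\<psi> x) \<le> B" "\<And>x y. norm (\<psi> x - \<psi> y) \<le> B * dist x y"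
  shows "norm ((\<Sum>i<n. fst z i *\<^sub>R \<psi> (snd z i)) - (\<Sum>q\<in>P. w q *\<^sub>R \<psi> q))
    \<le> B * (sqrt (2 / \<alpha>) + 1 + 3 * card P) * sqrt V"
proof -
  have V01: "0 \<le> V" using lyap_controls(3) .
  have "sqrt (spread n z) \<le> sqrt (2 / \<alpha> * V)" using lyap_controls(2) by simp
  then have 1: "sqrt (spread n z) \<le> sqrt (2 / \<alpha>) * sqrt V" by (simp add: real_sqrt_mult real_sqrt_divide)
  have "V\<^sup>2 \<le> V" using V01 V(2) mult_left_le[of V V] by (simp add: power2_eq_square)
  then have "V \<le> sqrt V" by (rule real_le_rsqrt)
  then have 2: "omass n z \<le> sqrt V" using lyap_controls(1) by linarith
  have 3: "(\<Sum>q\<in>P. \<bar>gmass n z q - w q\<bar>) \<le> card P * (3 * sqrt V)"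
    using sum_bounded_above[of P "\<lambda>q. \<bar>gmass n z q - w q\<bar>" "3 * sqrt V"] lyap_controls(6) by simp
  have "sqrt (spread n z) + omass n z + (\<Sum>q\<in>P. \<bar>gmass n z q - w q\<bar>) \<le> (sqrt (2 / \<alpha>) + 1 + 3 * card P) * sqrt V"
    using 1 2 3 by (simp add: algebra_simps)
  from mult_left_mono[OF this assms(1)] target_approx[OF assms] show ?thesis by (simp add: mult.assoc)
qed

end

end

end

section \<open>Quantitative consequences of non-degeneracy\<close>

text \<open>A positive minimum on the unit sphere, then homogeneity. Functions vanishing off
  \<open>S\<close> with values in \<open>{- 1..1}\<close> form a compact product of compact sets, so
  the sphere is compact without a choice of coordinates.\<close>

lemma quadratic_coercive:
  fixes \<Phi> :: "('s \<Rightarrow> real) \<Rightarrow> real"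
  assumes fin: "finite S" and cont: "continuous_on UNIV \<Phi>"
    and homog: "\<And>c \<delta>. \<Phi> (\<lambda>s. c * \<delta> s) = c\<^sup>2 * \<Phi> \<delta>" and nonneg: "\<And>\<delta>. 0 \<le> \<Phi> \<delta>"
    and kernel: "\<And>\<delta>. (\<And>s. s \<notin> S \<Longrightarrow> \<delta> s = 0) \<Longrightarrow> \<Phi> \<delta> = 0 \<Longrightarrow> (\<And>s. s \<in> S \<Longrightarrow> \<delta> s = 0)"
  obtains C where "0 < C" "\<And>\<delta>. (\<And>s. s \<notin> S \<Longrightarrow> \<delta> s = 0) \<Longrightarrow> (\<Sum>s\<in>S. (\<delta> s)\<^sup>2) \<le> C * \<Phi> \<delta>"
proof -
  define N where "N \<delta> = (\<Sum>s\<in>S. (\<delta> s)\<^sup>2)" for \<delta> :: "'s \<Rightarrow> real"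
  define K where "K = PiE UNIV (\<lambda>s. if s \<in> S then {- 1..1} else {0 :: real}) \<inter> {\<delta>. N \<delta> = 1}"
  have contN: "continuous_on UNIV N"
    unfolding N_def by (intro continuous_intros continuous_on_product_coordinates)
  have "compact (PiE UNIV (\<lambda>s. if s \<in> S then {- 1..1} else {0 :: real}))"
    unfolding compactin_euclidean_iff[symmetric] euclidean_product_topology[symmetric] compactin_PiE by auto
  moreover have "closed {\<delta>. N \<delta> = 1}"
    using closed_Collect_eq[OF contN continuous_on_const] by simp
  ultimately have cK: "compact K" unfolding K_def by (rule compact_Int_closed)
  obtain m where m: "0 < m" "\<And>\<delta>. \<delta> \<in> K \<Longrightarrow> m \<le> \<Phi> \<delta>"
  proof (cases "K = {}")
    case False
    obtain \<delta>0 where d0: "\<delta>0 \<in> K" "\<And>\<delta>. \<delta> \<in> K \<Longrightarrow> \<Phi> \<delta>0 \<le> \<Phi> \<delta>"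
      using continuous_attains_inf[OF cK False continuous_on_subset[OF cont]] by blast
    have "\<Phi> \<delta>0 \<noteq> 0"
    proof
      assume *: "\<Phi> \<delta>0 = 0"
      have off: "\<delta>0 s = 0" if "s \<notin> S" for s
        using d0(1) that by (auto simp: K_def PiE_def Pi_def dest!: spec[of _ s] split: if_splits)
      have "N \<delta>0 = 0" unfolding N_def using kernel[OF off *] by simp
      then show False using d0(1) by (simp add: K_def)
    qed
    then show thesis using that[of "\<Phi> \<delta>0"] d0(2) nonneg[of \<delta>0] by fastforce
  qed (use that[of 1] in auto)
  show thesis
  proof (rule that[of "1 / m"])
    fix \<delta> :: "'s \<Rightarrow> real" assume off: "\<And>s. s \<notin> S \<Longrightarrow> \<delta> s = 0"
    show "(\<Sum>s\<in>S. (\<delta> s)\<^sup>2) \<le> 1 / m * \<Phi> \<delta>"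
    proof (cases "N \<delta> = 0")
      case False
      moreover have "0 \<le> N \<delta>" unfolding N_def by (intro sum_nonneg) auto
      ultimately have Np: "0 < N \<delta>" by simp
      define c where "c = 1 / sqrt (N \<delta>)"
      have c2: "c\<^sup>2 = 1 / N \<delta>" using Np by (simp add: c_def power_divide)
      have N1: "N (\<lambda>s. c * \<delta> s) = 1"
        using Np c2 unfolding N_def power_mult_distrib sum_distrib_left[symmetric] by simp
      have "(\<lambda>s. c * \<delta> s) \<in> K"
      proof -
        have "c * \<delta> s \<in> {- 1..1}" if "s \<in> S" for s
        proof -
          have "(c * \<delta> s)\<^sup>2 \<le> N (\<lambda>s. c * \<delta> s)" unfolding N_def using fin that by (intro member_le_sum[where f = "\<lambda>s. (c * \<delta> s)\<^sup>2"]) auto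
          then have "\<bar>c * \<delta> s\<bar> \<le> 1" using N1 abs_le_square_iff[of "c * \<delta> s" 1] by simp
          then show ?thesis by (simp add: abs_le_iff)
        qed
        then show ?thesis using N1 off by (auto simp: K_def)
      qed
      from m(2)[OF this] have "m \<le> \<Phi> \<delta> / N \<delta>" using homog[of c \<delta>] c2 by simp
      then show ?thesis using Np m(1) by (simp add: N_def field_simps)
    qed (use nonneg m(1) in \<open>simp add: N_def\<close>)
  qed (use m in simp)
qed

text \<open>The equilibrium as seen by the minimizing player, reduced to weights on finite sets:
  \<open>P\<close> and \<open>w\<close> are its own strategy, \<open>Q\<close> and \<open>v\<close>
  the opponent's. The clause \<open>unique\<close> concerns the opponent's weights because these are
  what the payoffs at \<open>P\<close> are to determine.\<close>

locale game_side = smooth_payoff f gx hx L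
  for f :: "'n::finite torus \<Rightarrow> 'm::finite torus \<Rightarrow> real" and gx hx L +
  fixes P :: "'n torus set" and w :: "'n torus \<Rightarrow> real" and Q :: "'m torus set" and v :: "'m torus \<Rightarrow> real" and \<rho> :: real
  assumes finP: "finite P" and finQ: "finite Q"
    and w_pos: "\<And>p. p \<in> P \<Longrightarrow> 0 < w p" and v_pos: "\<And>q. q \<in> Q \<Longrightarrow> 0 < v q"
    and w_sum: "(\<Sum>p\<in>P. w p) = 1" and v_sum: "(\<Sum>q\<in>Q. v q) = 1"
    and value_ge: "\<And>x. \<rho> \<le> (\<Sum>q\<in>Q. v q * f x q)" and value_eq: "\<And>x. (\<Sum>q\<in>Q. v q * f x q) = \<rho> \<longleftrightarrow> x \<in> P"
    and value_P: "\<And>q. q \<in> Q \<Longrightarrow> (\<Sum>p\<in>P. w p * f p q) = \<rho>"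
    and hess_pos: "\<And>p u. p \<in> P \<Longrightarrow> u \<noteq> 0 \<Longrightarrow> 0 < u \<bullet> (\<Sum>q\<in>Q. v q *\<^sub>R hx p q u)"
    and unique: "\<And>v'. (\<And>q. q \<in> Q \<Longrightarrow> 0 \<le> v' q) \<Longrightarrow> (\<Sum>q\<in>Q. v' q) = 1 \<Longrightarrow>
       (\<And>x. \<rho> \<le> (\<Sum>q\<in>Q. v' q * f x q)) \<Longrightarrow> (\<And>q. q \<in> Q \<Longrightarrow> v' q = v q)"
begin

lemma td_sum: "twice_diff (\<lambda>x. \<Sum>q\<in>S. c q * f x (Y q)) (\<lambda>x. \<Sum>q\<in>S. c q *\<^sub>R gx x (Y q)) (\<lambda>x u. \<Sum>q\<in>S. c q *\<^sub>R hx x (Y q) u)"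
  by (rule twice_diff_sum[OF td])

lemma td_Q: "twice_diff (\<lambda>x. \<Sum>q\<in>Q. c q * f x q) (\<lambda>x. \<Sum>q\<in>Q. c q *\<^sub>R gx x q) (\<lambda>x u. \<Sum>q\<in>Q. c q *\<^sub>R hx x q u)"
  by (rule td_sum)

lemma critical: "p \<in> P \<Longrightarrow> (\<Sum>q\<in>Q. v q *\<^sub>R gx p q) = 0"
  by (rule grad_eq_0_at_min[OF td_Q[of v]]) (simp add: value_ge iffD2[OF value_eq])

text \<open>Each quadratic form is positive on the compact unit sphere and homogeneous, and there
  are finitely many points.\<close>

lemma hess_coercive: obtains lam where "0 < lam" "lam \<le> L"
  "\<And>p u. p \<in> P \<Longrightarrow> lam * (norm u)\<^sup>2 \<le> u \<bullet> (\<Sum>q\<in>Q. v q *\<^sub>R hx p q u)"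
proof -
  have "\<exists>l>0. \<forall>u. l * (norm u)\<^sup>2 \<le> u \<bullet> (\<Sum>q\<in>Q. v q *\<^sub>R hx p q u)" if p: "p \<in> P" for p
  proof -
    let ?H = "\<lambda>u. \<Sum>q\<in>Q. v q *\<^sub>R hx p q u"
    have lin: "linear ?H"
      using td_Q[of v] unfolding twice_diff_def by (blast dest: has_derivative_linear)
    have "compact (sphere (0 :: real ^ 'n) 1)" by simp
    moreover have "sphere (0 :: real ^ 'n) 1 \<noteq> {}" by simp
    moreover have "continuous_on (sphere 0 1) (\<lambda>u. u \<bullet> ?H u)"
      by (intro continuous_on_inner continuous_on_id linear_continuous_on linear_conv_bounded_linear[THEN iffD1] lin)
    ultimately have "\<exists>u0\<in>sphere 0 1. \<forall>u\<in>sphere 0 1. u0 \<bullet> ?H u0 \<le> u \<bullet> ?H u"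
      by (rule continuous_attains_inf)
    then obtain u0 where u0: "u0 \<in> sphere 0 1" "\<And>u. u \<in> sphere 0 1 \<Longrightarrow> u0 \<bullet> ?H u0 \<le> u \<bullet> ?H u"
      by (elim bexE) (rule that, assumption, erule bspec)
    have "u0 \<bullet> ?H u0 * (norm u)\<^sup>2 \<le> u \<bullet> ?H u" for u
    proof (cases "u = 0")
      case False
      let ?e = "(1 / norm u) *\<^sub>R u"
      have "u0 \<bullet> ?H u0 \<le> ?e \<bullet> ?H ?e" using False by (intro u0(2)) simp
      also have "?H ?e = (1 / norm u) *\<^sub>R ?H u" using lin by (rule linear_scale)
      also have "?e \<bullet> ((1 / norm u) *\<^sub>R ?H u) = (u \<bullet> ?H u) / (norm u)\<^sup>2" by (simp add: power2_eq_square)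
      finally show ?thesis using False by (simp add: field_simps)
    qed simp
    moreover have "0 < u0 \<bullet> ?H u0" using hess_pos[OF p, of u0] u0(1) by (cases "u0 = 0") auto
    ultimately show ?thesis by blast
  qed
  then have "\<forall>p\<in>P. \<exists>l. 0 < l \<and> (\<forall>u. l * (norm u)\<^sup>2 \<le> u \<bullet> (\<Sum>q\<in>Q. v q *\<^sub>R hx p q u))" by blast
  from bchoice[OF this] obtain l where
    l: "\<And>p. p \<in> P \<Longrightarrow> 0 < l p" "\<And>p u. p \<in> P \<Longrightarrow> l p * (norm u)\<^sup>2 \<le> u \<bullet> (\<Sum>q\<in>Q. v q *\<^sub>R hx p q u)"
    by blast
  show thesis
  proof (rule that[of "Min (insert L (l ` P))"])
    show "0 < Min (insert L (l ` P))" using finP l(1) L_pos by (subst Min_gr_iff) auto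
    show "Min (insert L (l ` P)) * (norm u)\<^sup>2 \<le> u \<bullet> (\<Sum>q\<in>Q. v q *\<^sub>R hx p q u)" if "p \<in> P" for p u
    proof -
      have "Min (insert L (l ` P)) \<le> l p" using finP that by (intro Min_le) auto
      then have "Min (insert L (l ` P)) * (norm u)\<^sup>2 \<le> l p * (norm u)\<^sup>2" by (intro mult_right_mono) auto
      then show ?thesis using l(2)[OF that, of u] by linarith
    qed
  qed (use finP in auto)
qed

text \<open>The Lipschitz bound for the second derivative enters here: a displacement of at most
  \<open>norm u\<close> lowers the quadratic form by at most \<open>L * norm u\<close> times the
  square of the norm.\<close>

lemma hess_near:
  assumes lam: "\<And>p u. p \<in> P \<Longrightarrow> lam * (norm u)\<^sup>2 \<le> u \<bullet> (\<Sum>q\<in>Q. v q *\<^sub>R hx p q u)"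
    and p: "p \<in> P" and s: "0 \<le> s" "s \<le> 1"
  shows "(lam - L * norm u) * (norm u)\<^sup>2 \<le> u \<bullet> (\<Sum>q\<in>Q. v q *\<^sub>R hx (shift p (s *\<^sub>R u)) q u)"
proof -
  let ?x = "shift p (s *\<^sub>R u)"
  have "dist p ?x \<le> norm u"
    using dist_shift_le'[of p "s *\<^sub>R u"] s mult_right_mono[of s 1 "norm u"] by simp
  then have "L * dist p ?x * (norm u)\<^sup>2 \<le> L * norm u * (norm u)\<^sup>2" using L_pos by (intro mult_right_mono mult_left_mono) auto
  then have le: "u \<bullet> hx p q u - L * norm u * (norm u)\<^sup>2 \<le> u \<bullet> hx ?x q u" for q
    using hx_lip[of u p q ?x q] by simp
  have "(\<Sum>q\<in>Q. v q * (u \<bullet> hx p q u - L * norm u * (norm u)\<^sup>2)) \<le> (\<Sum>q\<in>Q. v q * (u \<bullet> hx ?x q u))"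
    using v_pos by (intro sum_mono mult_left_mono le) (auto simp: less_imp_le)
  moreover have "(\<Sum>q\<in>Q. v q * (u \<bullet> hx p q u - L * norm u * (norm u)\<^sup>2))
      = (\<Sum>q\<in>Q. v q * (u \<bullet> hx p q u)) - L * norm u * (norm u)\<^sup>2"
    using v_sum by (simp add: right_diff_distrib sum_subtractf flip: sum_distrib_right)
  ultimately show ?thesis using lam[OF p, of u] by (simp add: inner_sum_right algebra_simps)
qed

text \<open>Half of the Hessian bound survives within this radius and Taylor's formula halves it
  again; the first-order term vanishes by \<open>critical\<close>.\<close>

lemma gap_near:
  assumes lam: "\<And>p u. p \<in> P \<Longrightarrow> lam * (norm u)\<^sup>2 \<le> u \<bullet> (\<Sum>q\<in>Q. v q *\<^sub>R hx p q u)"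
    and p: "p \<in> P" and x: "2 * L * dist p x \<le> lam"
  shows "\<rho> + lam / 4 * (dist p x)\<^sup>2 \<le> (\<Sum>q\<in>Q. v q * f x q)"
proof -
  let ?u = "disp p x"
  have "lam / 2 * (norm ?u)\<^sup>2 \<le> (lam - L * norm ?u) * (norm ?u)\<^sup>2" using x by (intro mult_right_mono) auto
  then have "lam / 2 * (norm ?u)\<^sup>2 \<le> ?u \<bullet> (\<Sum>q\<in>Q. v q *\<^sub>R hx (shift p (s *\<^sub>R ?u)) q ?u)" if "0 \<le> s" "s \<le> 1" for s
    using hess_near[OF lam p that, of ?u] by linarith
  from second_order(1)[OF td_Q[of v], where u = ?u and x = p, OF this] show ?thesis
    using critical[OF p] value_eq[of p] p by simp
qed

lemma continuous_value: "continuous_on UNIV (\<lambda>x. \<Sum>q\<in>Q. c q * f x q)"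
  by (intro continuous_intros continuous_payoff.continuous_fst[OF continuous_payoff])

text \<open>Outside the balls the payoff is continuous on a compact set and stays above
  \<open>\<rho>\<close>, so its minimum there leaves a positive gap.\<close>

lemma gap_far:
  assumes "0 < R" obtains c where "0 < c" "\<And>x. (\<And>p. p \<in> P \<Longrightarrow> R < dist p x) \<Longrightarrow> \<rho> + c \<le> (\<Sum>q\<in>Q. v q * f x q)"
proof -
  let ?K = "\<Inter>p\<in>P. {x. R \<le> dist p x}"
  have cl: "closed ?K" by (intro closed_INT ballI closed_Collect_le continuous_intros)
  have cK: "compact ?K" using compact_Int_closed[OF compact_torus cl] by simp
  show thesis
  proof (cases "?K = {}")
    case True
    show thesis
    proof (rule that[of 1])
      fix x assume "\<And>p. p \<in> P \<Longrightarrow> R < dist p x"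
      then have "x \<in> ?K" by (auto simp: less_imp_le)
      then show "\<rho> + 1 \<le> (\<Sum>q\<in>Q. v q * f x q)" using True by blast
    qed simp
  next
    case False
    obtain x0 where x0: "x0 \<in> ?K" "\<And>x. x \<in> ?K \<Longrightarrow> (\<Sum>q\<in>Q. v q * f x0 q) \<le> (\<Sum>q\<in>Q. v q * f x q)"
      using continuous_attains_inf[OF cK False continuous_on_subset[OF continuous_value[of v]]] by blast
    show thesis
    proof (rule that[of "(\<Sum>q\<in>Q. v q * f x0 q) - \<rho>"])
      have "x0 \<notin> P" using x0(1) assms by force
      then show "0 < (\<Sum>q\<in>Q. v q * f x0 q) - \<rho>" using value_eq[of x0] value_ge[of x0] by simp
      show "\<rho> + ((\<Sum>q\<in>Q. v q * f x0 q) - \<rho>) \<le> (\<Sum>q\<in>Q. v q * f x q)" if "\<And>p. p \<in> P \<Longrightarrow> R < dist p x" for x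
        using x0(2)[of x] that by (auto simp: less_imp_le)
    qed
  qed
qed

text \<open>A perturbation of the opponent's weights that changes neither the value nor the gradient at the
  points of \<open>P\<close> would give a second equilibrium: the points of \<open>P\<close> stay global minimizers by the
  second-order condition nearby and by the gap far away.\<close>

lemma kernel_trivial:
  assumes d0: "(\<Sum>q\<in>Q. \<delta> q) = 0" and df: "\<And>p. p \<in> P \<Longrightarrow> (\<Sum>q\<in>Q. \<delta> q * f p q) = 0"
    and dg: "\<And>p. p \<in> P \<Longrightarrow> (\<Sum>q\<in>Q. \<delta> q *\<^sub>R gx p q) = 0" and q: "q \<in> Q"
  shows "\<delta> q = 0"
proof -
  obtain lam where lam: "0 < lam" "lam \<le> L"
    "\<And>p u. p \<in> P \<Longrightarrow> lam * (norm u)\<^sup>2 \<le> u \<bullet> (\<Sum>q\<in>Q. v q *\<^sub>R hx p q u)" using hess_coercive by metis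
  define R where "R = lam / (2 * L)"
  have R: "0 < R" "2 * L * R = lam" using lam(1) L_pos by (auto simp: R_def)
  obtain c where c: "0 < c" "\<And>x. (\<And>p. p \<in> P \<Longrightarrow> R < dist p x) \<Longrightarrow> \<rho> + c \<le> (\<Sum>q\<in>Q. v q * f x q)"
    using gap_far[OF R(1)] by metis
  define D where "D = (\<Sum>q\<in>Q. \<bar>\<delta> q\<bar>)"
  define m where "m = Min (v ` Q)"
  have D: "0 \<le> D" "\<And>q. q \<in> Q \<Longrightarrow> \<bar>\<delta> q\<bar> \<le> D"
    using finQ by (auto simp: D_def intro: sum_nonneg member_le_sum[where f = "\<lambda>q. \<bar>\<delta> q\<bar>"])
  have m: "0 < m" "\<And>q. q \<in> Q \<Longrightarrow> m \<le> v q" 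
  proof -
    show "0 < m" unfolding m_def using finQ q v_pos by (subst Min_gr_iff) auto
  qed (use finQ in \<open>auto simp: m_def\<close>)
  \<comment> \<open>The three bounds keep, in this order, the perturbed weights nonnegative, the
    perturbed Hessian nonnegative within radius \<open>R\<close>, and the gap nonnegative outside.
    Adding 1 to \<open>D\<close> avoids a division by zero.\<close>
  define \<epsilon> where "\<epsilon> = min m (min (lam / (2 * L)) (c / L)) / (D + 1)"
  have e: "0 < \<epsilon>" "\<epsilon> * D \<le> m" "\<epsilon> * D \<le> lam / (2 * L)" "\<epsilon> * D \<le> c / L"
  proof -
    have mn: "0 < min m (min (lam / (2 * L)) (c / L))" using m lam c L_pos by simp
    then show "0 < \<epsilon>" using D by (simp add: \<epsilon>_def)
    have "\<epsilon> * D = min m (min (lam / (2 * L)) (c / L)) * (D / (D + 1))" by (simp add: \<epsilon>_def)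
    also have "\<dots> \<le> min m (min (lam / (2 * L)) (c / L)) * 1" using mn D by (intro mult_left_mono) auto
    finally show "\<epsilon> * D \<le> m" "\<epsilon> * D \<le> lam / (2 * L)" "\<epsilon> * D \<le> c / L" by auto
  qed
  have bd: "\<bar>\<epsilon> * (\<Sum>q\<in>Q. \<delta> q * h q)\<bar> \<le> \<epsilon> * D * M" if "\<And>q. \<bar>h q\<bar> \<le> M" for h :: "'m torus \<Rightarrow> real" and M
  proof -
    have "\<bar>\<Sum>q\<in>Q. \<delta> q * h q\<bar> \<le> (\<Sum>q\<in>Q. \<bar>\<delta> q\<bar> * M)"
      by (rule order_trans[OF sum_abs]) (use that in \<open>auto simp: abs_mult intro!: sum_mono mult_left_mono\<close>)
    also have "\<dots> = D * M" by (simp add: D_def sum_distrib_right)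
    finally have "\<epsilon> * \<bar>\<Sum>q\<in>Q. \<delta> q * h q\<bar> \<le> \<epsilon> * (D * M)" using e(1) by (intro mult_left_mono) auto
    then show ?thesis using e(1) by (simp add: abs_mult)
  qed
  define v' where "v' q = v q + \<epsilon> * \<delta> q" for q
  have "v' q = v q"
  proof (rule unique)
    show "0 \<le> v' q" if "q \<in> Q" for q
    proof -
      have "\<epsilon> * \<bar>\<delta> q\<bar> \<le> \<epsilon> * D" using D(2)[OF that] e(1) by (intro mult_left_mono) auto
      moreover have "- (\<epsilon> * \<bar>\<delta> q\<bar>) \<le> \<epsilon> * \<delta> q" using e(1) by (simp add: abs_if)
      ultimately show ?thesis using e(2) m(2)[OF that] unfolding v'_def by linarith
    qed
    show "(\<Sum>q\<in>Q. v' q) = 1" using v_sum d0 by (simp add: v'_def sum.distrib flip: sum_distrib_left)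
    have split: "(\<Sum>q\<in>Q. v' q * h q) = (\<Sum>q\<in>Q. v q * h q) + \<epsilon> * (\<Sum>q\<in>Q. \<delta> q * h q)" for h :: "'m torus \<Rightarrow> real"
      by (simp add: v'_def distrib_right sum.distrib sum_distrib_left mult.assoc)
    show "\<rho> \<le> (\<Sum>q\<in>Q. v' q * f x q)" for x
    proof (cases "\<exists>p\<in>P. dist p x \<le> R")
      case True
      then obtain p where p: "p \<in> P" "dist p x \<le> R" by blast
      let ?u = "disp p x"
      have "0 \<le> ?u \<bullet> (\<Sum>q\<in>Q. v' q *\<^sub>R hx (shift p (s *\<^sub>R ?u)) q ?u)" if s: "0 \<le> s" "s \<le> 1" for s
      proof -
        let ?h = "\<lambda>q. ?u \<bullet> hx (shift p (s *\<^sub>R ?u)) q ?u"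
        have "L * norm ?u \<le> L * R" using p L_pos by (intro mult_left_mono) auto
        then have "lam / 2 * (norm ?u)\<^sup>2 \<le> (lam - L * norm ?u) * (norm ?u)\<^sup>2" using R by (intro mult_right_mono) auto
        then have "lam / 2 * (norm ?u)\<^sup>2 \<le> (\<Sum>q\<in>Q. v q * ?h q)"
          using hess_near[OF lam(3) p(1) s, of ?u] by (simp add: inner_sum_right)
        moreover have "\<bar>\<epsilon> * (\<Sum>q\<in>Q. \<delta> q * ?h q)\<bar> \<le> \<epsilon> * D * (L * (norm ?u)\<^sup>2)"
          by (rule bd) (rule hx_bound)
        moreover have "\<epsilon> * D * (L * (norm ?u)\<^sup>2) \<le> lam / (2 * L) * (L * (norm ?u)\<^sup>2)"
          using e(3) L_pos by (intro mult_right_mono) auto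
        moreover have "lam / (2 * L) * (L * (norm ?u)\<^sup>2) = lam / 2 * (norm ?u)\<^sup>2" using L_pos by simp
        ultimately have "0 \<le> (\<Sum>q\<in>Q. v' q * ?h q)" unfolding split by linarith
        then show ?thesis by (simp add: inner_sum_right)
      qed
      from second_order(1)[OF td_Q[of v'], where u = ?u and x = p, OF this]
      have "(\<Sum>q\<in>Q. v' q * f p q) + (\<Sum>q\<in>Q. v' q *\<^sub>R gx p q) \<bullet> ?u \<le> (\<Sum>q\<in>Q. v' q * f x q)" by simp
      moreover have "(\<Sum>q\<in>Q. v' q * f p q) = \<rho>" unfolding split using df[OF p(1)] value_eq[of p] p(1) by simp
      moreover have "(\<Sum>q\<in>Q. v' q *\<^sub>R gx p q) = (\<Sum>q\<in>Q. v q *\<^sub>R gx p q) + \<epsilon> *\<^sub>R (\<Sum>q\<in>Q. \<delta> q *\<^sub>R gx p q)"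
        by (simp add: v'_def scaleR_add_left sum.distrib scaleR_sum_right)
      ultimately show ?thesis using critical[OF p(1)] dg[OF p(1)] by simp
    next
      case False
      then have "\<rho> + c \<le> (\<Sum>q\<in>Q. v q * f x q)" by (intro c(2)) auto
      moreover have "\<bar>\<epsilon> * (\<Sum>q\<in>Q. \<delta> q * f x q)\<bar> \<le> \<epsilon> * D * L" by (rule bd) (rule f_bound)
      moreover have "\<epsilon> * D * L \<le> c / L * L" using e(4) L_pos by (intro mult_right_mono) auto
      ultimately show ?thesis unfolding split using L_pos by simp
    qed
  qed (rule q)
  then show ?thesis using e(1) by (simp add: v'_def)
qed

text \<open>A step of the algorithm reveals payoffs only up to an unknown common level, hence the
  free \<open>t\<close>. Averaging over \<open>w\<close> determines \<open>t\<close>, since all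
  points of \<open>Q\<close> have the same value against \<open>w\<close>; the rest is
  \<open>kernel_trivial\<close> made quantitative by compactness.\<close>

lemma weights_coercive:
  "\<exists>C>0. \<forall>\<delta> t. (\<Sum>q\<in>Q. (\<delta> q)\<^sup>2)
    \<le> C * ((\<Sum>q\<in>Q. \<delta> q)\<^sup>2 + (\<Sum>p\<in>P. ((\<Sum>q\<in>Q. \<delta> q * f p q) - t)\<^sup>2 + (norm (\<Sum>q\<in>Q. \<delta> q *\<^sub>R gx p q))\<^sup>2))"
proof -
  define A where "A \<delta> p = (\<Sum>q\<in>Q. \<delta> q * f p q)" for \<delta> p
  define g where "g \<delta> p = (\<Sum>q\<in>Q. \<delta> q *\<^sub>R gx p q)" for \<delta> p
  define \<Phi> where "\<Phi> \<delta> = (\<Sum>q\<in>Q. \<delta> q)\<^sup>2 + (\<Sum>p\<in>P. (A \<delta> p)\<^sup>2 + (norm (g \<delta> p))\<^sup>2)" for \<delta>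
  obtain C where C: "0 < C" "\<And>\<delta>. (\<And>q. q \<notin> Q \<Longrightarrow> \<delta> q = 0) \<Longrightarrow> (\<Sum>q\<in>Q. (\<delta> q)\<^sup>2) \<le> C * \<Phi> \<delta>"
  proof (rule quadratic_coercive[OF finQ, of \<Phi>])
    show "continuous_on UNIV \<Phi>"
      unfolding \<Phi>_def A_def g_def by (intro continuous_intros continuous_on_product_coordinates)
    show "\<Phi> (\<lambda>q. c * \<delta> q) = c\<^sup>2 * \<Phi> \<delta>" for c \<delta>
    proof -
      have "A (\<lambda>q. c * \<delta> q) p = c * A \<delta> p" "g (\<lambda>q. c * \<delta> q) p = c *\<^sub>R g \<delta> p" for p
        by (simp_all add: A_def g_def sum_distrib_left scaleR_sum_right mult.assoc)
      moreover have "(\<Sum>q\<in>Q. c * \<delta> q) = c * (\<Sum>q\<in>Q. \<delta> q)" by (simp add: sum_distrib_left)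
      moreover have "(\<Sum>p\<in>P. (c * A \<delta> p)\<^sup>2 + (norm (c *\<^sub>R g \<delta> p))\<^sup>2) = c\<^sup>2 * (\<Sum>p\<in>P. (A \<delta> p)\<^sup>2 + (norm (g \<delta> p))\<^sup>2)"
        by (simp add: power_mult_distrib distrib_left sum_distrib_left)
      ultimately show ?thesis unfolding \<Phi>_def by (simp only: power_mult_distrib distrib_left)
    qed
    show "0 \<le> \<Phi> \<delta>" for \<delta> unfolding \<Phi>_def by (intro add_nonneg_nonneg sum_nonneg) auto
    fix \<delta> :: "'m torus \<Rightarrow> real" and q assume z: "\<Phi> \<delta> = 0" and q: "q \<in> Q"
    have nn: "0 \<le> (\<Sum>p\<in>P. (A \<delta> p)\<^sup>2 + (norm (g \<delta> p))\<^sup>2)" by (intro sum_nonneg) auto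
    then have 1: "(\<Sum>q\<in>Q. \<delta> q) = 0" and 2: "(\<Sum>p\<in>P. (A \<delta> p)\<^sup>2 + (norm (g \<delta> p))\<^sup>2) = 0"
      using z by (auto simp: \<Phi>_def add_nonneg_eq_0_iff)
    have "A \<delta> p = 0 \<and> g \<delta> p = 0" if "p \<in> P" for p
    proof -
      have "(A \<delta> p)\<^sup>2 + (norm (g \<delta> p))\<^sup>2 = 0" using 2 that finP by (subst (asm) sum_nonneg_eq_0_iff) auto
      then show ?thesis by (simp add: sum_power2_eq_zero_iff)
    qed
    then show "\<delta> q = 0" using kernel_trivial[OF 1 _ _ q] by (simp add: A_def g_def)
  qed auto
  define k where "k = 1 + 4 * card P * (1 + \<rho>\<^sup>2) + 2 + 4 * card P"
  have k: "0 < k" by (simp add: k_def add_pos_nonneg)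
  show ?thesis
  proof (intro exI[of _ "C * k"] conjI allI)
    fix \<delta> :: "'m torus \<Rightarrow> real" and t :: real
    let ?\<delta> = "\<lambda>q. if q \<in> Q then \<delta> q else 0"
    let ?D = "\<Sum>q\<in>Q. \<delta> q" and ?E = "\<Sum>p\<in>P. (A \<delta> p - t)\<^sup>2" and ?N = "\<Sum>p\<in>P. (norm (g \<delta> p))\<^sup>2"
    have E: "0 \<le> ?E" and N: "0 \<le> ?N" by (auto intro: sum_nonneg)
    have "(\<Sum>p\<in>P. w p * A \<delta> p) = (\<Sum>q\<in>Q. \<delta> q * (\<Sum>p\<in>P. w p * f p q))"
      unfolding A_def sum_distrib_left by (subst sum.swap) (simp add: mult_ac)
    also have "\<dots> = \<rho> * ?D" using value_P by (simp add: sum_distrib_left mult.commute)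
    finally have t: "t = \<rho> * ?D - (\<Sum>p\<in>P. w p * (A \<delta> p - t))"
      using w_sum by (simp add: right_diff_distrib sum_subtractf flip: sum_distrib_right)
    have sq: "(a + b)\<^sup>2 \<le> 2 * a\<^sup>2 + 2 * b\<^sup>2" for a b :: real
      using zero_le_power2[of "a - b"] by (simp add: power2_sum power2_diff)
    have "(\<Sum>p\<in>P. w p * (A \<delta> p - t))\<^sup>2 \<le> (\<Sum>p\<in>P. (w p)\<^sup>2) * ?E" by (rule Cauchy_Schwarz_ineq_sum)
    also have "(\<Sum>p\<in>P. (w p)\<^sup>2) * ?E \<le> 1 * ?E"
    proof (rule mult_right_mono[OF _ E])
      have "(w p)\<^sup>2 \<le> w p" if "p \<in> P" for p
      proof -
        have "w p \<le> 1" using member_le_sum[of p P w] finP w_pos w_sum that by (simp add: less_imp_le)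
        then show ?thesis using w_pos[OF that] by (simp add: power2_eq_square mult_le_cancel_left1)
      qed
      then have "(\<Sum>p\<in>P. (w p)\<^sup>2) \<le> (\<Sum>p\<in>P. w p)" by (rule sum_mono)
      then show "(\<Sum>p\<in>P. (w p)\<^sup>2) \<le> 1" using w_sum by simp
    qed
    finally have "(\<Sum>p\<in>P. w p * (A \<delta> p - t))\<^sup>2 \<le> ?E" by simp
    then have t2: "t\<^sup>2 \<le> 2 * \<rho>\<^sup>2 * ?D\<^sup>2 + 2 * ?E"
      using sq[of "\<rho> * ?D" "- (\<Sum>p\<in>P. w p * (A \<delta> p - t))"] t by (simp add: power_mult_distrib)
    have "(A \<delta> p)\<^sup>2 \<le> 2 * (A \<delta> p - t)\<^sup>2 + 2 * t\<^sup>2" for p using sq[of "A \<delta> p - t" t] by simp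
    then have "(\<Sum>p\<in>P. (A \<delta> p)\<^sup>2) \<le> (\<Sum>p\<in>P. 2 * (A \<delta> p - t)\<^sup>2 + 2 * t\<^sup>2)" by (rule sum_mono)
    also have "\<dots> = 2 * ?E + card P * (2 * t\<^sup>2)" by (simp add: sum.distrib sum_distrib_left)
    also have "card P * (2 * t\<^sup>2) \<le> card P * (2 * (2 * \<rho>\<^sup>2 * ?D\<^sup>2 + 2 * ?E))" using t2 by (intro mult_left_mono) auto
    finally have "\<Phi> \<delta> \<le> ?D\<^sup>2 + (2 * ?E + card P * (2 * (2 * \<rho>\<^sup>2 * ?D\<^sup>2 + 2 * ?E))) + ?N"
      unfolding \<Phi>_def by (simp add: sum.distrib)
    also have "\<dots> = (1 + 4 * card P * \<rho>\<^sup>2) * ?D\<^sup>2 + (2 + 4 * card P) * ?E + 1 * ?N" by (simp add: algebra_simps)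
    also have "\<dots> \<le> k * ?D\<^sup>2 + k * ?E + k * ?N"
      by (intro add_mono mult_right_mono E N) (auto simp: k_def algebra_simps)
    finally have \<Phi>: "\<Phi> \<delta> \<le> k * (?D\<^sup>2 + (?E + ?N))" by (simp add: distrib_left)
    have "\<Phi> ?\<delta> = \<Phi> \<delta>" by (simp add: \<Phi>_def A_def g_def)
    then have "(\<Sum>q\<in>Q. (\<delta> q)\<^sup>2) \<le> C * \<Phi> \<delta>" using C(2)[of ?\<delta>] by simp
    also have "\<dots> \<le> C * (k * (?D\<^sup>2 + (?E + ?N)))" using \<Phi> C(1) by (intro mult_left_mono) auto
    finally show "(\<Sum>q\<in>Q. (\<delta> q)\<^sup>2) \<le> C * k * ((\<Sum>q\<in>Q. \<delta> q)\<^sup>2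
        + (\<Sum>p\<in>P. ((\<Sum>q\<in>Q. \<delta> q * f p q) - t)\<^sup>2 + (norm (\<Sum>q\<in>Q. \<delta> q *\<^sub>R gx p q))\<^sup>2))"
      by (simp add: A_def g_def sum.distrib mult.assoc)
  qed (use C k in simp)
qed

end

section \<open>Upper bound for the Lyapunov function and crude displacement in one step\<close>

context clusters begin

lemma w_min: obtains W where "0 < W" "\<And>q. q \<in> P \<Longrightarrow> W \<le> w q"
proof (rule that[of "Min (insert 1 (w ` P))"])
  show "0 < Min (insert 1 (w ` P))" using fin w_pos by (subst Min_gr_iff) auto
qed (use fin in auto)

lemma spread_le_1:
  assumes "fst z \<in> prob_simplex n" shows "spread n z \<le> 1"
proof -
  have "spread n z \<le> (\<Sum>q\<in>P. \<Sum>i\<in>grp n z q. fst z i * 1)"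
    unfolding spread_def
  proof (intro sum_mono mult_left_mono)
    fix q i assume "q \<in> P" "i \<in> grp n z q"
    then show "0 \<le> fst z i" "(dist q (snd z i))\<^sup>2 \<le> 1"
      using fst_nonneg[OF assms] R_le by (auto simp: grp_def intro!: power_le_one)
  qed
  also have "\<dots> \<le> 1" using total_mass[OF assms] omass_nonneg[OF assms] by (simp add: gmass_def)
  finally show ?thesis .
qed

lemma omass_le_1:
  assumes "fst z \<in> prob_simplex n" shows "omass n z \<le> 1"
  using total_mass[OF assms] sum_nonneg[of P "gmass n z"] gmass_nonneg[OF assms] by simp

text \<open>Replacing \<open>kmass\<close> by \<open>gmass\<close> in \<open>lyap_le\<close> costs a
  squared spread, which is at most the spread itself as that never exceeds 1. The constant is
  uniform over \<open>\<alpha> \<le> \<Gamma>\<close>.\<close>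

lemma lyap_upper:
  assumes "0 < \<Gamma>"
  obtains K where "0 < K" "\<And>\<alpha> n z. fst z \<in> prob_simplex n \<Longrightarrow> 0 \<le> \<alpha> \<Longrightarrow> \<alpha> \<le> \<Gamma> \<Longrightarrow>
    (\<And>q. q \<in> P \<Longrightarrow> w q / 2 \<le> kmass \<alpha> n z q) \<Longrightarrow>
    lyap \<alpha> n z \<le> K * (omass n z + spread n z + (\<Sum>q\<in>P. (gmass n z q - w q)\<^sup>2))"
proof -
  obtain W where W: "0 < W" "\<And>q. q \<in> P \<Longrightarrow> W \<le> w q" using w_min by metis
  define K where "K = 1 + \<Gamma> + card P * (\<Gamma>\<^sup>2 / W) + 4 / W"
  show thesis
  proof (rule that[of K])
    show "0 < K" using assms W by (simp add: K_def add_pos_nonneg)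
    fix \<alpha> n and z :: "'d particles"
    assume z: "fst z \<in> prob_simplex n" and \<alpha>: "0 \<le> \<alpha>" "\<alpha> \<le> \<Gamma>" and h: "\<And>q. q \<in> P \<Longrightarrow> w q / 2 \<le> kmass \<alpha> n z q"
    let ?s = "spread n z" and ?\<delta> = "\<lambda>q. gmass n z q - w q"
    note nn = spread_nonneg[OF z] omass_nonneg[OF z] gspread_nonneg[OF z]
    have t: "2 * (kmass \<alpha> n z q - w q)\<^sup>2 / w q \<le> 4 / W * (?\<delta> q)\<^sup>2 + \<Gamma>\<^sup>2 / W * ?s" if q: "q \<in> P" for q
    proof -
      have "gspread n z q \<le> 1" using gspread_le[OF z q] spread_le_1[OF z] by linarith
      then have "(gspread n z q)\<^sup>2 \<le> gspread n z q" using nn(3) by (simp add: power2_eq_square mult_left_le)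
      then have gs: "(gspread n z q)\<^sup>2 \<le> ?s" using gspread_le[OF z q] by linarith
      have sq: "(a - b)\<^sup>2 \<le> 2 * a\<^sup>2 + 2 * b\<^sup>2" for a b :: real
        using zero_le_power2[of "a + b"] by (simp add: power2_sum power2_diff)
      have "(kmass \<alpha> n z q - w q)\<^sup>2 \<le> 2 * (?\<delta> q)\<^sup>2 + 2 * (\<alpha> / 2 * gspread n z q)\<^sup>2"
        using sq[of "?\<delta> q" "\<alpha> / 2 * gspread n z q"] by (simp add: kmass_eq algebra_simps)
      also have "(\<alpha> / 2 * gspread n z q)\<^sup>2 = \<alpha>\<^sup>2 / 4 * (gspread n z q)\<^sup>2" by (simp add: power_mult_distrib power_divide)
      also have "\<alpha>\<^sup>2 / 4 * (gspread n z q)\<^sup>2 \<le> \<Gamma>\<^sup>2 / 4 * ?s"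
        using \<alpha> gs by (intro mult_mono) (auto intro: power_mono)
      finally have "2 * (kmass \<alpha> n z q - w q)\<^sup>2 \<le> 4 * (?\<delta> q)\<^sup>2 + \<Gamma>\<^sup>2 * ?s" by simp
      then have "2 * (kmass \<alpha> n z q - w q)\<^sup>2 / w q \<le> (4 * (?\<delta> q)\<^sup>2 + \<Gamma>\<^sup>2 * ?s) / W"
        using W q nn by (intro frac_le) auto
      then show ?thesis by (simp add: add_divide_distrib)
    qed
    have "lyap \<alpha> n z \<le> omass n z + \<alpha> / 2 * ?s + (\<Sum>q\<in>P. 2 * (kmass \<alpha> n z q - w q)\<^sup>2 / w q)"
      by (rule lyap_le[OF z h])
    also have "\<dots> \<le> omass n z + \<Gamma> * ?s + (\<Sum>q\<in>P. 4 / W * (?\<delta> q)\<^sup>2 + \<Gamma>\<^sup>2 / W * ?s)"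
      using \<alpha> nn t by (intro add_mono mult_right_mono sum_mono) auto
    also have "\<dots> = 1 * omass n z + (\<Gamma> + card P * (\<Gamma>\<^sup>2 / W)) * ?s + 4 / W * (\<Sum>q\<in>P. (?\<delta> q)\<^sup>2)"
      by (simp only: sum.distrib sum_distrib_left[symmetric] sum_constant) (simp add: algebra_simps)
    also have "\<dots> \<le> K * omass n z + K * ?s + K * (\<Sum>q\<in>P. (?\<delta> q)\<^sup>2)"
      using assms W nn by (intro add_mono mult_right_mono) (auto simp: K_def intro!: sum_nonneg add_nonneg_nonneg)
    finally show "lyap \<alpha> n z \<le> K * (omass n z + ?s + (\<Sum>q\<in>P. (?\<delta> q)\<^sup>2))" by (simp add: distrib_left)
  qed
qed

end

text \<open>A crude bound that presupposes nothing about where the particles are: weights change by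
  a factor within \<open>4 * \<eta> * L\<close> of 1, positions by at most
  \<open>2 * \<sigma> * L\<close>. It carries nearness to the equilibrium from the old iterate to
  the new one.\<close>

lemma prox_step_displacement:
  fixes \<psi> :: "'d::finite torus \<Rightarrow> 'b::real_normed_vector"
  assumes step: "prox_step G Gg \<eta> \<sigma> n z z'" and pos: "0 < \<eta>" "0 < \<sigma>" "0 < L"
    and G: "\<And>x. \<bar>G x\<bar> \<le> L" and Gg: "\<And>x. norm (Gg x) \<le> L" and small: "2 * (\<eta> * L) \<le> 1 / 2"
    and \<psi>: "\<And>x. norm (\<psi> x) \<le> L" "\<And>x y. norm (\<psi> x - \<psi> y) \<le> L * dist x y"
  shows "norm ((\<Sum>i<n. fst z' i *\<^sub>R \<psi> (snd z' i)) - (\<Sum>i<n. fst z i *\<^sub>R \<psi> (snd z i))) \<le> (4 * \<eta> + 2 * \<sigma>) * L\<^sup>2"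
proof -
  define Z where "Z = (\<Sum>i<n. fst z i * exp (- \<eta> * G (snd z' i)))"
  have a: "(\<Sum>i<n. fst z i) = 1" "\<And>i. i < n \<Longrightarrow> 0 \<le> fst z i" using step by (auto simp: prox_step_def prob_simplex_def)
  have a': "fst z' i = fst z i * (exp (- \<eta> * G (snd z' i)) / Z)" if "i < n" for i
    using step that unfolding prox_step_def Z_def by simp
  have eb: "exp (- (\<eta> * L)) \<le> exp (- \<eta> * G x)" "exp (- \<eta> * G x) \<le> exp (\<eta> * L)" for x
    using mult_left_mono[of "G x" L \<eta>] mult_left_mono[of "- L" "G x" \<eta>] G[of x] pos by (auto simp: abs_le_iff)
  have Z: "exp (- (\<eta> * L)) \<le> Z" "Z \<le> exp (\<eta> * L)"
  proof -
    have "(\<Sum>i<n. fst z i * exp (- (\<eta> * L))) \<le> Z" "Z \<le> (\<Sum>i<n. fst z i * exp (\<eta> * L))"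
      unfolding Z_def using a(2) eb by (intro sum_mono mult_left_mono; auto)+
    then show "exp (- (\<eta> * L)) \<le> Z" "Z \<le> exp (\<eta> * L)" using a(1) by (simp_all flip: sum_distrib_right)
  qed
  have Zp: "0 < Z" using Z(1) exp_gt_zero less_le_trans by blast
  define \<tau> where "\<tau> i = exp (- \<eta> * G (snd z' i)) / Z" for i
  have \<tau>: "\<bar>\<tau> i - 1\<bar> \<le> 4 * (\<eta> * L)" "\<tau> i \<le> 2" "0 < \<tau> i" for i
  proof -
    define x where "x = 2 * (\<eta> * L)"
    have x: "0 \<le> x" "x \<le> 1 / 2" using pos small by (auto simp: x_def)
    have "\<tau> i \<le> exp (\<eta> * L) / exp (- (\<eta> * L))" unfolding \<tau>_def using eb Z Zp by (intro frac_le) auto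
    also have "\<dots> = exp x" by (simp add: x_def flip: exp_diff)
    finally have u: "\<tau> i \<le> exp x" .
    have "exp (- x) = exp (- (\<eta> * L)) / exp (\<eta> * L)" by (simp add: x_def flip: exp_diff)
    also have "\<dots> \<le> \<tau> i" unfolding \<tau>_def using eb Z Zp by (intro frac_le) auto
    finally have l: "1 - x \<le> \<tau> i" using exp_ge_add_one_self[of "- x"] by linarith
    have "x * x \<le> x * (1 / 2)" using x by (intro mult_left_mono) auto
    then have "exp x \<le> 1 + 3 / 2 * x" using exp_bound[of x] x by (simp add: power2_eq_square)
    then show "\<bar>\<tau> i - 1\<bar> \<le> 4 * (\<eta> * L)" "\<tau> i \<le> 2" using u l x unfolding x_def by linarith+
    show "0 < \<tau> i" using Zp by (simp add: \<tau>_def)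
  qed
  have summand: "norm (fst z' i *\<^sub>R \<psi> (snd z' i) - fst z i *\<^sub>R \<psi> (snd z i)) \<le> fst z i * ((4 * \<eta> + 2 * \<sigma>) * L\<^sup>2)" if i: "i < n" for i
  proof (cases "0 < fst z i")
    case True
    have "snd z i = shift (snd z' i) ((\<sigma> * fst z' i / fst z i) *\<^sub>R Gg (snd z' i))"
      using step True i unfolding prox_step_def by blast
    also have "\<sigma> * fst z' i / fst z i = \<sigma> * \<tau> i" using a'[OF i] True by (simp add: \<tau>_def)
    finally have "dist (snd z' i) (snd z i) \<le> norm ((\<sigma> * \<tau> i) *\<^sub>R Gg (snd z' i))" using dist_shift_le' by metis
    also have "\<dots> = \<sigma> * \<tau> i * norm (Gg (snd z' i))" using pos \<tau>(3)[of i] by simp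
    also have "\<dots> \<le> \<sigma> * 2 * L" using pos \<tau>(2,3)[of i] Gg by (intro mult_mono) (auto simp: less_imp_le)
    finally have "L * dist (snd z' i) (snd z i) \<le> L * (\<sigma> * 2 * L)" using pos by (intro mult_left_mono) auto
    then have 1: "norm (\<psi> (snd z' i) - \<psi> (snd z i)) \<le> 2 * \<sigma> * L\<^sup>2"
      using \<psi>(2)[of "snd z' i" "snd z i"] by (simp add: power2_eq_square mult_ac)
    have "\<bar>\<tau> i - 1\<bar> * norm (\<psi> (snd z' i)) \<le> 4 * (\<eta> * L) * L" using \<tau>(1)[of i] \<psi>(1) pos by (intro mult_mono) auto
    then have 2: "norm ((\<tau> i - 1) *\<^sub>R \<psi> (snd z' i)) \<le> 4 * \<eta> * L\<^sup>2" by (simp add: power2_eq_square mult_ac)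
    have "fst z' i *\<^sub>R \<psi> (snd z' i) - fst z i *\<^sub>R \<psi> (snd z i)
        = fst z i *\<^sub>R ((\<tau> i - 1) *\<^sub>R \<psi> (snd z' i) + (\<psi> (snd z' i) - \<psi> (snd z i)))"
      using a'[OF i] by (simp add: \<tau>_def algebra_simps)
    then show ?thesis using 1 2 True norm_triangle_ineq[of "(\<tau> i - 1) *\<^sub>R \<psi> (snd z' i)" "\<psi> (snd z' i) - \<psi> (snd z i)"]
      by (simp add: distrib_right)
  next
    case False
    then have "fst z i = 0" using a(2)[OF i] by simp
    then show ?thesis using a'[OF i] by simp
  qed
  have "norm (\<Sum>i<n. fst z' i *\<^sub>R \<psi> (snd z' i) - fst z i *\<^sub>R \<psi> (snd z i)) \<le> (\<Sum>i<n. fst z i * ((4 * \<eta> + 2 * \<sigma>) * L\<^sup>2))"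
    by (intro sum_norm_le summand) auto
  then show ?thesis using a(1) by (simp add: sum_subtractf flip: sum_distrib_right)
qed

section \<open>Contraction of the Lyapunov function\<close>

text \<open>The radius is tied to the Hessian bound. Up to distance \<open>2 * R\<close>, the outer
  edge of the shell in \<open>trapped\<close>, the Hessian loses at most \<open>lam / 4\<close>; a
  perturbed opponent may take another quarter, and \<open>lam / 2\<close> is left. \<open>c1\<close>
  is the gap outside radius \<open>R\<close>.\<close>

locale game_clusters = game_side f gx hx L P w Q v \<rho> + CP: clusters P w R + CQ: clusters Q v R
  for f :: "'n::finite torus \<Rightarrow> 'm::finite torus \<Rightarrow> real" and gx hx L P w Q v \<rho> R +
  fixes lam c1 :: real
  assumes lam_pos: "0 < lam" and c1_pos: "0 < c1"
    and lam: "\<And>p u. p \<in> P \<Longrightarrow> lam * (norm u)\<^sup>2 \<le> u \<bullet> (\<Sum>q\<in>Q. v q *\<^sub>R hx p q u)"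
    and R_small: "8 * L * R \<le> lam"
    and far: "\<And>x. (\<And>p. p \<in> P \<Longrightarrow> R < dist p x) \<Longrightarrow> \<rho> + c1 \<le> (\<Sum>q\<in>Q. v q * f x q)"
begin

lemma gap_ge:
  assumes z: "fst z \<in> prob_simplex n"
  shows "lam / 4 * CP.spread n z + c1 * CP.omass n z \<le> (\<Sum>i<n. fst z i * (\<Sum>q\<in>Q. v q * f (snd z i) q)) - \<rho>"
proof -
  let ?F = "\<lambda>i. (\<Sum>q\<in>Q. v q * f (snd z i) q) - \<rho>"
  have "(\<Sum>i<n. fst z i * (\<Sum>q\<in>Q. v q * f (snd z i) q)) - \<rho> = (\<Sum>i<n. fst z i * ?F i)"
    using z by (simp add: right_diff_distrib sum_subtractf prob_simplex_def flip: sum_distrib_right)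
  also have "\<dots> = (\<Sum>q\<in>P. \<Sum>i\<in>CP.grp n z q. fst z i * ?F i) + (\<Sum>i\<in>CP.outer n z. fst z i * ?F i)"
    by (rule CP.sum_split_groups)
  also have "\<dots> \<ge> (\<Sum>q\<in>P. \<Sum>i\<in>CP.grp n z q. fst z i * (lam / 4 * (dist q (snd z i))\<^sup>2)) + (\<Sum>i\<in>CP.outer n z. fst z i * c1)"
  proof (intro add_mono sum_mono mult_left_mono)
    fix q i assume q: "q \<in> P" and i: "i \<in> CP.grp n z q"
    have "2 * L * dist q (snd z i) \<le> 2 * L * R" using i L_pos by (intro mult_left_mono) (auto simp: CP.grp_def)
    then have "2 * L * dist q (snd z i) \<le> lam" using R_small lam_pos by simp
    from gap_near[OF lam q this] show "lam / 4 * (dist q (snd z i))\<^sup>2 \<le> ?F i" by simp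
    show "0 \<le> fst z i" using i CP.fst_nonneg[OF z] by (simp add: CP.grp_def)
  next
    fix i assume i: "i \<in> CP.outer n z"
    then show "c1 \<le> ?F i" using far[of "snd z i"] by (simp add: CP.outer_def)
    show "0 \<le> fst z i" using i CP.fst_nonneg[OF z] by (simp add: CP.outer_def)
  qed
  also have "(\<Sum>q\<in>P. \<Sum>i\<in>CP.grp n z q. fst z i * (lam / 4 * (dist q (snd z i))\<^sup>2)) + (\<Sum>i\<in>CP.outer n z. fst z i * c1)
      = lam / 4 * CP.spread n z + c1 * CP.omass n z"
    by (simp add: CP.spread_def CP.omass_def sum_distrib_left mult_ac)
  finally show ?thesis .
qed

definition opp :: "nat \<Rightarrow> 'm particles \<Rightarrow> 'n torus \<Rightarrow> real" where
  "opp m y x = (\<Sum>j<m. fst y j * f x (snd y j))"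

definition opp_grad :: "nat \<Rightarrow> 'm particles \<Rightarrow> 'n torus \<Rightarrow> real ^ 'n" where
  "opp_grad m y x = (\<Sum>j<m. fst y j *\<^sub>R gx x (snd y j))"

lemma convex_combination_norm:
  fixes \<psi> :: "nat \<Rightarrow> 'b::real_normed_vector"
  assumes "fst y \<in> prob_simplex m" "\<And>j. norm (\<psi> j) \<le> K"
  shows "norm (\<Sum>j<m. fst y j *\<^sub>R \<psi> j) \<le> K"
proof -
  have "norm (\<Sum>j<m. fst y j *\<^sub>R \<psi> j) \<le> (\<Sum>j<m. fst y j * K)"
    using assms by (intro sum_norm_le) (auto simp: prob_simplex_def intro!: mult_left_mono)
  also have "\<dots> = K" using assms(1) by (simp add: prob_simplex_def flip: sum_distrib_right)
  finally show ?thesis .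
qed

context
  fixes m :: nat and y :: "'m particles"
  assumes y: "fst y \<in> prob_simplex m"
begin

lemma opp_bound: "\<bar>opp m y x\<bar> \<le> L"
  using convex_combination_norm[OF y, of "\<lambda>j. f x (snd y j)" L] f_bound by (simp add: opp_def)

lemma opp_grad_bound: "norm (opp_grad m y x) \<le> L"
  unfolding opp_grad_def by (rule convex_combination_norm[OF y]) (rule gx_bound)

lemma opp_lip: "\<bar>opp m y x - opp m y x'\<bar> \<le> L * dist x x'"
proof -
  have "norm (f x (snd y j) - f x' (snd y j)) \<le> L * dist x x'" for j
    using f_lip[of x "snd y j" x' "snd y j"] by simp
  from convex_combination_norm[OF y this] show ?thesis
    by (simp add: opp_def right_diff_distrib sum_subtractf)
qed

lemma opp_grad_lip: "norm (opp_grad m y x - opp_grad m y x') \<le> L * dist x x'"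
proof -
  have "norm (gx x (snd y j) - gx x' (snd y j)) \<le> L * dist x x'" for j
    using gx_lip[of x "snd y j" x' "snd y j"] by simp
  from convex_combination_norm[OF y this] show ?thesis
    by (simp add: opp_grad_def scaleR_diff_right sum_subtractf)
qed

lemma td_opp: "twice_diff (opp m y) (opp_grad m y) (\<lambda>x u. \<Sum>j<m. fst y j *\<^sub>R hx x (snd y j) u)"
  unfolding opp_def[abs_def] opp_grad_def[abs_def] by (rule td_sum)

text \<open>A hypothesis cannot be polymorphic, so nearness is required separately for real test
  functions, which yield the Hessian bound, and for vector-valued ones, which yield the gradient
  bound.\<close>

context
  fixes \<epsilon> :: real
  assumes \<epsilon>: "\<epsilon> \<le> lam / 4" "\<epsilon> \<le> lam * R / 2"
    and near: "\<And>\<psi> :: 'm torus \<Rightarrow> real. (\<And>x. norm (\<psi> x) \<le> L) \<Longrightarrow> (\<And>x x'. norm (\<psi> x - \<psi> x') \<le> L * dist x x') \<Longrightarrow>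
       norm ((\<Sum>j<m. fst y j *\<^sub>R \<psi> (snd y j)) - (\<Sum>q\<in>Q. v q *\<^sub>R \<psi> q)) \<le> \<epsilon>"
    and near': "\<And>\<psi> :: 'm torus \<Rightarrow> real ^ 'n. (\<And>x. norm (\<psi> x) \<le> L) \<Longrightarrow> (\<And>x x'. norm (\<psi> x - \<psi> x') \<le> L * dist x x') \<Longrightarrow>
       norm ((\<Sum>j<m. fst y j *\<^sub>R \<psi> (snd y j)) - (\<Sum>q\<in>Q. v q *\<^sub>R \<psi> q)) \<le> \<epsilon>"
begin

text \<open>For fixed \<open>u\<close>, the quadratic form divided by
  \<open>(norm u)\<^sup>2\<close> is a bounded Lipschitz function of the opponent's position. So
  \<open>near\<close> applies to it and passes coercivity from the equilibrium weights to the
  particles.\<close>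

lemma opp_hess:
  assumes p: "p \<in> P" and u: "norm u \<le> 2 * R" and s: "0 \<le> s" "s \<le> 1"
  shows "lam / 2 * (norm u)\<^sup>2 \<le> u \<bullet> (\<Sum>j<m. fst y j *\<^sub>R hx (shift p (s *\<^sub>R u)) (snd y j) u)"
proof (cases "u = 0")
  case False
  let ?x = "shift p (s *\<^sub>R u)"
  define \<psi> where "\<psi> q = (u \<bullet> hx ?x q u) / (norm u)\<^sup>2" for q
  have n: "0 < (norm u)\<^sup>2" using False by simp
  have frac: "\<bar>c / d\<bar> \<le> K" if "\<bar>c\<bar> \<le> K * d" "0 < d" for c d K :: real
    using that by (simp add: pos_divide_le_eq)
  have "norm ((\<Sum>j<m. fst y j *\<^sub>R \<psi> (snd y j)) - (\<Sum>q\<in>Q. v q *\<^sub>R \<psi> q)) \<le> \<epsilon>"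
  proof (rule near)
    show "norm (\<psi> q) \<le> L" for q unfolding \<psi>_def real_norm_def by (rule frac[OF hx_bound n])
    show "norm (\<psi> q - \<psi> q') \<le> L * dist q q'" for q q'
      unfolding \<psi>_def real_norm_def diff_divide_distrib[symmetric]
      by (rule frac[OF _ n]) (use hx_lip[of u ?x q ?x q'] in simp)
  qed
  then have "(\<Sum>q\<in>Q. v q * \<psi> q) - \<epsilon> \<le> (\<Sum>j<m. fst y j * \<psi> (snd y j))" by (simp add: abs_le_iff)
  then have "((\<Sum>q\<in>Q. v q * \<psi> q) - \<epsilon>) * (norm u)\<^sup>2 \<le> (\<Sum>j<m. fst y j * \<psi> (snd y j)) * (norm u)\<^sup>2"
    using n by (intro mult_right_mono) auto
  moreover have "(\<Sum>q\<in>Q. v q * \<psi> q) * (norm u)\<^sup>2 = u \<bullet> (\<Sum>q\<in>Q. v q *\<^sub>R hx ?x q u)"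
    "(\<Sum>j<m. fst y j * \<psi> (snd y j)) * (norm u)\<^sup>2 = u \<bullet> (\<Sum>j<m. fst y j *\<^sub>R hx ?x (snd y j) u)"
    using n by (simp_all add: sum_distrib_right \<psi>_def inner_sum_right)
  ultimately have 1: "u \<bullet> (\<Sum>q\<in>Q. v q *\<^sub>R hx ?x q u) - \<epsilon> * (norm u)\<^sup>2 \<le> u \<bullet> (\<Sum>j<m. fst y j *\<^sub>R hx ?x (snd y j) u)"
    by (simp add: left_diff_distrib)
  have "L * norm u \<le> L * (2 * R)" using u L_pos by (intro mult_left_mono) auto
  then have "lam / 2 + \<epsilon> \<le> lam - L * norm u" using R_small \<epsilon>(1) by linarith
  then have "(lam / 2 + \<epsilon>) * (norm u)\<^sup>2 \<le> (lam - L * norm u) * (norm u)\<^sup>2" by (intro mult_right_mono) auto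
  then show ?thesis using 1 hess_near[OF lam p s, of u] by (simp add: distrib_right)
qed simp

lemma opp_conv:
  assumes p: "p \<in> P" and u: "norm u \<le> 2 * R"
  shows "opp m y (shift p u) - opp_grad m y (shift p u) \<bullet> u \<le> opp m y p"
proof -
  have "0 \<le> lam / 2 * (norm u)\<^sup>2" using lam_pos by simp
  then show ?thesis using second_order(2)[OF td_opp opp_hess[OF p u]] by linarith
qed

text \<open>The gradient at the centre vanishes against the equilibrium weights, hence is at most
  \<open>\<epsilon> \<le> lam * R / 2\<close> here; over a distance of at least \<open>R\<close> the
  Hessian outweighs it.\<close>

lemma opp_outward:
  assumes p: "p \<in> P" and u: "R \<le> norm u" "norm u \<le> 2 * R"
  shows "0 \<le> opp_grad m y (shift p u) \<bullet> u"
proof -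
  have "norm (opp_grad m y p - (\<Sum>q\<in>Q. v q *\<^sub>R gx p q)) \<le> \<epsilon>"
    unfolding opp_grad_def by (rule near') (use gx_bound gx_lip[of p _ p] in auto)
  then have "norm (opp_grad m y p) \<le> \<epsilon>" using critical[OF p] by simp
  then have "norm (opp_grad m y p) * norm u \<le> lam * R / 2 * norm u" using \<epsilon>(2) by (intro mult_right_mono) auto
  moreover have "lam * R / 2 * norm u \<le> lam / 2 * (norm u)\<^sup>2"
    using mult_left_mono[OF u(1), of "lam / 2 * norm u"] lam_pos by (simp add: power2_eq_square mult_ac)
  moreover have "- (norm (opp_grad m y p) * norm u) \<le> opp_grad m y p \<bullet> u"
    using Cauchy_Schwarz_ineq2[of "opp_grad m y p" u] by linarith
  ultimately show ?thesis using second_order(3)[OF td_opp opp_hess[OF p u(2)]] by linarith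
qed

end

end

text \<open>\<open>weights_coercive\<close> applied to the cluster mass errors. Replacing particles
  by centres costs spread and outside mass, and the equilibrium weights contribute value
  \<open>\<rho>\<close> and gradient 0 at \<open>P\<close>, so the free level is
  \<open>c - \<rho>\<close>.\<close>

lemma weights_error:
  obtains K where "0 < K" "\<And>m y c. fst y \<in> prob_simplex m \<Longrightarrow>
    (\<Sum>q\<in>Q. (CQ.gmass m y q - v q)\<^sup>2) \<le> K * (CQ.omass m y + CQ.spread m y
      + (\<Sum>p\<in>P. (opp m y p - c)\<^sup>2 + (norm (opp_grad m y p))\<^sup>2))"
proof -
  obtain C where C: "0 < C" "\<And>\<delta> t. (\<Sum>q\<in>Q. (\<delta> q)\<^sup>2)
    \<le> C * ((\<Sum>q\<in>Q. \<delta> q)\<^sup>2 + (\<Sum>p\<in>P. ((\<Sum>q\<in>Q. \<delta> q * f p q) - t)\<^sup>2 + (norm (\<Sum>q\<in>Q. \<delta> q *\<^sub>R gx p q))\<^sup>2))"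
    using weights_coercive by blast
  define k where "k = 3 + card P * (8 * L\<^sup>2)"
  have k: "0 < k" by (simp add: k_def add_pos_nonneg)
  show thesis
  proof (rule that[of "C * k"])
    show "0 < C * k" using C k by simp
    fix m c and y :: "'m particles" assume y: "fst y \<in> prob_simplex m"
    let ?s = "CQ.spread m y" and ?o = "CQ.omass m y" and ?\<delta> = "\<lambda>q. CQ.gmass m y q - v q"
    let ?E = "\<Sum>p\<in>P. (opp m y p - c)\<^sup>2 + (norm (opp_grad m y p))\<^sup>2"
    note nn = CQ.spread_nonneg[OF y] CQ.omass_nonneg[OF y] CQ.omass_le_1[OF y]
    have sq: "(a + b)\<^sup>2 \<le> 2 * a\<^sup>2 + 2 * b\<^sup>2" for a b :: real
      using zero_le_power2[of "a - b"] by (simp add: power2_sum power2_diff)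
    have o2: "?o\<^sup>2 \<le> ?o" using nn by (simp add: power2_eq_square mult_left_le)
    let ?e = "L * (sqrt ?s + ?o)"
    have e2: "?e\<^sup>2 \<le> 2 * L\<^sup>2 * (?s + ?o)"
    proof -
      have "(sqrt ?s + ?o)\<^sup>2 \<le> 2 * (?s + ?o)" using sq[of "sqrt ?s" ?o] o2 nn by simp
      then have "L\<^sup>2 * (sqrt ?s + ?o)\<^sup>2 \<le> L\<^sup>2 * (2 * (?s + ?o))" by (intro mult_left_mono) auto
      then show ?thesis unfolding power_mult_distrib by (simp add: algebra_simps)
    qed
    have "(\<Sum>q\<in>Q. ?\<delta> q) = - ?o" using CQ.total_mass[OF y] v_sum by (simp add: sum_subtractf)
    then have D: "(\<Sum>q\<in>Q. ?\<delta> q)\<^sup>2 \<le> ?o" using o2 by simp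
    have t: "((\<Sum>q\<in>Q. ?\<delta> q * f p q) - (c - \<rho>))\<^sup>2 + (norm (\<Sum>q\<in>Q. ?\<delta> q *\<^sub>R gx p q))\<^sup>2
        \<le> 8 * L\<^sup>2 * (?s + ?o) + 2 * ((opp m y p - c)\<^sup>2 + (norm (opp_grad m y p))\<^sup>2)" if p: "p \<in> P" for p
    proof -
      let ?A = "opp m y p - (\<Sum>q\<in>Q. CQ.gmass m y q * f p q)"
      have "\<bar>?A\<bar> \<le> ?e"
        using CQ.spread_approx[OF y, of L "\<lambda>q. f p q"] L_pos f_bound f_lip[of p _ p] by (simp add: opp_def)
      then have A: "?A\<^sup>2 \<le> ?e\<^sup>2" by (intro power2_le_iff_abs_le[THEN iffD2]) auto
      have "(\<Sum>q\<in>Q. ?\<delta> q * f p q) - (c - \<rho>) = (opp m y p - c) + - ?A"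
        using value_eq[of p] p by (simp add: left_diff_distrib sum_subtractf)
      then have 1: "((\<Sum>q\<in>Q. ?\<delta> q * f p q) - (c - \<rho>))\<^sup>2 \<le> 2 * (opp m y p - c)\<^sup>2 + 2 * ?e\<^sup>2"
        using sq[of "opp m y p - c" "- ?A"] A by (simp only: power2_minus)
      let ?B = "opp_grad m y p - (\<Sum>q\<in>Q. CQ.gmass m y q *\<^sub>R gx p q)"
      have B: "norm ?B \<le> ?e"
        using CQ.spread_approx[OF y, of L "\<lambda>q. gx p q"] L_pos gx_bound gx_lip[of p _ p] by (simp add: opp_grad_def)
      have "(\<Sum>q\<in>Q. ?\<delta> q *\<^sub>R gx p q) = opp_grad m y p - ?B"
        using critical[OF p] by (simp add: scaleR_diff_left sum_subtractf)
      then have "norm (\<Sum>q\<in>Q. ?\<delta> q *\<^sub>R gx p q) \<le> norm (opp_grad m y p) + ?e"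
        using B norm_triangle_ineq4[of "opp_grad m y p" ?B] by simp
      then have "(norm (\<Sum>q\<in>Q. ?\<delta> q *\<^sub>R gx p q))\<^sup>2 \<le> (norm (opp_grad m y p) + ?e)\<^sup>2" by (intro power_mono) auto
      then have 2: "(norm (\<Sum>q\<in>Q. ?\<delta> q *\<^sub>R gx p q))\<^sup>2 \<le> 2 * (norm (opp_grad m y p))\<^sup>2 + 2 * ?e\<^sup>2"
        using sq[of "norm (opp_grad m y p)" ?e] by linarith
      have comb: "x + x' \<le> 4 * t + 2 * (a + b)" if "x \<le> 2 * a + 2 * e" "x' \<le> 2 * b + 2 * e" "e \<le> t" for x x' a b e t :: real
        using that by simp
      show ?thesis using comb[OF 1 2 e2] by (simp only: mult.assoc[symmetric])
    qed
    have E0: "0 \<le> ?E" by (intro sum_nonneg) auto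
    have "(\<Sum>p\<in>P. ((\<Sum>q\<in>Q. ?\<delta> q * f p q) - (c - \<rho>))\<^sup>2 + (norm (\<Sum>q\<in>Q. ?\<delta> q *\<^sub>R gx p q))\<^sup>2)
       \<le> (\<Sum>p\<in>P. 8 * L\<^sup>2 * (?s + ?o) + 2 * ((opp m y p - c)\<^sup>2 + (norm (opp_grad m y p))\<^sup>2))"
      by (rule sum_mono[OF t])
    also have "\<dots> = card P * (8 * L\<^sup>2 * (?s + ?o)) + 2 * ?E" by (simp add: sum.distrib sum_distrib_left)
    finally have "(\<Sum>q\<in>Q. (?\<delta> q)\<^sup>2) \<le> C * (?o + (card P * (8 * L\<^sup>2 * (?s + ?o)) + 2 * ?E))"
      using C(1) D by (intro order_trans[OF C(2)[of ?\<delta> "c - \<rho>"]] mult_left_mono) auto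
    also have "?o + (card P * (8 * L\<^sup>2 * (?s + ?o)) + 2 * ?E) \<le> k * (?o + ?s + ?E)"
      using nn E0 by (simp add: k_def algebra_simps)
    finally show "(\<Sum>q\<in>Q. (?\<delta> q)\<^sup>2) \<le> C * k * (?o + ?s + ?E)" using C(1) by (simp add: mult.assoc)
  qed
qed

text \<open>If \<open>opp m y\<close> is almost at least \<open>\<rho>\<close> everywhere, then it is almost \<open>\<rho>\<close> with an almost vanishing
  gradient at the points of \<open>P\<close>, since its average over \<open>P\<close> is at most \<open>\<rho>\<close>.\<close>

lemma opp_at_targets:
  assumes y: "fst y \<in> prob_simplex m" and r: "0 \<le> r" and ge: "\<And>x. \<rho> - r \<le> opp m y x"
    and avg: "(\<Sum>p\<in>P. w p * opp m y p) \<le> \<rho>" and p: "p \<in> P" and W: "0 < W" "W \<le> w p" "W \<le> 1"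
  shows "\<bar>opp m y p - \<rho>\<bar> \<le> r / W" "(norm (opp_grad m y p))\<^sup>2 \<le> 4 * L * (r / W)"
proof -
  have rW: "r \<le> r / W" using r W by (simp add: le_divide_eq mult_left_le)
  have "w p * (opp m y p - (\<rho> - r)) \<le> (\<Sum>p\<in>P. w p * (opp m y p - (\<rho> - r)))"
    using finP p ge CP.w_pos by (intro member_le_sum[where f = "\<lambda>p. w p * (opp m y p - (\<rho> - r))"] mult_nonneg_nonneg) (auto simp: less_imp_le)
  also have "\<dots> = (\<Sum>p\<in>P. w p * opp m y p) - (\<rho> - r)"
    using CP.w_sum by (simp add: right_diff_distrib[of "w _" "opp m y _"] sum_subtractf flip: sum_distrib_right)
  also have "\<dots> \<le> r" using avg by simp
  finally have "w p * (opp m y p - (\<rho> - r)) \<le> r" .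
  moreover have "W * (opp m y p - (\<rho> - r)) \<le> w p * (opp m y p - (\<rho> - r))" using W ge[of p] by (intro mult_right_mono) auto
  ultimately have up: "opp m y p - (\<rho> - r) \<le> r / W" using W by (simp add: le_divide_eq mult.commute)
  then show "\<bar>opp m y p - \<rho>\<bar> \<le> r / W" using ge[of p] rW r by (simp add: abs_le_iff)
  \<comment> \<open>A gradient step of size \<open>1 / L\<close> lowers the payoff by at least
    \<open>(norm ?g)\<^sup>2 / (2 * L)\<close>, yet cannot lead below
    \<open>\<rho> - r\<close>.\<close>
  let ?g = "opp_grad m y p" and ?u = "- (1 / L) *\<^sub>R opp_grad m y p"
  have bnd: "\<bar>\<Sum>j<m. fst y j * (u \<bullet> hx x (snd y j) u)\<bar> \<le> L * (norm u)\<^sup>2" for u x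
    using convex_combination_norm[OF y, of "\<lambda>j. u \<bullet> hx x (snd y j) u"] hx_bound by simp
  have "- (L * (norm ?u)\<^sup>2) \<le> ?u \<bullet> (- (\<Sum>j<m. fst y j *\<^sub>R hx (shift p (s *\<^sub>R ?u)) (snd y j) ?u))" for s
    using bnd[of ?u "shift p (s *\<^sub>R ?u)"] unfolding inner_minus_right inner_sum_right inner_scaleR_right
    by linarith
  from second_order(1)[OF twice_diff_minus[OF td_opp[OF y]], where x = p and u = ?u, OF this]
  have "opp m y (shift p ?u) \<le> opp m y p + ?g \<bullet> ?u + L * (norm ?u)\<^sup>2 / 2" by simp
  note le = this
  have a: "?g \<bullet> ?u = - ((norm ?g)\<^sup>2 / L)" by (simp add: power2_norm_eq_inner)
  have b: "L * (norm ?u)\<^sup>2 / 2 = (norm ?g)\<^sup>2 / L / 2" using L_pos by (simp add: power_divide power2_eq_square)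
  have "(norm ?g)\<^sup>2 / L / 2 \<le> r / W" using le ge[of "shift p ?u"] up unfolding a b by linarith
  then have "(norm ?g)\<^sup>2 \<le> 2 * (L * (r / W))" using L_pos by (simp add: field_simps)
  moreover have "0 \<le> L * (r / W)" using r W L_pos by simp
  ultimately show "(norm ?g)\<^sup>2 \<le> 4 * L * (r / W)" by simp
qed

end

context clusters begin

text \<open>Half of \<open>\<epsilon>\<close> pays for the distance of the old iterate from the
  equilibrium, the other half for the displacement in the step. The energy of the new iterate is not
  consulted, which avoids a circular argument.\<close>

lemma near_after_step:
  fixes \<psi> :: "'d torus \<Rightarrow> 'b::real_normed_vector"
  assumes step: "prox_step G Gg \<eta> \<sigma> n z z'" and pos: "0 < \<eta>" "0 < \<sigma>" "0 < L" "0 < \<Gamma>"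
    and G: "\<And>x. \<bar>G x\<bar> \<le> L" and Gg: "\<And>x. norm (Gg x) \<le> L" and small: "2 * (\<eta> * L) \<le> 1 / 2"
    and kpos: "\<And>q. q \<in> P \<Longrightarrow> 0 < kmass \<alpha> n z q" and \<alpha>: "1 / \<Gamma> \<le> \<alpha>" and V: "lyap \<alpha> n z \<le> v0" "v0 \<le> 1"
    and \<epsilon>: "(4 * \<eta> + 2 * \<sigma>) * L\<^sup>2 \<le> \<epsilon> / 2" "L * (sqrt (2 * \<Gamma>) + 1 + 3 * card P) * sqrt v0 \<le> \<epsilon> / 2"
    and \<psi>: "\<And>x. norm (\<psi> x) \<le> L" "\<And>x y. norm (\<psi> x - \<psi> y) \<le> L * dist x y"
  shows "norm ((\<Sum>i<n. fst z' i *\<^sub>R \<psi> (snd z' i)) - (\<Sum>q\<in>P. w q *\<^sub>R \<psi> q)) \<le> \<epsilon>"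
proof -
  have simplex: "fst z \<in> prob_simplex n" using step by (simp add: prox_step_def)
  have \<alpha>p: "0 < \<alpha>" using \<alpha> pos by (meson divide_pos_pos less_le_trans zero_less_one)
  have "2 / \<alpha> \<le> 2 * \<Gamma>" using \<alpha> \<alpha>p pos by (simp add: field_simps)
  then have "L * (sqrt (2 / \<alpha>) + 1 + 3 * card P) * sqrt v0 \<le> L * (sqrt (2 * \<Gamma>) + 1 + 3 * card P) * sqrt v0"
    using pos lyap_controls(3)[OF simplex kpos \<alpha>p V] by (intro mult_right_mono mult_left_mono add_mono) auto
  moreover have "norm ((\<Sum>i<n. fst z i *\<^sub>R \<psi> (snd z i)) - (\<Sum>q\<in>P. w q *\<^sub>R \<psi> q))
      \<le> L * (sqrt (2 / \<alpha>) + 1 + 3 * card P) * sqrt v0"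
    by (rule target_approx_lyap[OF simplex kpos \<alpha>p V _ \<psi>]) (use pos in auto)
  ultimately have "norm ((\<Sum>i<n. fst z i *\<^sub>R \<psi> (snd z i)) - (\<Sum>q\<in>P. w q *\<^sub>R \<psi> q)) \<le> \<epsilon> / 2"
    using \<epsilon>(2) by linarith
  moreover have "norm ((\<Sum>i<n. fst z' i *\<^sub>R \<psi> (snd z' i)) - (\<Sum>i<n. fst z i *\<^sub>R \<psi> (snd z i))) \<le> \<epsilon> / 2"
    using prox_step_displacement[OF step pos(1-3) G Gg small \<psi>] \<epsilon>(1) by linarith
  ultimately show ?thesis
    using norm_triangle_ineq[of "(\<Sum>i<n. fst z' i *\<^sub>R \<psi> (snd z' i)) - (\<Sum>i<n. fst z i *\<^sub>R \<psi> (snd z i))"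
        "(\<Sum>i<n. fst z i *\<^sub>R \<psi> (snd z i)) - (\<Sum>q\<in>P. w q *\<^sub>R \<psi> q)"] by simp
qed

lemma mass_window:
  assumes "fst z \<in> prob_simplex n" "\<And>q. q \<in> P \<Longrightarrow> 0 < kmass \<alpha> n z q" "0 < \<alpha>" "lyap \<alpha> n z \<le> v0" "v0 \<le> 1"
    and W: "\<And>q. q \<in> P \<Longrightarrow> W \<le> w q" "2 * sqrt v0 \<le> W / 4" and q: "q \<in> P"
  shows "3 / 4 * w q \<le> kmass \<alpha> n z q" "kmass \<alpha> n z q \<le> 5 / 4 * w q"
  using lyap_controls(5)[OF assms(1-5) q] W(1)[OF q] W(2) by (simp_all add: abs_le_iff)

end

section \<open>Both players together\<close>

locale two_sided = X: game_clusters f gx hx L P w Q v \<rho> R lam c1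
    + Y: game_clusters "\<lambda>y x. - f x y" gy hy L Q v P w "- \<rho>" R lam c1
  for f :: "'n::finite torus \<Rightarrow> 'm::finite torus \<Rightarrow> real" and gx hx L P w Q v \<rho> R lam c1 gy hy
begin

text \<open>The logarithm is total, so \<open>lyap\<close> gives information only while the kernel
  masses are positive; positivity is therefore carried along the iteration.\<close>

definition state :: "real \<Rightarrow> nat \<Rightarrow> nat \<Rightarrow> 'n particles \<times> 'm particles \<Rightarrow> bool" where
  "state \<alpha> n m z \<longleftrightarrow> fst (fst z) \<in> prob_simplex n \<and> fst (snd z) \<in> prob_simplex m \<and>
     (\<forall>p\<in>P. 0 < X.CP.kmass \<alpha> n (fst z) p) \<and> (\<forall>q\<in>Q. 0 < X.CQ.kmass \<alpha> m (snd z) q)"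

definition energy :: "real \<Rightarrow> nat \<Rightarrow> nat \<Rightarrow> 'n particles \<times> 'm particles \<Rightarrow> real" where
  "energy \<alpha> n m z = X.CP.lyap \<alpha> n (fst z) + X.CQ.lyap \<alpha> m (snd z)"

lemma energy_ge:
  assumes "state \<alpha> n m z" "0 < \<alpha>"
  shows "0 \<le> X.CP.lyap \<alpha> n (fst z)" "0 \<le> X.CQ.lyap \<alpha> m (snd z)"
    "X.CP.lyap \<alpha> n (fst z) \<le> energy \<alpha> n m z" "X.CQ.lyap \<alpha> m (snd z) \<le> energy \<alpha> n m z" "0 \<le> energy \<alpha> n m z"
proof -
  show 1: "0 \<le> X.CP.lyap \<alpha> n (fst z)" "0 \<le> X.CQ.lyap \<alpha> m (snd z)"
    using assms X.CP.lyap_nonneg[of "fst z" n \<alpha>] X.CQ.lyap_nonneg[of "snd z" m \<alpha>] by (auto simp: state_def)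
  show "X.CP.lyap \<alpha> n (fst z) \<le> energy \<alpha> n m z" "X.CQ.lyap \<alpha> m (snd z) \<le> energy \<alpha> n m z" "0 \<le> energy \<alpha> n m z"
    using 1 by (auto simp: energy_def)
qed

text \<open>Both players respond to the same new iterate, so the bilinear terms \<open>F(\<mu>', \<nu>')\<close> cancel. An
  explicit step would leave an error here.\<close>

lemma gap_terms:
  assumes "fst x \<in> prob_simplex n" "fst y \<in> prob_simplex m"
  shows "(\<Sum>p\<in>P. w p * X.opp m y p) + (\<Sum>q\<in>Q. v q * Y.opp n x q)
     \<le> - (lam / 4 * (X.CP.spread n x + X.CQ.spread m y) + c1 * (X.CP.omass n x + X.CQ.omass m y))"
    and "(\<Sum>i<n. fst x i * X.opp m y (snd x i)) + (\<Sum>j<m. fst y j * Y.opp n x (snd y j)) = 0"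
proof -
  have "(\<Sum>p\<in>P. w p * X.opp m y p) = - (\<Sum>j<m. fst y j * (\<Sum>p\<in>P. w p * - f p (snd y j)))"
    unfolding X.opp_def sum_distrib_left by (subst sum.swap) (simp add: sum_negf mult_ac)
  moreover have "(\<Sum>q\<in>Q. v q * Y.opp n x q) = - (\<Sum>i<n. fst x i * (\<Sum>q\<in>Q. v q * f (snd x i) q))"
    unfolding Y.opp_def sum_distrib_left by (subst sum.swap) (simp add: sum_negf mult_ac)
  ultimately show "(\<Sum>p\<in>P. w p * X.opp m y p) + (\<Sum>q\<in>Q. v q * Y.opp n x q)
     \<le> - (lam / 4 * (X.CP.spread n x + X.CQ.spread m y) + c1 * (X.CP.omass n x + X.CQ.omass m y))"
    using X.gap_ge[OF assms(1)] Y.gap_ge[OF assms(2)] by (simp add: distrib_left)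
  have "(\<Sum>j<m. fst y j * Y.opp n x (snd y j)) = - (\<Sum>i<n. fst x i * X.opp m y (snd x i))"
    unfolding X.opp_def Y.opp_def sum_distrib_left by (subst sum.swap) (simp add: sum_negf mult_ac)
  then show "(\<Sum>i<n. fst x i * X.opp m y (snd x i)) + (\<Sum>j<m. fst y j * Y.opp n x (snd y j)) = 0" by simp
qed

definition update :: "real \<Rightarrow> real \<Rightarrow> nat \<Rightarrow> nat \<Rightarrow> 'n particles \<times> 'm particles \<Rightarrow> 'n particles \<times> 'm particles \<Rightarrow> bool" where
  "update \<eta> \<sigma> n m z z' \<longleftrightarrow>
     prox_step (X.opp m (snd z')) (X.opp_grad m (snd z')) \<eta> \<sigma> n (fst z) (fst z') \<and>
     prox_step (Y.opp n (fst z')) (Y.opp_grad n (fst z')) \<eta> \<sigma> m (snd z) (snd z')"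

context
  fixes \<Gamma> W v0 \<eta> \<sigma> \<alpha> \<epsilon> :: real
  assumes \<Gamma>: "0 < \<Gamma>" "\<Gamma> * R\<^sup>2 \<le> 1 / 8" "32 * (\<Gamma> * L * R) \<le> lam"
    and W: "0 < W" "\<And>p. p \<in> P \<Longrightarrow> W \<le> w p" "\<And>q. q \<in> Q \<Longrightarrow> W \<le> v q"
    and \<epsilon>: "\<epsilon> \<le> lam / 4" "\<epsilon> \<le> lam * R / 2"
    and v0: "v0 \<le> 1" "2 * sqrt v0 \<le> W / 4"
      "L * (sqrt (2 * \<Gamma>) + 1 + 3 * card P) * sqrt v0 \<le> \<epsilon> / 2" "L * (sqrt (2 * \<Gamma>) + 1 + 3 * card Q) * sqrt v0 \<le> \<epsilon> / 2"
    and steps: "0 < \<eta>" "0 < \<sigma>" "\<alpha> * \<sigma> = \<eta>" "1 / \<Gamma> \<le> \<alpha>" "\<alpha> \<le> \<Gamma>"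
    and small: "\<eta> * L \<le> 1 / 16" "2 * \<sigma> * L \<le> R" "(4 * \<eta> + 2 * \<sigma>) * L\<^sup>2 \<le> \<epsilon> / 2" "992 * (\<eta> * L\<^sup>2) \<le> lam"
begin

text \<open>The gap pays for the errors when the half steps are added: of its spread coefficient
  \<open>lam / 4\<close> half covers the cluster errors, and of the variance coefficient 1/3 half
  has been used up by \<open>half_step\<close>.\<close>

lemma energy_decrease:
  assumes st: "state \<alpha> n m z" and V: "energy \<alpha> n m z \<le> v0" and upd: "update \<eta> \<sigma> n m z z'"
  obtains cx cy E D where "0 \<le> E" "0 \<le> D"
    "energy \<alpha> n m z' \<le> energy \<alpha> n m z - (\<eta> * lam / 8 * (X.CP.spread n (fst z') + X.CQ.spread m (snd z'))
       + \<eta> * c1 * (X.CP.omass n (fst z') + X.CQ.omass m (snd z')) + \<eta>\<^sup>2 / 6 * E + \<eta> * \<sigma> / 16 * D)"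
    "\<And>p. p \<in> P \<Longrightarrow> w p / 4 * ((X.opp m (snd z') p - cx)\<^sup>2 + (norm (X.opp_grad m (snd z') p))\<^sup>2)
       \<le> E + D + 2 * L\<^sup>2 * (X.CP.spread n (fst z') + X.CQ.spread m (snd z'))"
    "\<And>q. q \<in> Q \<Longrightarrow> v q / 4 * ((Y.opp n (fst z') q - cy)\<^sup>2 + (norm (Y.opp_grad n (fst z') q))\<^sup>2)
       \<le> E + D + 2 * L\<^sup>2 * (X.CP.spread n (fst z') + X.CQ.spread m (snd z'))"
    "\<And>p. p \<in> P \<Longrightarrow> w p / 2 \<le> X.CP.kmass \<alpha> n (fst z') p"
    "\<And>q. q \<in> Q \<Longrightarrow> v q / 2 \<le> X.CQ.kmass \<alpha> m (snd z') q"
proof -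
  define x y x' y' where "x = fst z" "y = snd z" "x' = fst z'" "y' = snd z'"
  note xy = x_y_x'_y'_def
  have \<alpha>: "0 < \<alpha>" using steps by (metis zero_less_mult_pos2)
  note L = X.L_pos
  have sx: "prox_step (X.opp m y') (X.opp_grad m y') \<eta> \<sigma> n x x'"
    and sy: "prox_step (Y.opp n x') (Y.opp_grad n x') \<eta> \<sigma> m y y'"
    using upd by (auto simp: update_def xy)
  have simp: "fst x \<in> prob_simplex n" "fst y \<in> prob_simplex m" "fst x' \<in> prob_simplex n" "fst y' \<in> prob_simplex m"
    using sx sy by (auto simp: prox_step_def)
  have kx: "\<And>p. p \<in> P \<Longrightarrow> 0 < X.CP.kmass \<alpha> n x p" and ky: "\<And>q. q \<in> Q \<Longrightarrow> 0 < X.CQ.kmass \<alpha> m y q"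
    using st by (auto simp: state_def xy)
  have Vx: "X.CP.lyap \<alpha> n x \<le> v0" and Vy: "X.CQ.lyap \<alpha> m y \<le> v0"
    using energy_ge[OF st \<alpha>] V by (auto simp: xy)
  have sm: "2 * (\<eta> * L) \<le> 1 / 2" using small(1) by simp
  have aR: "\<alpha> * R\<^sup>2 \<le> 1 / 8" using \<Gamma> steps(5) mult_right_mono[of \<alpha> \<Gamma> "R\<^sup>2"] by simp
  note bx = X.opp_bound[OF simp(4)] X.opp_grad_bound[OF simp(4)]
    and by' = Y.opp_bound[OF simp(3)] Y.opp_grad_bound[OF simp(3)]
  \<comment> \<open>The half steps require convexity of the payoff against the new opponent; these
    facts provide it from the old energy.\<close>
  note nearY = X.CQ.near_after_step[OF sy steps(1,2) L \<Gamma>(1) by' sm ky steps(4) Vy v0(1) small(3) v0(4)]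
    and nearX = X.CP.near_after_step[OF sx steps(1,2) L \<Gamma>(1) bx sm kx steps(4) Vx v0(1) small(3) v0(3)]
  note cx = X.opp_conv[OF simp(4) \<epsilon> nearY nearY] X.opp_outward[OF simp(4) \<epsilon> nearY nearY]
  note cy = Y.opp_conv[OF simp(3) \<epsilon> nearX nearX] Y.opp_outward[OF simp(3) \<epsilon> nearX nearX]
  obtain c1x Ex Dx where hx: "0 \<le> Ex" "0 \<le> Dx"
    "\<eta> * (\<Sum>i<n. fst x' i * X.opp m y' (snd x' i)) - \<eta> * c1x \<le> - (\<eta>\<^sup>2 / 3) * Ex"
    "X.CP.lyap \<alpha> n x' \<le> X.CP.lyap \<alpha> n x + \<eta> * ((\<Sum>p\<in>P. w p * X.opp m y' p) - c1x)
      + 2 * \<eta> * (\<alpha> * L * R + 31 * \<eta> * L\<^sup>2) * X.CP.spread n x' + \<eta>\<^sup>2 / 6 * Ex - \<eta> * \<sigma> / 16 * Dx"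
    "\<And>p. p \<in> P \<Longrightarrow> w p / 4 * ((X.opp m y' p - c1x)\<^sup>2 + (norm (X.opp_grad m y' p))\<^sup>2) \<le> Ex + Dx + 2 * L\<^sup>2 * X.CP.spread n x'"
    "\<And>p. p \<in> P \<Longrightarrow> w p / 2 \<le> X.CP.kmass \<alpha> n x' p"
    by (rule X.CP.half_step[OF sx steps(1,2) L steps(3) bx X.opp_lip[OF simp(4)] cx small(1) aR small(2)
          X.CP.mass_window[OF simp(1) kx \<alpha> Vx v0(1) W(2) v0(2)] X.opp_grad_lip[OF simp(4)]]) blast+
  obtain c1y Ey Dy where hy: "0 \<le> Ey" "0 \<le> Dy"
    "\<eta> * (\<Sum>j<m. fst y' j * Y.opp n x' (snd y' j)) - \<eta> * c1y \<le> - (\<eta>\<^sup>2 / 3) * Ey"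
    "X.CQ.lyap \<alpha> m y' \<le> X.CQ.lyap \<alpha> m y + \<eta> * ((\<Sum>q\<in>Q. v q * Y.opp n x' q) - c1y)
      + 2 * \<eta> * (\<alpha> * L * R + 31 * \<eta> * L\<^sup>2) * X.CQ.spread m y' + \<eta>\<^sup>2 / 6 * Ey - \<eta> * \<sigma> / 16 * Dy"
    "\<And>q. q \<in> Q \<Longrightarrow> v q / 4 * ((Y.opp n x' q - c1y)\<^sup>2 + (norm (Y.opp_grad n x' q))\<^sup>2) \<le> Ey + Dy + 2 * L\<^sup>2 * X.CQ.spread m y'"
    "\<And>q. q \<in> Q \<Longrightarrow> v q / 2 \<le> X.CQ.kmass \<alpha> m y' q"
    by (rule X.CQ.half_step[OF sy steps(1,2) L steps(3) by' Y.opp_lip[OF simp(3)] cy small(1) aR small(2)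
          X.CQ.mass_window[OF simp(2) ky \<alpha> Vy v0(1) W(3) v0(2)] Y.opp_grad_lip[OF simp(3)]]) blast+
  let ?sx = "X.CP.spread n x'" and ?sy = "X.CQ.spread m y'" and ?ox = "X.CP.omass n x'" and ?oy = "X.CQ.omass m y'"
  have nn: "0 \<le> ?sx" "0 \<le> ?sy" using X.CP.spread_nonneg[OF simp(3)] X.CQ.spread_nonneg[OF simp(4)] by auto
  define A where "A = (\<Sum>p\<in>P. w p * X.opp m y' p)"
  define B where "B = (\<Sum>q\<in>Q. v q * Y.opp n x' q)"
  have gap: "A + B \<le> - (lam / 4 * (?sx + ?sy) + c1 * (?ox + ?oy))"
    unfolding A_def B_def by (rule gap_terms(1)[OF simp(3,4)])
  have canc: "(\<Sum>i<n. fst x' i * X.opp m y' (snd x' i)) + (\<Sum>j<m. fst y' j * Y.opp n x' (snd y' j)) = 0"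
    by (rule gap_terms(2)[OF simp(3,4)])
  \<comment> \<open>The soft minima of the two players are bounded below only in sum, through the
    cancellation \<open>canc\<close>.\<close>
  have c: "- \<eta> * c1x - \<eta> * c1y \<le> - (\<eta>\<^sup>2 / 3) * Ex - (\<eta>\<^sup>2 / 3) * Ey"
  proof -
    have "\<eta> * (\<Sum>i<n. fst x' i * X.opp m y' (snd x' i)) + \<eta> * (\<Sum>j<m. fst y' j * Y.opp n x' (snd y' j)) = 0"
      using canc by (simp flip: distrib_left)
    then show ?thesis using hx(3) hy(3) by simp
  qed
  \<comment> \<open>Each of the two terms in the bracket is at most \<open>lam / 32\<close>; the
    number 992 in the smallness hypothesis is 31 times 32.\<close>
  have coef: "2 * \<eta> * (\<alpha> * L * R + 31 * \<eta> * L\<^sup>2) \<le> \<eta> * lam / 8"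
  proof -
    have "\<alpha> * (L * R) \<le> \<Gamma> * (L * R)" using steps L X.CP.R_pos by (intro mult_right_mono) auto
    then have "\<alpha> * L * R + 31 * \<eta> * L\<^sup>2 \<le> lam / 16" using \<Gamma>(3) small(4) by (simp add: mult.assoc)
    then have "(2 * \<eta>) * (\<alpha> * L * R + 31 * \<eta> * L\<^sup>2) \<le> (2 * \<eta>) * (lam / 16)" using steps by (intro mult_left_mono) auto
    then show ?thesis by simp
  qed
  have s: "2 * \<eta> * (\<alpha> * L * R + 31 * \<eta> * L\<^sup>2) * ?sx \<le> \<eta> * lam / 8 * ?sx" "2 * \<eta> * (\<alpha> * L * R + 31 * \<eta> * L\<^sup>2) * ?sy \<le> \<eta> * lam / 8 * ?sy"
    by (rule mult_right_mono[OF coef nn(1)], rule mult_right_mono[OF coef nn(2)])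
  have g: "\<eta> * A + \<eta> * B \<le> - (\<eta> * lam / 4 * ?sx) - \<eta> * lam / 4 * ?sy - \<eta> * c1 * (?ox + ?oy)"
    using mult_left_mono[OF gap, of \<eta>] steps(1) by (simp add: algebra_simps)
  have "X.CP.lyap \<alpha> n x' + X.CQ.lyap \<alpha> m y' \<le> (X.CP.lyap \<alpha> n x + X.CQ.lyap \<alpha> m y) - (\<eta> * lam / 8 * (?sx + ?sy)
       + \<eta> * c1 * (?ox + ?oy) + \<eta>\<^sup>2 / 6 * (Ex + Ey) + \<eta> * \<sigma> / 16 * (Dx + Dy))"
  proof -
    have 1: "X.CP.lyap \<alpha> n x' \<le> X.CP.lyap \<alpha> n x + (\<eta> * A - \<eta> * c1x) + \<eta> * lam / 8 * ?sx + \<eta>\<^sup>2 / 6 * Ex - \<eta> * \<sigma> / 16 * Dx"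
      using hx(4) s(1) unfolding A_def[symmetric] right_diff_distrib by linarith
    have 2: "X.CQ.lyap \<alpha> m y' \<le> X.CQ.lyap \<alpha> m y + (\<eta> * B - \<eta> * c1y) + \<eta> * lam / 8 * ?sy + \<eta>\<^sup>2 / 6 * Ey - \<eta> * \<sigma> / 16 * Dy"
      using hy(4) s(2) unfolding B_def[symmetric] right_diff_distrib by linarith
    show ?thesis using 1 2 g c unfolding distrib_left by simp
  qed
  then have dec: "energy \<alpha> n m z' \<le> energy \<alpha> n m z - (\<eta> * lam / 8 * (?sx + ?sy)
       + \<eta> * c1 * (?ox + ?oy) + \<eta>\<^sup>2 / 6 * (Ex + Ey) + \<eta> * \<sigma> / 16 * (Dx + Dy))"
    by (simp only: energy_def xy)
  have Ls: "0 \<le> 2 * L\<^sup>2 * ?sx" "0 \<le> 2 * L\<^sup>2 * ?sy" using nn by auto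
  show thesis
  proof (rule that[of "Ex + Ey" "Dx + Dy" c1x c1y])
    show "energy \<alpha> n m z' \<le> energy \<alpha> n m z - (\<eta> * lam / 8 * (X.CP.spread n (fst z') + X.CQ.spread m (snd z'))
       + \<eta> * c1 * (X.CP.omass n (fst z') + X.CQ.omass m (snd z')) + \<eta>\<^sup>2 / 6 * (Ex + Ey) + \<eta> * \<sigma> / 16 * (Dx + Dy))"
      using dec by (simp only: xy)
    show "w p / 4 * ((X.opp m (snd z') p - c1x)\<^sup>2 + (norm (X.opp_grad m (snd z') p))\<^sup>2)
       \<le> Ex + Ey + (Dx + Dy) + 2 * L\<^sup>2 * (X.CP.spread n (fst z') + X.CQ.spread m (snd z'))" if "p \<in> P" for p
      using hx(5)[OF that] hy(1,2) Ls unfolding xy distrib_left by linarith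
    show "v q / 4 * ((Y.opp n (fst z') q - c1y)\<^sup>2 + (norm (Y.opp_grad n (fst z') q))\<^sup>2)
       \<le> Ex + Ey + (Dx + Dy) + 2 * L\<^sup>2 * (X.CP.spread n (fst z') + X.CQ.spread m (snd z'))" if "q \<in> Q" for q
      using hy(5)[OF that] hx(1,2) Ls unfolding xy distrib_left by linarith
    show "w p / 2 \<le> X.CP.kmass \<alpha> n (fst z') p" if "p \<in> P" for p using hx(6)[OF that] by (simp only: xy)
    show "v q / 2 \<le> X.CQ.kmass \<alpha> m (snd z') q" if "q \<in> Q" for q using hy(6)[OF that] by (simp only: xy)
  qed (use hx hy in auto)
qed

text \<open>The decrease is at least a multiple of the gains, and the new energy is at most a
  multiple of them: \<open>energy_decrease\<close> bounds the values at the centres,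
  \<open>weights_error\<close> the mass errors, and \<open>lyap_upper\<close> the energy. The gains
  are those of the new iterate, hence the factor \<open>1 + \<theta>\<close> on the left.\<close>

lemma contraction:
  "\<exists>\<theta>>0. \<forall>n m z z'. state \<alpha> n m z \<and> energy \<alpha> n m z \<le> v0 \<and> update \<eta> \<sigma> n m z z' \<longrightarrow>
     state \<alpha> n m z' \<and> (1 + \<theta>) * energy \<alpha> n m z' \<le> energy \<alpha> n m z"
proof -
  have \<alpha>: "0 < \<alpha>" using steps by (metis zero_less_mult_pos2)
  obtain Kx where Kx: "0 < Kx" "\<And>\<alpha> n z. fst z \<in> prob_simplex n \<Longrightarrow> 0 \<le> \<alpha> \<Longrightarrow> \<alpha> \<le> \<Gamma> \<Longrightarrow>
    (\<And>q. q \<in> P \<Longrightarrow> w q / 2 \<le> X.CP.kmass \<alpha> n z q) \<Longrightarrow>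
    X.CP.lyap \<alpha> n z \<le> Kx * (X.CP.omass n z + X.CP.spread n z + (\<Sum>q\<in>P. (X.CP.gmass n z q - w q)\<^sup>2))"
    by (rule X.CP.lyap_upper[OF \<Gamma>(1)]) blast
  obtain Ky where Ky: "0 < Ky" "\<And>\<alpha> n z. fst z \<in> prob_simplex n \<Longrightarrow> 0 \<le> \<alpha> \<Longrightarrow> \<alpha> \<le> \<Gamma> \<Longrightarrow>
    (\<And>q. q \<in> Q \<Longrightarrow> v q / 2 \<le> X.CQ.kmass \<alpha> n z q) \<Longrightarrow>
    X.CQ.lyap \<alpha> n z \<le> Ky * (X.CQ.omass n z + X.CQ.spread n z + (\<Sum>q\<in>Q. (X.CQ.gmass n z q - v q)\<^sup>2))"
    by (rule X.CQ.lyap_upper[OF \<Gamma>(1)]) blast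
  obtain Jy where Jy: "0 < Jy" "\<And>m y c. fst y \<in> prob_simplex m \<Longrightarrow>
    (\<Sum>q\<in>Q. (X.CQ.gmass m y q - v q)\<^sup>2) \<le> Jy * (X.CQ.omass m y + X.CQ.spread m y
      + (\<Sum>p\<in>P. (X.opp m y p - c)\<^sup>2 + (norm (X.opp_grad m y p))\<^sup>2))"
    by (rule X.weights_error) blast
  obtain Jx where Jx: "0 < Jx" "\<And>n x c. fst x \<in> prob_simplex n \<Longrightarrow>
    (\<Sum>p\<in>P. (X.CP.gmass n x p - w p)\<^sup>2) \<le> Jx * (X.CP.omass n x + X.CP.spread n x
      + (\<Sum>q\<in>Q. (Y.opp n x q - c)\<^sup>2 + (norm (Y.opp_grad n x q))\<^sup>2))"
    by (rule Y.weights_error) blast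
  define k where "k = (1 + (card P + card Q) * (4 / W * (1 + 2 * L\<^sup>2)))"
  define K where "K = Kx * (1 + Jx * k) + Ky * (1 + Jy * k)"
  have k: "1 \<le> k" using W(1) by (simp add: k_def)
  have K: "0 < K" using Kx(1) Ky(1) Jx(1) Jy(1) k by (simp add: K_def add_pos_pos)
  define \<theta>0 where "\<theta>0 = Min {\<eta> * lam / 8, \<eta> * c1, \<eta>\<^sup>2 / 6, \<eta> * \<sigma> / 16}"
  have t0: "0 < \<theta>0" using steps X.lam_pos X.c1_pos by (simp add: \<theta>0_def)
  have t0': "\<theta>0 \<le> \<eta> * lam / 8" "\<theta>0 \<le> \<eta> * c1" "\<theta>0 \<le> \<eta>\<^sup>2 / 6" "\<theta>0 \<le> \<eta> * \<sigma> / 16" by (auto simp: \<theta>0_def)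
  show ?thesis
  proof (intro exI[of _ "\<theta>0 / K"] conjI allI impI; (elim conjE)?)
    show "0 < \<theta>0 / K" using t0 K by simp
    fix n m z z' assume st: "state \<alpha> n m z" and V: "energy \<alpha> n m z \<le> v0" and upd: "update \<eta> \<sigma> n m z z'"
    let ?x = "fst z'" and ?y = "snd z'"
    obtain cx cy E D where e: "0 \<le> E" "0 \<le> D"
      "energy \<alpha> n m z' \<le> energy \<alpha> n m z - (\<eta> * lam / 8 * (X.CP.spread n ?x + X.CQ.spread m ?y)
       + \<eta> * c1 * (X.CP.omass n ?x + X.CQ.omass m ?y) + \<eta>\<^sup>2 / 6 * E + \<eta> * \<sigma> / 16 * D)"
      "\<And>p. p \<in> P \<Longrightarrow> w p / 4 * ((X.opp m ?y p - cx)\<^sup>2 + (norm (X.opp_grad m ?y p))\<^sup>2)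
         \<le> E + D + 2 * L\<^sup>2 * (X.CP.spread n ?x + X.CQ.spread m ?y)"
      "\<And>q. q \<in> Q \<Longrightarrow> v q / 4 * ((Y.opp n ?x q - cy)\<^sup>2 + (norm (Y.opp_grad n ?x q))\<^sup>2)
         \<le> E + D + 2 * L\<^sup>2 * (X.CP.spread n ?x + X.CQ.spread m ?y)"
      "\<And>p. p \<in> P \<Longrightarrow> w p / 2 \<le> X.CP.kmass \<alpha> n ?x p"
      "\<And>q. q \<in> Q \<Longrightarrow> v q / 2 \<le> X.CQ.kmass \<alpha> m ?y q"
      by (rule energy_decrease[OF st V upd]) blast
    have simp: "fst ?x \<in> prob_simplex n" "fst ?y \<in> prob_simplex m"
      using upd by (auto simp: update_def prox_step_def)
    show "state \<alpha> n m z'"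
      using simp e(6,7) X.CP.w_pos X.CQ.w_pos unfolding state_def by (meson half_gt_zero less_le_trans)
    let ?S = "X.CP.spread n ?x + X.CQ.spread m ?y" and ?O = "X.CP.omass n ?x + X.CQ.omass m ?y"
    note nn = X.CP.spread_nonneg[OF simp(1)] X.CQ.spread_nonneg[OF simp(2)] X.CP.omass_nonneg[OF simp(1)] X.CQ.omass_nonneg[OF simp(2)]
    \<comment> \<open>The gains of \<open>energy_decrease\<close> without their
      coefficients.\<close>
    define T where "T = ?S + ?O + E + D"
    have T0: "0 \<le> T" using nn e by (simp add: T_def)
    have center: "A \<le> 4 / W * (1 + 2 * L\<^sup>2) * T"
      if "W \<le> u" "u / 4 * A \<le> E + D + 2 * L\<^sup>2 * ?S" "0 \<le> A" for A u
    proof -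
      have "W / 4 * A \<le> u / 4 * A" using that by (intro mult_right_mono) auto
      also have "\<dots> \<le> E + D + 2 * L\<^sup>2 * ?S" by (rule that)
      also have "\<dots> \<le> T + 2 * L\<^sup>2 * T" using nn e by (intro add_mono mult_left_mono) (auto simp: T_def)
      finally have "W / 4 * A \<le> (1 + 2 * L\<^sup>2) * T" by (simp add: distrib_right)
      then show ?thesis using W(1) by (simp add: field_simps)
    qed
    have cP: "(\<Sum>p\<in>P. (X.opp m ?y p - cx)\<^sup>2 + (norm (X.opp_grad m ?y p))\<^sup>2) \<le> card P * (4 / W * (1 + 2 * L\<^sup>2) * T)"
      by (rule sum_bounded_above) (rule center[OF W(2) e(4)], auto)
    have cQ: "(\<Sum>q\<in>Q. (Y.opp n ?x q - cy)\<^sup>2 + (norm (Y.opp_grad n ?x q))\<^sup>2) \<le> card Q * (4 / W * (1 + 2 * L\<^sup>2) * T)"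
      by (rule sum_bounded_above) (rule center[OF W(3) e(5)], auto)
    have q0: "0 \<le> 4 / W * (1 + 2 * L\<^sup>2) * T" using W(1) T0 by simp
    have kT: "k * T = T + card P * (4 / W * (1 + 2 * L\<^sup>2) * T) + card Q * (4 / W * (1 + 2 * L\<^sup>2) * T)"
      unfolding k_def distrib_right of_nat_add by (simp only: mult_1 mult.assoc add.assoc)
    have p0: "0 \<le> card P * (4 / W * (1 + 2 * L\<^sup>2) * T)" "0 \<le> card Q * (4 / W * (1 + 2 * L\<^sup>2) * T)"
      by (intro mult_nonneg_nonneg q0 of_nat_0_le_iff)+
    have "X.CQ.omass m ?y + X.CQ.spread m ?y + (\<Sum>p\<in>P. (X.opp m ?y p - cx)\<^sup>2 + (norm (X.opp_grad m ?y p))\<^sup>2) \<le> k * T"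
      using cP p0 nn e unfolding kT T_def[symmetric] by (simp add: T_def)
    then have dy: "(\<Sum>q\<in>Q. (X.CQ.gmass m ?y q - v q)\<^sup>2) \<le> Jy * (k * T)"
      using Jy(1) by (intro order_trans[OF Jy(2)[OF simp(2), of cx]] mult_left_mono) auto
    have "X.CP.omass n ?x + X.CP.spread n ?x + (\<Sum>q\<in>Q. (Y.opp n ?x q - cy)\<^sup>2 + (norm (Y.opp_grad n ?x q))\<^sup>2) \<le> k * T"
      using cQ p0 nn e unfolding kT T_def[symmetric] by (simp add: T_def)
    then have dx: "(\<Sum>p\<in>P. (X.CP.gmass n ?x p - w p)\<^sup>2) \<le> Jx * (k * T)"
      using Jx(1) by (intro order_trans[OF Jx(2)[OF simp(1), of cy]] mult_left_mono) auto
    have "X.CP.lyap \<alpha> n ?x \<le> Kx * (X.CP.omass n ?x + X.CP.spread n ?x + (\<Sum>q\<in>P. (X.CP.gmass n ?x q - w q)\<^sup>2))"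
      using e(6) \<alpha> steps(5) by (intro Kx(2)[OF simp(1)]) auto
    also have "\<dots> \<le> Kx * (T + Jx * (k * T))" using dx nn e Kx(1) by (intro mult_left_mono) (auto simp: T_def)
    finally have 1: "X.CP.lyap \<alpha> n ?x \<le> Kx * (1 + Jx * k) * T" by (simp add: algebra_simps)
    have "X.CQ.lyap \<alpha> m ?y \<le> Ky * (X.CQ.omass m ?y + X.CQ.spread m ?y + (\<Sum>q\<in>Q. (X.CQ.gmass m ?y q - v q)\<^sup>2))"
      using e(7) \<alpha> steps(5) by (intro Ky(2)[OF simp(2)]) auto
    also have "\<dots> \<le> Ky * (T + Jy * (k * T))" using dy nn e Ky(1) by (intro mult_left_mono) (auto simp: T_def)
    finally have 2: "X.CQ.lyap \<alpha> m ?y \<le> Ky * (1 + Jy * k) * T" by (simp add: algebra_simps)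
    have "energy \<alpha> n m z' \<le> K * T" using 1 2 by (simp add: energy_def K_def distrib_right)
    then have "\<theta>0 / K * energy \<alpha> n m z' \<le> \<theta>0 / K * (K * T)" using t0 K by (intro mult_left_mono) auto
    then have "\<theta>0 / K * energy \<alpha> n m z' \<le> \<theta>0 * T" using K by simp
    moreover have "\<theta>0 * T \<le> \<eta> * lam / 8 * ?S + \<eta> * c1 * ?O + \<eta>\<^sup>2 / 6 * E + \<eta> * \<sigma> / 16 * D"
      unfolding T_def distrib_left using t0' nn e by (intro add_mono mult_right_mono) auto
    ultimately show "(1 + \<theta>0 / K) * energy \<alpha> n m z' \<le> energy \<alpha> n m z" using e(3) by (simp add: distrib_right)
  qed
qed

end

end

section \<open>Bounding the Wasserstein-Fisher-Rao distance\<close>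

text \<open>Twofold differentiability already makes the first derivatives continuous, and hence
  measurable.\<close>

lemma test_function_measurable:
  assumes "test_function \<psi>"
  shows "\<And>z. (\<lambda>(t, u). \<psi> t (abs_torus u)) differentiable (at z)"
    and "\<And>v. continuous_on UNIV (\<lambda>z. frechet_derivative (\<lambda>(t, u). \<psi> t (abs_torus u)) (at z) v)"
proof -
  let ?\<Psi> = "\<lambda>(t, u). \<psi> t (abs_torus u)"
  have "times_differentiable (Suc (Suc 0)) ?\<Psi>" using assms unfolding test_function_def by blast
  then have d: "\<And>z. ?\<Psi> differentiable (at z)" and d2: "\<And>v z. (\<lambda>x. frechet_derivative ?\<Psi> (at x) v) differentiable (at z)"
    by auto
  show "\<And>z. ?\<Psi> differentiable (at z)" by (rule d)
  show "\<And>v. continuous_on UNIV (\<lambda>z. frechet_derivative ?\<Psi> (at z) v)"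
    using d2 differentiable_imp_continuous_within continuous_on_eq_continuous_within by blast
qed

definition test_deriv :: "(real \<Rightarrow> 'd::finite torus \<Rightarrow> real) \<Rightarrow> real \<Rightarrow> real ^ 'd \<Rightarrow> real \<times> (real ^ 'd) \<Rightarrow> real" where
  "test_deriv \<psi> t u = frechet_derivative (\<lambda>(t, u). \<psi> t (abs_torus u)) (at (t, u))"

lemma test_function_derivatives:
  fixes \<psi> :: "real \<Rightarrow> 'd::finite torus \<Rightarrow> real"
  assumes "test_function \<psi>"
  shows "((\<lambda>(t, u). \<psi> t (abs_torus u)) has_derivative test_deriv \<psi> t u) (at (t, u))"
    and "deriv (\<lambda>s. \<psi> s (abs_torus u)) t = test_deriv \<psi> t u (1, 0)"
    and "torus_grad (\<psi> t) (abs_torus u) = (\<Sum>b\<in>Basis. test_deriv \<psi> t u (0, b) *\<^sub>R b)"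
    and "torus_grad (\<psi> t) (abs_torus u) \<bullet> h = test_deriv \<psi> t u (0, h)"
proof -
  let ?\<Psi> = "\<lambda>(t, u). \<psi> t (abs_torus u)"
  have D: "(?\<Psi> has_derivative test_deriv \<psi> t u) (at (t, u))" for t u
    unfolding test_deriv_def by (rule frechet_derivative_works[THEN iffD1, OF test_function_measurable(1)[OF assms(1)]])
  show "(?\<Psi> has_derivative test_deriv \<psi> t u) (at (t, u))" by (rule D)
  have lin: "linear (test_deriv \<psi> t u)" for t u by (rule has_derivative_linear[OF D])
  have "((\<lambda>s. ?\<Psi> (s, u)) has_derivative (\<lambda>s. test_deriv \<psi> t u (s, 0))) (at t)"
    by (rule has_derivative_compose[where f = "\<lambda>s. (s, u)", OF _ D[of t u]]) (auto intro!: derivative_eq_intros)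
  moreover have "(\<lambda>s. test_deriv \<psi> t u (s, 0)) = (*) (test_deriv \<psi> t u (1, 0))"
  proof
    fix s show "test_deriv \<psi> t u (s, 0) = test_deriv \<psi> t u (1, 0) * s"
      using linear_scale[OF lin, of t u s "(1, 0)"] by (simp only: scaleR_Pair) (simp add: mult.commute)
  qed
  ultimately have "((\<lambda>s. \<psi> s (abs_torus u)) has_real_derivative test_deriv \<psi> t u (1, 0)) (at t)"
    unfolding has_field_derivative_def by simp
  from DERIV_imp_deriv[OF this]
  show "deriv (\<lambda>s. \<psi> s (abs_torus u)) t = test_deriv \<psi> t u (1, 0)" .
  let ?g = "\<Sum>b\<in>Basis. test_deriv \<psi> t u (0, b) *\<^sub>R b"
  have "linear (test_deriv \<psi> t u \<circ> (\<lambda>h. (0, h)))"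
  proof (rule linear_compose[OF _ lin])
    show "linear (\<lambda>h :: real ^ 'd. (0 :: real, h))" by (rule linearI) auto
  qed
  then have lin0: "linear (\<lambda>h. test_deriv \<psi> t u (0, h))" by (simp add: o_def)
  have g: "h \<bullet> ?g = test_deriv \<psi> t u (0, h)" for h by (rule linear_riesz[OF lin0])
  have D0: "(?\<Psi> has_derivative test_deriv \<psi> t u) (at (t, u + 0))" using D by simp
  have "((\<lambda>h. (t, u + h)) has_derivative (\<lambda>h. (0, h))) (at 0)"
    by (intro has_derivative_Pair has_derivative_const) (auto intro!: derivative_eq_intros)
  from has_derivative_compose[OF this D0]
  have "((\<lambda>h. ?\<Psi> (t, u + h)) has_derivative (\<lambda>h. test_deriv \<psi> t u (0, h))) (at 0)" .
  then have "GDERIV (\<lambda>h. \<psi> t (shift (abs_torus u) h)) 0 :> ?g"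
    unfolding gderiv_def shift_abs g by simp
  then show grad: "torus_grad (\<psi> t) (abs_torus u) = ?g" by (rule torus_grad_eq)
  show "torus_grad (\<psi> t) (abs_torus u) \<bullet> h = test_deriv \<psi> t u (0, h)" unfolding grad using g[of h] by (simp add: inner_commute)
qed

lemma test_function_continuous:
  fixes \<psi> :: "real \<Rightarrow> 'd::finite torus \<Rightarrow> real"
  assumes "test_function \<psi>"
  shows "continuous_on UNIV (\<psi> t)" "continuous_on UNIV (\<lambda>x. deriv (\<lambda>s. \<psi> s x) t)" "continuous_on UNIV (torus_grad (\<psi> t))"
proof -
  let ?\<Psi> = "\<lambda>(t, u). \<psi> t (abs_torus u)"
  have "continuous_on UNIV ?\<Psi>"
    using test_function_measurable(1)[OF assms] differentiable_imp_continuous_within continuous_on_eq_continuous_within by blast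
  then have "continuous_on UNIV (\<lambda>u. ?\<Psi> (t, u))"
    by (rule continuous_on_compose2) (auto intro!: continuous_intros)
  then show "continuous_on UNIV (\<psi> t)" unfolding continuous_on_torus_iff[of "\<psi> t"] by simp
  have c: "continuous_on UNIV (\<lambda>u. test_deriv \<psi> t u v)" for v
    unfolding test_deriv_def
    by (rule continuous_on_compose2[OF test_function_measurable(2)[OF assms, of v], where f = "\<lambda>u. (t, u)"])
      (auto intro!: continuous_intros)
  show "continuous_on UNIV (\<lambda>x. deriv (\<lambda>s. \<psi> s x) t)"
    unfolding continuous_on_torus_iff[of "\<lambda>x. deriv (\<lambda>s. \<psi> s x) t"] test_function_derivatives(2)[OF assms] by (rule c)
  show "continuous_on UNIV (torus_grad (\<psi> t))"
    unfolding continuous_on_torus_iff[of "torus_grad (\<psi> t)"] test_function_derivatives(3)[OF assms]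
    by (intro continuous_intros c)
qed

text \<open>Particles moving with constant velocity whose square-root weights are affine in time. If the
  integrand of the weak formulation fails to be integrable, its integral is 0 by convention.\<close>

lemma wfr_particle_path:
  fixes c :: "nat \<Rightarrow> 'd::finite torus" and u :: "nat \<Rightarrow> real ^ 'd" and b s e :: "nat \<Rightarrow> real"
  defines "wt t i \<equiv> b i * ((1 - t) * s i + t * e i)\<^sup>2" and "ps t i \<equiv> shift (c i) ((1 - t) *\<^sub>R u i)"
  assumes b: "\<And>i. i < n \<Longrightarrow> 0 \<le> b i"
    and mv: "(\<lambda>(t, x). v t x) \<in> borel_measurable (borel \<Otimes>\<^sub>M borel)"
    and mr: "(\<lambda>(t, x). r t x) \<in> borel_measurable (borel \<Otimes>\<^sub>M borel)"
    and v: "\<And>t i. i < n \<Longrightarrow> 0 \<le> t \<Longrightarrow> t < 1 \<Longrightarrow> v t (ps t i) = - u i"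
    and r: "\<And>t i. i < n \<Longrightarrow> 0 \<le> t \<Longrightarrow> t < 1 \<Longrightarrow> r t (ps t i) * ((1 - t) * s i + t * e i) = 2 * (e i - s i)"
    and cost: "\<And>t. 0 \<le> t \<Longrightarrow> t < 1 \<Longrightarrow>
       (\<Sum>i<n. wt t i * (\<eta> / (2 * \<sigma>) * (norm (u i))\<^sup>2) + 2 * (b i * (e i - s i)\<^sup>2)) \<le> K"
    and pos: "0 \<le> \<eta>" "0 \<le> \<sigma>"
  shows "WFR2 \<eta> \<sigma> (pmeas {..<n} (wt 0) (ps 0)) (pmeas {..<n} (wt 1) (ps 1)) \<le> ennreal K"
proof -
  define \<mu> where "\<mu> t = pmeas {..<n} (wt t) (ps t)" for t
  have wt: "0 \<le> wt t i" if "i < n" for t i using b[OF that] by (simp add: wt_def)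
  have mv': "v t \<in> borel_measurable borel" and mr': "r t \<in> borel_measurable borel" for t
    using measurable_compose[OF measurable_Pair1' mv, of t] measurable_compose[OF measurable_Pair1' mr, of t] by simp_all
  have int: "(\<integral>x. g x \<partial>\<mu> t) = (\<Sum>i<n. wt t i * g (ps t i))" if "g \<in> borel_measurable borel" for g :: "'d torus \<Rightarrow> real" and t
    unfolding \<mu>_def using integral_pmeas[OF _ _ that, of "{..<n}" "wt t" "ps t"] wt by simp
  have cps: "continuous_on S (\<lambda>t. ps t i)" for S i
    unfolding ps_def by (intro continuous_intros)
  have CE: "continuity_equation \<mu> v r"
    unfolding continuity_equation_def
  proof (intro allI impI)
    fix \<psi> :: "real \<Rightarrow> 'd torus \<Rightarrow> real" assume \<psi>: "test_function \<psi>"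
    note td = test_function_derivatives[OF \<psi>] and tc = test_function_continuous[OF \<psi>]
    define I where "I t = (\<integral>x. deriv (\<lambda>s. \<psi> s x) t + torus_grad (\<psi> t) x \<bullet> v t x + \<psi> t x * r t x \<partial>\<mu> t)" for t
    define W where "W t = (\<Sum>i<n. wt t i * \<psi> t (ps t i))" for t
    have I: "I t = (\<Sum>i<n. wt t i * (deriv (\<lambda>s. \<psi> s (ps t i)) t + torus_grad (\<psi> t) (ps t i) \<bullet> v t (ps t i) + \<psi> t (ps t i) * r t (ps t i)))" for t
    proof -
      have m: "(\<lambda>x. deriv (\<lambda>s. \<psi> s x) t) \<in> borel_measurable borel" "torus_grad (\<psi> t) \<in> borel_measurable borel" "\<psi> t \<in> borel_measurable borel"
        using tc borel_measurable_continuous_onI by blast+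
      have "(\<lambda>x. deriv (\<lambda>s. \<psi> s x) t + torus_grad (\<psi> t) x \<bullet> v t x + \<psi> t x * r t x) \<in> borel_measurable borel"
        by (intro borel_measurable_add borel_measurable_times borel_measurable_inner m mv' mr')
      then show ?thesis unfolding I_def by (rule int)
    qed
    have der: "((\<lambda>t. wt t i * \<psi> t (ps t i)) has_real_derivative
        2 * b i * (e i - s i) * ((1 - t) * s i + t * e i) * \<psi> t (ps t i)
        + wt t i * (deriv (\<lambda>s. \<psi> s (ps t i)) t + torus_grad (\<psi> t) (ps t i) \<bullet> - u i)) (at t)" for t i
    proof -
      obtain a where a: "c i = abs_torus a" using ex_abs_torus by blast
      let ?\<xi> = "\<lambda>t. a + (1 - t) *\<^sub>R u i"
      let ?D = "test_deriv \<psi> t (?\<xi> t)"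
      have pt: "ps t i = abs_torus (?\<xi> t)" for t by (simp add: ps_def a shift_abs)
      have lin: "linear ?D" by (rule has_derivative_linear[OF td(1)])
      have "((\<lambda>t. (t, ?\<xi> t)) has_derivative (\<lambda>h. (h, - h *\<^sub>R u i))) (at t)"
        by (auto intro!: derivative_eq_intros)
      from has_derivative_compose[OF this td(1)]
      have "((\<lambda>t. \<psi> t (ps t i)) has_derivative (\<lambda>h. ?D (h, - h *\<^sub>R u i))) (at t)" by (simp add: pt)
      moreover have "?D (h, - h *\<^sub>R u i) = (?D (1, 0) + ?D (0, - u i)) * h" for h
        using linear_scale[OF lin, of h "(1, - u i)"] linear_add[OF lin, of "(1, 0)" "(0, - u i)"] by (simp add: mult.commute)
      ultimately have d1: "((\<lambda>t. \<psi> t (ps t i)) has_real_derivative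
          deriv (\<lambda>s. \<psi> s (ps t i)) t + torus_grad (\<psi> t) (ps t i) \<bullet> - u i) (at t)"
        unfolding has_field_derivative_def pt td(2) td(4) by simp
      have d2: "((\<lambda>t. wt t i) has_real_derivative 2 * b i * (e i - s i) * ((1 - t) * s i + t * e i)) (at t)"
        unfolding wt_def by (auto intro!: derivative_eq_intros simp: algebra_simps)
      show ?thesis using DERIV_mult[OF d2 d1] by (simp add: algebra_simps)
    qed
    have dW: "(W has_real_derivative I t) (at t)" if t: "0 < t" "t < 1" for t
    proof -
      have "I t = (\<Sum>i<n. 2 * b i * (e i - s i) * ((1 - t) * s i + t * e i) * \<psi> t (ps t i)
        + wt t i * (deriv (\<lambda>s. \<psi> s (ps t i)) t + torus_grad (\<psi> t) (ps t i) \<bullet> - u i))"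
        unfolding I
      proof (rule sum.cong[OF refl])
        fix i assume "i \<in> {..<n}"
        then have i: "i < n" by simp
        let ?q = "(1 - t) * s i + t * e i"
        \<comment> \<open>One factor \<open>?q\<close> is split off the weight, because the
          hypothesis prescribes only the product of the rate and the root weight. No division is
          involved, so a vanishing root does no harm.\<close>
        have "wt t i * (\<psi> t (ps t i) * r t (ps t i)) = b i * ?q * \<psi> t (ps t i) * (r t (ps t i) * ?q)"
          by (simp add: wt_def power2_eq_square)
        also have "\<dots> = 2 * b i * (e i - s i) * ?q * \<psi> t (ps t i)" using r[OF i, of t] t by simp
        finally show "wt t i * (deriv (\<lambda>s. \<psi> s (ps t i)) t + torus_grad (\<psi> t) (ps t i) \<bullet> v t (ps t i) + \<psi> t (ps t i) * r t (ps t i))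
          = 2 * b i * (e i - s i) * ?q * \<psi> t (ps t i) + wt t i * (deriv (\<lambda>s. \<psi> s (ps t i)) t + torus_grad (\<psi> t) (ps t i) \<bullet> - u i)"
          using v[OF i, of t] t by (simp add: distrib_left)
      qed
      then show ?thesis unfolding W_def using DERIV_sum[OF der] by simp
    qed
    obtain t0 t1 where supp: "0 < t0" "t1 < 1" "\<And>t x. t \<notin> {t0..t1} \<Longrightarrow> \<psi> t x = 0"
      using \<psi> unfolding test_function_def by blast
    have W0: "W 0 = 0" "W 1 = 0" using supp by (auto simp: W_def)
    have "continuous_on {0..1} W"
      unfolding W_def using der[THEN DERIV_isCont] by (intro continuous_on_sum continuous_at_imp_continuous_on) auto
    \<comment> \<open>The gauge integral asks for no regularity of \<open>I\<close>; the derivative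
      is known only in the open interval, where the fields are prescribed.\<close>
    then have "(I has_integral (W 1 - W 0)) {0..1}"
      by (intro fundamental_theorem_of_calculus_interior) (use dW in \<open>auto simp: has_real_derivative_iff_has_vector_derivative\<close>)
    then have HK: "integral {0..1} I = 0" using W0 by (simp add: integral_unique)
    have "(LINT t:{0..1}|lborel. I t) = 0"
    proof (cases "set_integrable lborel {0..1} I")
      case True
      then show ?thesis using set_borel_integral_eq_integral(2)[OF True] HK by simp
    next
      case False
      then show ?thesis unfolding set_lebesgue_integral_def set_integrable_def by (simp add: not_integrable_integral_eq)
    qed
    then show "(LINT t:{0..1}|lborel. (\<integral>x. deriv (\<lambda>s. \<psi> s x) t + torus_grad (\<psi> t) x \<bullet> v t x + \<psi> t x * r t x \<partial>\<mu> t)) = 0"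
      by (simp only: I_def)
  qed
  have adm: "wfr_admissible (\<mu> 0) (\<mu> 1) \<mu> v r"
    unfolding wfr_admissible_def
  proof (intro conjI ballI allI impI refl mv mr CE)
    fix t :: real
    show "finite_measure (\<mu> t)" unfolding \<mu>_def using wt by (intro finite_measure_pmeas) auto
    show "sets (\<mu> t) = sets borel" by (simp add: \<mu>_def)
    show "integrable (\<mu> t) (\<lambda>x. (norm (v t x))\<^sup>2)" "integrable (\<mu> t) (\<lambda>x. (r t x)\<^sup>2)"
      unfolding \<mu>_def using mv' mr' by (auto intro!: integrable_pmeas)
  next
    fix \<phi> :: "'d torus \<Rightarrow> real" assume \<phi>: "continuous_on UNIV \<phi>"
    show "continuous_on {0..1} (\<lambda>t. \<integral>x. \<phi> x \<partial>\<mu> t)"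
      unfolding int[OF borel_measurable_continuous_onI[OF \<phi>]] wt_def
      by (intro continuous_intros continuous_on_compose2[OF \<phi> cps]) auto
  qed
  define c where "c t = (\<integral>\<^sup>+ x. ennreal (\<eta> / (2 * \<sigma>) * (norm (v t x))\<^sup>2 + 1 / 2 * (r t x)\<^sup>2) \<partial>\<mu> t)" for t
  have ct: "c t \<le> ennreal K" if t: "0 \<le> t" "t < 1" for t
  proof -
    have "(\<lambda>x. ennreal (\<eta> / (2 * \<sigma>) * (norm (v t x))\<^sup>2 + 1 / 2 * (r t x)\<^sup>2)) \<in> borel_measurable borel"
      using mv'[of t] mr'[of t] by measurable
    then have "c t = (\<Sum>i<n. ennreal (wt t i) * ennreal (\<eta> / (2 * \<sigma>) * (norm (v t (ps t i)))\<^sup>2 + 1 / 2 * (r t (ps t i))\<^sup>2))"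
      unfolding c_def \<mu>_def by (rule nn_integral_pmeas[OF finite_lessThan])
    also have "\<dots> = (\<Sum>i<n. ennreal (wt t i * (\<eta> / (2 * \<sigma>) * (norm (u i))\<^sup>2) + 2 * (b i * (e i - s i)\<^sup>2)))"
    proof (rule sum.cong[OF refl])
      fix i assume "i \<in> {..<n}"
      then have i: "i < n" by simp
      let ?q = "(1 - t) * s i + t * e i"
      have "wt t i * (r t (ps t i))\<^sup>2 = b i * (r t (ps t i) * ?q)\<^sup>2" by (simp add: wt_def power_mult_distrib mult_ac)
      also have "\<dots> = 4 * (b i * (e i - s i)\<^sup>2)" unfolding r[OF i t] by (simp only: power_mult_distrib) simp
      finally have "wt t i * (\<eta> / (2 * \<sigma>) * (norm (v t (ps t i)))\<^sup>2 + 1 / 2 * (r t (ps t i))\<^sup>2)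
          = wt t i * (\<eta> / (2 * \<sigma>) * (norm (u i))\<^sup>2) + 2 * (b i * (e i - s i)\<^sup>2)"
        unfolding v[OF i t] by (simp add: distrib_left)
      moreover have "0 \<le> \<eta> / (2 * \<sigma>) * (norm (v t (ps t i)))\<^sup>2 + 1 / 2 * (r t (ps t i))\<^sup>2" using pos by simp
      ultimately show "ennreal (wt t i) * ennreal (\<eta> / (2 * \<sigma>) * (norm (v t (ps t i)))\<^sup>2 + 1 / 2 * (r t (ps t i))\<^sup>2)
          = ennreal (wt t i * (\<eta> / (2 * \<sigma>) * (norm (u i))\<^sup>2) + 2 * (b i * (e i - s i)\<^sup>2))"
        using wt[OF i, of t] by (simp only: ennreal_mult[symmetric])
    qed
    also have "\<dots> = ennreal (\<Sum>i<n. wt t i * (\<eta> / (2 * \<sigma>) * (norm (u i))\<^sup>2) + 2 * (b i * (e i - s i)\<^sup>2))"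
      using wt b pos by (intro sum_ennreal) auto
    also have "\<dots> \<le> ennreal K" using cost[OF t] by (rule ennreal_leI)
    finally show ?thesis .
  qed
  have "(\<integral>\<^sup>+ t\<in>{0..1}. c t \<partial>lborel) \<le> (\<integral>\<^sup>+ t. ennreal K * indicator {0..1 :: real} t \<partial>lborel)"
  proof -
    have "AE t in lborel. t \<noteq> (1::real)" by (rule AE_lborel_singleton)
    then have "AE t in lborel. c t * indicator {0..1} t \<le> ennreal K * indicator {0..1} t"
      by eventually_elim (use ct in \<open>auto simp: indicator_def\<close>)
    then show ?thesis by (rule nn_integral_mono_AE)
  qed
  also have "\<dots> = ennreal K" by (simp add: nn_integral_cmult_indicator)
  finally have "(\<integral>\<^sup>+ t\<in>{0..1}. c t \<partial>lborel) \<le> ennreal K" .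
  moreover have "WFR2 \<eta> \<sigma> (\<mu> 0) (\<mu> 1) \<le> (\<integral>\<^sup>+ t\<in>{0..1}. c t \<partial>lborel)"
    unfolding WFR2_def c_def by (rule Inf_lower) (use adm in blast)
  ultimately show ?thesis by (simp add: \<mu>_def)
qed

section \<open>Transport of clusters to their centres\<close>

lemma dist_shift_shift:
  assumes "norm (u - u') \<le> 1 / 2" shows "dist (shift q u) (shift q u') = norm (u - u')"
  using dist_shift_eq[of "u' - u" "shift q u"] assms by (simp add: norm_minus_commute)

lemma disp_shift:
  assumes "norm u \<le> 1 / 4" shows "disp q (shift q u) = u"
proof -
  have "norm (disp q (shift q u)) = norm u" using dist_shift_eq[of u q] assms by simp
  then have n: "norm (disp q (shift q u) - u) \<le> 1 / 2"
    using norm_triangle_ineq4[of "disp q (shift q u)" u] assms by simp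
  show ?thesis using dist_shift_shift[OF n, of q] by simp
qed

text \<open>Two displacements of norm at most 1/4 differ by at most 1/2, so \<open>disp q\<close>
  preserves distances on this ball.\<close>

lemma continuous_on_disp: "continuous_on (cball q (1 / 4)) (disp q)"
  unfolding continuous_on_iff
proof (intro ballI allI impI)
  fix x and e :: real assume x: "x \<in> cball q (1 / 4)" and e: "0 < e"
  have "dist (disp q x') (disp q x) = dist x' x" if x': "x' \<in> cball q (1 / 4)" for x'
  proof -
    have "norm (disp q x' - disp q x) \<le> 1 / 2"
      using norm_triangle_ineq4[of "disp q x'" "disp q x"] x x' by simp
    from dist_shift_shift[OF this, of q] show ?thesis by (simp add: dist_norm)
  qed
  then show "\<exists>d>0. \<forall>x'\<in>cball q (1 / 4). dist x' x < d \<longrightarrow> dist (disp q x') (disp q x) < e" using e by auto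
qed

context clusters begin

text \<open>The first term is the transport cost: weights at most double on the way, which cancels
  the 2 in \<open>\<eta> / (2 * \<sigma>)\<close>. The other terms are the costs of moving root
  masses linearly, to the target inside a cluster and to zero outside.\<close>

lemma wfr_bound:
  assumes simplex: "fst z \<in> prob_simplex n" and g: "\<And>q. q \<in> P \<Longrightarrow> w q / 2 \<le> gmass n z q" and pos: "0 < \<eta>" "0 < \<sigma>"
  shows "WFR2 \<eta> \<sigma> (particle_measure n z) (pmeas P w (\<lambda>q. q))
    \<le> ennreal (\<eta> / \<sigma> * spread n z + 2 * (\<Sum>q\<in>P. (sqrt (w q) - sqrt (gmass n z q))\<^sup>2) + 2 * omass n z)"
proof -
  define cl where "cl i = (SOME q. q \<in> P \<and> i \<in> grp n z q)" for i
  have cl: "cl i = q" if "q \<in> P" "i \<in> grp n z q" for i q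
  proof -
    have "cl i \<in> P \<and> i \<in> grp n z (cl i)" unfolding cl_def by (rule someI[of _ q]) (use that in blast)
    then show ?thesis using grp_disjoint[of "cl i" q n z] that by blast
  qed
  let ?o = "\<lambda>i. i \<in> outer n z"
  have cases: thesis if i: "i < n" and o: "?o i \<Longrightarrow> thesis"
    and g: "\<And>q. q \<in> P \<Longrightarrow> i \<in> grp n z q \<Longrightarrow> \<not> ?o i \<Longrightarrow> cl i = q \<Longrightarrow> thesis" for i thesis
  proof (cases "?o i")
    case False
    then obtain q where "q \<in> P" "i \<in> grp n z q" using i by (auto simp: outer_def grp_def not_less)
    then show thesis using g False cl by blast
  qed (rule o)
  have gp: "0 < gmass n z q" if "q \<in> P" for q using g[OF that] w_pos[OF that] by simp
  note a0 = fst_nonneg[OF simplex]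
  define c where "c i = (if ?o i then snd z i else cl i)" for i
  define u where "u i = (if ?o i then 0 else disp (cl i) (snd z i))" for i
  \<comment> \<open>Inside a cluster \<open>b\<close> is the particle's share of the cluster mass,
    whose root moves from \<open>s\<close> to \<open>e\<close>. Outside, the particle stays where it
    is and its weight is scaled by a root that falls from 1 to 0.\<close>
  define b where "b i = (if ?o i then fst z i else fst z i / gmass n z (cl i))" for i
  define s where "s i = (if ?o i then 1 else sqrt (gmass n z (cl i)))" for i
  define e where "e i = (if ?o i then 0 else sqrt (w (cl i)))" for i
  define wt where "wt = (\<lambda>t i. b i * ((1 - t) * s i + t * e i)\<^sup>2)"
  define ps where "ps = (\<lambda>t i. shift (c i) ((1 - t) *\<^sub>R u i))"
  define sq where "sq q t = (1 - t) * sqrt (gmass n z q) + t * sqrt (w q)" for q t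
  define Z where "Z = - (\<Union>q\<in>P. cball q R)"
  \<comment> \<open>The fields have to be functions of time and place, not of the particle. In a
    cluster displacements shrink like \<open>1 - t\<close>, so the velocity is the present
    displacement over \<open>1 - t\<close>, reversed; the rate is twice the logarithmic derivative
    of the root mass, outside the clusters \<open>- 2 / (1 - t)\<close>.\<close>
  define v where "v t x = (\<Sum>q\<in>P. (- 1 / (1 - t)) *\<^sub>R (indicator (cball q R) x *\<^sub>R disp q x))" for t x
  define r where "r t x = (\<Sum>q\<in>P. indicator (cball q R) x * (2 * (sqrt (w q) - sqrt (gmass n z q)) / sq q t)) + indicator Z x * (- 2 / (1 - t))" for t x
  have Zs: "Z \<in> sets borel"
  proof -
    have "closed (\<Union>q\<in>P. cball q R)" using fin by (intro closed_UN) auto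
    then have "open Z" unfolding Z_def by (rule open_Compl)
    then show ?thesis by simp
  qed
  have R4: "R \<le> 1 / 4" using R_le by simp
  have other: "x \<notin> cball q' R" if "q \<in> P" "q' \<in> P" "q \<noteq> q'" "dist q x \<le> R" for q q' x
    using separated[OF that(1-3)] dist_triangle2[of q q' x] that(4) by auto
  have in_ball: "v t x = (- 1 / (1 - t)) *\<^sub>R disp q x \<and> r t x = 2 * (sqrt (w q) - sqrt (gmass n z q)) / sq q t"
    if q: "q \<in> P" "dist q x \<le> R" for q x t
  proof -
    have ind: "indicator (cball q' R) x = (if q' = q then 1 else 0 :: real)" if "q' \<in> P" for q'
      using other[OF q(1) that _ q(2)] q(2) by (auto simp: indicator_def)
    have "v t x = (\<Sum>q'\<in>P. if q' = q then (- 1 / (1 - t)) *\<^sub>R disp q x else 0)"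
      unfolding v_def by (rule sum.cong[OF refl]) (simp add: ind)
    moreover have "(\<Sum>q'\<in>P. indicator (cball q' R) x * (2 * (sqrt (w q') - sqrt (gmass n z q')) / sq q' t))
       = (\<Sum>q'\<in>P. if q' = q then 2 * (sqrt (w q) - sqrt (gmass n z q)) / sq q t else 0)"
      by (rule sum.cong[OF refl]) (simp add: ind)
    moreover have "x \<notin> Z" using q by (auto simp: Z_def)
    ultimately show ?thesis using q(1) fin unfolding r_def by simp
  qed
  have out_ball: "v t x = 0 \<and> r t x = - 2 / (1 - t)" if "\<And>q. q \<in> P \<Longrightarrow> R < dist q x" for x t
  proof -
    have "indicator (cball q R) x = (0 :: real)" if "q \<in> P" for q using \<open>\<And>q. q \<in> P \<Longrightarrow> R < dist q x\<close>[OF that] by (simp add: indicator_def)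
    moreover have "x \<in> Z" using that by (auto simp: Z_def not_le)
    ultimately show ?thesis by (simp add: v_def r_def)
  qed
  have sqp: "0 < sq q t" if "q \<in> P" "0 \<le> t" "t < 1" for q t
    using gp[OF that(1)] w_pos[OF that(1)] that by (simp add: sq_def add_pos_nonneg)
  have path: "WFR2 \<eta> \<sigma> (pmeas {..<n} (wt 0) (ps 0)) (pmeas {..<n} (wt 1) (ps 1))
    \<le> ennreal (\<eta> / \<sigma> * spread n z + 2 * (\<Sum>q\<in>P. (sqrt (w q) - sqrt (gmass n z q))\<^sup>2) + 2 * omass n z)"
    unfolding wt_def ps_def
  proof (rule wfr_particle_path)
    show "0 \<le> b i" if "i < n" for i
      by (rule cases[OF that]) (use a0[OF that] gp in \<open>auto simp: b_def less_imp_le\<close>)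
    show "(\<lambda>(t, x). v t x) \<in> borel_measurable (borel \<Otimes>\<^sub>M borel)"
    proof -
      have [measurable]: "(\<lambda>x. indicator (cball q R) x *\<^sub>R disp q x) \<in> borel_measurable borel" for q
        by (rule borel_measurable_continuous_on_indicator) (use R4 in \<open>auto intro: continuous_on_subset[OF continuous_on_disp]\<close>)
      show ?thesis unfolding v_def by measurable
    qed
    show "(\<lambda>(t, x). r t x) \<in> borel_measurable (borel \<Otimes>\<^sub>M borel)"
    proof -
      note Zs[measurable]
      have [measurable]: "cball q R \<in> sets borel" for q by simp
      show ?thesis unfolding r_def sq_def by measurable
    qed
  next
    fix t :: real and i assume i: "i < n" and t: "0 \<le> t" "t < 1"
    let ?x = "shift (c i) ((1 - t) *\<^sub>R u i)"
    have "v t ?x = - u i \<and> r t ?x * ((1 - t) * s i + t * e i) = 2 * (e i - s i)"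
    proof (rule cases[OF i])
      assume o: "?o i"
      then have "v t (snd z i) = 0" "r t (snd z i) = - 2 / (1 - t)" using out_ball[of "snd z i" t] by (auto simp: outer_def)
      moreover have "1 - t \<noteq> 0" using t by simp
      then have "- 2 / (1 - t) * (1 - t) = - 2" by (metis nonzero_mult_div_cancel_right times_divide_eq_left)
      ultimately show ?thesis using o by (simp add: c_def u_def s_def e_def)
    next
      fix q assume q: "q \<in> P" "i \<in> grp n z q" "\<not> ?o i" "cl i = q"
      let ?d = "disp q (snd z i)"
      have "norm ?d \<le> R" using q(2) by (simp add: grp_def)
      then have n: "norm ((1 - t) *\<^sub>R ?d) \<le> R" using t mult_mono[of "1 - t" 1 "norm ?d" R] by simp
      have x: "?x = shift q ((1 - t) *\<^sub>R ?d)" using q by (simp add: c_def u_def)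
      have dx: "disp q ?x = (1 - t) *\<^sub>R ?d" unfolding x by (rule disp_shift) (use n R4 in linarith)
      have "dist q ?x \<le> R" using n dx norm_disp[of q ?x] by simp
      from in_ball[OF q(1) this, of t] show ?thesis
        using q dx t sqp[OF q(1) t] by (simp add: u_def s_def e_def sq_def)
    qed
    then show "v t ?x = - u i" "r t ?x * ((1 - t) * s i + t * e i) = 2 * (e i - s i)" by auto
  next
    fix t :: real assume t: "0 \<le> t" "t < 1"
    let ?c = "\<lambda>i. b i * ((1 - t) * s i + t * e i)\<^sup>2 * (\<eta> / (2 * \<sigma>) * (norm (u i))\<^sup>2) + 2 * (b i * (e i - s i)\<^sup>2)"
    have gr: "(\<Sum>i\<in>grp n z q. ?c i) \<le> \<eta> / \<sigma> * gspread n z q + 2 * (sqrt (w q) - sqrt (gmass n z q))\<^sup>2" if q: "q \<in> P" for q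
    proof -
      have G: "0 < gmass n z q" by (rule gp[OF q])
      \<comment> \<open>Both ends of the interpolation are at most the root of twice the initial
        cluster mass, since \<open>w q \<le> 2 * gmass n z q\<close>.\<close>
      have sq2: "(sq q t)\<^sup>2 \<le> 2 * gmass n z q"
      proof -
        have "sqrt (w q) \<le> sqrt (2 * gmass n z q)" using g[OF q] by simp
        moreover have "sqrt (gmass n z q) \<le> sqrt (2 * gmass n z q)" using G by simp
        ultimately have "sq q t \<le> (1 - t) * sqrt (2 * gmass n z q) + t * sqrt (2 * gmass n z q)"
          unfolding sq_def using t by (intro add_mono mult_left_mono) auto
        then have "sq q t \<le> sqrt (2 * gmass n z q)" by (simp add: algebra_simps)
        then have "(sq q t)\<^sup>2 \<le> (sqrt (2 * gmass n z q))\<^sup>2" using sqp[OF q t] by (intro power_mono) auto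
        then show ?thesis using G by simp
      qed
      have "?c i \<le> \<eta> / \<sigma> * (fst z i * (dist q (snd z i))\<^sup>2) + fst z i * (2 / gmass n z q * (sqrt (w q) - sqrt (gmass n z q))\<^sup>2)"
        if i: "i \<in> grp n z q" for i
      proof -
        have i': "i < n" "\<not> ?o i" using i q by (auto simp: grp_def outer_def not_less)
        have cq: "cl i = q" by (rule cl[OF q i])
        have "fst z i / gmass n z q * (sq q t)\<^sup>2 \<le> fst z i / gmass n z q * (2 * gmass n z q)"
          using sq2 a0[OF i'(1)] G by (intro mult_left_mono) auto
        also have "\<dots> = 2 * fst z i" using G by simp
        finally have "fst z i / gmass n z q * (sq q t)\<^sup>2 * (\<eta> / (2 * \<sigma>) * (dist q (snd z i))\<^sup>2)
            \<le> 2 * fst z i * (\<eta> / (2 * \<sigma>) * (dist q (snd z i))\<^sup>2)"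
          using pos by (intro mult_right_mono) auto
        also have "\<dots> = \<eta> / \<sigma> * (fst z i * (dist q (snd z i))\<^sup>2)" by simp
        finally show ?thesis using i' cq by (simp add: b_def s_def e_def u_def sq_def)
      qed
      then have "(\<Sum>i\<in>grp n z q. ?c i) \<le> (\<Sum>i\<in>grp n z q. \<eta> / \<sigma> * (fst z i * (dist q (snd z i))\<^sup>2)
          + fst z i * (2 / gmass n z q * (sqrt (w q) - sqrt (gmass n z q))\<^sup>2))" by (rule sum_mono)
      also have "\<dots> = \<eta> / \<sigma> * gspread n z q + gmass n z q * (2 / gmass n z q * (sqrt (w q) - sqrt (gmass n z q))\<^sup>2)"
        unfolding sum.distrib sum_distrib_left[symmetric] sum_distrib_right[symmetric] gspread_def gmass_def ..
      finally show ?thesis using G by simp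
    qed
    have ou: "?c i \<le> 2 * fst z i" if "i \<in> outer n z" for i
      using that by (simp add: b_def s_def e_def u_def)
    have "(\<Sum>i<n. ?c i) = (\<Sum>q\<in>P. \<Sum>i\<in>grp n z q. ?c i) + (\<Sum>i\<in>outer n z. ?c i)" by (rule sum_split_groups)
    also have "\<dots> \<le> (\<Sum>q\<in>P. \<eta> / \<sigma> * gspread n z q + 2 * (sqrt (w q) - sqrt (gmass n z q))\<^sup>2) + (\<Sum>i\<in>outer n z. 2 * fst z i)"
      by (intro add_mono sum_mono gr ou)
    also have "\<dots> = \<eta> / \<sigma> * spread n z + 2 * (\<Sum>q\<in>P. (sqrt (w q) - sqrt (gmass n z q))\<^sup>2) + 2 * omass n z"
      unfolding sum.distrib sum_distrib_left[symmetric] by (simp add: omass_def spread_eq[OF simplex])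
    finally show "(\<Sum>i<n. ?c i) \<le> \<eta> / \<sigma> * spread n z + 2 * (\<Sum>q\<in>P. (sqrt (w q) - sqrt (gmass n z q))\<^sup>2) + 2 * omass n z" .
  qed (use pos in auto)
  have wtn: "0 \<le> wt t i" if "i < n" for t i
    by (rule cases[OF that]) (use a0[OF that] gp in \<open>auto simp: wt_def b_def less_imp_le\<close>)
  have "pmeas {..<n} (wt 0) (ps 0) = particle_measure n z"
    unfolding particle_measure_pmeas
  proof (rule pmeas_cong)
    fix i assume "i \<in> {..<n}"
    then have i: "i < n" by simp
    show "0 \<le> wt 0 i" by (rule wtn[OF i])
    show "wt 0 i = fst z i"
      by (rule cases[OF i]) (use gp in \<open>auto simp: wt_def b_def s_def e_def less_imp_le less_imp_neq[symmetric]\<close>)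
    show "ps 0 i = snd z i" by (rule cases[OF i]) (auto simp: ps_def c_def u_def)
  qed simp
  moreover have "pmeas {..<n} (wt 1) (ps 1) = pmeas P w (\<lambda>q. q)"
  proof (rule measure_eqI)
    fix A assume "A \<in> sets (pmeas {..<n} (wt 1) (ps 1))"
    then have A: "A \<in> sets borel" by simp
    have "(\<Sum>i<n. if ps 1 i \<in> A then wt 1 i else 0) = (\<Sum>q\<in>P. \<Sum>i\<in>grp n z q. if ps 1 i \<in> A then wt 1 i else 0)
        + (\<Sum>i\<in>outer n z. if ps 1 i \<in> A then wt 1 i else 0)" by (rule sum_split_groups)
    also have "(\<Sum>i\<in>outer n z. if ps 1 i \<in> A then wt 1 i else 0) = 0"
      by (rule sum.neutral) (simp add: wt_def e_def)
    also have "(\<Sum>q\<in>P. \<Sum>i\<in>grp n z q. if ps 1 i \<in> A then wt 1 i else 0) = (\<Sum>q\<in>P. if q \<in> A then w q else 0)"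
    proof (rule sum.cong[OF refl])
      fix q assume q: "q \<in> P"
      have "(\<Sum>i\<in>grp n z q. if ps 1 i \<in> A then wt 1 i else 0) = (\<Sum>i\<in>grp n z q. fst z i * (if q \<in> A then w q / gmass n z q else 0))"
      proof (rule sum.cong[OF refl])
        fix i assume i: "i \<in> grp n z q"
        then have "\<not> ?o i" using q by (auto simp: grp_def outer_def not_less)
        then show "(if ps 1 i \<in> A then wt 1 i else 0) = fst z i * (if q \<in> A then w q / gmass n z q else 0)"
          using cl[OF q i] w_pos[OF q] by (simp add: ps_def wt_def c_def b_def e_def)
      qed
      also have "\<dots> = gmass n z q * (if q \<in> A then w q / gmass n z q else 0)"
        unfolding gmass_def sum_distrib_right ..
      finally show "(\<Sum>i\<in>grp n z q. if ps 1 i \<in> A then wt 1 i else 0) = (if q \<in> A then w q else 0)"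
        using gp[OF q] by simp
    qed
    finally have "(\<Sum>i<n. if ps 1 i \<in> A then wt 1 i else 0) = (\<Sum>q\<in>P. if q \<in> A then w q else 0)" by simp
    moreover have "emeasure (pmeas {..<n} (wt 1) (ps 1)) A = ennreal (\<Sum>i<n. if ps 1 i \<in> A then wt 1 i else 0)"
      by (rule emeasure_pmeas) (use wtn A in auto)
    moreover have "emeasure (pmeas P w (\<lambda>q. q)) A = ennreal (\<Sum>q\<in>P. if q \<in> A then w q else 0)"
      by (rule emeasure_pmeas) (use fin w_pos A in \<open>auto simp: less_imp_le\<close>)
    ultimately show "emeasure (pmeas {..<n} (wt 1) (ps 1)) A = emeasure (pmeas P w (\<lambda>q. q)) A" by simp
  qed simp
  ultimately show ?thesis using path by simp
qed

lemma wfr_lyap: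
  fixes V W :: real
  assumes simplex: "fst z \<in> prob_simplex n" and kpos: "\<And>q. q \<in> P \<Longrightarrow> 0 < kmass (\<eta> / \<sigma>) n z q"
    and pos: "0 < \<eta>" "0 < \<sigma>" and V: "lyap (\<eta> / \<sigma>) n z \<le> V" "V \<le> 1" and W: "\<And>q. q \<in> P \<Longrightarrow> W \<le> w q" "3 * sqrt V \<le> W / 2"
  shows "WFR2 \<eta> \<sigma> (particle_measure n z) (pmeas P w (\<lambda>q. q)) \<le> ennreal ((4 + 8 * card P) * V)"
proof -
  let ?\<alpha> = "\<eta> / \<sigma>"
  have \<alpha>: "0 < ?\<alpha>" using pos by simp
  note lc = lyap_controls[OF simplex kpos \<alpha> V]
  have g: "w q / 2 \<le> gmass n z q" if "q \<in> P" for q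
    using lyap_controls(6)[OF simplex kpos \<alpha> V that] W(1)[OF that] W(2) by (simp add: abs_le_iff)
  have sp: "?\<alpha> * spread n z \<le> 2 * V" 
  proof -
    have "a * (2 / a * V) = 2 * V" if "0 < a" for a :: real using that by simp
    then show ?thesis using mult_left_mono[OF lc(2), of ?\<alpha>] \<alpha> by (metis less_imp_le)
  qed
  have root: "(sqrt (w q) - sqrt (gmass n z q))\<^sup>2 \<le> 4 * V" if q: "q \<in> P" for q
  proof -
    let ?k = "kmass ?\<alpha> n z q" and ?g = "gmass n z q"
    have gs: "0 \<le> ?\<alpha> * gspread n z q" using gspread_nonneg[OF simplex] \<alpha> by (intro mult_nonneg_nonneg) auto
    have kg: "?k \<le> ?g" "?g - ?k \<le> V"
    proof -
      have "?\<alpha> * gspread n z q \<le> ?\<alpha> * spread n z" using gspread_le[OF simplex q] \<alpha> by (intro mult_left_mono) auto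
      then show "?k \<le> ?g" "?g - ?k \<le> V" using gs sp unfolding kmass_eq by simp_all
    qed
    have k0: "0 < ?k" by (rule kpos[OF q])
    have "(sqrt ?g - sqrt ?k)\<^sup>2 \<le> ?g - ?k"
    proof -
      have "sqrt ?k * sqrt ?k \<le> sqrt ?g * sqrt ?k" using kg k0 by (intro mult_right_mono) auto
      then show ?thesis using k0 kg by (simp add: power2_diff)
    qed
    then have 1: "(sqrt ?g - sqrt ?k)\<^sup>2 \<le> V" using kg by linarith
    have sqi: "(a - b)\<^sup>2 \<le> 2 * (c - b)\<^sup>2 + 2 * (a - c)\<^sup>2" for a b c :: real
      using zero_le_power2[of "(a - c) - (c - b)"] by (simp add: power2_eq_square algebra_simps)
    show ?thesis using sqi[of "sqrt ?g" "sqrt (w q)" "sqrt ?k"] 1 lyap_controls(4)[OF simplex kpos \<alpha> V q] by (simp add: power2_commute[of "sqrt (w q)"])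
  qed
  \<comment> \<open>The final constant: 2 from the spread, 2 from the outside mass, and 2 times 4
    from each cluster.\<close>
  have "(\<Sum>q\<in>P. (sqrt (w q) - sqrt (gmass n z q))\<^sup>2) \<le> card P * (4 * V)" by (intro sum_bounded_above root)
  then have "\<eta> / \<sigma> * spread n z + 2 * (\<Sum>q\<in>P. (sqrt (w q) - sqrt (gmass n z q))\<^sup>2) + 2 * omass n z \<le> (4 + 8 * card P) * V"
    using sp lc(1) by (simp add: algebra_simps)
  then show ?thesis using wfr_bound[OF simplex g pos] by (meson ennreal_leI order_trans)
qed

end

section \<open>From the game to the contraction setting\<close>

lemma smooth_payoff_mono:
  assumes "smooth_payoff f gx hx L" "L \<le> L'" shows "smooth_payoff f gx hx L'"
proof -
  interpret smooth_payoff f gx hx L by fact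
  have up: "c \<le> L' * d" if "c \<le> L * d" "0 \<le> d" for c d
    using that mult_right_mono[OF assms(2), of d] by linarith
  show ?thesis
  proof
    show "0 < L'" using L_pos assms(2) by simp
    show "twice_diff (\<lambda>x. f x y) (\<lambda>x. gx x y) (\<lambda>x. hx x y)" for y by (rule td)
    show "\<bar>f x y\<bar> \<le> L'" for x y using f_bound[of x y] assms(2) by simp
    show "norm (gx x y) \<le> L'" for x y using gx_bound[of x y] assms(2) by simp
    show "\<bar>f x y - f x' y'\<bar> \<le> L' * (dist x x' + dist y y')" for x x' y y' by (rule up[OF f_lip]) simp
    show "norm (gx x y - gx x' y') \<le> L' * (dist x x' + dist y y')" for x x' y y' by (rule up[OF gx_lip]) simp
    show "\<bar>u \<bullet> hx x y u\<bar> \<le> L' * (norm u)\<^sup>2" for x y u by (rule up[OF hx_bound]) simp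
    show "\<bar>u \<bullet> hx x y u - u \<bullet> hx x' y' u\<bar> \<le> L' * (dist x x' + dist y y') * (norm u)\<^sup>2" for x x' y y' u
      using up[of _ "(dist x x' + dist y y') * (norm u)\<^sup>2"] hx_lip[of u x y x' y'] by (simp add: mult.assoc)
  qed
qed

text \<open>Complementary slackness: an average equal to \<open>\<rho>\<close> of values on one side
  of \<open>\<rho>\<close> forces equality at every atom. Hence weights on \<open>supp \<nu>\<close>
  that keep all payoffs above \<open>\<rho>\<close> form an equilibrium with \<open>\<mu>\<close>,
  and uniqueness of the equilibrium becomes uniqueness of these weights.\<close>

lemma game_side_of_MNE:
  assumes smooth: "smooth_payoff f gx hx L" and MNE: "is_MNE f \<mu> \<nu>"
    and uniq: "\<And>\<mu>' \<nu>'. is_MNE f \<mu>' \<nu>' \<Longrightarrow> \<nu>' = \<nu>"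
    and fin: "finite (supp \<mu>)" "finite (supp \<nu>)"
    and val: "\<And>x. (\<integral>y. f x y \<partial>\<nu>) = payoff f \<mu> \<nu> \<Longrightarrow> x \<in> supp \<mu>"
    and hess: "\<And>x u. x \<in> supp \<mu> \<Longrightarrow> u \<noteq> 0 \<Longrightarrow> 0 < u \<bullet> (\<Sum>q\<in>supp \<nu>. measure \<nu> {q} *\<^sub>R hx x q u)"
  shows "game_side f gx hx L (supp \<mu>) (\<lambda>p. measure \<mu> {p}) (supp \<nu>) (\<lambda>q. measure \<nu> {q}) (payoff f \<mu> \<nu>)"
proof -
  interpret smooth_payoff f gx hx L by fact
  interpret C: continuous_payoff f L by (rule continuous_payoff)
  let ?P = "supp \<mu>" and ?Q = "supp \<nu>" and ?w = "\<lambda>p. measure \<mu> {p}" and ?v = "\<lambda>q. measure \<nu> {q}" and ?\<rho> = "payoff f \<mu> \<nu>"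
  have pr: "\<mu> \<in> prob_measures" "\<nu> \<in> prob_measures" and le: "\<And>y. (\<integral>x. f x y \<partial>\<mu>) \<le> ?\<rho>" and ge: "\<And>x. ?\<rho> \<le> (\<integral>y. f x y \<partial>\<nu>)"
    using MNE unfolding C.is_MNE_iff by auto
  note dm = finite_supp_decompose[OF pr(1) fin(1)] and dn = finite_supp_decompose[OF pr(2) fin(2)]
  have wn: "\<And>p. p \<in> ?P \<Longrightarrow> 0 \<le> ?w p" and vn: "\<And>q. q \<in> ?Q \<Longrightarrow> 0 \<le> ?v q" by simp_all
  have im: "(\<integral>x. f x y \<partial>\<mu>) = (\<Sum>p\<in>?P. ?w p * f p y)" for y
    using C.integral_pmeas_fst[OF fin(1), where w = ?w and y = y and X = "\<lambda>p. p"] unfolding dm(1)[symmetric] by simp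
  have in': "(\<integral>y. f x y \<partial>\<nu>) = (\<Sum>q\<in>?Q. ?v q * f x q)" for x
    using C.integral_pmeas_snd[OF fin(2), where w = ?v and x = x and X = "\<lambda>q. q"] unfolding dn(1)[symmetric] by simp
  have pay: "payoff f \<mu> (pmeas ?Q v (\<lambda>q. q)) = (\<Sum>q\<in>?Q. v q * (\<integral>x. f x q \<partial>\<mu>))" if "\<And>q. q \<in> ?Q \<Longrightarrow> 0 \<le> v q" for v
  proof -
    have "(\<lambda>y. \<integral>x. f x y \<partial>\<mu>) \<in> borel_measurable borel"
      unfolding im using borel_measurable_continuous_onI[OF C.continuous_snd] by measurable
    then show ?thesis unfolding payoff_def using integral_pmeas[OF fin(2) that, where g = "\<lambda>y. \<integral>x. f x y \<partial>\<mu>" and X = "\<lambda>q. q"] by simp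
  qed
  have rQ: "?\<rho> = (\<Sum>q\<in>?Q. ?v q * (\<integral>x. f x q \<partial>\<mu>))" using pay[of ?v] dn(1) by simp
  then have rP: "?\<rho> = (\<Sum>p\<in>?P. ?w p * (\<integral>y. f p y \<partial>\<nu>))"
    unfolding im in' sum_distrib_left by (subst (asm) sum.swap) (simp add: mult_ac)
  have eqQ: "(\<integral>x. f x q \<partial>\<mu>) = ?\<rho>" if q: "q \<in> ?Q" for q
  proof -
    have "(\<Sum>q\<in>?Q. ?v q * (?\<rho> - (\<integral>x. f x q \<partial>\<mu>))) = 0"
      using dn(3) rQ by (simp add: right_diff_distrib sum_subtractf flip: sum_distrib_right)
    moreover have "\<And>q. q \<in> ?Q \<Longrightarrow> 0 \<le> ?v q * (?\<rho> - (\<integral>x. f x q \<partial>\<mu>))" using le by (intro mult_nonneg_nonneg) auto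
    ultimately have "?v q * (?\<rho> - (\<integral>x. f x q \<partial>\<mu>)) = 0" using q fin(2) by (simp add: sum_nonneg_eq_0_iff)
    then show ?thesis using dn(2)[OF q] by simp
  qed
  have eqP: "(\<integral>y. f p y \<partial>\<nu>) = ?\<rho>" if p: "p \<in> ?P" for p
  proof -
    have "(\<Sum>p\<in>?P. ?w p * ((\<integral>y. f p y \<partial>\<nu>) - ?\<rho>)) = 0"
      using dm(3) rP by (simp add: right_diff_distrib sum_subtractf flip: sum_distrib_right)
    moreover have "\<And>p. p \<in> ?P \<Longrightarrow> 0 \<le> ?w p * ((\<integral>y. f p y \<partial>\<nu>) - ?\<rho>)" using ge by (intro mult_nonneg_nonneg) auto
    ultimately have "?w p * ((\<integral>y. f p y \<partial>\<nu>) - ?\<rho>) = 0" using p fin(1) by (simp add: sum_nonneg_eq_0_iff)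
    then show ?thesis using dm(2)[OF p] by simp
  qed
  show ?thesis
  proof
    show "(\<Sum>q\<in>?Q. ?v q * f x q) = ?\<rho> \<longleftrightarrow> x \<in> ?P" for x using val[of x] eqP[of x] unfolding in' by blast
    fix v' q assume v': "\<And>q. q \<in> ?Q \<Longrightarrow> 0 \<le> v' q" "(\<Sum>q\<in>?Q. v' q) = 1" "\<And>x. ?\<rho> \<le> (\<Sum>q\<in>?Q. v' q * f x q)" and q: "q \<in> ?Q"
    let ?\<nu> = "pmeas ?Q v' (\<lambda>q. q)"
    have "payoff f \<mu> ?\<nu> = (\<Sum>q\<in>?Q. v' q * (\<integral>x. f x q \<partial>\<mu>))" by (rule pay) (rule v'(1))
    also have "\<dots> = (\<Sum>q\<in>?Q. v' q * ?\<rho>)" using eqQ by (intro sum.cong) auto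
    finally have "payoff f \<mu> ?\<nu> = ?\<rho>" using v'(2) by (simp flip: sum_distrib_right)
    then have "is_MNE f \<mu> ?\<nu>"
      unfolding C.is_MNE_iff using pr(1) pmeas_prob[OF fin(2) v'(1,2), where X = "\<lambda>q. q"] le v'(3)
      by (simp add: C.integral_pmeas_snd[OF fin(2) v'(1)])
    then have "?\<nu> = \<nu>" by (rule uniq)
    moreover have "measure ?\<nu> {q} = v' q"
      using measure_pmeas[OF fin(2) v'(1), where A = "{q}" and X = "\<lambda>q. q"] q fin(2) by simp
    ultimately show "v' q = ?v q" by simp
  qed (use fin dm(2,3) dn(2,3) ge eqQ hess in \<open>auto simp flip: im in'\<close>)
qed

lemma finite_separated:
  fixes P :: "'a::metric_space set"
  assumes "finite P" obtains d where "0 < d" "\<And>p p'. p \<in> P \<Longrightarrow> p' \<in> P \<Longrightarrow> p \<noteq> p' \<Longrightarrow> d \<le> dist p p'"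
proof -
  let ?D = "insert 1 ((\<lambda>(p, p'). dist p p') ` {(p, p') \<in> P \<times> P. p \<noteq> p'})"
  have f: "finite ?D" using finite_subset[of "{(p, p') \<in> P \<times> P. p \<noteq> p'}" "P \<times> P"] assms by auto
  show thesis
  proof (rule that[of "Min ?D"])
    show "0 < Min ?D" using f by (subst Min_gr_iff) auto
    show "Min ?D \<le> dist p p'" if "p \<in> P" "p' \<in> P" "p \<noteq> p'" for p p'
      by (rule Min_le[OF f]) (use that in force)
  qed
qed

section \<open>Narrow convergence\<close>

context clusters begin

text \<open>A continuous \<open>\<phi>\<close> need not be Lipschitz, so
  \<open>target_approx\<close> does not apply. Uniform continuity still bounds its increments by
  \<open>e\<close> plus a multiple of the squared distance, which matches the spread.\<close>

lemma narrow_lyap: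
  fixes \<phi> :: "'d torus \<Rightarrow> real"
  assumes \<phi>: "continuous_on UNIV \<phi>" and \<alpha>: "0 < \<alpha>" and e: "0 < e"
  shows "\<exists>C\<ge>0. \<forall>n z V. fst z \<in> prob_simplex n \<and> (\<forall>q\<in>P. 0 < kmass \<alpha> n z q) \<and> lyap \<alpha> n z \<le> V \<and> V \<le> 1 \<longrightarrow>
     \<bar>(\<integral>x. \<phi> x \<partial>particle_measure n z) - (\<integral>x. \<phi> x \<partial>pmeas P w (\<lambda>q. q))\<bar> \<le> e + C * sqrt V"
proof -
  obtain B where B: "\<And>x. \<bar>\<phi> x\<bar> \<le> B"
    using compact_imp_bounded[OF compact_continuous_image[OF \<phi> compact_torus]] unfolding bounded_iff by auto
  have B0: "0 \<le> B" using B[of undefined] by linarith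
  obtain d where d: "0 < d" "\<And>x y. dist x y < d \<Longrightarrow> \<bar>\<phi> x - \<phi> y\<bar> < e"
    using compact_uniformly_continuous[OF \<phi> compact_torus] e unfolding uniformly_continuous_on_def dist_real_def by auto
  let ?c = "2 * B / d\<^sup>2"
  have c0: "0 \<le> ?c" using B0 by simp
  have local: "\<bar>\<phi> x - \<phi> y\<bar> \<le> e + ?c * (dist y x)\<^sup>2" for x y
  proof (cases "dist x y < d")
    case True
    then show ?thesis using d(2)[of x y] c0 by (smt (verit) mult_nonneg_nonneg zero_le_power2)
  next
    case False
    then have "d\<^sup>2 \<le> (dist y x)\<^sup>2" using d(1) by (intro power_mono) (auto simp: dist_commute)
    then have "?c * d\<^sup>2 \<le> ?c * (dist y x)\<^sup>2" using c0 by (intro mult_left_mono)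
    then show ?thesis using B[of x] B[of y] e d(1) by simp
  qed
  let ?C = "?c * (2 / \<alpha>) + B + 3 * B * card P"
  show ?thesis
  proof (intro exI[of _ ?C] conjI allI impI; (elim conjE)?)
    show "0 \<le> ?C" using c0 \<alpha> B0 by simp
    fix n V and z :: "'d particles"
    assume z: "fst z \<in> prob_simplex n" and k: "\<forall>q\<in>P. 0 < kmass \<alpha> n z q" and V: "lyap \<alpha> n z \<le> V" "V \<le> 1"
    have k': "\<And>q. q \<in> P \<Longrightarrow> 0 < kmass \<alpha> n z q" using k by blast
    have lc: "omass n z \<le> V" "spread n z \<le> 2 / \<alpha> * V" "0 \<le> V" "\<And>q. q \<in> P \<Longrightarrow> \<bar>gmass n z q - w q\<bar> \<le> 3 * sqrt V"
      using lyap_controls[OF z k' \<alpha> V] by blast+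
    have mb: "\<phi> \<in> borel_measurable borel" by (rule borel_measurable_continuous_onI[OF \<phi>])
    note a0 = fst_nonneg[OF z]
    have 1: "(\<integral>x. \<phi> x \<partial>particle_measure n z) = (\<Sum>i<n. fst z i * \<phi> (snd z i))"
      unfolding particle_measure_pmeas using integral_pmeas[OF _ _ mb, of "{..<n}" "fst z" "snd z"] a0 by simp
    have 2: "(\<integral>x. \<phi> x \<partial>pmeas P w (\<lambda>q. q)) = (\<Sum>q\<in>P. w q * \<phi> q)"
      using integral_pmeas[OF fin _ mb, of w "\<lambda>q. q"] w_pos by (simp add: less_imp_le)
    have split: "(\<Sum>i<n. fst z i * \<phi> (snd z i)) - (\<Sum>q\<in>P. w q * \<phi> q)
      = (\<Sum>q\<in>P. \<Sum>i\<in>grp n z q. fst z i * (\<phi> (snd z i) - \<phi> q)) + (\<Sum>i\<in>outer n z. fst z i * \<phi> (snd z i))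
        + (\<Sum>q\<in>P. (gmass n z q - w q) * \<phi> q)"
      unfolding sum_split_groups[of _ n z] gmass_def
      by (simp add: left_diff_distrib right_diff_distrib sum_subtractf sum_distrib_right)
    have A: "\<bar>\<Sum>q\<in>P. \<Sum>i\<in>grp n z q. fst z i * (\<phi> (snd z i) - \<phi> q)\<bar> \<le> e + ?c * spread n z"
    proof -
      have "\<bar>\<Sum>q\<in>P. \<Sum>i\<in>grp n z q. fst z i * (\<phi> (snd z i) - \<phi> q)\<bar>
          \<le> (\<Sum>q\<in>P. \<Sum>i\<in>grp n z q. fst z i * e + ?c * (fst z i * (dist q (snd z i))\<^sup>2))"
      proof (rule order_trans[OF sum_abs sum_mono], rule order_trans[OF sum_abs sum_mono])
        fix q i assume "i \<in> grp n z q"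
        then have "0 \<le> fst z i" using a0 by (simp add: grp_def)
        then have "fst z i * \<bar>\<phi> (snd z i) - \<phi> q\<bar> \<le> fst z i * (e + ?c * (dist q (snd z i))\<^sup>2)"
          using local by (intro mult_left_mono)
        then show "\<bar>fst z i * (\<phi> (snd z i) - \<phi> q)\<bar> \<le> fst z i * e + ?c * (fst z i * (dist q (snd z i))\<^sup>2)"
          using \<open>0 \<le> fst z i\<close> by (simp add: abs_mult distrib_left mult_ac)
      qed
      also have "\<dots> = (\<Sum>q\<in>P. gmass n z q) * e + ?c * spread n z"
        unfolding sum.distrib sum_distrib_left[symmetric] sum_distrib_right[symmetric] gmass_def spread_def ..
      also have "(\<Sum>q\<in>P. gmass n z q) * e \<le> 1 * e"
        using total_mass[OF z] omass_nonneg[OF z] e by (intro mult_right_mono) auto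
      finally show ?thesis by simp
    qed
    have Bd: "\<bar>\<Sum>i\<in>outer n z. fst z i * \<phi> (snd z i)\<bar> \<le> B * omass n z"
    proof -
      have "\<bar>\<Sum>i\<in>outer n z. fst z i * \<phi> (snd z i)\<bar> \<le> (\<Sum>i\<in>outer n z. fst z i * B)"
        using B a0 by (intro order_trans[OF sum_abs sum_mono]) (auto simp: abs_mult outer_def intro!: mult_left_mono)
      then show ?thesis by (simp add: omass_def sum_distrib_left mult.commute)
    qed
    have D: "\<bar>\<Sum>q\<in>P. (gmass n z q - w q) * \<phi> q\<bar> \<le> card P * (3 * sqrt V * B)"
      using B B0 lc(3,4) by (intro order_trans[OF sum_abs] sum_bounded_above) (auto simp: abs_mult intro!: mult_mono)
    have VV: "V \<le> sqrt V"
    proof -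
      have "V\<^sup>2 \<le> V" using lc(3) V(2) mult_left_le[of V V] by (simp add: power2_eq_square)
      then show ?thesis by (rule real_le_rsqrt)
    qed
    have "?c * spread n z \<le> ?c * (2 / \<alpha> * sqrt V)"
      using lc(2) mult_left_mono[OF VV, of "2 / \<alpha>"] \<alpha> by (intro mult_left_mono c0) simp
    moreover have "B * omass n z \<le> B * sqrt V" using lc(1) VV B0 by (intro mult_left_mono) auto
    moreover have "e + ?C * sqrt V = e + ?c * (2 / \<alpha> * sqrt V) + B * sqrt V + card P * (3 * sqrt V * B)"
      by (simp add: algebra_simps)
    ultimately show "\<bar>(\<integral>x. \<phi> x \<partial>particle_measure n z) - (\<integral>x. \<phi> x \<partial>pmeas P w (\<lambda>q. q))\<bar> \<le> e + ?C * sqrt V"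
      unfolding 1 2 split using A Bd D by linarith
  qed
qed

lemma narrow_limit:
  fixes \<phi> :: "'d torus \<Rightarrow> real" and V :: "nat \<Rightarrow> real"
  assumes \<phi>: "continuous_on UNIV \<phi>" and \<alpha>: "0 < \<alpha>" and z: "\<And>k. fst (z k) \<in> prob_simplex n"
    and k: "\<And>k q. q \<in> P \<Longrightarrow> 0 < kmass \<alpha> n (z k) q" and V: "\<And>k. lyap \<alpha> n (z k) \<le> V k" "\<And>k. V k \<le> 1" and lim: "V \<longlonglongrightarrow> 0"
  shows "(\<lambda>k. \<integral>x. \<phi> x \<partial>particle_measure n (z k)) \<longlonglongrightarrow> (\<integral>x. \<phi> x \<partial>pmeas P w (\<lambda>q. q))"
proof (rule LIMSEQ_I)
  fix e :: real assume e: "0 < e"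
  obtain C where C: "0 \<le> C" "\<And>k. \<bar>(\<integral>x. \<phi> x \<partial>particle_measure n (z k)) - (\<integral>x. \<phi> x \<partial>pmeas P w (\<lambda>q. q))\<bar> \<le> e / 2 + C * sqrt (V k)"
    using narrow_lyap[OF \<phi> \<alpha>, of "e / 2"] e z k V by (metis half_gt_zero)
  have "(\<lambda>k. C * sqrt (V k)) \<longlonglongrightarrow> C * sqrt 0" by (intro tendsto_intros lim)
  then have "(\<lambda>k. C * sqrt (V k)) \<longlonglongrightarrow> 0" by simp
  then obtain N where N: "\<And>k. k \<ge> N \<Longrightarrow> norm (C * sqrt (V k) - 0) < e / 2"
    using LIMSEQ_D[of _ 0 "e / 2"] e by (metis half_gt_zero)
  have "norm ((\<integral>x. \<phi> x \<partial>particle_measure n (z k)) - (\<integral>x. \<phi> x \<partial>pmeas P w (\<lambda>q. q))) < e" if "k \<ge> N" for k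
    using C(2)[of k] N[OF that] by simp
  then show "\<exists>N. \<forall>k\<ge>N. norm ((\<integral>x. \<phi> x \<partial>particle_measure n (z k)) - (\<integral>x. \<phi> x \<partial>pmeas P w (\<lambda>q. q))) < e" by blast
qed

end

section \<open>The NI error against the energy\<close>

context two_sided begin

lemma particle_prob: "fst x \<in> prob_simplex k \<Longrightarrow> particle_measure k x \<in> prob_measures"
  unfolding particle_measure_pmeas by (rule pmeas_prob) (auto simp: prob_simplex_def)

lemma integrals:
  assumes "fst x \<in> prob_simplex n" "fst y \<in> prob_simplex m"
  shows "(\<integral>p. f p q \<partial>particle_measure n x) = - Y.opp n x q" "(\<integral>q. f p q \<partial>particle_measure m y) = X.opp m y p"
proof -
  interpret C: continuous_payoff f L by (rule X.continuous_payoff)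
  have "\<And>i. i \<in> {..<n} \<Longrightarrow> 0 \<le> fst x i" "\<And>j. j \<in> {..<m} \<Longrightarrow> 0 \<le> fst y j" using assms by (auto simp: prob_simplex_def)
  then show "(\<integral>p. f p q \<partial>particle_measure n x) = - Y.opp n x q" "(\<integral>q. f p q \<partial>particle_measure m y) = X.opp m y p"
    unfolding particle_measure_pmeas
    using C.integral_pmeas_fst[where S = "{..<n}" and w = "fst x" and y = q and X = "snd x"]
      C.integral_pmeas_snd[where S = "{..<m}" and w = "fst y" and x = p and X = "snd y"]
    by (simp_all add: X.opp_def Y.opp_def sum_negf)
qed

text \<open>No deviation beats \<open>\<rho>\<close> against the equilibrium weights of either
  player; replacing these by the particles changes every pure payoff by an error of order
  \<open>sqrt V\<close>.\<close>

lemma NI_energy: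
  assumes st: "state \<alpha> n m z" and \<alpha>: "0 < \<alpha>" and V: "energy \<alpha> n m z \<le> V" "V \<le> 1"
  shows "NI f (particle_measure n (fst z)) (particle_measure m (snd z))
    \<le> L * (sqrt (2 / \<alpha>) + 1 + 3 * card P) * sqrt V + L * (sqrt (2 / \<alpha>) + 1 + 3 * card Q) * sqrt V"
proof -
  interpret C: continuous_payoff f L by (rule X.continuous_payoff)
  let ?x = "fst z" and ?y = "snd z"
  have s: "fst ?x \<in> prob_simplex n" "fst ?y \<in> prob_simplex m" using st by (auto simp: state_def)
  have k: "\<And>p. p \<in> P \<Longrightarrow> 0 < X.CP.kmass \<alpha> n ?x p" "\<And>q. q \<in> Q \<Longrightarrow> 0 < X.CQ.kmass \<alpha> m ?y q" using st by (auto simp: state_def)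
  have l: "X.CP.lyap \<alpha> n ?x \<le> V" "X.CQ.lyap \<alpha> m ?y \<le> V" using energy_ge[OF st \<alpha>] V by auto
  let ?A = "L * (sqrt (2 / \<alpha>) + 1 + 3 * card P) * sqrt V" and ?B = "L * (sqrt (2 / \<alpha>) + 1 + 3 * card Q) * sqrt V"
  have "NI f (particle_measure n ?x) (particle_measure m ?y) \<le> (\<rho> + ?A) - (\<rho> - ?B)"
  proof (rule C.NI_le[OF particle_prob[OF s(1)] particle_prob[OF s(2)]])
    fix q
    have "norm ((\<Sum>i<n. fst ?x i *\<^sub>R f (snd ?x i) q) - (\<Sum>p\<in>P. w p *\<^sub>R f p q)) \<le> ?A"
      by (rule X.CP.target_approx_lyap[OF s(1) k(1) \<alpha> l(1) V(2)]) (use X.L_pos X.f_bound X.f_lip[of _ q _ q] in auto)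
    moreover have "(\<Sum>p\<in>P. w p * f p q) \<le> \<rho>" using Y.value_ge[of q] by (simp add: sum_negf)
    ultimately show "(\<integral>x. f x q \<partial>particle_measure n ?x) \<le> \<rho> + ?A"
      unfolding integrals(1)[OF s] Y.opp_def by (simp add: sum_negf)
  next
    fix p
    have "norm ((\<Sum>j<m. fst ?y j *\<^sub>R f p (snd ?y j)) - (\<Sum>q\<in>Q. v q *\<^sub>R f p q)) \<le> ?B"
      by (rule X.CQ.target_approx_lyap[OF s(2) k(2) \<alpha> l(2) V(2)]) (use X.L_pos X.f_bound X.f_lip[of p _ p] in auto)
    moreover have "\<rho> \<le> (\<Sum>q\<in>Q. v q * f p q)" by (rule X.value_ge)
    ultimately show "\<rho> - ?B \<le> (\<integral>y. f p y \<partial>particle_measure m ?y)"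
      unfolding integrals(2)[OF s] X.opp_def by simp
  qed
  then show ?thesis by simp
qed

text \<open>Pure deviations give \<open>- r \<le> X.opp m y p + Y.opp n x q\<close> for all
  \<open>p\<close> and \<open>q\<close>. Averaging with both equilibrium weights bounds the gap.
  Averaging with one of them gives the pointwise bounds, because a payoff averaged over an
  equilibrium strategy is on the right side of the value.\<close>

lemma NI_small_bounds:
  assumes s: "fst x \<in> prob_simplex n" "fst y \<in> prob_simplex m"
    and NI: "NI f (particle_measure n x) (particle_measure m y) \<le> r"
  shows "lam / 4 * (X.CP.spread n x + X.CQ.spread m y) + c1 * (X.CP.omass n x + X.CQ.omass m y) \<le> r"
    "\<rho> - r \<le> X.opp m y p" "(\<Sum>p\<in>P. w p * X.opp m y p) \<le> \<rho>"
    "- \<rho> - r \<le> Y.opp n x q" "(\<Sum>q\<in>Q. v q * Y.opp n x q) \<le> - \<rho>"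
proof -
  interpret C: continuous_payoff f L by (rule X.continuous_payoff)
  have pt: "- Y.opp n x q - X.opp m y p \<le> r" for p q
    using C.NI_ge[OF particle_prob[OF s(1)] particle_prob[OF s(2)], where x = p and y = q] NI integrals[OF s] by simp
  have avP: "(\<Sum>p\<in>P. w p * X.opp m y p) \<ge> c" if "\<And>p. c \<le> X.opp m y p" for c
  proof -
    have "(\<Sum>p\<in>P. w p * c) \<le> (\<Sum>p\<in>P. w p * X.opp m y p)" using that X.CP.w_pos by (intro sum_mono mult_left_mono) (auto simp: less_imp_le)
    then show ?thesis using X.CP.w_sum by (simp flip: sum_distrib_right)
  qed
  have avQ: "(\<Sum>q\<in>Q. v q * Y.opp n x q) \<ge> c" if "\<And>q. c \<le> Y.opp n x q" for c
  proof -
    have "(\<Sum>q\<in>Q. v q * c) \<le> (\<Sum>q\<in>Q. v q * Y.opp n x q)" using that X.CQ.w_pos by (intro sum_mono mult_left_mono) (auto simp: less_imp_le)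
    then show ?thesis using X.CQ.w_sum by (simp flip: sum_distrib_right)
  qed
  have 1: "- r - X.opp m y p \<le> (\<Sum>q\<in>Q. v q * Y.opp n x q)" for p
  proof (rule avQ)
    show "- r - X.opp m y p \<le> Y.opp n x q" for q using pt[of q p] by linarith
  qed
  have 2: "- r - (\<Sum>q\<in>Q. v q * Y.opp n x q) \<le> (\<Sum>p\<in>P. w p * X.opp m y p)"
  proof (rule avP)
    show "- r - (\<Sum>q\<in>Q. v q * Y.opp n x q) \<le> X.opp m y p" for p using 1[of p] by linarith
  qed
  have 3: "- r - Y.opp n x q \<le> (\<Sum>p\<in>P. w p * X.opp m y p)" for q
  proof (rule avP)
    show "- r - Y.opp n x q \<le> X.opp m y p" for p using pt[of q p] by linarith
  qed
  have g: "(\<Sum>q\<in>Q. v q * Y.opp n x q) = - (\<Sum>i<n. fst x i * (\<Sum>q\<in>Q. v q * f (snd x i) q))"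
    unfolding Y.opp_def sum_distrib_left by (subst sum.swap) (simp add: sum_negf mult_ac)
  have g': "(\<Sum>p\<in>P. w p * X.opp m y p) = - (\<Sum>j<m. fst y j * (\<Sum>p\<in>P. w p * - f p (snd y j)))"
    unfolding X.opp_def sum_distrib_left by (subst sum.swap) (simp add: sum_negf mult_ac)
  have nnx: "0 \<le> lam / 4 * X.CP.spread n x + c1 * X.CP.omass n x"
    using X.CP.spread_nonneg[OF s(1)] X.CP.omass_nonneg[OF s(1)] X.lam_pos X.c1_pos by simp
  have nny: "0 \<le> lam / 4 * X.CQ.spread m y + c1 * X.CQ.omass m y"
    using X.CQ.spread_nonneg[OF s(2)] X.CQ.omass_nonneg[OF s(2)] X.lam_pos X.c1_pos by simp
  show 4: "(\<Sum>q\<in>Q. v q * Y.opp n x q) \<le> - \<rho>" using X.gap_ge[OF s(1)] nnx unfolding g by linarith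
  show 5: "(\<Sum>p\<in>P. w p * X.opp m y p) \<le> \<rho>" using Y.gap_ge[OF s(2)] nny unfolding g' by linarith
  show "lam / 4 * (X.CP.spread n x + X.CQ.spread m y) + c1 * (X.CP.omass n x + X.CQ.omass m y) \<le> r"
    using gap_terms(1)[OF s] 2 by linarith
  show "\<rho> - r \<le> X.opp m y p" using 1[of p] 4 by linarith
  show "- \<rho> - r \<le> Y.opp n x q" using 3[of q] 5 by linarith
qed

text \<open>The hypothesis on the initial NI error enters here. It makes the gap small and the
  payoffs at the equilibrium points nearly constant, so the same linear system as in
  \<open>contraction\<close> bounds the mass errors, which also makes the kernel masses
  positive.\<close>

lemma initial_state:
  assumes \<Gamma>: "0 < \<Gamma>" and W: "0 < W" "W \<le> 1" "\<And>p. p \<in> P \<Longrightarrow> W \<le> w p" "\<And>q. q \<in> Q \<Longrightarrow> W \<le> v q" and v0: "0 < v0"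
  shows "\<exists>r0>0. \<forall>\<alpha> n m z. 0 \<le> \<alpha> \<and> \<alpha> \<le> \<Gamma> \<and> fst (fst z) \<in> prob_simplex n \<and> fst (snd z) \<in> prob_simplex m \<and>
     NI f (particle_measure n (fst z)) (particle_measure m (snd z)) \<le> r0 \<longrightarrow> state \<alpha> n m z \<and> energy \<alpha> n m z \<le> v0"
proof -
  obtain Kx where Kx: "0 < Kx" "\<And>\<alpha> n z. fst z \<in> prob_simplex n \<Longrightarrow> 0 \<le> \<alpha> \<Longrightarrow> \<alpha> \<le> \<Gamma> \<Longrightarrow>
    (\<And>q. q \<in> P \<Longrightarrow> w q / 2 \<le> X.CP.kmass \<alpha> n z q) \<Longrightarrow>
    X.CP.lyap \<alpha> n z \<le> Kx * (X.CP.omass n z + X.CP.spread n z + (\<Sum>q\<in>P. (X.CP.gmass n z q - w q)\<^sup>2))"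
    by (rule X.CP.lyap_upper[OF \<Gamma>]) blast
  obtain Ky where Ky: "0 < Ky" "\<And>\<alpha> n z. fst z \<in> prob_simplex n \<Longrightarrow> 0 \<le> \<alpha> \<Longrightarrow> \<alpha> \<le> \<Gamma> \<Longrightarrow>
    (\<And>q. q \<in> Q \<Longrightarrow> v q / 2 \<le> X.CQ.kmass \<alpha> n z q) \<Longrightarrow>
    X.CQ.lyap \<alpha> n z \<le> Ky * (X.CQ.omass n z + X.CQ.spread n z + (\<Sum>q\<in>Q. (X.CQ.gmass n z q - v q)\<^sup>2))"
    by (rule X.CQ.lyap_upper[OF \<Gamma>]) blast
  obtain Jy where Jy: "0 < Jy" "\<And>m y c. fst y \<in> prob_simplex m \<Longrightarrow>
    (\<Sum>q\<in>Q. (X.CQ.gmass m y q - v q)\<^sup>2) \<le> Jy * (X.CQ.omass m y + X.CQ.spread m y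
      + (\<Sum>p\<in>P. (X.opp m y p - c)\<^sup>2 + (norm (X.opp_grad m y p))\<^sup>2))"
    by (rule X.weights_error) blast
  obtain Jx where Jx: "0 < Jx" "\<And>n x c. fst x \<in> prob_simplex n \<Longrightarrow>
    (\<Sum>p\<in>P. (X.CP.gmass n x p - w p)\<^sup>2) \<le> Jx * (X.CP.omass n x + X.CP.spread n x
      + (\<Sum>q\<in>Q. (Y.opp n x q - c)\<^sup>2 + (norm (Y.opp_grad n x q))\<^sup>2))"
    by (rule Y.weights_error) blast
  \<comment> \<open>The constant with which \<open>r0\<close> bounds the squared value error plus
    the squared gradient at one equilibrium point; the square of \<open>r0 / W\<close> becomes
    linear in \<open>r0\<close> because \<open>r0 \<le> 1\<close>.\<close>
  define t where "t = 1 / W\<^sup>2 + 4 * L / W"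
  define k where "k = 1 / c1 + 4 / lam + (card P + card Q) * t"
  have t: "0 < t" using W X.L_pos by (simp add: t_def add_pos_pos)
  have k: "0 < k" unfolding k_def using t X.c1_pos X.lam_pos by (intro add_pos_nonneg add_pos_pos mult_nonneg_nonneg) auto
  define E where "E = Kx * (k + Jx * k) + Ky * (k + Jy * k)"
  have E: "0 < E" using Kx(1) Ky(1) Jx(1) Jy(1) k by (simp add: E_def add_pos_pos)
  \<comment> \<open>The entries ensure, in this order: squares of \<open>r0\<close> are at most
    linear, the mass errors of either player are at most \<open>W / 4\<close>, the spread lowers a
    kernel mass by at most \<open>W / 4\<close>, and the energy is at most
    \<open>v0\<close>.\<close>
  define r0 where "r0 = Min {1, (W / 4)\<^sup>2 / (Jx * k), (W / 4)\<^sup>2 / (Jy * k), W / 4 / (2 * \<Gamma> / lam), v0 / E}"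
  have r0: "0 < r0" using W(1) Jx(1) Jy(1) k \<Gamma> X.lam_pos v0 E by (simp add: r0_def)
  have r0_le: "r0 \<le> 1" "r0 \<le> (W / 4)\<^sup>2 / (Jx * k)" "r0 \<le> (W / 4)\<^sup>2 / (Jy * k)" "r0 \<le> W / 4 / (2 * \<Gamma> / lam)" "r0 \<le> v0 / E"
    by (auto simp: r0_def)
  have pd: "a * b \<le> c" if "b \<le> c / a" "0 < a" for a b c :: real
    using that by (simp add: pos_le_divide_eq mult.commute)
  have r: "r0 \<le> 1" "Jx * (k * r0) \<le> (W / 4)\<^sup>2" "Jy * (k * r0) \<le> (W / 4)\<^sup>2" "2 * \<Gamma> / lam * r0 \<le> W / 4" "E * r0 \<le> v0"
    using r0_le(1) pd[OF r0_le(2)] pd[OF r0_le(3)] pd[OF r0_le(4)] pd[OF r0_le(5)] Jx(1) Jy(1) k \<Gamma> X.lam_pos E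
    by (simp_all only: mult_pos_pos divide_pos_pos zero_less_numeral mult.assoc)
  show ?thesis
  proof (intro exI[of _ r0] conjI allI impI r0; elim conjE)
    fix \<alpha> n m and z :: "'n particles \<times> 'm particles"
    let ?x = "fst z" and ?y = "snd z"
    assume \<alpha>: "0 \<le> \<alpha>" "\<alpha> \<le> \<Gamma>" and s: "fst ?x \<in> prob_simplex n" "fst ?y \<in> prob_simplex m"
      and NI: "NI f (particle_measure n ?x) (particle_measure m ?y) \<le> r0"
    note b = NI_small_bounds[OF s NI]
    have nn: "0 \<le> X.CP.spread n ?x" "0 \<le> X.CQ.spread m ?y" "0 \<le> X.CP.omass n ?x" "0 \<le> X.CQ.omass m ?y"
      using X.CP.spread_nonneg[OF s(1)] X.CQ.spread_nonneg[OF s(2)] X.CP.omass_nonneg[OF s(1)] X.CQ.omass_nonneg[OF s(2)] by auto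
    have sp: "X.CP.spread n ?x + X.CQ.spread m ?y \<le> 4 / lam * r0" and om: "X.CP.omass n ?x + X.CQ.omass m ?y \<le> 1 / c1 * r0"
    proof -
      have "0 \<le> c1 * (X.CP.omass n ?x + X.CQ.omass m ?y)" "0 \<le> lam / 4 * (X.CP.spread n ?x + X.CQ.spread m ?y)"
        using nn X.c1_pos X.lam_pos by simp_all
      then have "lam / 4 * (X.CP.spread n ?x + X.CQ.spread m ?y) \<le> r0" "c1 * (X.CP.omass n ?x + X.CQ.omass m ?y) \<le> r0"
        using b(1) by linarith+
      then show "X.CP.spread n ?x + X.CQ.spread m ?y \<le> 4 / lam * r0" "X.CP.omass n ?x + X.CQ.omass m ?y \<le> 1 / c1 * r0"
        using X.lam_pos X.c1_pos by (simp_all add: pos_le_divide_eq mult_ac)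
    qed
    have square_le: "A\<^sup>2 + B \<le> t * r0" if "\<bar>A\<bar> \<le> r0 / W" "B \<le> 4 * L * (r0 / W)" for A B
    proof -
      have "A\<^sup>2 \<le> (r0 / W)\<^sup>2" using that(1) r0 W by (intro power2_le_iff_abs_le[THEN iffD2]) auto
      also have "\<dots> = r0 * (r0 / W\<^sup>2)" by (simp add: power_divide power2_eq_square)
      also have "\<dots> \<le> 1 * (r0 / W\<^sup>2)" using r(1) r0 by (intro mult_right_mono) auto
      finally show ?thesis using that(2) by (simp add: t_def distrib_right)
    qed
    have tP: "(\<Sum>p\<in>P. (X.opp m ?y p - \<rho>)\<^sup>2 + (norm (X.opp_grad m ?y p))\<^sup>2) \<le> card P * (t * r0)"
    proof (rule sum_bounded_above)
      fix p assume p: "p \<in> P"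
      show "(X.opp m ?y p - \<rho>)\<^sup>2 + (norm (X.opp_grad m ?y p))\<^sup>2 \<le> t * r0"
        by (rule square_le) (rule X.opp_at_targets[OF s(2) less_imp_le[OF r0] b(2,3) p W(1) W(3)[OF p] W(2)])+
    qed
    have tQ: "(\<Sum>q\<in>Q. (Y.opp n ?x q - - \<rho>)\<^sup>2 + (norm (Y.opp_grad n ?x q))\<^sup>2) \<le> card Q * (t * r0)"
    proof (rule sum_bounded_above)
      fix q assume q: "q \<in> Q"
      show "(Y.opp n ?x q - - \<rho>)\<^sup>2 + (norm (Y.opp_grad n ?x q))\<^sup>2 \<le> t * r0"
        by (rule square_le) (rule Y.opp_at_targets[OF s(1) less_imp_le[OF r0] b(4,5) q W(1) W(4)[OF q] W(2)])+
    qed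
    have pq: "0 \<le> card P * (t * r0)" "0 \<le> card Q * (t * r0)"
      by (intro mult_nonneg_nonneg of_nat_0_le_iff less_imp_le[OF t] less_imp_le[OF r0])+
    have kr: "k * r0 = 1 / c1 * r0 + 4 / lam * r0 + card P * (t * r0) + card Q * (t * r0)"
      unfolding k_def distrib_right of_nat_add by (simp only: mult.assoc add.assoc)
    have dy: "(\<Sum>q\<in>Q. (X.CQ.gmass m ?y q - v q)\<^sup>2) \<le> Jy * (k * r0)"
      using Jy(1) sp om tP pq nn unfolding kr by (intro order_trans[OF Jy(2)[OF s(2), of \<rho>]] mult_left_mono) auto
    have dx: "(\<Sum>p\<in>P. (X.CP.gmass n ?x p - w p)\<^sup>2) \<le> Jx * (k * r0)"
      using Jx(1) sp om tQ pq nn unfolding kr by (intro order_trans[OF Jx(2)[OF s(1), of "- \<rho>"]] mult_left_mono) auto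
    \<comment> \<open>Mass error and spread each take at most a quarter of \<open>W\<close>,
      together at most half of the target.\<close>
    have half: "c / 2 \<le> g - \<alpha> / 2 * h" if "(g - c)\<^sup>2 \<le> (W / 4)\<^sup>2" "0 \<le> h" "h \<le> 4 / lam * r0" "W \<le> c" for c g h
    proof -
      have "\<bar>g - c\<bar> \<le> W / 4" using that(1) W(1) by (simp add: abs_le_square_iff[symmetric])
      moreover have "\<alpha> / 2 * h \<le> \<Gamma> / 2 * (4 / lam * r0)" using \<alpha> that \<Gamma> by (intro mult_mono) auto
      moreover have "\<Gamma> / 2 * (4 / lam * r0) \<le> W / 4" using r(4) by (simp add: mult_ac)
      ultimately show ?thesis using that(4) W(1) by linarith
    qed
    have kx: "w p / 2 \<le> X.CP.kmass \<alpha> n ?x p" if p: "p \<in> P" for p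
    proof -
      have "(X.CP.gmass n ?x p - w p)\<^sup>2 \<le> (\<Sum>p\<in>P. (X.CP.gmass n ?x p - w p)\<^sup>2)" using p X.CP.fin by (intro member_le_sum) auto
      then have "(X.CP.gmass n ?x p - w p)\<^sup>2 \<le> (W / 4)\<^sup>2" using dx r(2) by linarith
      moreover have "X.CP.gspread n ?x p \<le> 4 / lam * r0" using X.CP.gspread_le[OF s(1) p] sp nn by linarith
      ultimately show ?thesis unfolding X.CP.kmass_eq using X.CP.gspread_nonneg[OF s(1)] W(3)[OF p] by (intro half) auto
    qed
    have ky: "v q / 2 \<le> X.CQ.kmass \<alpha> m ?y q" if q: "q \<in> Q" for q
    proof -
      have "(X.CQ.gmass m ?y q - v q)\<^sup>2 \<le> (\<Sum>q\<in>Q. (X.CQ.gmass m ?y q - v q)\<^sup>2)" using q X.CQ.fin by (intro member_le_sum) auto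
      then have "(X.CQ.gmass m ?y q - v q)\<^sup>2 \<le> (W / 4)\<^sup>2" using dy r(3) by linarith
      moreover have "X.CQ.gspread m ?y q \<le> 4 / lam * r0" using X.CQ.gspread_le[OF s(2) q] sp nn by linarith
      ultimately show ?thesis unfolding X.CQ.kmass_eq using X.CQ.gspread_nonneg[OF s(2)] W(4)[OF q] by (intro half) auto
    qed
    have "0 < X.CP.kmass \<alpha> n ?x p" if "p \<in> P" for p using kx[OF that] X.CP.w_pos[OF that] by linarith
    moreover have "0 < X.CQ.kmass \<alpha> m ?y q" if "q \<in> Q" for q using ky[OF that] X.CQ.w_pos[OF that] by linarith
    ultimately show "state \<alpha> n m z" using s by (simp add: state_def)
    have "X.CP.lyap \<alpha> n ?x \<le> Kx * (X.CP.omass n ?x + X.CP.spread n ?x + (\<Sum>q\<in>P. (X.CP.gmass n ?x q - w q)\<^sup>2))"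
      by (rule Kx(2)[OF s(1) \<alpha> kx])
    also have "\<dots> \<le> Kx * (k * r0 + Jx * (k * r0))"
      using dx sp om pq nn Kx(1) kr by (intro mult_left_mono) auto
    finally have 1: "X.CP.lyap \<alpha> n ?x \<le> Kx * (k + Jx * k) * r0" by (simp add: algebra_simps)
    have "X.CQ.lyap \<alpha> m ?y \<le> Ky * (X.CQ.omass m ?y + X.CQ.spread m ?y + (\<Sum>q\<in>Q. (X.CQ.gmass m ?y q - v q)\<^sup>2))"
      by (rule Ky(2)[OF s(2) \<alpha> ky])
    also have "\<dots> \<le> Ky * (k * r0 + Jy * (k * r0))"
      using dy sp om pq nn Ky(1) kr by (intro mult_left_mono) auto
    finally have 2: "X.CQ.lyap \<alpha> m ?y \<le> Ky * (k + Jy * k) * r0" by (simp add: algebra_simps)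
    show "energy \<alpha> n m z \<le> v0" using 1 2 r(5) by (simp add: energy_def E_def distrib_right)
  qed
qed

end

section \<open>Choice of the energy level and the step sizes\<close>

context two_sided begin

text \<open>The order of choices matters: the accuracy \<open>\<epsilon>\<close> depends on the
  fixed radius, the energy level \<open>v0\<close> on \<open>\<epsilon>\<close>, the step-size
  thresholds on \<open>\<epsilon>\<close>, and the rate \<open>\<beta>\<close> on the actual steps.
  Since \<open>v0\<close> precedes the steps, \<open>r0\<close> can be chosen so that the iteration
  starts below it.\<close>

lemma convergence:
  assumes \<Gamma>: "1 \<le> \<Gamma>" "8 * (\<Gamma> * R) \<le> 1" "32 * (\<Gamma> * L * R) \<le> lam"
    and W: "0 < W" "W \<le> 1" "\<forall>p\<in>P. W \<le> w p" "\<forall>q\<in>Q. W \<le> v q"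
  shows "\<exists>\<eta>0>0. \<exists>\<sigma>0>0. \<forall>\<eta> \<sigma>.
      0 < \<eta> \<and> \<eta> \<le> \<eta>0 \<and> 0 < \<sigma> \<and> \<sigma> \<le> \<sigma>0 \<and> 1 / \<Gamma> \<le> \<eta> / \<sigma> \<and> \<eta> / \<sigma> \<le> \<Gamma> \<longrightarrow>
      (\<exists>r0>0. \<exists>c>0. \<exists>\<beta>. 0 < \<beta> \<and> \<beta> < 1 \<and> c \<le> 1 \<and> 3 * sqrt c \<le> W / 2 \<and>
        (\<forall>n m z. fst (fst (z 0)) \<in> prob_simplex n \<and> fst (snd (z 0)) \<in> prob_simplex m \<and>
          (\<forall>k. update \<eta> \<sigma> n m (z k) (z (Suc k))) \<and>
          NI f (particle_measure n (fst (z 0))) (particle_measure m (snd (z 0))) \<le> r0 \<longrightarrow>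
          (\<forall>k. state (\<eta> / \<sigma>) n m (z k) \<and> energy (\<eta> / \<sigma>) n m (z k) \<le> c * (\<beta> ^ k)\<^sup>2)))"
proof -
  note W = W(1,2) bspec[OF W(3)] bspec[OF W(4)]
  note pos = X.L_pos X.CP.R_pos X.lam_pos
  define \<epsilon> where "\<epsilon> = min (lam / 4) (lam * R / 2)"
  have \<epsilon>: "0 < \<epsilon>" "\<epsilon> \<le> lam / 4" "\<epsilon> \<le> lam * R / 2" using pos by (auto simp: \<epsilon>_def)
  define KP where "KP = L * (sqrt (2 * \<Gamma>) + 1 + 3 * card P)"
  define KQ where "KQ = L * (sqrt (2 * \<Gamma>) + 1 + 3 * card Q)"
  have K: "0 < KP" "0 < KQ" using pos \<Gamma>(1) unfolding KP_def KQ_def by (intro mult_pos_pos add_pos_nonneg; simp)+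
  \<comment> \<open>The root of the energy level is chosen first because all requirements involve
    \<open>sqrt v0\<close>: the mass window, the WFR bound and the nearness of either
    player.\<close>
  define s0 where "s0 = Min {1, W / 8, \<epsilon> / 2 / KP, \<epsilon> / 2 / KQ}"
  have s0: "0 < s0" using W(1) \<epsilon>(1) K by (simp add: s0_def)
  have s0': "s0 \<le> 1" "s0 \<le> W / 8" "s0 \<le> \<epsilon> / 2 / KP" "s0 \<le> \<epsilon> / 2 / KQ" by (auto simp: s0_def)
  define v0 where "v0 = s0\<^sup>2"
  have sv: "sqrt v0 = s0" using s0 by (simp add: v0_def)
  have v0: "0 < v0" "v0 \<le> 1" using s0 s0'(1) by (auto simp: v0_def power_le_one)
  have v0': "2 * sqrt v0 \<le> W / 4" "3 * sqrt v0 \<le> W / 2" "KP * sqrt v0 \<le> \<epsilon> / 2" "KQ * sqrt v0 \<le> \<epsilon> / 2"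
    using s0' s0 K W(1) unfolding sv by (auto simp: pos_le_divide_eq mult_ac)
  define \<eta>0 where "\<eta>0 = Min {1 / (16 * L), \<epsilon> / (16 * L\<^sup>2), lam / (992 * L\<^sup>2)}"
  define \<sigma>0 where "\<sigma>0 = min (R / (2 * L)) (\<epsilon> / (8 * L\<^sup>2))"
  have \<eta>0: "0 < \<eta>0" "\<eta>0 \<le> 1 / (16 * L)" "\<eta>0 \<le> \<epsilon> / (16 * L\<^sup>2)" "\<eta>0 \<le> lam / (992 * L\<^sup>2)"
    using pos \<epsilon>(1) by (auto simp: \<eta>0_def)
  have \<sigma>0: "0 < \<sigma>0" "\<sigma>0 \<le> R / (2 * L)" "\<sigma>0 \<le> \<epsilon> / (8 * L\<^sup>2)"
    using pos \<epsilon>(1) by (auto simp: \<sigma>0_def)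
  have G0: "0 < \<Gamma>" using \<Gamma>(1) by simp
  have GR: "\<Gamma> * R\<^sup>2 \<le> 1 / 8"
  proof -
    have "\<Gamma> * R * R \<le> 1 / 8 * 1" using \<Gamma> pos X.CP.R_le by (intro mult_mono) auto
    then show ?thesis by (simp add: power2_eq_square mult.assoc)
  qed
  show ?thesis
  proof (rule exI[of _ \<eta>0], rule conjI[OF \<eta>0(1)], rule exI[of _ \<sigma>0], rule conjI[OF \<sigma>0(1)], intro allI impI, elim conjE)
    fix \<eta> \<sigma> :: real assume e: "0 < \<eta>" "\<eta> \<le> \<eta>0" "0 < \<sigma>" "\<sigma> \<le> \<sigma>0" "1 / \<Gamma> \<le> \<eta> / \<sigma>" "\<eta> / \<sigma> \<le> \<Gamma>"
    let ?\<alpha> = "\<eta> / \<sigma>"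
    have \<alpha>: "0 < ?\<alpha>" "?\<alpha> * \<sigma> = \<eta>" using e by auto
    have le: "\<eta> \<le> 1 / (16 * L)" "\<eta> \<le> \<epsilon> / (16 * L\<^sup>2)" "\<eta> \<le> lam / (992 * L\<^sup>2)" "\<sigma> \<le> R / (2 * L)" "\<sigma> \<le> \<epsilon> / (8 * L\<^sup>2)"
      using e(2,4) \<eta>0 \<sigma>0 by linarith+
    have L2: "0 < L\<^sup>2" using pos by simp
    have small: "\<eta> * L \<le> 1 / 16" "2 * \<sigma> * L \<le> R" "992 * (\<eta> * L\<^sup>2) \<le> lam" "16 * (\<eta> * L\<^sup>2) \<le> \<epsilon>" "8 * (\<sigma> * L\<^sup>2) \<le> \<epsilon>"
      using le pos L2 by (auto simp: pos_le_divide_eq mult_ac)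
    have small': "(4 * \<eta> + 2 * \<sigma>) * L\<^sup>2 \<le> \<epsilon> / 2" using small(4,5) by (simp add: distrib_right)
    obtain \<theta> where \<theta>: "0 < \<theta>" "\<And>n m z z'. state ?\<alpha> n m z \<Longrightarrow> energy ?\<alpha> n m z \<le> v0 \<Longrightarrow> update \<eta> \<sigma> n m z z' \<Longrightarrow>
       state ?\<alpha> n m z' \<and> (1 + \<theta>) * energy ?\<alpha> n m z' \<le> energy ?\<alpha> n m z"
      using contraction[OF G0 GR \<Gamma>(3) W(1,3,4) \<epsilon>(2,3) v0(2) v0'(1) v0'(3)[unfolded KP_def] v0'(4)[unfolded KQ_def]
        e(1,3) \<alpha>(2) e(5,6) small(1,2) small' small(3)] by blast
    obtain r0 where r0: "0 < r0" "\<And>n m z. fst (fst z) \<in> prob_simplex n \<Longrightarrow> fst (snd z) \<in> prob_simplex m \<Longrightarrow>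
       NI f (particle_measure n (fst z)) (particle_measure m (snd z)) \<le> r0 \<Longrightarrow> state ?\<alpha> n m z \<and> energy ?\<alpha> n m z \<le> v0"
      using initial_state[OF G0 W v0(1)] \<alpha>(1) e(6) by (meson less_imp_le)
    \<comment> \<open>The energy contracts by the square of \<open>\<beta>\<close>, so that its
      root, which bounds the NI error, contracts by \<open>\<beta>\<close>.\<close>
    define \<beta> where "\<beta> = 1 / sqrt (1 + \<theta>)"
    have \<beta>: "0 < \<beta>" "\<beta> < 1" "\<beta>\<^sup>2 = 1 / (1 + \<theta>)" using \<theta>(1) by (auto simp: \<beta>_def power_divide)
    have main: "state ?\<alpha> n m (z k) \<and> energy ?\<alpha> n m (z k) \<le> v0 * (\<beta> ^ k)\<^sup>2"
      if z: "fst (fst (z 0)) \<in> prob_simplex n" "fst (snd (z 0)) \<in> prob_simplex m" "\<And>k. update \<eta> \<sigma> n m (z k) (z (Suc k))"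
        "NI f (particle_measure n (fst (z 0))) (particle_measure m (snd (z 0))) \<le> r0" for n m z k
    proof (induction k)
      case 0
      then show ?case using r0(2)[OF z(1,2,4)] by simp
    next
      case (Suc k)
      have "(\<beta> ^ k)\<^sup>2 \<le> 1" using \<beta> by (intro power_le_one) (auto intro: power_le_one)
      then have "v0 * (\<beta> ^ k)\<^sup>2 \<le> v0" using v0 by (simp add: mult_left_le)
      then have "energy ?\<alpha> n m (z k) \<le> v0" using Suc by linarith
      from \<theta>(2)[OF conjunct1[OF Suc] this z(3)[of k]]
      have st: "state ?\<alpha> n m (z (Suc k))" and le: "(1 + \<theta>) * energy ?\<alpha> n m (z (Suc k)) \<le> v0 * (\<beta> ^ k)\<^sup>2"
        using Suc by auto
      have "energy ?\<alpha> n m (z (Suc k)) \<le> v0 * (\<beta> ^ k)\<^sup>2 / (1 + \<theta>)"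
        using le \<theta>(1) by (simp add: pos_le_divide_eq mult.commute)
      also have "\<dots> = v0 * (\<beta> ^ Suc k)\<^sup>2" by (simp add: power_mult_distrib \<beta>(3))
      finally show ?case using st by blast
    qed
    show "\<exists>r0>0. \<exists>c>0. \<exists>\<beta>. 0 < \<beta> \<and> \<beta> < 1 \<and> c \<le> 1 \<and> 3 * sqrt c \<le> W / 2 \<and>
        (\<forall>n m z. fst (fst (z 0)) \<in> prob_simplex n \<and> fst (snd (z 0)) \<in> prob_simplex m \<and>
          (\<forall>k. update \<eta> \<sigma> n m (z k) (z (Suc k))) \<and>
          NI f (particle_measure n (fst (z 0))) (particle_measure m (snd (z 0))) \<le> r0 \<longrightarrow>
          (\<forall>k. state (\<eta> / \<sigma>) n m (z k) \<and> energy (\<eta> / \<sigma>) n m (z k) \<le> c * (\<beta> ^ k)\<^sup>2))"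
      by (rule exI[of _ r0], rule conjI[OF r0(1)], rule exI[of _ v0], rule conjI[OF v0(1)], rule exI[of _ \<beta>])
        (use \<beta> v0 v0'(2) main in blast)
  qed
qed

end

text \<open>The Hessians at the equilibrium points fix \<open>lam\<close>, then \<open>lam\<close>
  and \<open>\<Gamma>\<close> limit the radius \<open>R\<close>, and only then is the gap
  \<open>c1\<close> outside that radius determined.\<close>

lemma two_sided_exists:
  assumes X: "game_side f gx hx L P w Q v \<rho>" and Y: "game_side (\<lambda>y x. - f x y) gy hy L Q v P w (- \<rho>)" and \<Gamma>: "1 \<le> \<Gamma>"
  obtains R lam c1 where "two_sided f gx hx L P w Q v \<rho> R lam c1 gy hy" "8 * (\<Gamma> * R) \<le> 1" "32 * (\<Gamma> * L * R) \<le> lam"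
proof -
  interpret X: game_side f gx hx L P w Q v \<rho> by fact
  interpret Y: game_side "\<lambda>y x. - f x y" gy hy L Q v P w "- \<rho>" by fact
  obtain lx where lx: "0 < lx" "\<And>p u. p \<in> P \<Longrightarrow> lx * (norm u)\<^sup>2 \<le> u \<bullet> (\<Sum>q\<in>Q. v q *\<^sub>R hx p q u)"
    by (rule X.hess_coercive) blast
  obtain ly where ly: "0 < ly" "\<And>q u. q \<in> Q \<Longrightarrow> ly * (norm u)\<^sup>2 \<le> u \<bullet> (\<Sum>p\<in>P. w p *\<^sub>R hy q p u)"
    by (rule Y.hess_coercive) blast
  obtain dx where dx: "0 < dx" "\<And>p p'. p \<in> P \<Longrightarrow> p' \<in> P \<Longrightarrow> p \<noteq> p' \<Longrightarrow> dx \<le> dist p p'"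
    using finite_separated[OF X.finP] by blast
  obtain dy where dy: "0 < dy" "\<And>p p'. p \<in> Q \<Longrightarrow> p' \<in> Q \<Longrightarrow> p \<noteq> p' \<Longrightarrow> dy \<le> dist p p'"
    using finite_separated[OF X.finQ] by blast
  define lam where "lam = min lx ly"
  have lam: "0 < lam" using lx(1) ly(1) by (simp add: lam_def)
  define R where "R = Min {1 / 4, dx / 4, dy / 4, lam / (8 * L), 1 / (8 * \<Gamma>), lam / (32 * (\<Gamma> * L))}"
  have GL: "0 < \<Gamma> * L" "0 < \<Gamma>" "0 < L" using \<Gamma> X.L_pos by auto
  have R: "0 < R" using dx(1) dy(1) lam GL by (simp add: R_def)
  have R_le: "R \<le> 1 / 4" "R \<le> dx / 4" "R \<le> dy / 4" "R \<le> lam / (8 * L)" "R \<le> 1 / (8 * \<Gamma>)" "R \<le> lam / (32 * (\<Gamma> * L))"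
    by (auto simp: R_def)
  have R': "8 * L * R \<le> lam" "8 * (\<Gamma> * R) \<le> 1" "32 * (\<Gamma> * L * R) \<le> lam"
    using R_le(4-6) GL by (auto simp: pos_le_divide_eq mult_ac)
  obtain cx where cx: "0 < cx" "\<And>x. (\<And>p. p \<in> P \<Longrightarrow> R < dist p x) \<Longrightarrow> \<rho> + cx \<le> (\<Sum>q\<in>Q. v q * f x q)"
    by (rule X.gap_far[OF R]) blast
  obtain cy where cy: "0 < cy" "\<And>y. (\<And>q. q \<in> Q \<Longrightarrow> R < dist q y) \<Longrightarrow> - \<rho> + cy \<le> (\<Sum>p\<in>P. w p * - f p y)"
    by (rule Y.gap_far[OF R]) blast
  define c1 where "c1 = min cx cy"
  have CP: "clusters P w R"
  proof
    show "2 * R < dist q q'" if "q \<in> P" "q' \<in> P" "q \<noteq> q'" for q q' using dx(2)[OF that] dx(1) R_le(2) by linarith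
  qed (use X.finP X.w_pos X.w_sum R R_le(1) in auto)
  have CQ: "clusters Q v R"
  proof
    show "2 * R < dist q q'" if "q \<in> Q" "q' \<in> Q" "q \<noteq> q'" for q q' using dy(2)[OF that] dy(1) R_le(3) by linarith
  qed (use X.finQ X.v_pos X.v_sum R R_le(1) in auto)
  have "game_clusters f gx hx L P w Q v \<rho> R lam c1"
  proof (intro game_clusters.intro X CP CQ game_clusters_axioms.intro)
    show "lam * (norm u)\<^sup>2 \<le> u \<bullet> (\<Sum>q\<in>Q. v q *\<^sub>R hx p q u)" if "p \<in> P" for p u
      using lx(2)[OF that, of u] mult_right_mono[of lam lx "(norm u)\<^sup>2"] by (simp add: lam_def)
    show "\<rho> + c1 \<le> (\<Sum>q\<in>Q. v q * f x q)" if "\<And>p. p \<in> P \<Longrightarrow> R < dist p x" for x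
      using cx(2)[OF that] by (simp add: c1_def)
  qed (use lam cx(1) cy(1) R' in \<open>auto simp: c1_def\<close>)
  moreover have "game_clusters (\<lambda>y x. - f x y) gy hy L Q v P w (- \<rho>) R lam c1"
  proof (intro game_clusters.intro Y CP CQ game_clusters_axioms.intro)
    show "lam * (norm u)\<^sup>2 \<le> u \<bullet> (\<Sum>p\<in>P. w p *\<^sub>R hy q p u)" if "q \<in> Q" for q u
      using ly(2)[OF that, of u] mult_right_mono[of lam ly "(norm u)\<^sup>2"] by (simp add: lam_def)
    show "- \<rho> + c1 \<le> (\<Sum>p\<in>P. w p * - f p y)" if "\<And>q. q \<in> Q \<Longrightarrow> R < dist q y" for y
      using cy(2)[OF that] by (simp add: c1_def)
  qed (use lam cx(1) cy(1) R' in \<open>auto simp: c1_def\<close>)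
  ultimately have "two_sided f gx hx L P w Q v \<rho> R lam c1 gy hy" by (rule two_sided.intro)
  then show thesis using R'(2,3) by (rule that)
qed

text \<open>The second half is the first applied to the negated transpose; the larger of the two
  smoothness constants serves both players.\<close>

lemma game_sides_of_game:
  assumes "nondegenerate_sparse_game f \<mu>s \<nu>s"
  obtains gx hx gy hy L where
    "game_side f gx hx L (supp \<mu>s) (\<lambda>p. measure \<mu>s {p}) (supp \<nu>s) (\<lambda>q. measure \<nu>s {q}) (payoff f \<mu>s \<nu>s)"
    "game_side (\<lambda>y x. - f x y) gy hy L (supp \<nu>s) (\<lambda>q. measure \<nu>s {q}) (supp \<mu>s) (\<lambda>p. measure \<mu>s {p}) (- payoff f \<mu>s \<nu>s)"
proof -
  let ?F = "\<lambda>x. \<integral>y. f x y \<partial>\<nu>s" and ?H = "\<lambda>y. \<integral>x. f x y \<partial>\<mu>s" and ?\<rho> = "payoff f \<mu>s \<nu>s"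
  have C: "torus_C21 f" and MNE: "is_MNE f \<mu>s \<nu>s" and uniq: "\<And>\<mu> \<nu>. is_MNE f \<mu> \<nu> \<Longrightarrow> \<mu> = \<mu>s \<and> \<nu> = \<nu>s"
    and fin: "finite (supp \<mu>s)" "finite (supp \<nu>s)"
    and val: "\<And>x. ?F x = ?\<rho> \<Longrightarrow> x \<in> supp \<mu>s" "\<And>y. ?H y = ?\<rho> \<Longrightarrow> y \<in> supp \<nu>s"
    and pd: "\<And>x. x \<in> supp \<mu>s \<Longrightarrow> pos_def (torus_hess ?F x)" "\<And>y. y \<in> supp \<nu>s \<Longrightarrow> pos_def (- torus_hess ?H y)"
    using assms unfolding nondegenerate_sparse_game_def Let_def by auto
  obtain gx hx L1 where "smooth_payoff f gx hx L1" using torus_C21_smooth_payoff(1)[OF C] by blast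
  then have SX: "smooth_payoff f gx hx (max L1 L2)" for L2 by (rule smooth_payoff_mono) simp
  obtain gy hy L2 where "smooth_payoff (\<lambda>y x. - f x y) gy hy L2" using torus_C21_smooth_payoff(2)[OF C] by blast
  then have SY: "smooth_payoff (\<lambda>y x. - f x y) gy hy (max L1 L2)" by (rule smooth_payoff_mono) simp
  interpret X: smooth_payoff f gx hx "max L1 L2" by (rule SX)
  interpret Y: smooth_payoff "\<lambda>y x. - f x y" gy hy "max L1 L2" by (rule SY)
  interpret CX: continuous_payoff f "max L1 L2" by (rule X.continuous_payoff)
  interpret CY: continuous_payoff "\<lambda>y x. - f x y" "max L1 L2" by (rule Y.continuous_payoff)
  have pr: "\<mu>s \<in> prob_measures" "\<nu>s \<in> prob_measures" using MNE by (auto simp: is_MNE_def)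
  note dm = finite_supp_decompose(1)[OF pr(1) fin(1)] and dn = finite_supp_decompose(1)[OF pr(2) fin(2)]
  have F: "?F = (\<lambda>x. \<Sum>q\<in>supp \<nu>s. measure \<nu>s {q} * f x q)"
    using CX.integral_pmeas_snd[OF fin(2), where w = "\<lambda>q. measure \<nu>s {q}" and X = "\<lambda>q. q"]
    unfolding dn[symmetric] by simp
  have H: "?H = (\<lambda>y. - (\<Sum>p\<in>supp \<mu>s. measure \<mu>s {p} * - f p y))"
    using CX.integral_pmeas_fst[OF fin(1), where w = "\<lambda>p. measure \<mu>s {p}" and X = "\<lambda>p. p"]
    unfolding dm[symmetric] by (simp add: sum_negf)
  have neg: "payoff (\<lambda>y x. - f x y) \<nu>s \<mu>s = - ?\<rho>"
    using CX.payoff_swap[OF pr] by (simp add: payoff_def)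
  have 1: "game_side f gx hx (max L1 L2) (supp \<mu>s) (\<lambda>p. measure \<mu>s {p}) (supp \<nu>s) (\<lambda>q. measure \<nu>s {q}) ?\<rho>"
  proof (rule game_side_of_MNE[OF SX MNE _ fin val(1)])
    show "\<nu>' = \<nu>s" if "is_MNE f \<mu>' \<nu>'" for \<mu>' \<nu>' using uniq[OF that] by simp
    fix x u assume x: "x \<in> supp \<mu>s" and u: "u \<noteq> (0 :: real ^ 'a)"
    have "0 < u \<bullet> (torus_hess ?F x *v u)" using pd(1)[OF x] u by (simp add: pos_def_def)
    then show "0 < u \<bullet> (\<Sum>q\<in>supp \<nu>s. measure \<nu>s {q} *\<^sub>R hx x q u)"
      unfolding F by (simp only: torus_hess_inner[OF twice_diff_sum[OF X.td]])
  qed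
  have 2: "game_side (\<lambda>y x. - f x y) gy hy (max L1 L2) (supp \<nu>s) (\<lambda>q. measure \<nu>s {q}) (supp \<mu>s) (\<lambda>p. measure \<mu>s {p})
      (payoff (\<lambda>y x. - f x y) \<nu>s \<mu>s)"
  proof (rule game_side_of_MNE[OF SY CX.is_MNE_swap[THEN iffD1, OF MNE] _ fin(2,1)])
    show "\<mu>' = \<mu>s" if "is_MNE (\<lambda>y x. - f x y) \<nu>' \<mu>'" for \<mu>' \<nu>'
      using uniq[of \<mu>' \<nu>'] that CX.is_MNE_swap by blast
    show "y \<in> supp \<nu>s" if "(\<integral>x. - f x y \<partial>\<mu>s) = payoff (\<lambda>y x. - f x y) \<nu>s \<mu>s" for y
      using val(2)[of y] that unfolding neg by simp
    fix y u assume y: "y \<in> supp \<nu>s" and u: "u \<noteq> (0 :: real ^ 'b)"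
    have td: "twice_diff ?H (\<lambda>y. - (\<Sum>p\<in>supp \<mu>s. measure \<mu>s {p} *\<^sub>R gy y p)) (\<lambda>y u. - (\<Sum>p\<in>supp \<mu>s. measure \<mu>s {p} *\<^sub>R hy y p u))"
      unfolding H by (rule twice_diff_minus[OF twice_diff_sum[OF Y.td]])
    have "0 < u \<bullet> (- torus_hess ?H y *v u)" using pd(2)[OF y] u by (simp add: pos_def_def)
    then have "0 < - (u \<bullet> (torus_hess ?H y *v u))" using matrix_vector_mult_diff_rdistrib[of 0 "torus_hess ?H y" u] by simp
    then show "0 < u \<bullet> (\<Sum>p\<in>supp \<mu>s. measure \<mu>s {p} *\<^sub>R hy y p u)"
      unfolding torus_hess_inner[OF td] by simp
  qed
  show thesis by (rule that[OF 1 2[unfolded neg]])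
qed

theorem theorem2p1:
  fixes f :: "'n::finite torus \<Rightarrow> 'm::finite torus \<Rightarrow> real"
    and \<mu>s :: "'n torus measure" and \<nu>s :: "'m torus measure" and \<Gamma>0 :: real
  assumes "nondegenerate_sparse_game f \<mu>s \<nu>s"
    and "\<Gamma>0 \<ge> 1"
  shows "\<exists>\<eta>0>0. \<exists>\<sigma>0>0. \<forall>\<eta> \<sigma> :: real.
    0 < \<eta> \<and> \<eta> \<le> \<eta>0 \<and> 0 < \<sigma> \<and> \<sigma> \<le> \<sigma>0 \<and> inverse \<Gamma>0 \<le> \<sigma> / \<eta> \<and> \<sigma> / \<eta> \<le> \<Gamma>0 \<longrightarrow>
    (\<exists>C>0. \<exists>C'>0. \<exists>r0>0. \<exists>\<kappa>>0. \<kappa> < 1 \<and>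
      (\<forall>(n::nat) (m::nat) (z :: nat \<Rightarrow> 'n particles \<times> 'm particles).
        n \<ge> 1 \<and> m \<ge> 1 \<and> cppp_iterates f \<eta> \<sigma> n m z \<longrightarrow>
        (let \<mu> = (\<lambda>k. particle_measure n (fst (z k)));
             \<nu> = (\<lambda>k. particle_measure m (snd (z k)))
         in NI f (\<mu> 0) (\<nu> 0) \<le> r0 \<longrightarrow>
           (\<forall>k. NI f (\<mu> k) (\<nu> k) \<le> C * (1 - \<kappa>) ^ k \<and>
                WFR2 \<eta> \<sigma> (\<mu> k) \<mu>s + WFR2 \<eta> \<sigma> (\<nu> k) \<nu>s \<le> ennreal (C' * (1 - \<kappa>) ^ k)) \<and>
           (\<forall>\<phi> :: 'n torus \<Rightarrow> real. continuous_on UNIV \<phi> \<longrightarrow>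
                (\<lambda>k. \<integral>x. \<phi> x \<partial>\<mu> k) \<longlonglongrightarrow> (\<integral>x. \<phi> x \<partial>\<mu>s)) \<and>
           (\<forall>\<psi> :: 'm torus \<Rightarrow> real. continuous_on UNIV \<psi> \<longrightarrow>
                (\<lambda>k. \<integral>y. \<psi> y \<partial>\<nu> k) \<longlonglongrightarrow> (\<integral>y. \<psi> y \<partial>\<nu>s)))))"
proof -
  obtain gx hx gy hy L where sides:
    "game_side f gx hx L (supp \<mu>s) (\<lambda>p. measure \<mu>s {p}) (supp \<nu>s) (\<lambda>q. measure \<nu>s {q}) (payoff f \<mu>s \<nu>s)"
    "game_side (\<lambda>y x. - f x y) gy hy L (supp \<nu>s) (\<lambda>q. measure \<nu>s {q}) (supp \<mu>s) (\<lambda>p. measure \<mu>s {p}) (- payoff f \<mu>s \<nu>s)"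
    by (rule game_sides_of_game[OF assms(1)])
  obtain R lam c1 where ts: "two_sided f gx hx L (supp \<mu>s) (\<lambda>p. measure \<mu>s {p}) (supp \<nu>s) (\<lambda>q. measure \<nu>s {q}) (payoff f \<mu>s \<nu>s) R lam c1 gy hy"
    and R: "8 * (\<Gamma>0 * R) \<le> 1" "32 * (\<Gamma>0 * L * R) \<le> lam"
    by (rule two_sided_exists[OF sides assms(2)])
  let ?P = "supp \<mu>s" and ?Q = "supp \<nu>s" and ?w = "\<lambda>p. measure \<mu>s {p}" and ?v = "\<lambda>q. measure \<nu>s {q}"
  interpret two_sided f gx hx L ?P ?w ?Q ?v "payoff f \<mu>s \<nu>s" R lam c1 gy hy by (rule ts)
  have pr: "\<mu>s \<in> prob_measures" "\<nu>s \<in> prob_measures"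
    using assms(1) by (auto simp: nondegenerate_sparse_game_def Let_def is_MNE_def)
  have dm: "pmeas ?P ?w (\<lambda>p. p) = \<mu>s" and dn: "pmeas ?Q ?v (\<lambda>q. q) = \<nu>s"
    using finite_supp_decompose(1)[OF pr(1) X.finP] finite_supp_decompose(1)[OF pr(2) X.finQ] by simp_all
  obtain Wx Wy where Wx: "0 < Wx" "\<And>p. p \<in> ?P \<Longrightarrow> Wx \<le> ?w p" and Wy: "0 < Wy" "\<And>q. q \<in> ?Q \<Longrightarrow> Wy \<le> ?v q"
    using X.CP.w_min X.CQ.w_min by metis
  define W where "W = min 1 (min Wx Wy)"
  have W: "0 < W" "W \<le> 1" "\<forall>p\<in>?P. W \<le> ?w p" "\<forall>q\<in>?Q. W \<le> ?v q"
    using Wx Wy by (auto simp: W_def min_le_iff_disj)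
  obtain \<eta>0 \<sigma>0 where es: "0 < \<eta>0" "0 < \<sigma>0" and es': "\<forall>\<eta> \<sigma>.
      0 < \<eta> \<and> \<eta> \<le> \<eta>0 \<and> 0 < \<sigma> \<and> \<sigma> \<le> \<sigma>0 \<and> 1 / \<Gamma>0 \<le> \<eta> / \<sigma> \<and> \<eta> / \<sigma> \<le> \<Gamma>0 \<longrightarrow>
      (\<exists>r0>0. \<exists>c>0. \<exists>\<beta>. 0 < \<beta> \<and> \<beta> < 1 \<and> c \<le> 1 \<and> 3 * sqrt c \<le> W / 2 \<and>
        (\<forall>n m z. fst (fst (z 0)) \<in> prob_simplex n \<and> fst (snd (z 0)) \<in> prob_simplex m \<and>
          (\<forall>k. update \<eta> \<sigma> n m (z k) (z (Suc k))) \<and>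
          NI f (particle_measure n (fst (z 0))) (particle_measure m (snd (z 0))) \<le> r0 \<longrightarrow>
          (\<forall>k. state (\<eta> / \<sigma>) n m (z k) \<and> energy (\<eta> / \<sigma>) n m (z k) \<le> c * (\<beta> ^ k)\<^sup>2)))"
    using convergence[OF assms(2) R W] by (elim exE conjE)
  show ?thesis
  proof (rule exI[of _ \<eta>0], rule conjI[OF es(1)], rule exI[of _ \<sigma>0], rule conjI[OF es(2)], intro allI impI, elim conjE)
    fix \<eta> \<sigma> :: real
    assume e: "0 < \<eta>" "\<eta> \<le> \<eta>0" "0 < \<sigma>" "\<sigma> \<le> \<sigma>0" and G: "inverse \<Gamma>0 \<le> \<sigma> / \<eta>" "\<sigma> / \<eta> \<le> \<Gamma>0"
    let ?\<alpha> = "\<eta> / \<sigma>"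
    \<comment> \<open>The admissible range of \<open>\<sigma> / \<eta>\<close> is invariant under
      inversion, so it is also the range of \<open>\<eta> / \<sigma>\<close>.\<close>
    have \<alpha>: "0 < ?\<alpha>" "1 / \<Gamma>0 \<le> ?\<alpha>" "?\<alpha> \<le> \<Gamma>0"
      using e G assms(2) by (auto simp: field_simps)
    obtain r0 c \<beta> where c: "0 < r0" "0 < c" "0 < \<beta>" "\<beta> < 1" "c \<le> 1" "3 * sqrt c \<le> W / 2"
      and conv: "\<And>n m z k. fst (fst (z 0)) \<in> prob_simplex n \<Longrightarrow> fst (snd (z 0)) \<in> prob_simplex m \<Longrightarrow>
          (\<And>k. update \<eta> \<sigma> n m (z k) (z (Suc k))) \<Longrightarrow>
          NI f (particle_measure n (fst (z 0))) (particle_measure m (snd (z 0))) \<le> r0 \<Longrightarrow>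
          state ?\<alpha> n m (z k) \<and> energy ?\<alpha> n m (z k) \<le> c * (\<beta> ^ k)\<^sup>2"
      using es'[rule_format, OF conjI[OF e(1) conjI[OF e(2) conjI[OF e(3) conjI[OF e(4) conjI[OF \<alpha>(2,3)]]]]]] by (elim exE conjE) blast
    \<comment> \<open>The constants depend on the step sizes and the numbers of equilibrium points,
      not on \<open>n\<close>, \<open>m\<close> or the iterates.\<close>
    define CN where "CN = L * (sqrt (2 / ?\<alpha>) + 1 + 3 * card ?P) + L * (sqrt (2 / ?\<alpha>) + 1 + 3 * card ?Q)"
    define CW where "CW = (4 + 8 * real (card ?P)) + (4 + 8 * real (card ?Q))"
    have CN: "0 < CN" unfolding CN_def using X.L_pos e(1,3) by (intro add_pos_pos[OF mult_pos_pos mult_pos_pos] add_pos_nonneg; simp)+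
    have CW: "0 < CW" by (simp add: CW_def add_pos_nonneg)
    show "\<exists>C>0. \<exists>C'>0. \<exists>r0>0. \<exists>\<kappa>>0. \<kappa> < 1 \<and>
      (\<forall>(n::nat) (m::nat) (z :: nat \<Rightarrow> 'n particles \<times> 'm particles).
        n \<ge> 1 \<and> m \<ge> 1 \<and> cppp_iterates f \<eta> \<sigma> n m z \<longrightarrow>
        (let \<mu> = (\<lambda>k. particle_measure n (fst (z k)));
             \<nu> = (\<lambda>k. particle_measure m (snd (z k)))
         in NI f (\<mu> 0) (\<nu> 0) \<le> r0 \<longrightarrow>
           (\<forall>k. NI f (\<mu> k) (\<nu> k) \<le> C * (1 - \<kappa>) ^ k \<and>
                WFR2 \<eta> \<sigma> (\<mu> k) \<mu>s + WFR2 \<eta> \<sigma> (\<nu> k) \<nu>s \<le> ennreal (C' * (1 - \<kappa>) ^ k)) \<and>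
           (\<forall>\<phi> :: 'n torus \<Rightarrow> real. continuous_on UNIV \<phi> \<longrightarrow>
                (\<lambda>k. \<integral>x. \<phi> x \<partial>\<mu> k) \<longlonglongrightarrow> (\<integral>x. \<phi> x \<partial>\<mu>s)) \<and>
           (\<forall>\<psi> :: 'm torus \<Rightarrow> real. continuous_on UNIV \<psi> \<longrightarrow>
                (\<lambda>k. \<integral>y. \<psi> y \<partial>\<nu> k) \<longlonglongrightarrow> (\<integral>y. \<psi> y \<partial>\<nu>s))))"
      unfolding Let_def
    proof (rule exI[of _ CN], rule conjI[OF CN], rule exI[of _ CW], rule conjI[OF CW], rule exI[of _ r0], rule conjI[OF c(1)],
        rule exI[of _ "1 - \<beta>"], intro conjI allI impI; (elim conjE)?)
      show "0 < 1 - \<beta>" "1 - \<beta> < 1" using c by auto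
      fix n m :: nat and z :: "nat \<Rightarrow> 'n particles \<times> 'm particles"
      assume it: "cppp_iterates f \<eta> \<sigma> n m z" and NI0: "NI f (particle_measure n (fst (z 0))) (particle_measure m (snd (z 0))) \<le> r0"
      have z0: "fst (fst (z 0)) \<in> prob_simplex n" "fst (snd (z 0)) \<in> prob_simplex m" and cu: "\<And>k. cppp_update f \<eta> \<sigma> n m (z k) (z (Suc k))"
        using it by (auto simp: cppp_iterates_def)
      \<comment> \<open>An update is known to be a proximal step once its starting weights lie in
        the simplex; the induction below alternates between the two facts.\<close>
      have upd: "update \<eta> \<sigma> n m (z k) (z (Suc k))"
        if "fst (fst (z k)) \<in> prob_simplex n" "fst (snd (z k)) \<in> prob_simplex m" for k
        using cppp_update_prox_step[OF cu e(1,3) that X.smooth_payoff_axioms Y.smooth_payoff_axioms]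
        unfolding update_def X.opp_def X.opp_grad_def Y.opp_def Y.opp_grad_def by simp
      have simplex: "fst (fst (z k)) \<in> prob_simplex n \<and> fst (snd (z k)) \<in> prob_simplex m" for k
      proof (induction k)
        case (Suc k)
        then show ?case using upd[of k] by (auto simp: update_def prox_step_def)
      qed (use z0 in auto)
      define V where "V k = c * (\<beta> ^ k)\<^sup>2" for k
      have st: "state ?\<alpha> n m (z k)" and en: "energy ?\<alpha> n m (z k) \<le> V k" for k
        using conv[OF z0 upd NI0] simplex unfolding V_def by blast+
      have b1: "0 \<le> \<beta> ^ k" "\<beta> ^ k \<le> 1" for k using c by (auto intro: power_le_one)
      have sV: "sqrt (V k) \<le> \<beta> ^ k" for k
      proof -
        have "sqrt (V k) = sqrt c * \<beta> ^ k" using b1 by (simp add: V_def real_sqrt_mult)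
        also have "\<dots> \<le> 1 * \<beta> ^ k" using c b1 by (intro mult_right_mono) auto
        finally show ?thesis by simp
      qed
      have Vc: "V k \<le> c" for k using b1[of k] c(2) by (simp add: V_def mult_left_le power_le_one)
      have V1: "V k \<le> 1" for k using Vc[of k] c(5) by linarith
      have V0: "0 \<le> V k" for k using c(2) by (simp add: V_def)
      \<comment> \<open>The energy, and with it the WFR bound, decays with the square of
        \<open>\<beta>\<close>; it is weakened to the rate of the NI error so that both share
        \<open>\<kappa> = 1 - \<beta>\<close>.\<close>
      have Vb: "V k \<le> \<beta> ^ k" for k
      proof -
        have "(\<beta> ^ k)\<^sup>2 \<le> \<beta> ^ k" using b1[of k] by (simp add: power2_eq_square mult_left_le)
        moreover have "c * (\<beta> ^ k)\<^sup>2 \<le> 1 * (\<beta> ^ k)\<^sup>2" using c(5) by (intro mult_right_mono) auto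
        ultimately show ?thesis by (simp add: V_def)
      qed
      have sqV: "3 * sqrt (V k) \<le> W / 2" for k using Vc[of k] c(6) real_sqrt_le_mono[OF Vc[of k]] by linarith
      have lx: "X.CP.lyap ?\<alpha> n (fst (z k)) \<le> V k" and ly: "X.CQ.lyap ?\<alpha> m (snd (z k)) \<le> V k" for k
        using energy_ge[OF st[of k] \<alpha>(1)] en[of k] by linarith+
      have kx: "0 < X.CP.kmass ?\<alpha> n (fst (z k)) p" if "p \<in> ?P" for k p using st[of k] that by (simp add: state_def)
      have ky: "0 < X.CQ.kmass ?\<alpha> m (snd (z k)) q" if "q \<in> ?Q" for k q using st[of k] that by (simp add: state_def)
      show "NI f (particle_measure n (fst (z k))) (particle_measure m (snd (z k))) \<le> CN * (1 - (1 - \<beta>)) ^ k" for k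
      proof -
        have "NI f (particle_measure n (fst (z k))) (particle_measure m (snd (z k))) \<le> CN * sqrt (V k)"
          using NI_energy[OF st[of k] \<alpha>(1) en[of k] V1[of k]] by (simp only: CN_def distrib_right)
        also have "\<dots> \<le> CN * \<beta> ^ k" using sV CN by (intro mult_left_mono) auto
        finally show ?thesis by simp
      qed
      show "WFR2 \<eta> \<sigma> (particle_measure n (fst (z k))) \<mu>s + WFR2 \<eta> \<sigma> (particle_measure m (snd (z k))) \<nu>s
          \<le> ennreal (CW * (1 - (1 - \<beta>)) ^ k)" for k
      proof -
        have "WFR2 \<eta> \<sigma> (particle_measure n (fst (z k))) \<mu>s \<le> ennreal ((4 + 8 * card ?P) * V k)"
          using X.CP.wfr_lyap[OF conjunct1[OF simplex] kx e(1,3) lx V1 bspec[OF W(3)] sqV] unfolding dm by simp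
        moreover have "WFR2 \<eta> \<sigma> (particle_measure m (snd (z k))) \<nu>s \<le> ennreal ((4 + 8 * card ?Q) * V k)"
          using X.CQ.wfr_lyap[OF conjunct2[OF simplex] ky e(1,3) ly V1 bspec[OF W(4)] sqV] unfolding dn by simp
        ultimately have "WFR2 \<eta> \<sigma> (particle_measure n (fst (z k))) \<mu>s + WFR2 \<eta> \<sigma> (particle_measure m (snd (z k))) \<nu>s
            \<le> ennreal ((4 + 8 * card ?P) * V k) + ennreal ((4 + 8 * card ?Q) * V k)" by (rule add_mono)
        also have "\<dots> = ennreal (CW * V k)" using V0[of k] by (simp add: CW_def distrib_right flip: ennreal_plus)
        also have "\<dots> \<le> ennreal (CW * \<beta> ^ k)" using Vb CW by (intro ennreal_leI mult_left_mono) auto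
        finally show ?thesis by simp
      qed
      have lim: "V \<longlonglongrightarrow> 0"
      proof -
        have "(\<lambda>k. c * (\<beta> ^ k)\<^sup>2) \<longlonglongrightarrow> c * 0\<^sup>2" using c by (intro tendsto_intros LIMSEQ_realpow_zero) auto
        then show ?thesis by (simp add: V_def[abs_def])
      qed
      show "(\<lambda>k. \<integral>x. \<phi> x \<partial>particle_measure n (fst (z k))) \<longlonglongrightarrow> (\<integral>x. \<phi> x \<partial>\<mu>s)" if "continuous_on UNIV \<phi>" for \<phi> :: "'n torus \<Rightarrow> real"
        using X.CP.narrow_limit[OF that \<alpha>(1), of "\<lambda>k. fst (z k)" n V] simplex kx lx V1 lim unfolding dm by blast
      show "(\<lambda>k. \<integral>y. \<psi> y \<partial>particle_measure m (snd (z k))) \<longlonglongrightarrow> (\<integral>y. \<psi> y \<partial>\<nu>s)" if "continuous_on UNIV \<psi>" for \<psi> :: "'m torus \<Rightarrow> real"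
        using X.CQ.narrow_limit[OF that \<alpha>(1), of "\<lambda>k. snd (z k)" m V] simplex ky ly V1 lim unfolding dn by blast
    qed
  qed
qed

end
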